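(* Let $n\ge3$, $\kappa\in(0,1)$, and let $\mathbf{R}^n_h$ be a perturbed $C^{2+\kappa}$ half space of type $(K)$ with boundary $\Gamma=\partial\mathbf{R}^n_h$; let $R_\ast$ be the reach of $\Gamma$. Then there is a constant $C=C(K,R_\ast,R_h)>0$ such that $$\|w\cdot\mathbf{n}\|_{L^\infty(\Gamma)\cap\dot H^{-\frac12}(\Gamma)}\le C\,\|w\|_{vBMOL^2(\mathbf{R}^n_h)}$$ for all $w\in vBMOL^2(\mathbf{R}^n_h)$ with $\operatorname{div}w=0$ in $\mathbf{R}^n_h$.
   Context: Perturbed half space. For $x\in\mathbf{R}^n$ write $x=(x',x_n)$, $x'\in\mathbf{R}^{n-1}$, and $\nabla'=(\partial_1,\dots,\partial_{n-1})$. For a compactly supported function $h\not\equiv0$ of class $C^{2+\kappa}$ on $\mathbf{R}^{n-1}$, $\mathbf{R}^n_h=\{(x',x_n)\in\mathbf{R}^n\mid x_n>h(x')\}$ is called a perturbed $C^{2+\kappa}$ half space. It is of type $(K)$ if $\sup_{x'}|\nabla'^2h(x')|<K$. $R_h>0$ is the smallest positive number with $\operatorname{supp}h\subseteq\overline{B_{R_h}(0')}$. $\mathbf{n}$ is the exterior unit normal of $\Gamma$. Reach. Let $\Omega=\mathbf{R}^n_h$ and $d$ be the signed distance to $\Gamma$ (positive in $\Omega$, negative outside). The reach of $\Gamma$ in $\Omega$ is the supremum of $R>0$ such that every $x\in\Omega$ with $|d(x)|<R$ has a unique $\pi x\in\Gamma$ with $|x-\pi x|=|d(x)|$; the reach in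 $\Omega^{\mathrm c}$ is defined likewise; $R_\ast$ is the minimum of the two. Function spaces. Let $d_\Gamma$ be the distance function from $\Gamma$. For $\mu,\nu\in(0,\infty]$, $[f]_{BMO^\mu(\Omega)}=\sup\{|B_r(x)|^{-1}\int_{B_r(x)}|f-f_{B_r(x)}|\,dy: B_r(x)\subset\Omega,\ r<\mu\}$, where $f_B$ is the average over $B$; $[f]_{b^\nu(\Gamma)}=\sup\{r^{-n}\int_{\Omega\cap B_r(x)}|f|\,dy: x\in\Gamma,\ 0<r<\nu\}$; $[v]_{vBMO^{\mu,\nu}(\Omega)}=[v]_{BMO^\mu(\Omega)}+[\nabla d_\Gamma\cdot v]_{b^\nu(\Gamma)}$, and $vBMO^{\mu,\nu}(\Omega)$ is the set of $v\in L^1_{loc}(\Omega)^n$ for which this is finite. $vBMOL^2(\Omega)=vBMO^{\mu,\nu}(\Omega)\cap L^2(\Omega)^n$; this space does not depend on $\mu,\nu$. Its norm is $\|v\|_{vBMOL^2(\Omega)}=[v]_{vBMO^{\infty,\infty}(\Omega)}+\|v\|_{L^2(\Omega)}$ (other $\mu,\nu$ give equivalent norms). $\dot H^{1/2}(\Gamma)$ is the space of $f\in L^{\frac{2n-2}{n-2}}(\Gamma)$ with $\|f\|_{\dot H^{1/2}(\Gamma)}^2=\int_\Gamma\int_\Gamma\frac{|f(x)-f(y)|^2}{|x-y|^n}\,d\mathcal{H}^{n-1}(x)\,d\mathcal{H}^{n-1}(y)<\infty$, and $\dot H^{-1/2}(\Gamma)$ is its dual space with the dual norm, the pairing being $\int_\Gamma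 gf\,d\mathcal{H}^{n-1}$. The norm of $L^\infty(\Gamma)\cap\dot H^{-1/2}(\Gamma)$ is the sum of the two norms. For $w\in L^2(\Omega)^n$ with $\operatorname{div}w=0$, the normal trace $w\cdot\mathbf{n}$ is defined weakly by $\langle w\cdot\mathbf{n},\varphi|_\Gamma\rangle=\int_\Omega w\cdot\nabla\varphi\,dx$, $\varphi\in C_c^\infty(\mathbf{R}^n)$. The assertion includes that it belongs to $L^\infty(\Gamma)\cap\dot H^{-1/2}(\Gamma)$. Constants may also depend on $n$. *)

theory Defs
  imports "HOL-Analysis.Analysis" "HOL-Probability.Essential_Supremum"
begin

subsection \<open>Differentiable functions and test functions\<close>

definition pderiv_at :: "'a::euclidean_space \<Rightarrow> ('a \<Rightarrow> real) \<Rightarrow> 'a \<Rightarrow> real" where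
  "pderiv_at b f x = frechet_derivative f (at x) b"

definition grad :: "('a::euclidean_space \<Rightarrow> real) \<Rightarrow> 'a \<Rightarrow> 'a" where
  "grad f x = (\<Sum>b\<in>Basis. pderiv_at b f x *\<^sub>R b)"

definition hessian :: "(real ^ 'm \<Rightarrow> real) \<Rightarrow> real ^ 'm \<Rightarrow> real ^ 'm ^ 'm" where
  "hessian f x = (\<chi> i j. pderiv_at (axis i 1) (pderiv_at (axis j 1) f) x)"

fun C_k :: "nat \<Rightarrow> ('a::euclidean_space \<Rightarrow> real) \<Rightarrow> bool" where
  "C_k 0 f \<longleftrightarrow> continuous_on UNIV f"
| "C_k (Suc k) f \<longleftrightarrow> (\<forall>x. f differentiable at x) \<and> (\<forall>b\<in>Basis. C_k k (pderiv_at b f))"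

definition supp :: "('a::topological_space \<Rightarrow> real) \<Rightarrow> 'a set" where
  "supp f = closure {x. f x \<noteq> 0}"

definition test_functions :: "'a::euclidean_space set \<Rightarrow> ('a \<Rightarrow> real) set" where
  "test_functions \<Omega> = {\<phi>. (\<forall>k. C_k k \<phi>) \<and> compact (supp \<phi>) \<and> supp \<phi> \<subseteq> \<Omega>}"

text \<open>Used for compactly supported functions only, so no boundedness of the lower-order
  derivatives is required.\<close>

definition C_2_Hoelder :: "real \<Rightarrow> (real ^ 'm \<Rightarrow> real) \<Rightarrow> bool" where
  "C_2_Hoelder \<kappa> f \<longleftrightarrow> C_k 2 f \<and>
     (\<exists>L. \<forall>x y. norm (hessian f x - hessian f y) \<le> L * dist x y powr \<kappa>)"


subsection \<open>Perturbed half spaces\<close>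

text \<open>The space of dimension $n$ is rendered as the product of \<^typ>\<open>real ^ 'm\<close> and
  \<^typ>\<open>real\<close>, where $n - 1$ is the cardinality of the type \<^typ>\<open>'m\<close>; the product carries
  the Euclidean norm.\<close>

definition perturbed_half_space :: "(real ^ 'm \<Rightarrow> real) \<Rightarrow> ((real ^ 'm) \<times> real) set" where
  "perturbed_half_space h = {(x', x\<^sub>n). x\<^sub>n > h x'}"

definition admissible_perturbation :: "real \<Rightarrow> (real ^ 'm \<Rightarrow> real) \<Rightarrow> bool" where
  "admissible_perturbation \<kappa> h \<longleftrightarrow>
     C_2_Hoelder \<kappa> h \<and> compact (supp h) \<and> (\<exists>x. h x \<noteq> 0)"

text \<open>The norm on matrices is the Euclidean (Frobenius) norm.\<close>

definition of_type_K :: "real \<Rightarrow> (real ^ 'm \<Rightarrow> real) \<Rightarrow> bool" where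
  "of_type_K K h \<longleftrightarrow> (SUP x. norm (hessian h x)) < K"

definition supp_radius :: "('a::real_normed_vector \<Rightarrow> real) \<Rightarrow> real" where
  "supp_radius h = (LEAST R. R > 0 \<and> supp h \<subseteq> cball 0 R)"

definition signed_dist :: "'a::metric_space set \<Rightarrow> 'a \<Rightarrow> real" where
  "signed_dist \<Omega> x =
     (if x \<in> \<Omega> then infdist x (frontier \<Omega>) else - infdist x (frontier \<Omega>))"

definition reach_in :: "'a::metric_space set \<Rightarrow> 'a set \<Rightarrow> ennreal" where
  "reach_in \<Omega> A =
     (SUP R \<in> {R. R > 0 \<and> (\<forall>x\<in>A. \<bar>signed_dist \<Omega> x\<bar> < R \<longrightarrow>
        (\<exists>!p. p \<in> frontier \<Omega> \<and> dist x p = \<bar>signed_dist \<Omega> x\<bar>))}. ennreal R)"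

definition reach :: "'a::metric_space set \<Rightarrow> ennreal" where
  "reach \<Omega> = min (reach_in \<Omega> \<Omega>) (reach_in \<Omega> (- \<Omega>))"


subsection \<open>Surface measure\<close>

text \<open>Hausdorff measure, normalised so as to agree with Lebesgue measure in dimension $s$.
  The covering sets have to be bounded because \<^const>\<open>diameter\<close> is unspecified on
  unbounded sets.\<close>

definition hausdorff_pre :: "nat \<Rightarrow> real \<Rightarrow> 'a::metric_space set \<Rightarrow> ennreal" where
  "hausdorff_pre s \<delta> A =
     (INF U \<in> {U :: nat \<Rightarrow> 'a set. A \<subseteq> (\<Union>i. U i) \<and> (\<forall>i. bounded (U i) \<and> diameter (U i) \<le> \<delta>)}.
        \<Sum>i. if U i = {} then 0
             else ennreal (unit_ball_vol (real s) * (diameter (U i) / 2) ^ s))"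

definition hausdorff_outer :: "nat \<Rightarrow> 'a::metric_space set \<Rightarrow> ennreal" where
  "hausdorff_outer s A = (SUP \<delta> \<in> {0<..}. hausdorff_pre s \<delta> A)"

definition hausdorff_measure :: "nat \<Rightarrow> 'a::metric_space measure" where
  "hausdorff_measure s = measure_of UNIV (sets borel) (hausdorff_outer s)"

definition surface_measure :: "'a::euclidean_space set \<Rightarrow> 'a measure" where
  "surface_measure \<Gamma> = restrict_space (hausdorff_measure (DIM('a) - 1)) \<Gamma>"


subsection \<open>BMO-type spaces on a domain\<close>

text \<open>Elements of function spaces are represented by functions on the whole space, of which
  only the values on the domain (or on the boundary) matter. Seminorms take values in
  \<^typ>\<open>ennreal\<close>.\<close>

definition L1_loc :: "'a::euclidean_space set \<Rightarrow> ('a \<Rightarrow> 'a) set" where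
  "L1_loc \<Omega> = {v. \<forall>A. compact A \<and> A \<subseteq> \<Omega> \<longrightarrow> v absolutely_integrable_on A}"

definition average :: "'a::euclidean_space set \<Rightarrow> ('a \<Rightarrow> 'a) \<Rightarrow> 'a" where
  "average B v = (LINT y:B|lebesgue. v y) /\<^sub>R measure lebesgue B"

definition bmo_seminorm :: "ennreal \<Rightarrow> 'a::euclidean_space set \<Rightarrow> ('a \<Rightarrow> 'a) \<Rightarrow> ennreal" where
  "bmo_seminorm \<mu> \<Omega> v =
     (SUP (x, r) \<in> {(x, r). 0 < r \<and> ennreal r < \<mu> \<and> ball x r \<subseteq> \<Omega>}.
        (\<integral>\<^sup>+y\<in>ball x r. ennreal (norm (v y - average (ball x r) v)) \<partial>lebesgue)
          / emeasure lebesgue (ball x r))"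

definition b_seminorm :: "ennreal \<Rightarrow> 'a::euclidean_space set \<Rightarrow> ('a \<Rightarrow> real) \<Rightarrow> ennreal" where
  "b_seminorm \<nu> \<Omega> f =
     (SUP (x, r) \<in> {(x, r). x \<in> frontier \<Omega> \<and> 0 < r \<and> ennreal r < \<nu>}.
        (\<integral>\<^sup>+y\<in>\<Omega> \<inter> ball x r. ennreal \<bar>f y\<bar> \<partial>lebesgue) / ennreal (r ^ DIM('a)))"

text \<open>The distance function is Lipschitz continuous, so its gradient is defined almost
  everywhere, and \<^const>\<open>grad\<close> is arbitrary on a null set only.\<close>

definition vbmo_seminorm ::
    "ennreal \<Rightarrow> ennreal \<Rightarrow> 'a::euclidean_space set \<Rightarrow> ('a \<Rightarrow> 'a) \<Rightarrow> ennreal" where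
  "vbmo_seminorm \<mu> \<nu> \<Omega> v =
     bmo_seminorm \<mu> \<Omega> v
     + b_seminorm \<nu> \<Omega> (\<lambda>y. grad (\<lambda>z. infdist z (frontier \<Omega>)) y \<bullet> v y)"

definition vBMO :: "ennreal \<Rightarrow> ennreal \<Rightarrow> 'a::euclidean_space set \<Rightarrow> ('a \<Rightarrow> 'a) set" where
  "vBMO \<mu> \<nu> \<Omega> = {v \<in> L1_loc \<Omega>. vbmo_seminorm \<mu> \<nu> \<Omega> v < \<infinity>}"

definition L2_space :: "'a::euclidean_space set \<Rightarrow> ('a \<Rightarrow> 'a) set" where
  "L2_space \<Omega> = {v \<in> borel_measurable (lebesgue_on \<Omega>).
     integrable (lebesgue_on \<Omega>) (\<lambda>x. (norm (v x))\<^sup>2)}"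

definition L2_norm :: "'a::euclidean_space set \<Rightarrow> ('a \<Rightarrow> 'a) \<Rightarrow> real" where
  "L2_norm \<Omega> v = sqrt (\<integral>x. (norm (v x))\<^sup>2 \<partial>lebesgue_on \<Omega>)"

text \<open>The intersection does not depend on $\mu$ and $\nu$; infinity is chosen for both.\<close>

definition vBMOL2 :: "'a::euclidean_space set \<Rightarrow> ('a \<Rightarrow> 'a) set" where
  "vBMOL2 \<Omega> = vBMO \<infinity> \<infinity> \<Omega> \<inter> L2_space \<Omega>"

definition vBMOL2_norm :: "'a::euclidean_space set \<Rightarrow> ('a \<Rightarrow> 'a) \<Rightarrow> real" where
  "vBMOL2_norm \<Omega> v = enn2real (vbmo_seminorm \<infinity> \<infinity> \<Omega> v) + L2_norm \<Omega> v"

definition div_free :: "'a::euclidean_space set \<Rightarrow> ('a \<Rightarrow> 'a) \<Rightarrow> bool" where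
  "div_free \<Omega> w \<longleftrightarrow>
     (\<forall>\<phi>\<in>test_functions \<Omega>. (\<integral>x. w x \<bullet> grad \<phi> x \<partial>lebesgue_on \<Omega>) = 0)"


subsection \<open>Function spaces on the boundary\<close>

definition Linf_space :: "'a::euclidean_space set \<Rightarrow> ('a \<Rightarrow> real) set" where
  "Linf_space \<Gamma> = {g \<in> borel_measurable (surface_measure \<Gamma>).
     esssup (surface_measure \<Gamma>) (\<lambda>x. ennreal \<bar>g x\<bar>) < \<infinity>}"

definition Linf_norm :: "'a::euclidean_space set \<Rightarrow> ('a \<Rightarrow> real) \<Rightarrow> real" where
  "Linf_norm \<Gamma> g = enn2real (esssup (surface_measure \<Gamma>) (\<lambda>x. ennreal \<bar>g x\<bar>))"

definition Hhalf_energy :: "'a::euclidean_space set \<Rightarrow> ('a \<Rightarrow> real) \<Rightarrow> ennreal" where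
  "Hhalf_energy \<Gamma> f =
     (\<integral>\<^sup>+x. \<integral>\<^sup>+y. ennreal (\<bar>f x - f y\<bar>\<^sup>2 / norm (x - y) ^ DIM('a))
        \<partial>surface_measure \<Gamma> \<partial>surface_measure \<Gamma>)"

definition Hhalf :: "'a::euclidean_space set \<Rightarrow> ('a \<Rightarrow> real) set" where
  "Hhalf \<Gamma> = {f \<in> borel_measurable (surface_measure \<Gamma>).
     integrable (surface_measure \<Gamma>)
       (\<lambda>x. \<bar>f x\<bar> powr ((2 * real DIM('a) - 2) / (real DIM('a) - 2)))
     \<and> Hhalf_energy \<Gamma> f < \<infinity>}"

definition Hhalf_norm :: "'a::euclidean_space set \<Rightarrow> ('a \<Rightarrow> real) \<Rightarrow> real" where
  "Hhalf_norm \<Gamma> f = sqrt (enn2real (Hhalf_energy \<Gamma> f))"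

text \<open>Boundedness makes such functionals invariant under changing their argument on a null
  set of the surface measure.\<close>

definition Hhalf_dual :: "'a::euclidean_space set \<Rightarrow> (('a \<Rightarrow> real) \<Rightarrow> real) set" where
  "Hhalf_dual \<Gamma> = {l.
     (\<forall>f\<in>Hhalf \<Gamma>. \<forall>g\<in>Hhalf \<Gamma>. \<forall>a b. l (\<lambda>x. a * f x + b * g x) = a * l f + b * l g)
     \<and> (\<exists>B. \<forall>f\<in>Hhalf \<Gamma>. \<bar>l f\<bar> \<le> B * Hhalf_norm \<Gamma> f)}"

definition Hhalf_dual_norm :: "'a::euclidean_space set \<Rightarrow> (('a \<Rightarrow> real) \<Rightarrow> real) \<Rightarrow> real" where
  "Hhalf_dual_norm \<Gamma> l = (SUP f \<in> {f \<in> Hhalf \<Gamma>. Hhalf_norm \<Gamma> f \<le> 1}. \<bar>l f\<bar>)"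

text \<open>A function $g$ on $\Gamma$ is identified with the functional given by integration against
  $g$. The product of $g$ with an element of the space need not be integrable, even if $g$ is
  bounded and the functional is continuous; on such elements the functional is the continuous
  extension.\<close>

definition represents :: "'a::euclidean_space set \<Rightarrow> ('a \<Rightarrow> real) \<Rightarrow> (('a \<Rightarrow> real) \<Rightarrow> real) \<Rightarrow> bool" where
  "represents \<Gamma> g l \<longleftrightarrow>
     (\<forall>f\<in>Hhalf \<Gamma>. integrable (surface_measure \<Gamma>) (\<lambda>x. g x * f x) \<longrightarrow>
        l f = (\<integral>x. g x * f x \<partial>surface_measure \<Gamma>))"

definition is_normal_trace :: "'a::euclidean_space set \<Rightarrow> ('a \<Rightarrow> 'a) \<Rightarrow> ('a \<Rightarrow> real) \<Rightarrow> bool" where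
  "is_normal_trace \<Omega> w g \<longleftrightarrow>
     (\<forall>\<phi>\<in>test_functions UNIV.
        integrable (surface_measure (frontier \<Omega>)) (\<lambda>x. g x * \<phi> x) \<and>
        (\<integral>x. g x * \<phi> x \<partial>surface_measure (frontier \<Omega>)) = (\<integral>x. w x \<bullet> grad \<phi> x \<partial>lebesgue_on \<Omega>))"

end

theory Submission
  imports Defs
begin

text \<open>Shearing by the graph of $h$ turns $w$ into a field $u$ on the upper half space that is
divergence-free against test functions vanishing near the boundary. For a test function $\varphi$,
the flux $\int w \cdot \nabla\varphi$ is therefore concentrated in the strip of width $\varepsilon$
above $\Gamma$. There the vertical component of $u$ is, up to an error $O(t\,|w|)$ at height $t$,
controlled by $|\nabla d_\Gamma \cdot w|$, so averaging over cylinders of size $\varepsilon$ bounds the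
flux by the $b^\infty$ seminorm times $\int |\varphi|$, while the error vanishes with
$\varepsilon$ because $w \in L^2$. A functional with this bound is represented by a bounded function.

For the dual norm, a function on $\Gamma$ of finite $\dot H^{1/2}$ energy is extended to the half space by
averages over balls whose radius is the distance from the boundary. The gradient of the extension is
bounded in $L^2$ by the energy, and pairing it with $u$ gives the functional.

The projection to $\mathbf{R}^{n-1}$ does not increase distances, so Lebesgue measure transported to
$\Gamma$ is at most a multiple of the surface measure and has a bounded density with respect to it;
this replaces the area formula.\<close>

subsection \<open>Gradients and test functions\<close>

text \<open>Two gaps shape the proof. The divergence condition is tested with smooth functions,
  whereas the shear is only as smooth as \<open>h\<close>; so every identity is first extended by
  mollification to C^1 functions with compact support, and the cutoffs may then be C^1 splines. And
  the product of the trace \<open>g\<close> with a function \<open>f\<close> of finite energy need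
  not be integrable, so the functional is defined by pairing \<open>u\<close> with the gradient of
  the extension of \<open>f\<close>. That it equals the integral whenever the product is integrable
  takes a limit: the extension is shifted upwards by \<open>\<delta> n\<close> and cut off at radius
  of order \<open>K n\<close>. The geometry enters through two numbers: \<open>K\<close> is a
  Lipschitz constant of the gradient of \<open>h\<close>, and L = K (2 R_h + 1) bounds that
  gradient. Below height 1/(2K) the distance from the boundary is squeezed between the distance to a
  foot point and a function built from a ball touching the graph from above; so it is differentiable
  there and its gradient is the unit normal at the foot point. Replacing the foot point by the
  vertical projection costs the error O(t |w|).\<close>

definition has_gradient :: "('a::euclidean_space \<Rightarrow> real) \<Rightarrow> ('a \<Rightarrow> 'a) \<Rightarrow> bool" where
  "has_gradient f G \<longleftrightarrow> (\<forall>x. (f has_derivative (\<lambda>v. G x \<bullet> v)) (at x))"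

lemma pderiv_at_eqI:
  assumes "(f has_derivative D) (at x)"
  shows "pderiv_at b f x = D b"
  using frechet_derivative_at[OF assms] unfolding pderiv_at_def by simp

lemma pderiv_at_fun_eqI:
  assumes "\<And>x. (f has_derivative D x) (at x)"
  shows "pderiv_at b f = (\<lambda>x. D x b)"
  using pderiv_at_eqI[OF assms] by blast

lemma grad_eqI:
  assumes "(f has_derivative (\<lambda>v. G \<bullet> v)) (at x)"
  shows "grad f x = G"
  unfolding grad_def pderiv_at_eqI[OF assms] by (rule euclidean_representation)

lemma has_gradient_grad: "has_gradient f G \<Longrightarrow> grad f = G"
  unfolding has_gradient_def by (auto intro: grad_eqI)

lemma has_derivative_grad:
  assumes "f differentiable (at x)"
  shows "(f has_derivative (\<lambda>v. grad f x \<bullet> v)) (at x)"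
proof -
  let ?D = "frechet_derivative f (at x)"
  have d: "(f has_derivative ?D) (at x)" using assms by (simp add: frechet_derivative_works)
  then have lin: "linear ?D" by (rule has_derivative_linear)
  have "?D v = grad f x \<bullet> v" for v
  proof -
    have "?D v = ?D (\<Sum>b\<in>Basis. (v \<bullet> b) *\<^sub>R b)" by (simp add: euclidean_representation)
    also have "\<dots> = (\<Sum>b\<in>Basis. (v \<bullet> b) * ?D b)" using lin by (simp add: linear_sum linear_cmul)
    also have "\<dots> = grad f x \<bullet> v"
      unfolding grad_def inner_sum_left pderiv_at_def
      by (rule sum.cong) (auto simp: inner_commute)
    finally show ?thesis .
  qed
  then have "?D = (\<lambda>v. grad f x \<bullet> v)" by auto
  with d show ?thesis by simp
qed

lemma grad_inner_Basis: "b \<in> Basis \<Longrightarrow> grad f x \<bullet> b = pderiv_at b f x"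
  unfolding grad_def by (simp add: inner_sum_left inner_Basis if_distrib cong: if_cong)

section \<open>Closure of the classes \<open>C_k\<close> under algebra and composition\<close>

lemma C_k_Suc_imp: "C_k (Suc k) f \<Longrightarrow> C_k k f"
proof (induction k arbitrary: f)
  case 0
  then show ?case
    by (auto intro!: continuous_at_imp_continuous_on differentiable_imp_continuous_within)
next
  case (Suc k)
  then show ?case by auto
qed

lemma C_k_const: "C_k k (\<lambda>x. c)"
proof (induction k arbitrary: c)
  case (Suc k)
  have "pderiv_at b (\<lambda>x. c) = (\<lambda>x. 0)" for b :: 'a
    by (rule ext) (simp add: pderiv_at_eqI[OF has_derivative_const])
  with Suc show ?case by simp
qed simp

lemma C_k_inner: "C_k k (\<lambda>x. x \<bullet> c)"
proof (cases k)
  case (Suc j)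
  have "((\<lambda>x. x \<bullet> c) has_derivative (\<lambda>v. v \<bullet> c)) (at x)" for x :: 'a
    by (auto intro!: derivative_eq_intros)
  then have "pderiv_at b (\<lambda>x. x \<bullet> c) = (\<lambda>x. b \<bullet> c)" and "(\<lambda>x. x \<bullet> c) differentiable (at x)" for b x :: 'a
    using pderiv_at_fun_eqI[of "\<lambda>x. x \<bullet> c" "\<lambda>x v. v \<bullet> c"] by (auto simp: differentiable_def)
  with Suc show ?thesis by (simp add: C_k_const)
qed (auto intro!: continuous_intros)

lemma C_k_add: "C_k k f \<Longrightarrow> C_k k g \<Longrightarrow> C_k k (\<lambda>x. f x + g x)"
proof (induction k arbitrary: f g)
  case (Suc k)
  have D: "((\<lambda>x. f x + g x) has_derivative (\<lambda>v. grad f x \<bullet> v + grad g x \<bullet> v)) (at x)" for x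
    using Suc.prems by (intro has_derivative_add has_derivative_grad) auto
  then have "pderiv_at b (\<lambda>x. f x + g x) = (\<lambda>x. pderiv_at b f x + pderiv_at b g x)" if "b \<in> Basis" for b
    using that by (subst pderiv_at_fun_eqI[OF D]) (auto simp: grad_inner_Basis)
  with Suc show ?case by auto
qed (auto intro!: continuous_intros)

lemma C_k_mult: "C_k k f \<Longrightarrow> C_k k g \<Longrightarrow> C_k k (\<lambda>x. f x * g x)"
proof (induction k arbitrary: f g)
  case (Suc k)
  have D: "((\<lambda>x. f x * g x) has_derivative (\<lambda>v. f x * (grad g x \<bullet> v) + (grad f x \<bullet> v) * g x)) (at x)" for x
    using Suc.prems by (intro has_derivative_mult has_derivative_grad) auto
  then have eq: "pderiv_at b (\<lambda>x. f x * g x) = (\<lambda>x. f x * pderiv_at b g x + pderiv_at b f x * g x)"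
    if "b \<in> Basis" for b
    using that by (subst pderiv_at_fun_eqI[OF D]) (auto simp: grad_inner_Basis)
  have "C_k k f" "C_k k g" using Suc.prems by (auto intro: C_k_Suc_imp simp del: C_k.simps)
  with Suc eq show ?case by (auto intro!: C_k_add)
qed (auto intro!: continuous_intros)

lemma C_k_cmult: "C_k k f \<Longrightarrow> C_k k (\<lambda>x. c * f x)"
  by (intro C_k_mult C_k_const)

lemma C_k_sum: "finite A \<Longrightarrow> (\<And>i. i \<in> A \<Longrightarrow> C_k k (f i)) \<Longrightarrow> C_k k (\<lambda>x. \<Sum>i\<in>A. f i x)"
  by (induction A rule: finite_induct) (auto intro: C_k_add C_k_const)

text \<open>The family \<open>E\<close> lists the successive derivatives of one function.
  Differentiating the composition moves from index j to j + 1, so the induction has to keep j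
  general.\<close>

lemma C_k_compose_real:
  fixes E :: "nat \<Rightarrow> real \<Rightarrow> real"
  assumes E: "\<And>j t. (E j has_real_derivative E (Suc j) t) (at t)"
  shows "C_k k u \<Longrightarrow> C_k k (\<lambda>x. E j (u x))"
proof (induction k arbitrary: u j)
  case 0
  have "continuous_on UNIV (E j)"
    using E by (auto intro!: continuous_at_imp_continuous_on DERIV_isCont)
  with 0 show ?case by (auto intro: continuous_on_compose2)
next
  case (Suc k)
  have D: "((\<lambda>x. E j (u x)) has_derivative (\<lambda>v. (grad u x \<bullet> v) * E (Suc j) (u x))) (at x)" for x
    using Suc.prems by (intro DERIV_compose_FDERIV[OF E] has_derivative_grad) auto
  then have eq: "b \<in> Basis \<Longrightarrow> pderiv_at b (\<lambda>x. E j (u x)) = (\<lambda>x. pderiv_at b u x * E (Suc j) (u x))"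
    and "(\<lambda>x. E j (u x)) differentiable (at x)" for b x
    by (subst pderiv_at_fun_eqI[OF D]) (use D in \<open>auto simp: grad_inner_Basis differentiable_def\<close>)
  moreover have "C_k k u" using Suc.prems by (auto intro: C_k_Suc_imp simp del: C_k.simps)
  ultimately show ?case using Suc by (auto intro!: C_k_mult)
qed

text \<open>For \<open>P\<close> = 1 this is exp(-1/t), the standard smooth function that vanishes
  to infinite order at 0. The polynomial factor in 1/t makes the class closed under
  differentiation.\<close>

definition flat_exp :: "real poly \<Rightarrow> real \<Rightarrow> real" where
  "flat_exp P t = (if t > 0 then poly P (1 / t) * exp (- (1 / t)) else 0)"

lemma tendsto_poly_exp: "((\<lambda>s. poly P s * exp (- s)) \<longlongrightarrow> (0::real)) at_top"
proof -
  have "((\<lambda>s. \<Sum>i\<le>degree P. coeff P i * (s ^ i * exp (- s))) \<longlongrightarrow> (\<Sum>i\<le>degree P. coeff P i * 0)) at_top"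
  proof (intro tendsto_intros)
    fix i show "((\<lambda>s. s ^ i * exp (- s)) \<longlongrightarrow> (0::real)) at_top"
      using tendsto_power_div_exp_0[of i] by (simp add: exp_minus field_simps)
  qed
  then show ?thesis by (simp add: poly_altdef sum_distrib_right mult.assoc)
qed

text \<open>For t > 0 put s = 1/t: the derivative of P(s) exp(-s) is s^2 (P - P')(s) exp(-s). At 0
  the difference quotient from the right is s P(s) exp(-s), which tends to 0 as s grows.\<close>

lemma flat_exp_deriv:
  "(flat_exp P has_real_derivative flat_exp ([:0,0,1:] * (P - pderiv P)) t) (at t)"
proof -
  consider "t > 0" | "t < 0" | "t = 0" by linarith
  then show ?thesis
  proof cases
    case 1
    have "((\<lambda>t. poly P (1 / t) * exp (- (1 / t))) has_real_derivative
       poly P (1 / t) * (exp (- (1 / t)) * (1 / t\<^sup>2)) + poly (pderiv P) (1/t) * (- (1 / t\<^sup>2)) * exp (- (1 / t))) (at t)"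
      using 1 by (auto intro!: derivative_eq_intros DERIV_chain2[OF poly_DERIV] simp: power2_eq_square field_simps)
    then have "(flat_exp P has_real_derivative
       poly P (1 / t) * (exp (- (1 / t)) * (1 / t\<^sup>2)) + poly (pderiv P) (1/t) * (- (1 / t\<^sup>2)) * exp (- (1 / t))) (at t)"
      by (rule DERIV_cong_ev[THEN iffD1, rotated 3])
         (use 1 in \<open>auto simp: flat_exp_def eventually_nhds intro!: exI[of _ "{0<..}"]\<close>)
    then show ?thesis
      by (rule DERIV_cong) (use 1 in \<open>simp add: flat_exp_def field_simps power2_eq_square\<close>)
  next
    case 2
    have "((\<lambda>t. 0) has_real_derivative 0) (at t)" by simp
    then have "(flat_exp P has_real_derivative 0) (at t)"
      by (rule DERIV_cong_ev[THEN iffD1, rotated 3])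
         (use 2 in \<open>auto simp: flat_exp_def eventually_nhds intro!: exI[of _ "{..<0}"]\<close>)
    then show ?thesis using 2 by (simp add: flat_exp_def)
  next
    case 3
    have "((\<lambda>x. poly ([:0,1:] * P) (1/x) * exp (- (1/x))) \<longlongrightarrow> 0) (at_right 0)"
      using filterlim_compose[OF tendsto_poly_exp[of "[:0,1:] * P"] filterlim_inverse_at_top_right]
      by (simp add: inverse_eq_divide)
    then have r: "((\<lambda>x. flat_exp P x / x) \<longlongrightarrow> 0) (at_right 0)"
      by (rule Lim_transform_eventually)
         (auto simp: flat_exp_def eventually_at_right_less intro!: eventually_at_rightI[of 0 1])
    have l: "((\<lambda>x. flat_exp P x / x) \<longlongrightarrow> 0) (at_left 0)"
      by (rule Lim_transform_eventually[of "\<lambda>x. 0"])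
         (auto simp: flat_exp_def intro!: eventually_at_leftI[of "-1"])
    from filterlim_split_at[OF l r] have "((\<lambda>x. flat_exp P x / x) \<longlongrightarrow> 0) (at 0)" .
    then have "(flat_exp P has_real_derivative 0) (at 0)"
      by (simp add: DERIV_def flat_exp_def)
    with 3 show ?thesis by (simp add: flat_exp_def)
  qed
qed

primrec flat_poly :: "nat \<Rightarrow> real poly" where
  "flat_poly 0 = 1"
| "flat_poly (Suc j) = [:0,0,1:] * (flat_poly j - pderiv (flat_poly j))"

lemma C_k_flat_exp: "C_k k u \<Longrightarrow> C_k k (\<lambda>x. flat_exp 1 (u x))"
  using C_k_compose_real[of "\<lambda>j. flat_exp (flat_poly j)" k u 0]
  by (simp only: flat_poly.simps flat_exp_deriv simp_thms)

section \<open>Test functions, bumps and mollifiers\<close>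

lemma supp_subsetI: "closed S \<Longrightarrow> (\<And>x. x \<notin> S \<Longrightarrow> f x = 0) \<Longrightarrow> supp f \<subseteq> S"
  unfolding supp_def by (rule closure_minimal) auto

lemma zero_outside_supp: "x \<notin> supp f \<Longrightarrow> f x = 0"
  unfolding supp_def by (metis (mono_tags, lifting) closure_subset mem_Collect_eq subsetD)

lemma test_functionsI:
  assumes "\<And>k. C_k k f" "compact S" "S \<subseteq> U" "\<And>x. x \<notin> S \<Longrightarrow> f x = 0"
  shows "f \<in> test_functions U"
proof -
  have "supp f \<subseteq> S" using assms by (intro supp_subsetI compact_imp_closed)
  moreover have "closed (supp f)" unfolding supp_def by simp
  ultimately show ?thesis using assms compact_Int_closed[OF assms(2), of "supp f"]
    unfolding test_functions_def by (auto simp: Int_absorb1)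
qed

lemma test_functionsD:
  assumes "\<phi> \<in> test_functions U"
  shows "C_k k \<phi>" "compact (supp \<phi>)" "supp \<phi> \<subseteq> U" "\<phi> differentiable (at x)"
    "(\<phi> has_derivative (\<lambda>v. grad \<phi> x \<bullet> v)) (at x)" "continuous_on UNIV \<phi>"
proof -
  show *: "C_k k \<phi>" for k using assms by (auto simp: test_functions_def)
  show "compact (supp \<phi>)" "supp \<phi> \<subseteq> U" using assms by (auto simp: test_functions_def)
  show d: "\<phi> differentiable (at x)" using *[of "Suc 0"] by simp
  then show "(\<phi> has_derivative (\<lambda>v. grad \<phi> x \<bullet> v)) (at x)" by (rule has_derivative_grad)
  show "continuous_on UNIV \<phi>" using *[of 0] by simp
qed

lemma pderiv_test_functions:
  assumes "\<phi> \<in> test_functions U" "b \<in> Basis"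
  shows "pderiv_at b \<phi> \<in> test_functions U"
proof (rule test_functionsI)
  show "C_k k (pderiv_at b \<phi>)" for k
    using test_functionsD(1)[OF assms(1), of "Suc k"] assms(2) by simp
  fix x assume x: "x \<notin> supp \<phi>"
  have "((\<lambda>x. 0) has_derivative (\<lambda>v. 0)) (at x)" by simp
  then have "(\<phi> has_derivative (\<lambda>v. 0)) (at x)"
    by (rule has_derivative_transform_within_open[of _ _ _ _ "- supp \<phi>"])
       (use x in \<open>auto simp: supp_def open_Compl intro: zero_outside_supp[of _ \<phi>, unfolded supp_def] sym\<close>)
  then show "pderiv_at b \<phi> x = 0" by (rule pderiv_at_eqI)
qed (use test_functionsD[OF assms(1)] in auto)

lemma continuous_on_grad_test: "\<phi> \<in> test_functions U \<Longrightarrow> continuous_on UNIV (grad \<phi>)"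
  unfolding grad_def[abs_def]
  by (intro continuous_on_sum continuous_on_scaleR continuous_on_const
       test_functionsD(6)[OF pderiv_test_functions])

text \<open>The flat exponential is composed with r^2 - |x - a|^2, which is positive exactly on the
  ball; that function is written through coordinates so that sums and products of affine functions
  settle its smoothness.\<close>

lemma ex_bump:
  fixes a :: "'a::euclidean_space"
  assumes "r > 0"
  shows "\<exists>\<phi>\<in>test_functions UNIV. (\<forall>x. 0 \<le> \<phi> x) \<and> {x. \<phi> x > 0} = ball a r \<and> (\<forall>x. x \<notin> ball a r \<longrightarrow> \<phi> x = 0)"
proof -
  define u where "u x = r\<^sup>2 + (- 1) * (\<Sum>b\<in>Basis. (x \<bullet> b + - (a \<bullet> b)) * (x \<bullet> b + - (a \<bullet> b)))" for x
  have u: "u x = r\<^sup>2 - (dist a x)\<^sup>2" for x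
    unfolding u_def dist_norm norm_minus_commute[of a] power2_norm_eq_inner
    by (subst euclidean_inner) (simp add: inner_diff_left)
  have pos: "u x > 0 \<longleftrightarrow> x \<in> ball a r" for x
    using assms by (auto simp: u abs_less_iff power2_less_imp_less intro: power_strict_mono)
  have "C_k k u" for k unfolding u_def
    by (intro C_k_add C_k_mult C_k_sum C_k_inner C_k_const) auto
  then have C: "C_k k (\<lambda>x. flat_exp 1 (u x))" for k by (rule C_k_flat_exp)
  show ?thesis
  proof (intro bexI[of _ "\<lambda>x. flat_exp 1 (u x)"] conjI allI impI)
    show "(\<lambda>x. flat_exp 1 (u x)) \<in> test_functions UNIV"
      by (rule test_functionsI[OF C, of "cball a r"]) (auto simp: flat_exp_def pos)
  qed (auto simp: flat_exp_def pos)
qed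

lemma continuous_compact_support_bounded:
  fixes f :: "'a::topological_space \<Rightarrow> 'b::real_normed_vector"
  assumes "continuous_on UNIV f" "compact S" "\<And>x. x \<notin> S \<Longrightarrow> f x = 0"
  obtains B where "B > 0" "\<And>x. norm (f x) \<le> B"
proof -
  have "bounded (f ` S)"
    using assms by (intro compact_imp_bounded compact_continuous_image) (auto intro: continuous_on_subset)
  then obtain B where "\<And>x. x \<in> S \<Longrightarrow> norm (f x) \<le> B" unfolding bounded_iff by auto
  then show ?thesis using assms(3) by (intro that[of "max B 1"]) (simp, metis linorder_not_le max.cobounded1 max.cobounded2 norm_zero order.trans zero_le_one)
qed

lemma integrable_bounded_compact_support:
  fixes f :: "'a::euclidean_space \<Rightarrow> 'b::{banach,second_countable_topology}"
  assumes "sets M = sets borel" "f \<in> borel_measurable borel" "\<And>x. norm (f x) \<le> B" "\<And>x. x \<notin> S \<Longrightarrow> f x = 0"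
    "S \<in> sets borel" "emeasure M S < \<infinity>"
  shows "integrable M f"
proof (rule Bochner_Integration.integrable_bound)
  show "integrable M (\<lambda>x. B * indicator S x)"
    using assms by (intro integrable_mult_right integrable_real_indicator) auto
  show "f \<in> borel_measurable M" using assms measurable_cong_sets by blast
  show "AE x in M. norm (f x) \<le> norm (B * indicator S x)"
    using assms(3,4) by (intro AE_I2) (auto simp: indicator_def, smt (verit) norm_ge_zero)
qed

lemma integrable_test_function:
  assumes "\<phi> \<in> test_functions U" "sets M = sets borel" "\<And>S. compact S \<Longrightarrow> emeasure M S < \<infinity>"
  shows "integrable M \<phi>"
proof -
  obtain B where "\<And>x. norm (\<phi> x) \<le> B"
    using continuous_compact_support_bounded[of \<phi> "supp \<phi>"] test_functionsD[OF assms(1)] zero_outside_supp by metis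
  then show ?thesis using assms test_functionsD[OF assms(1)]
    by (intro integrable_bounded_compact_support[where S = "supp \<phi>" and B = B])
       (auto intro: borel_measurable_continuous_onI zero_outside_supp compact_imp_closed borel_closed)
qed

lemma ex_mollifier:
  assumes "r > 0"
  shows "\<exists>\<rho>\<in>test_functions (UNIV::'a::euclidean_space set). (\<forall>x. 0 \<le> \<rho> x) \<and> (\<forall>x. r \<le> norm x \<longrightarrow> \<rho> x = 0)
     \<and> integrable lborel \<rho> \<and> integral\<^sup>L lborel \<rho> = 1"
proof -
  obtain \<phi> :: "'a \<Rightarrow> real" where \<phi>: "\<phi> \<in> test_functions UNIV" "\<And>x. 0 \<le> \<phi> x" "{x. \<phi> x > 0} = ball 0 r" "\<And>x. x \<notin> ball 0 r \<Longrightarrow> \<phi> x = 0"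
    using ex_bump[OF assms, of 0] by metis
  have int: "integrable lborel \<phi>"
    by (rule integrable_test_function[OF \<phi>(1)]) (simp, erule emeasure_compact_finite)
  define c where "c = integral\<^sup>L lborel \<phi>"
  \<comment> \<open>A nonnegative function with integral zero vanishes almost everywhere, but the
    bump is positive on a ball of positive measure.\<close>
  have "c \<noteq> 0"
  proof
    assume "c = 0"
    then have "AE x in lborel. \<phi> x = 0"
      using integral_nonneg_eq_0_iff_AE[OF int] \<phi>(2) by (auto simp: c_def)
    then have "AE x in lborel. x \<notin> ball (0::'a) r"
    proof (rule eventually_mono)
      fix x assume "\<phi> x = 0" then have "x \<notin> {x. \<phi> x > 0}" by simp
      then show "x \<notin> ball 0 r" unfolding \<phi>(3) .
    qed
    then have "emeasure lborel (ball (0::'a) r) = 0"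
      by (subst (asm) AE_iff_measurable[OF _ refl]) (auto simp: ball_def)
    moreover have "emeasure lborel (ball (0::'a) r) > 0"
      using assms by (simp add: emeasure_ball)
    ultimately show False by simp
  qed
  moreover have "c \<ge> 0" unfolding c_def using \<phi>(2) by (intro integral_nonneg_AE) auto
  ultimately have c: "c > 0" by simp
  have "(\<lambda>x. (1/c) * \<phi> x) \<in> test_functions UNIV"
    using \<phi>(1) by (intro test_functionsI[of _ "supp \<phi>"] C_k_cmult test_functionsD(1)[OF \<phi>(1)])
       (auto simp: test_functionsD zero_outside_supp)
  then show ?thesis
    using int c \<phi> by (intro bexI[of _ "\<lambda>x. (1/c) * \<phi> x"]) (auto simp: c_def)
qed


section \<open>Differentiation under the integral and approximation by test functions\<close>

lemma integrable_mult_bounded: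
  fixes f g :: "'a \<Rightarrow> real"
  assumes "integrable M f" "g \<in> borel_measurable M" "\<And>x. \<bar>g x\<bar> \<le> c"
  shows "integrable M (\<lambda>x. f x * g x)"
proof (rule Bochner_Integration.integrable_bound)
  show "integrable M (\<lambda>x. c * f x)" using assms(1) by simp
  have "c \<ge> 0" using assms(3) abs_ge_zero order.trans by metis
  then show "AE x in M. norm (f x * g x) \<le> norm (c * f x)"
    using assms(3) by (intro AE_I2) (simp add: abs_mult mult.commute[of c] mult_left_mono)
qed (use assms in auto)

text \<open>The integrable Lipschitz constant \<open>B\<close> dominates the difference quotients
  and, in the limit, the derivative \<open>D\<close> itself. So measurability and integrability of
  \<open>D\<close> are consequences, \<open>D\<close> being a limit of quotients along 1/(n+1), and
  the remainder tends to zero by dominated convergence with majorant 2 B.\<close>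

lemma has_derivative_integral:
  fixes \<kappa> :: "'p::real_normed_vector \<Rightarrow> 'y \<Rightarrow> real"
  assumes int: "\<And>p. integrable M (\<kappa> p)"
    and der: "\<And>y. ((\<lambda>p. \<kappa> p y) has_derivative D y) (at p0)"
    and e: "e > 0" and lip: "\<And>p y. dist p0 p < e \<Longrightarrow> \<bar>\<kappa> p y - \<kappa> p0 y\<bar> \<le> B y * norm (p - p0)"
    and B: "integrable M B"
  shows "integrable M (\<lambda>y. D y v)" "\<And>y. \<bar>D y v\<bar> \<le> B y * norm v"
    "((\<lambda>p. \<integral>y. \<kappa> p y \<partial>M) has_derivative (\<lambda>v. \<integral>y. D y v \<partial>M)) (at p0)"
proof -
  have lim: "(\<lambda>n. (\<kappa> (p0 + (1 / real (Suc n)) *\<^sub>R v) y - \<kappa> p0 y) / (1 / real (Suc n))) \<longlonglongrightarrow> D y v" for y v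
  proof -
    have "bounded_linear (D y)" using der by (rule has_derivative_bounded_linear)
    then have s: "D y (s *\<^sub>R v) = s * D y v" for s by (simp add: linear_simps)
    have "((\<lambda>s. \<kappa> (p0 + s *\<^sub>R v) y) has_derivative (\<lambda>s. D y (s *\<^sub>R v))) (at 0)"
      by (rule has_derivative_compose[of "\<lambda>s. p0 + s *\<^sub>R v" _ 0 UNIV "\<lambda>p. \<kappa> p y", simplified])
         (auto intro!: derivative_eq_intros der)
    then have "((\<lambda>s. \<kappa> (p0 + s *\<^sub>R v) y) has_real_derivative D y v) (at 0)"
      by (simp add: s has_field_derivative_def mult.commute[of _ "D y v"])
    then have "((\<lambda>s. (\<kappa> (p0 + s *\<^sub>R v) y - \<kappa> p0 y) / s) \<longlongrightarrow> D y v) (at 0)"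
      by (simp add: DERIV_def)
    moreover have "filterlim (\<lambda>n. 1 / real (Suc n)) (at 0) sequentially"
      unfolding filterlim_at using LIMSEQ_inverse_real_of_nat by (simp add: inverse_eq_divide)
    ultimately show ?thesis by (rule filterlim_compose)
  qed
  show bd: "\<bar>D y v\<bar> \<le> B y * norm v" for y v
  proof (rule tendsto_upperbound[OF tendsto_rabs[OF lim]])
    have "eventually (\<lambda>n. (1 / real (Suc n)) * norm v < e) sequentially"
      by (rule order_tendstoD[OF _ e]) (use tendsto_mult_left_zero[OF LIMSEQ_inverse_real_of_nat, of "norm v"] in \<open>simp add: inverse_eq_divide\<close>)
    then show "\<forall>\<^sub>F n in sequentially. \<bar>(\<kappa> (p0 + (1 / real (Suc n)) *\<^sub>R v) y - \<kappa> p0 y) / (1 / real (Suc n))\<bar> \<le> B y * norm v"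
    proof eventually_elim
      case (elim n)
      then have "\<bar>\<kappa> (p0 + (1 / real (Suc n)) *\<^sub>R v) y - \<kappa> p0 y\<bar> \<le> B y * (1 / real (Suc n) * norm v)"
        using lip[of "p0 + (1 / real (Suc n)) *\<^sub>R v" y] by (simp add: dist_norm)
      then have "(1 / real (Suc n)) * (\<bar>\<kappa> (p0 + (1 / real (Suc n)) *\<^sub>R v) y - \<kappa> p0 y\<bar> / (1 / real (Suc n))) \<le> (1 / real (Suc n)) * (B y * norm v)"
        by (simp add: mult_ac)
      then have "\<bar>\<kappa> (p0 + (1 / real (Suc n)) *\<^sub>R v) y - \<kappa> p0 y\<bar> / (1 / real (Suc n)) \<le> B y * norm v"
        by (rule mult_left_le_imp_le) simp
      then show ?case by (simp only: abs_divide abs_of_pos[of "1 / real (Suc n)"] of_nat_0_less_iff zero_less_divide_1_iff zero_less_Suc)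
    qed
  qed simp
  have meas: "(\<lambda>y. D y v) \<in> borel_measurable M" for v
    by (rule borel_measurable_LIMSEQ_real[OF lim]) (use int in measurable)
  show intD: "integrable M (\<lambda>y. D y v)" for v
    using bd meas by (intro Bochner_Integration.integrable_bound[OF integrable_mult_left[OF B, of "norm v"]])
       (auto intro!: AE_I2 order.trans[OF _ abs_ge_self])
  have lin: "linear (D y)" for y using der by (rule has_derivative_linear)
  show "((\<lambda>p. \<integral>y. \<kappa> p y \<partial>M) has_derivative (\<lambda>v. \<integral>y. D y v \<partial>M)) (at p0)"
    unfolding has_derivative_at
  proof
    show "bounded_linear (\<lambda>v. \<integral>y. D y v \<partial>M)"
    proof (rule bounded_linear_intro[where K = "integral\<^sup>L M B"])
      fix u v :: 'p and r :: real
      show "(\<integral>y. D y (u + v) \<partial>M) = (\<integral>y. D y u \<partial>M) + (\<integral>y. D y v \<partial>M)"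
        using intD by (simp add: linear_add[OF lin])
      show "(\<integral>y. D y (r *\<^sub>R v) \<partial>M) = r *\<^sub>R (\<integral>y. D y v \<partial>M)"
        by (simp add: linear_cmul[OF lin])
      have "\<bar>\<integral>y. D y v \<partial>M\<bar> \<le> (\<integral>y. B y * norm v \<partial>M)"
        using bd intD B by (intro order.trans[OF integral_abs_bound] integral_mono) auto
      then show "norm (\<integral>y. D y v \<partial>M) \<le> norm v * integral\<^sup>L M B" by (simp add: mult.commute)
    qed
    show "(\<lambda>h. norm ((\<integral>y. \<kappa> (p0 + h) y \<partial>M) - (\<integral>y. \<kappa> p0 y \<partial>M) - (\<integral>y. D y h \<partial>M)) / norm h) \<midarrow>0\<rightarrow> 0"
      unfolding tendsto_at_iff_sequentially comp_def
    proof (intro allI impI)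
      fix X :: "nat \<Rightarrow> 'p" assume X: "\<forall>i. X i \<in> UNIV - {0}" "X \<longlonglongrightarrow> 0"
      obtain N where N: "\<And>n. n \<ge> N \<Longrightarrow> norm (X n) < e"
        using X(2) e by (metis LIMSEQ_D diff_zero)
      define q where "q n y = (\<kappa> (p0 + X n) y - \<kappa> p0 y - D y (X n)) / norm (X n)" for n y
      have "(\<lambda>n. \<integral>y. q (n + N) y \<partial>M) \<longlonglongrightarrow> (\<integral>y. 0 \<partial>M)"
      proof (rule integral_dominated_convergence[where w = "\<lambda>y. 2 * B y"])
        show "AE y in M. (\<lambda>n. q (n + N) y) \<longlonglongrightarrow> 0"
        proof (rule AE_I2)
          fix y
          have "(\<lambda>h. norm (\<kappa> (p0 + h) y - \<kappa> p0 y - D y h) / norm h) \<midarrow>0\<rightarrow> 0"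
            using der[of y] unfolding has_derivative_at by simp
          then have "(\<lambda>n. norm (\<kappa> (p0 + X n) y - \<kappa> p0 y - D y (X n)) / norm (X n)) \<longlonglongrightarrow> 0"
            using X unfolding tendsto_at_iff_sequentially comp_def by simp
          then have "(\<lambda>n. norm (q n y)) \<longlonglongrightarrow> 0" by (simp add: q_def)
          then show "(\<lambda>n. q (n + N) y) \<longlonglongrightarrow> 0"
            by (intro LIMSEQ_ignore_initial_segment) (rule tendsto_norm_zero_cancel)
        qed
        show "AE y in M. norm (q (n + N) y) \<le> 2 * B y" for n
        proof (rule AE_I2)
          fix y
          have "\<bar>\<kappa> (p0 + X (n + N)) y - \<kappa> p0 y\<bar> \<le> B y * norm (X (n + N))"
            using lip[of "p0 + X (n + N)" y] N[of "n + N"] by (simp add: dist_norm)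
          moreover have "\<bar>D y (X (n + N))\<bar> \<le> B y * norm (X (n + N))" by (rule bd)
          ultimately have "\<bar>\<kappa> (p0 + X (n + N)) y - \<kappa> p0 y - D y (X (n + N))\<bar> \<le> 2 * B y * norm (X (n + N))"
            by linarith
          then show "norm (q (n + N) y) \<le> 2 * B y" using X(1) by (simp add: q_def field_simps)
        qed
      qed (use int meas B in \<open>auto simp: q_def\<close>)
      then have "(\<lambda>n. \<bar>\<integral>y. q n y \<partial>M\<bar>) \<longlonglongrightarrow> 0"
        by (intro tendsto_rabs_zero) (simp add: LIMSEQ_offset)
      moreover have "(\<integral>y. q n y \<partial>M) = ((\<integral>y. \<kappa> (p0 + X n) y \<partial>M) - (\<integral>y. \<kappa> p0 y \<partial>M) - (\<integral>y. D y (X n) \<partial>M)) / norm (X n)" for n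
        unfolding q_def using int intD by simp
      ultimately show "(\<lambda>n. norm ((\<integral>y. \<kappa> (p0 + X n) y \<partial>M) - (\<integral>y. \<kappa> p0 y \<partial>M) - (\<integral>y. D y (X n) \<partial>M)) / norm (X n)) \<longlonglongrightarrow> 0"
        by simp
    qed
  qed
qed

lemma has_gradient_lipschitz:
  assumes "has_gradient f G" "\<And>x. norm (G x) \<le> B"
  shows "\<bar>f x - f y\<bar> \<le> B * norm (x - y)"
proof -
  have "norm (f x - f y) \<le> B * norm (x - y)"
  proof (rule differentiable_bound[of UNIV])
    show "(f has_derivative (\<lambda>v. G x \<bullet> v)) (at x within UNIV)" for x
      using assms(1) by (simp add: has_gradient_def)
    show "onorm (\<lambda>v. G x \<bullet> v) \<le> B" for x
      using assms(2)[of x] order.trans[OF norm_ge_zero assms(2)[of x]]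
      by (intro onorm_bound) (simp, use Cauchy_Schwarz_ineq2[of "G x"] mult_right_mono[OF assms(2)[of x] norm_ge_zero] in \<open>simp, blast intro: order.trans\<close>)
  qed auto
  then show ?thesis by simp
qed

lemma has_gradient_test: "\<phi> \<in> test_functions U \<Longrightarrow> has_gradient \<phi> (grad \<phi>)"
  by (simp add: has_gradient_def test_functionsD(5))

lemma has_gradient_zero_outside:
  assumes "has_gradient f G" "closed S" "\<And>x. x \<notin> S \<Longrightarrow> f x = 0" "x \<notin> S"
  shows "G x = 0"
proof -
  have "((\<lambda>x. 0) has_derivative (\<lambda>v. 0)) (at x)" by simp
  then have "(f has_derivative (\<lambda>v. 0)) (at x)"
    by (rule has_derivative_transform_within_open[of _ _ _ _ "- S"])
       (use assms in \<open>auto simp: open_Compl\<close>)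
  then have "grad f x = 0" by (intro grad_eqI) simp
  with has_gradient_grad[OF assms(1)] show ?thesis by simp
qed

text \<open>Every derivative falls on the test function, whose partial derivatives are again test
  functions; of \<open>f\<close> only integrability enters.\<close>

lemma C_k_convolution:
  fixes f :: "'a::euclidean_space \<Rightarrow> real"
  assumes f: "integrable lborel f"
  shows "\<phi> \<in> test_functions UNIV \<Longrightarrow> C_k k (\<lambda>x. \<integral>y. f y * \<phi> (x - y) \<partial>lborel)"
proof (induction k arbitrary: \<phi>)
  have D: "((\<lambda>x. \<integral>y. f y * \<phi> (x - y) \<partial>lborel) has_derivative (\<lambda>v. \<integral>y. f y * (grad \<phi> (x - y) \<bullet> v) \<partial>lborel)) (at x)"
    if \<phi>: "\<phi> \<in> test_functions UNIV" for \<phi> x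
  proof -
    obtain B where B: "\<And>x. norm (grad \<phi> x) \<le> B"
      using continuous_compact_support_bounded[OF continuous_on_grad_test[OF \<phi>], of "supp \<phi>"]
        has_gradient_zero_outside[OF has_gradient_test[OF \<phi>], of "supp \<phi>"] test_functionsD[OF \<phi>] zero_outside_supp
        compact_imp_closed by metis
    obtain B' where B': "\<And>x. norm (\<phi> x) \<le> B'"
      using continuous_compact_support_bounded[of \<phi> "supp \<phi>"] test_functionsD[OF \<phi>] zero_outside_supp by metis
    have m: "\<phi> \<in> borel_measurable borel" using test_functionsD(6)[OF \<phi>] by (rule borel_measurable_continuous_onI)
    show ?thesis
    proof (rule has_derivative_integral(3)[where e = 1 and B = "\<lambda>y. B * \<bar>f y\<bar>"])
      show "integrable lborel (\<lambda>y. f y * \<phi> (p - y))" for p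
        using m B' by (intro integrable_mult_bounded[OF f]) auto
      show "((\<lambda>p. f y * \<phi> (p - y)) has_derivative (\<lambda>v. f y * (grad \<phi> (x - y) \<bullet> v))) (at x)" for y
        by (rule has_derivative_mult_right, rule has_derivative_compose[of "\<lambda>p. p - y" "\<lambda>v. v" _ UNIV \<phi>, simplified])
           (auto intro!: derivative_eq_intros test_functionsD(5)[OF \<phi>])
      show "\<bar>f y * \<phi> (p - y) - f y * \<phi> (x - y)\<bar> \<le> B * \<bar>f y\<bar> * norm (p - x)" for p y
        using mult_left_mono[OF has_gradient_lipschitz[OF has_gradient_test[OF \<phi>] B, of "p - y" "x - y"], of "\<bar>f y\<bar>"]
        by (simp add: abs_mult right_diff_distrib[symmetric] mult_ac)
    qed (use f in auto)
  qed
  {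
    case 0
    then show ?case using D
      by (auto intro!: continuous_at_imp_continuous_on has_derivative_continuous)
  next
    case (Suc k)
    have "pderiv_at b (\<lambda>x. \<integral>y. f y * \<phi> (x - y) \<partial>lborel) = (\<lambda>x. \<integral>y. f y * pderiv_at b \<phi> (x - y) \<partial>lborel)" if "b \<in> Basis" for b
      using that by (subst pderiv_at_fun_eqI[OF D[OF Suc.prems]]) (simp add: grad_inner_Basis)
    moreover have "(\<lambda>x. \<integral>y. f y * \<phi> (x - y) \<partial>lborel) differentiable (at x)" for x
      using D[OF Suc.prems] by (auto simp: differentiable_def)
    ultimately show ?case using Suc.IH[OF pderiv_test_functions[OF Suc.prems]] by simp
  }
qed

lemma uniformly_continuous_compact_support:
  fixes f :: "'a::euclidean_space \<Rightarrow> 'b::real_normed_vector"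
  assumes f: "continuous_on UNIV f" "compact S" "\<And>x. x \<notin> S \<Longrightarrow> f x = 0" and "e > 0"
  obtains d where "d > 0" "\<And>x y. norm (x - y) < d \<Longrightarrow> norm (f x - f y) < e"
proof -
  obtain R where R: "S \<subseteq> ball 0 R" using assms(2) bounded_subset_ballD compact_imp_bounded by metis
  have "uniformly_continuous_on (cball 0 (R + 1)) f"
    using f(1) by (intro compact_uniformly_continuous) (auto intro: continuous_on_subset)
  then obtain d where d: "d > 0" "\<And>x y. x \<in> cball 0 (R+1) \<Longrightarrow> y \<in> cball 0 (R+1) \<Longrightarrow> dist y x < d \<Longrightarrow> dist (f y) (f x) < e"
    using \<open>e > 0\<close> unfolding uniformly_continuous_on_def by metis
  \<comment> \<open>The minimum with 1 keeps both points in the enlarged ball as soon as one of them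
    lies in \<open>S\<close>.\<close>
  show ?thesis
  proof (rule that[of "min d 1"])
    fix x y :: 'a assume xy: "norm (x - y) < min d 1"
    show "norm (f x - f y) < e"
    proof (cases "x \<in> S \<or> y \<in> S")
      case True
      then have "norm x < R \<or> norm y < R" using R by auto
      then have "norm x \<le> R + 1" "norm y \<le> R + 1" using xy norm_triangle_sub[of x y] norm_triangle_sub[of y x]
        by (auto simp: norm_minus_commute)
      then show ?thesis using d(2)[of y x] xy by (simp add: dist_norm)
    qed (use f(3) \<open>e > 0\<close> in auto)
  qed (use d in auto)
qed

lemma lborel_reflect: "distr lborel borel (\<lambda>y. a - y) = (lborel :: 'a::euclidean_space measure)"
  using lborel_affine[of "-1" a] by (simp add: density_1)

lemma integral_reflect_lborel:
  fixes f :: "'a::euclidean_space \<Rightarrow> real"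
  assumes "f \<in> borel_measurable borel"
  shows "(\<integral>y. f y \<partial>lborel) = (\<integral>y. f (a - y) \<partial>lborel)"
  by (subst lborel_reflect[of a, symmetric], subst integral_distr) (use assms in auto)

text \<open>Convolution with a mollifier whose radius lies below the moduli of continuity of both
  \<open>f\<close> and \<open>G\<close> for the error \<open>e\<close>, and below \<open>e\<close>
  itself, which limits the growth of the support.\<close>

lemma test_function_approx:
  fixes f :: "'a::euclidean_space \<Rightarrow> real"
  assumes f: "has_gradient f G" "continuous_on UNIV G" "compact S" "\<And>x. x \<notin> S \<Longrightarrow> f x = 0" and e: "e > 0"
  obtains \<phi> where "\<phi> \<in> test_functions UNIV" "\<And>x. (\<And>y. y \<in> S \<Longrightarrow> e \<le> dist x y) \<Longrightarrow> \<phi> x = 0"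
    "\<And>x. \<bar>\<phi> x - f x\<bar> \<le> e" "\<And>x. norm (grad \<phi> x - G x) \<le> e"
proof -
  have G0: "x \<notin> S \<Longrightarrow> G x = 0" for x
    using has_gradient_zero_outside[OF f(1) compact_imp_closed[OF f(3)] f(4)] by blast
  have cf: "continuous_on UNIV f"
    using f(1) unfolding has_gradient_def by (auto intro!: continuous_at_imp_continuous_on has_derivative_continuous)
  obtain B where B: "\<And>x. norm (G x) \<le> B"
    using continuous_compact_support_bounded[OF f(2,3) G0] by metis
  obtain B' where B': "\<And>x. norm (f x) \<le> B'"
    using continuous_compact_support_bounded[OF cf f(3,4)] by metis
  obtain d1 where d1: "d1 > 0" "\<And>x y. norm (x - y) < d1 \<Longrightarrow> norm (f x - f y) < e"
    using uniformly_continuous_compact_support[OF cf f(3,4) e] by metis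
  obtain d2 where d2: "d2 > 0" "\<And>x y. norm (x - y) < d2 \<Longrightarrow> norm (G x - G y) < e"
    using uniformly_continuous_compact_support[OF f(2,3) G0 e] by metis
  define r where "r = min e (min d1 d2)"
  have r: "r > 0" "r \<le> e" "r \<le> d1" "r \<le> d2" using e d1 d2 by (auto simp: r_def)
  obtain \<rho> :: "'a \<Rightarrow> real" where \<rho>: "\<rho> \<in> test_functions UNIV" "\<And>x. 0 \<le> \<rho> x" "\<And>x. r \<le> norm x \<Longrightarrow> \<rho> x = 0"
    "integrable lborel \<rho>" "integral\<^sup>L lborel \<rho> = 1"
    using ex_mollifier[OF r(1)] by metis
  have mf: "f \<in> borel_measurable borel"
    using cf by (rule borel_measurable_continuous_onI)
  have intf: "integrable lborel f"
    by (rule integrable_bounded_compact_support[OF _ mf B' f(4)])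
       (use f(3) emeasure_compact_finite[OF f(3)] in \<open>auto simp: compact_imp_closed borel_closed\<close>)
  define \<phi> where "\<phi> x = (\<integral>y. f y * \<rho> (x - y) \<partial>lborel)" for x
  have C: "C_k k \<phi>" for k unfolding \<phi>_def[abs_def] by (rule C_k_convolution[OF intf \<rho>(1)])
  \<comment> \<open>The first form of the convolution shows smoothness. After the reflection the
    derivative falls on \<open>f\<close>, so the gradient of \<phi> is an average of
    \<open>G\<close> and hence uniformly close to \<open>G\<close>.\<close>
  have \<phi>_alt: "\<phi> x = (\<integral>y. f (x - y) * \<rho> y \<partial>lborel)" for x
  proof -
    have m\<rho>: "\<rho> \<in> borel_measurable borel" using test_functionsD(6)[OF \<rho>(1)] by (rule borel_measurable_continuous_onI)
    show ?thesis unfolding \<phi>_def using mf m\<rho> integral_reflect_lborel[of "\<lambda>y. f y * \<rho> (x - y)" x] by simp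
  qed
  have D: "(\<phi> has_derivative (\<lambda>v. \<integral>y. \<rho> y * (G (x - y) \<bullet> v) \<partial>lborel)) (at x)" and intG: "integrable lborel (\<lambda>y. \<rho> y * (G (x - y) \<bullet> v))" for x v
  proof -
    have a1: "integrable lborel (\<lambda>y. f (p - y) * \<rho> y)" for p
      using mf B' unfolding mult.commute[of _ "\<rho> _"] by (intro integrable_mult_bounded[OF \<rho>(4)]) auto
    have a2: "((\<lambda>p. f (p - y) * \<rho> y) has_derivative (\<lambda>v. \<rho> y * (G (x - y) \<bullet> v))) (at x)" for y
      unfolding mult.commute[of _ "\<rho> y"]
      by (rule has_derivative_mult_right, rule has_derivative_compose[of "\<lambda>p. p - y" "\<lambda>v. v" _ UNIV f, simplified])
           (use f(1) in \<open>auto intro!: derivative_eq_intros simp: has_gradient_def\<close>)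
    have a3: "\<bar>f (p - y) * \<rho> y - f (x - y) * \<rho> y\<bar> \<le> B * \<bar>\<rho> y\<bar> * norm (p - x)" for p y
        using mult_right_mono[OF has_gradient_lipschitz[OF f(1) B, of "p - y" "x - y"], of "\<bar>\<rho> y\<bar>"]
        by (simp add: abs_mult[symmetric] left_diff_distrib[symmetric]) (simp add: abs_mult mult_ac)
    have a4: "integrable lborel (\<lambda>y. B * \<bar>\<rho> y\<bar>)" using \<rho>(4) by simp
    show "(\<phi> has_derivative (\<lambda>v. \<integral>y. \<rho> y * (G (x - y) \<bullet> v) \<partial>lborel)) (at x)"
      unfolding \<phi>_alt[abs_def] by (rule has_derivative_integral(3)[OF a1 a2 zero_less_one a3 a4])
    show "integrable lborel (\<lambda>y. \<rho> y * (G (x - y) \<bullet> v))"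
      by (rule has_derivative_integral(1)[OF a1 a2 zero_less_one a3 a4])
  qed
  have supp: "\<phi> x = 0" if "\<And>y. y \<in> S \<Longrightarrow> r \<le> dist x y" for x :: 'a
  proof -
    have "f y * \<rho> (x - y) = 0" for y
      using that[of y] f(4)[of y] \<rho>(3)[of "x - y"] by (cases "y \<in> S") (auto simp: dist_norm)
    then show ?thesis unfolding \<phi>_def by (simp only: integral_zero)
  qed
  obtain R where R: "S \<subseteq> ball 0 R" using f(3) bounded_subset_ballD compact_imp_bounded by metis
  show ?thesis
  proof (rule that[of \<phi>])
    show "\<phi> \<in> test_functions UNIV"
    proof (rule test_functionsI[OF C, of "cball 0 (R + r)"])
      fix x :: 'a assume "x \<notin> cball 0 (R + r)"
      then have x: "norm x > R + r" by simp
      show "\<phi> x = 0"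
      proof (rule supp)
        fix y assume "y \<in> S" then have "norm y < R" using R by auto
        then show "r \<le> dist x y" using x norm_triangle_sub[of x y] by (simp add: dist_norm)
      qed
    qed auto
    show "\<phi> x = 0" if "\<And>y. y \<in> S \<Longrightarrow> e \<le> dist x y" for x :: 'a
      using that r(2) by (intro supp) force
    show "\<bar>\<phi> x - f x\<bar> \<le> e" for x
    proof -
      have i: "integrable lborel (\<lambda>y. f (x - y) * \<rho> y)"
      using mf B' unfolding mult.commute[of _ "\<rho> _"] by (intro integrable_mult_bounded[OF \<rho>(4)]) auto
      have "\<phi> x - f x = (\<integral>y. f (x - y) * \<rho> y - f x * \<rho> y \<partial>lborel)"
        unfolding \<phi>_alt using i \<rho>(4,5) by simp
      also have "\<bar>\<dots>\<bar> \<le> (\<integral>y. e * \<rho> y \<partial>lborel)"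
      proof (rule order.trans[OF integral_abs_bound], rule integral_mono)
        fix y
        show "\<bar>f (x - y) * \<rho> y - f x * \<rho> y\<bar> \<le> e * \<rho> y"
        proof (cases "norm y < r")
          case True
          then have "\<bar>f (x - y) - f x\<bar> \<le> e" using d1(2)[of "x - y" x] r by auto
          then show ?thesis using \<rho>(2)[of y] by (simp add: left_diff_distrib[symmetric] abs_mult mult_right_mono)
        qed (use \<rho>(3)[of y] in auto)
      qed (use i \<rho> in auto)
      finally show ?thesis using \<rho>(5) by simp
    qed
    show "norm (grad \<phi> x - G x) \<le> e" for x
    proof -
      have g: "grad \<phi> x \<bullet> v = (\<integral>y. \<rho> y * (G (x - y) \<bullet> v) \<partial>lborel)" for v
        using has_derivative_unique[OF D has_derivative_grad[of \<phi> x]] D[of x] unfolding differentiable_def by metis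
      have "\<bar>(grad \<phi> x - G x) \<bullet> v\<bar> \<le> e * norm v" for v
      proof -
        have "(grad \<phi> x - G x) \<bullet> v = (\<integral>y. \<rho> y * (G (x - y) \<bullet> v) - \<rho> y * (G x \<bullet> v) \<partial>lborel)"
          unfolding inner_diff_left g using intG \<rho>(4,5) by simp
        also have "\<bar>\<dots>\<bar> \<le> (\<integral>y. \<rho> y * (e * norm v) \<partial>lborel)"
        proof (rule order.trans[OF integral_abs_bound], rule integral_mono)
          fix y
          show "\<bar>\<rho> y * (G (x - y) \<bullet> v) - \<rho> y * (G x \<bullet> v)\<bar> \<le> \<rho> y * (e * norm v)"
          proof (cases "norm y < r")
            case True
            then have "norm (G (x - y) - G x) \<le> e" using d2(2)[of "x - y" x] r by auto
            then have "\<bar>(G (x - y) - G x) \<bullet> v\<bar> \<le> e * norm v"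
              by (intro order.trans[OF Cauchy_Schwarz_ineq2] mult_right_mono) auto
            then show ?thesis using \<rho>(2)[of y]
              by (simp add: right_diff_distrib[symmetric] inner_diff_left[symmetric] abs_mult mult_left_mono)
          qed (use \<rho>(3)[of y] in auto)
        qed (use intG \<rho> in auto)
        finally show ?thesis using \<rho>(5) by simp
      qed
      from this[of "grad \<phi> x - G x"] show ?thesis
        using e by (cases "grad \<phi> x = G x") (auto simp: dot_square_norm power2_eq_square)
    qed
  qed
qed

text \<open>Functions carried over by the shear are C^1 but not smooth, while the hypotheses on the
  field speak of smooth functions. Uniform approximation of \<open>f\<close> and \<open>G\<close>
  closes this gap. With \<open>g\<close> = 0 this serves the divergence condition, with the trace
  density as \<open>g\<close> the trace identity.\<close>

lemma test_identity_extends: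
  fixes w :: "'a::euclidean_space \<Rightarrow> 'a"
  assumes U: "open U" and w: "w \<in> borel_measurable borel" "\<And>R. integrable lborel (\<lambda>x. indicator (ball 0 R) x *\<^sub>R w x)"
    and M: "sets M = sets borel" "\<And>R. emeasure M (ball 0 R) < \<infinity>"
    and g: "g \<in> borel_measurable borel" "\<And>x. \<bar>g x\<bar> \<le> c"
    and id: "\<And>\<phi>. \<phi> \<in> test_functions U \<Longrightarrow> (\<integral>x. w x \<bullet> grad \<phi> x \<partial>lborel) = (\<integral>x. g x * \<phi> x \<partial>M)"
    and f: "has_gradient f G" "continuous_on UNIV G" "compact S" "S \<subseteq> U" "\<And>x. x \<notin> S \<Longrightarrow> f x = 0"
  shows "(\<integral>x. w x \<bullet> G x \<partial>lborel) = (\<integral>x. g x * f x \<partial>M)"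
proof -
  have G0: "x \<notin> S \<Longrightarrow> G x = 0" for x
    using has_gradient_zero_outside[OF f(1) compact_imp_closed[OF f(3)] f(5)] by blast
  have cf: "continuous_on UNIV f"
    using f(1) unfolding has_gradient_def by (auto intro!: continuous_at_imp_continuous_on has_derivative_continuous)
  obtain B where B: "B > 0" "\<And>x. norm (G x) \<le> B"
    using continuous_compact_support_bounded[OF f(2,3) G0] by metis
  obtain B' where B': "B' > 0" "\<And>x. norm (f x) \<le> B'"
    using continuous_compact_support_bounded[OF cf f(3,5)] by metis
  obtain d where d: "d > 0" "\<And>x y. x \<in> S \<Longrightarrow> y \<in> - U \<Longrightarrow> d \<le> dist x y"
    using separate_compact_closed[OF f(3), of "- U"] U f(4) by (auto simp: closed_Compl disjoint_eq_subset_Compl)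
  obtain R where R: "S \<subseteq> ball 0 R" using f(3) bounded_subset_ballD compact_imp_bounded by metis
  \<comment> \<open>Errors below d/2 keep the supports of all approximants inside \<open>U\<close>;
    errors below 1 keep them in one fixed ball, over which \<open>w\<close> and \<open>M\<close>
    provide the majorants.\<close>
  define e where "e n = min 1 (d / 2) * (1 / real (Suc n))" for n
  have e0: "e n > 0" for n using d by (simp add: e_def)
  have e1: "e n \<le> min 1 (d/2)" for n unfolding e_def using d by (intro mult_left_le) auto
  have elim: "e \<longlonglongrightarrow> 0" unfolding e_def[abs_def]
    using tendsto_mult_right_zero[OF LIMSEQ_inverse_real_of_nat] by (simp add: inverse_eq_divide)
  have "\<exists>\<phi>. \<phi> \<in> test_functions UNIV \<and> (\<forall>x. (\<forall>y. y \<in> S \<longrightarrow> e n \<le> dist x y) \<longrightarrow> \<phi> x = 0) \<and>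
    (\<forall>x. \<bar>\<phi> x - f x\<bar> \<le> e n) \<and> (\<forall>x. norm (grad \<phi> x - G x) \<le> e n)" for n
    using test_function_approx[OF f(1,2,3,5) e0[of n]] by metis
  then obtain \<phi> where \<phi>: "\<And>n. \<phi> n \<in> test_functions UNIV" "\<And>n x. (\<forall>y. y \<in> S \<longrightarrow> e n \<le> dist x y) \<Longrightarrow> \<phi> n x = 0"
    "\<And>n x. \<bar>\<phi> n x - f x\<bar> \<le> e n" "\<And>n x. norm (grad (\<phi> n) x - G x) \<le> e n"
    by metis
  define S' where "S' = {x. \<exists>y\<in>S. dist x y \<le> min 1 (d / 2)}"
  have "S' = (\<Union>y\<in>S. \<Union>z\<in>cball 0 (min 1 (d/2)). {y + z})"
  proof (intro set_eqI iffI)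
    fix x assume "x \<in> S'"
    then obtain y where "y \<in> S" "dist x y \<le> min 1 (d / 2)" unfolding S'_def by blast
    then have "y \<in> S" "x - y \<in> cball 0 (min 1 (d/2))" "x = y + (x - y)" by (auto simp: dist_norm norm_minus_commute)
    then show "x \<in> (\<Union>y\<in>S. \<Union>z\<in>cball 0 (min 1 (d/2)). {y + z})" by blast
  qed (force simp: S'_def dist_norm)
  then have cS': "compact S'" using compact_sums'[OF f(3) compact_cball, of 0 "min 1 (d/2)"] by simp
  have S'U: "S' \<subseteq> U" using d unfolding S'_def by (force simp: dist_commute)
  have S'R: "S' \<subseteq> ball 0 (R + 1)"
  proof
    fix x assume "x \<in> S'"
    then obtain y where "y \<in> S" "norm (x - y) \<le> 1" by (auto simp: S'_def dist_norm)
    then show "x \<in> ball 0 (R + 1)" using R norm_triangle_sub[of x y] by force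
  qed
  have z: "\<phi> n x = 0" if "x \<notin> S'" for n x
    using that e1[of n] by (intro \<phi>(2)) (force simp: S'_def)
  have tU: "\<phi> n \<in> test_functions U" for n
    by (rule test_functionsI[OF test_functionsD(1)[OF \<phi>(1)] cS' S'U z])
  have gz: "grad (\<phi> n) x = 0" if "x \<notin> S'" for n x
    using has_gradient_zero_outside[OF has_gradient_test[OF \<phi>(1)] compact_imp_closed[OF cS'] z that] .
  have "(\<lambda>n. \<integral>x. w x \<bullet> grad (\<phi> n) x \<partial>lborel) \<longlonglongrightarrow> (\<integral>x. w x \<bullet> G x \<partial>lborel)"
  proof (rule integral_dominated_convergence[where w = "\<lambda>x. (B + 1) * norm (indicator (ball 0 (R+1)) x *\<^sub>R w x)"])
    show "(\<lambda>x. w x \<bullet> G x) \<in> borel_measurable lborel"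
      using w(1) borel_measurable_continuous_onI[OF f(2)] by auto
    show "(\<lambda>x. w x \<bullet> grad (\<phi> n) x) \<in> borel_measurable lborel" for n
      using w(1) borel_measurable_continuous_onI[OF continuous_on_grad_test[OF \<phi>(1)]] by auto
    show "integrable lborel (\<lambda>x. (B + 1) * norm (indicator (ball 0 (R+1)) x *\<^sub>R w x))"
      using w(2)[of "R+1"] by (intro integrable_mult_right integrable_norm)
    show "AE x in lborel. (\<lambda>n. w x \<bullet> grad (\<phi> n) x) \<longlonglongrightarrow> w x \<bullet> G x"
    proof (rule AE_I2)
      fix x
      have "(\<lambda>n. norm (grad (\<phi> n) x - G x)) \<longlonglongrightarrow> 0"
        by (rule tendsto_sandwich[OF _ _ tendsto_const elim]) (use \<phi>(4) in auto)
      then have "(\<lambda>n. grad (\<phi> n) x) \<longlonglongrightarrow> G x" by (rule LIM_zero_cancel[OF tendsto_norm_zero_cancel])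
      then show "(\<lambda>n. w x \<bullet> grad (\<phi> n) x) \<longlonglongrightarrow> w x \<bullet> G x" by (intro tendsto_intros)
    qed
    show "AE x in lborel. norm (w x \<bullet> grad (\<phi> n) x) \<le> (B + 1) * norm (indicator (ball 0 (R+1)) x *\<^sub>R w x)" for n
    proof (rule AE_I2)
      fix x
      have "norm (grad (\<phi> n) x) \<le> B + 1"
        using \<phi>(4)[of n x] B(2)[of x] e1[of n] norm_triangle_sub[of "grad (\<phi> n) x" "G x"] by linarith
      then have "\<bar>w x \<bullet> grad (\<phi> n) x\<bar> \<le> norm (w x) * (B + 1)"
        by (intro order.trans[OF Cauchy_Schwarz_ineq2] mult_left_mono) auto
      then show "norm (w x \<bullet> grad (\<phi> n) x) \<le> (B + 1) * norm (indicator (ball 0 (R+1)) x *\<^sub>R w x)"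
        using gz[of x n] subsetD[OF S'R, of x] B(1) by (cases "x \<in> S'") (auto simp: mult.commute indicator_def)
    qed
  qed
  moreover have "(\<lambda>n. \<integral>x. g x * \<phi> n x \<partial>M) \<longlonglongrightarrow> (\<integral>x. g x * f x \<partial>M)"
  proof (rule integral_dominated_convergence[where w = "\<lambda>x. (c * (B' + 1)) * indicator (ball 0 (R+1)) x"])
    show "(\<lambda>x. g x * f x) \<in> borel_measurable M" "(\<lambda>x. g x * \<phi> n x) \<in> borel_measurable M" for n
      using g(1) borel_measurable_continuous_onI[OF cf] borel_measurable_continuous_onI[OF test_functionsD(6)[OF \<phi>(1)]]
      by (auto simp: measurable_cong_sets[OF M(1) refl])
    show "integrable M (\<lambda>x. (c * (B' + 1)) * indicator (ball 0 (R+1)) x)"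
      using M by (intro integrable_mult_right integrable_real_indicator) auto
    show "AE x in M. (\<lambda>n. g x * \<phi> n x) \<longlonglongrightarrow> g x * f x"
    proof (rule AE_I2)
      fix x
      have "(\<lambda>n. norm (\<phi> n x - f x)) \<longlonglongrightarrow> 0"
        by (rule tendsto_sandwich[OF _ _ tendsto_const elim]) (use \<phi>(3) in auto)
      then have "(\<lambda>n. \<phi> n x) \<longlonglongrightarrow> f x" by (rule LIM_zero_cancel[OF tendsto_norm_zero_cancel])
      then show "(\<lambda>n. g x * \<phi> n x) \<longlonglongrightarrow> g x * f x" by (intro tendsto_intros)
    qed
    show "AE x in M. norm (g x * \<phi> n x) \<le> (c * (B' + 1)) * indicator (ball 0 (R+1)) x" for n
    proof (rule AE_I2)
      fix x
      have "\<bar>\<phi> n x\<bar> \<le> B' + 1"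
        using \<phi>(3)[of n x] B'(2)[of x] e1[of n] by (simp, linarith)
      then have "\<bar>g x * \<phi> n x\<bar> \<le> c * (B' + 1)"
        using g(2)[of x] unfolding abs_mult by (intro mult_mono) auto
      then show "norm (g x * \<phi> n x) \<le> (c * (B' + 1)) * indicator (ball 0 (R+1)) x"
        using z[of x n] subsetD[OF S'R, of x] abs_ge_zero[of "g x * \<phi> n x"] by (cases "x \<in> S'") (auto simp: indicator_def)
    qed
  qed
  ultimately show ?thesis using id[OF tU] LIMSEQ_unique by simp
qed

lemma ennreal_suminf_tail:
  fixes a :: "nat \<Rightarrow> ennreal"
  assumes "(\<Sum>k. a k) < \<infinity>" "e > 0"
  obtains n where "(\<Sum>k. a (k + n)) \<le> ennreal e"
proof -
  have fin: "a k < \<infinity>" for k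
    using assms(1) ennreal_suminf_lessD by blast
  define r where "r k = enn2real (a k)" for k
  have a: "a k = ennreal (r k)" and r0: "0 \<le> r k" for k using fin[of k] by (auto simp: r_def)
  have sm: "summable r"
    using assms(1) r0 unfolding a by (intro summable_suminf_not_top) auto
  obtain N where "\<And>n. n \<ge> N \<Longrightarrow> norm (\<Sum>i. r (i + n)) < e"
    using suminf_exist_split[OF assms(2) sm] by metis
  from this[of N] have "(\<Sum>i. r (i + N)) \<le> e" by simp
  moreover have "(\<Sum>k. a (k + N)) = ennreal (\<Sum>i. r (i + N))"
    unfolding a using sm r0 by (intro suminf_ennreal2) (auto simp: summable_iff_shift)
  ultimately have "(\<Sum>k. a (k + N)) \<le> ennreal e" by (simp add: ennreal_leI)
  then show ?thesis by (rule that)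
qed

subsection \<open>Metric outer measures\<close>

context
  fixes f :: "'a::metric_space set \<Rightarrow> ennreal"
  assumes f: "outer_measure_space UNIV f"
    and metric: "\<And>A B d. d > 0 \<Longrightarrow> (\<And>x y. x \<in> A \<Longrightarrow> y \<in> B \<Longrightarrow> d \<le> dist x y) \<Longrightarrow> f A + f B \<le> f (A \<union> B)"
begin

lemma outer_mono: "A \<subseteq> B \<Longrightarrow> f A \<le> f B"
  using f by (auto simp: outer_measure_space_def increasing_def)

lemma outer_empty: "f {} = 0"
  using f by (auto simp: outer_measure_space_def positive_def)

text \<open>Countable subadditivity of an outer measure space is stated for disjoint sequences;
  \<open>disjointed\<close> and monotonicity remove that restriction.\<close>

lemma outer_UN: "f (\<Union>i. A i) \<le> (\<Sum>i::nat. f (A i))"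
proof -
  have "f (\<Union>i. A i) = f (\<Union>i. disjointed A i)" by (simp add: UN_disjointed_eq)
  also have "\<dots> \<le> (\<Sum>i. f (disjointed A i))"
    using f disjoint_family_disjointed[of A] unfolding outer_measure_space_def countably_subadditive_def by auto
  also have "\<dots> \<le> (\<Sum>i. f (A i))"
    by (intro suminf_le summableI outer_mono disjointed_subset)
  finally show ?thesis .
qed

lemma outer_Un: "f (A \<union> B) \<le> f A + f B"
proof -
  have "f (A \<union> B) = f (\<Union>i. binaryset A B i)" by (simp add: UN_binaryset_eq)
  also have "\<dots> \<le> (\<Sum>i. f (binaryset A B i))" by (rule outer_UN)
  also have "\<dots> = f A + f B"
    using suminf_binaryset_eq[of f A B] outer_empty by simp
  finally show ?thesis .
qed

lemma outer_separated_sum: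
  assumes "\<And>i j x y. i < j \<Longrightarrow> x \<in> A i \<Longrightarrow> y \<in> A j \<Longrightarrow> d j \<le> dist x y" "\<And>j. d j > 0"
  shows "(\<Sum>i<n::nat. f (A i)) \<le> f (\<Union>i<n. A i)"
proof (induction n)
  case (Suc n)
  have "(\<Sum>i<Suc n. f (A i)) \<le> f (\<Union>i<n. A i) + f (A n)" using Suc by (simp add: add_right_mono)
  also have "\<dots> \<le> f ((\<Union>i<n. A i) \<union> A n)" by (rule metric[of "d n"]) (use assms in auto)
  also have "(\<Union>i<n. A i) \<union> A n = (\<Union>i<Suc n. A i)" by (auto simp: less_Suc_eq)
  finally show ?case .
qed (simp add: outer_empty)

text \<open>Caratheodory's argument. The part \<open>D n\<close> of \<open>X\<close> at distance at
  least 1/(n+1) from \<open>F\<close> is separated from \<open>F\<close>, so the metric property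
  applies to it. What remains of \<open>X - F\<close> is cut into layers \<open>A k\<close> by
  distance, and their series converges, so that its tail is negligible.\<close>

lemma closed_caratheodory_measurable:
  assumes F: "closed F"
  shows "f (X \<inter> F) + f (X - F) = f X"
proof (rule antisym)
  have "X = (X \<inter> F) \<union> (X - F)" by auto
  then show "f X \<le> f (X \<inter> F) + f (X - F)" using outer_Un by metis
  show "f (X \<inter> F) + f (X - F) \<le> f X"
  proof (cases "f X = \<infinity> \<or> F = {}")
    case True then show ?thesis by (auto simp: outer_empty)
  next
    case False
    then have fin: "f X < \<infinity>" and ne: "F \<noteq> {}" by (auto simp: less_top)
    define D where "D n = {x \<in> X. 1 / real (Suc n) \<le> infdist x F}" for n
    define A where "A n = {x \<in> X. 1 / real (n + 2) \<le> infdist x F \<and> infdist x F < 1 / real (n + 1)}" for n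
    define \<epsilon> where "\<epsilon> j = 1 / real (j + 1) - 1 / real (j + 2)" for j
    have \<epsilon>0: "\<epsilon> j > 0" for j unfolding \<epsilon>_def by (simp add: frac_less2)
    \<comment> \<open>Layers whose indices differ by at least two have positive distance, but
      neighbours may touch. Therefore the even and the odd layers are summed separately, each sum
      being at most \<open>f X\<close>.\<close>
    have sep: "\<epsilon> (j - 1) \<le> dist x y" if "i + 2 \<le> j" "x \<in> A i" "y \<in> A j" for i j x y
    proof -
      have "1 / real j \<le> 1 / real (i + 2)" using that(1) by (intro divide_left_mono) auto
      moreover have "infdist x F \<le> infdist y F + dist x y" by (rule infdist_triangle)
      moreover have "1 / real (j - 1 + 1) = 1 / real j" "real (j - 1 + 2) = real (j + 1)" using that(1) by auto
      ultimately show ?thesis using that(2,3) unfolding A_def \<epsilon>_def by auto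
    qed
    have s: "(\<Sum>k. f (A (2 * k + c))) \<le> f X" for c
    proof (rule suminf_le_const[OF summableI])
      fix n
      have "(\<Sum>k<n. f (A (2 * k + c))) \<le> f (\<Union>k<n. A (2 * k + c))"
      proof (rule outer_separated_sum[where d = "\<lambda>j. \<epsilon> (2 * j + c - 1)"])
        fix i j :: nat and x y assume "i < j" "x \<in> A (2 * i + c)" "y \<in> A (2 * j + c)"
        then show "\<epsilon> (2 * j + c - 1) \<le> dist x y" by (intro sep[of "2 * i + c"]) auto
      qed (rule \<epsilon>0)
      also have "\<dots> \<le> f X" by (rule outer_mono) (auto simp: A_def)
      finally show "(\<Sum>k<n. f (A (2 * k + c))) \<le> f X" .
    qed
    have "(\<Sum>k. f (A k)) \<le> f X + f X"
    proof (rule suminf_le_const[OF summableI])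
      fix n
      have "(\<Sum>k<n. f (A k)) \<le> (\<Sum>k<2 * n. f (A k))" by (rule sum_mono2) auto
      also have "\<dots> = (\<Sum>k<n. f (A (2 * k))) + (\<Sum>k<n. f (A (2 * k + 1)))"
        by (induction n) (auto simp: ac_simps)
      also have "\<dots> \<le> (\<Sum>k. f (A (2 * k))) + (\<Sum>k. f (A (2 * k + 1)))"
        by (intro add_mono sum_le_suminf) auto
      also have "\<dots> \<le> f X + f X" using s[of 0] s[of 1] by (intro add_mono) auto
      finally show "(\<Sum>k<n. f (A k)) \<le> f X + f X" .
    qed
    then have sfin: "(\<Sum>k. f (A k)) < \<infinity>" using fin by (auto simp: ennreal_add_eq_top less_top[symmetric] top_unique)
    have dF: "f (X \<inter> F) + f (D n) \<le> f X" for n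
    proof -
      have "f (X \<inter> F) + f (D n) \<le> f ((X \<inter> F) \<union> D n)"
      proof (rule metric[of "1 / real (Suc n)"])
        fix x y assume "x \<in> X \<inter> F" "y \<in> D n"
        then show "1 / real (Suc n) \<le> dist x y"
          using infdist_le[of x F y] by (auto simp: D_def dist_commute)
      qed simp
      also have "\<dots> \<le> f X" by (rule outer_mono) (auto simp: D_def)
      finally show ?thesis .
    qed
    have split: "X - F \<subseteq> D n \<union> (\<Union>k. A (k + n))" for n
    proof
      fix x assume x: "x \<in> X - F"
      then have pos: "infdist x F > 0"
        using in_closed_iff_infdist_zero[OF F ne] infdist_nonneg[of x F] by (metis DiffE order_le_less)
      show "x \<in> D n \<union> (\<Union>k. A (k + n))"
      proof (cases "x \<in> D n")
        case False
        then have lt: "infdist x F < 1 / real (Suc n)" using x by (auto simp: D_def)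
        define k where "k = (LEAST k. 1 / real (k + n + 2) \<le> infdist x F)"
        obtain j where "1 / infdist x F \<le> real j" using real_arch_simple by blast
        then have "1 / real (j + n + 2) \<le> infdist x F" using pos by (simp add: field_simps) (smt (verit) mult_nonneg_nonneg of_nat_0_le_iff)
        then have k1: "1 / real (k + n + 2) \<le> infdist x F" unfolding k_def by (rule LeastI)
        have k2: "infdist x F < 1 / real (k + n + 1)"
        proof (cases k)
          case (Suc i)
          then have "i < k" by simp
          then have "\<not> 1 / real (i + n + 2) \<le> infdist x F" unfolding k_def by (rule not_less_Least)
          then show ?thesis using Suc by (simp add: add.commute)
        qed (use lt in simp)
        then have "x \<in> A (k + n)" using k1 x by (auto simp: A_def)
        then show ?thesis by blast
      qed simp
    qed
    show ?thesis
    proof (rule ennreal_le_epsilon)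
      fix e :: real assume "e > 0"
      then obtain n where n: "(\<Sum>k. f (A (k + n))) \<le> ennreal e"
        using ennreal_suminf_tail[OF sfin] by blast
      have "f (X - F) \<le> f (D n \<union> (\<Union>k. A (k + n)))" by (rule outer_mono[OF split])
      also have "\<dots> \<le> f (D n) + f (\<Union>k. A (k + n))" by (rule outer_Un)
      also have "\<dots> \<le> f (D n) + ennreal e"
        by (intro add_left_mono order.trans[OF outer_UN n])
      finally have "f (X \<inter> F) + f (X - F) \<le> f (X \<inter> F) + (f (D n) + ennreal e)" by (rule add_left_mono)
      also have "\<dots> \<le> f X + ennreal e" using dF[of n] by (simp add: add.assoc[symmetric] add_right_mono)
      finally show "f (X \<inter> F) + f (X - F) \<le> f X + ennreal e" .
    qed
  qed
qed

lemma metric_outer_measure_space: "measure_space UNIV (sets borel) f"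
proof -
  interpret sigma_algebra UNIV "UNIV :: 'a set set" using sigma_algebra_Pow[of UNIV] by simp
  let ?L = "lambda_system UNIV UNIV f"
  have ms: "measure_space UNIV ?L f" using f by (rule caratheodory_lemma)
  have "Collect closed \<subseteq> ?L"
    using closed_caratheodory_measurable by (auto simp: lambda_system_eq)
  moreover have "sets (borel :: 'a measure) = sigma_sets UNIV (Collect closed)"
    by (simp add: borel_eq_closed)
  ultimately have sub: "sets borel \<subseteq> ?L"
    using ms by (simp add: measure_space_def sigma_algebra.sigma_sets_subset)
  show ?thesis
    unfolding measure_space_def
  proof (intro conjI)
    show "sigma_algebra UNIV (sets (borel :: 'a measure))"
      using sets.sigma_algebra_axioms[of "borel :: 'a measure"] by simp
    show "positive (sets borel) f" using ms by (auto simp: measure_space_def positive_def)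
    show "countably_additive (sets borel) f"
      using ms sub unfolding measure_space_def countably_additive_def by (meson subset_trans subsetD)
  qed
qed

end

subsection \<open>Hausdorff measure\<close>

definition hweight :: "nat \<Rightarrow> 'a::metric_space set \<Rightarrow> ennreal" where
  "hweight s U = (if U = {} then 0 else ennreal (unit_ball_vol (real s) * (diameter U / 2) ^ s))"

lemma hweight_empty [simp]: "hweight s {} = 0"
  by (simp add: hweight_def)

lemma hausdorff_pre_le:
  assumes "A \<subseteq> (\<Union>i. U i)" "\<And>i. bounded (U i)" "\<And>i. diameter (U i) \<le> \<delta>"
  shows "hausdorff_pre s \<delta> A \<le> (\<Sum>i. hweight s (U i))"
  unfolding hausdorff_pre_def hweight_def using assms by (intro INF_lower) auto

lemma hausdorff_pre_greatest:
  assumes "\<And>U. A \<subseteq> (\<Union>i. U i) \<Longrightarrow> (\<And>i. bounded (U i)) \<Longrightarrow> (\<And>i. diameter (U i) \<le> \<delta>) \<Longrightarrow> c \<le> (\<Sum>i. hweight s (U i))"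
  shows "c \<le> hausdorff_pre s \<delta> A"
  unfolding hausdorff_pre_def using assms unfolding hweight_def by (intro INF_greatest) auto

lemma hausdorff_pre_mono: "A \<subseteq> B \<Longrightarrow> hausdorff_pre s \<delta> A \<le> hausdorff_pre s \<delta> B"
  by (intro hausdorff_pre_greatest hausdorff_pre_le) auto

lemma hausdorff_pre_antimono: "\<delta> \<le> \<delta>' \<Longrightarrow> hausdorff_pre s \<delta>' A \<le> hausdorff_pre s \<delta> A"
  by (intro hausdorff_pre_greatest hausdorff_pre_le) (auto intro: order.trans)

lemma hausdorff_pre_empty: "\<delta> > 0 \<Longrightarrow> hausdorff_pre s \<delta> {} = 0"
  using hausdorff_pre_le[of "{}" "\<lambda>_. {}" \<delta> s] by (simp add: le_zero_eq)

text \<open>Covers of the single sets that are optimal up to e / 2^(n+1) are merged into one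
  sequence along \<open>prod_decode\<close>; the errors add up to e.\<close>

lemma hausdorff_pre_UN:
  fixes A :: "nat \<Rightarrow> 'a::metric_space set"
  shows "hausdorff_pre s \<delta> (\<Union>n. A n) \<le> (\<Sum>n. hausdorff_pre s \<delta> (A n))"
proof (rule ennreal_le_epsilon)
  fix e :: real assume e: "e > 0" and fin: "(\<Sum>n. hausdorff_pre s \<delta> (A n)) < top"
  have "\<exists>U. A n \<subseteq> (\<Union>i. U i) \<and> (\<forall>i. bounded (U i) \<and> diameter (U i) \<le> \<delta>) \<and>
     (\<Sum>i::nat. hweight s (U i)) \<le> hausdorff_pre s \<delta> (A n) + ennreal (e * (1/2) ^ Suc n)" for n
  proof (rule ccontr)
    assume "\<nexists>U. A n \<subseteq> (\<Union>i. U i) \<and> (\<forall>i. bounded (U i) \<and> diameter (U i) \<le> \<delta>) \<and>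
     (\<Sum>i::nat. hweight s (U i)) \<le> hausdorff_pre s \<delta> (A n) + ennreal (e * (1/2) ^ Suc n)"
    then have "hausdorff_pre s \<delta> (A n) + ennreal (e * (1/2) ^ Suc n) \<le> hausdorff_pre s \<delta> (A n)"
      by (intro hausdorff_pre_greatest) (meson linear)
    moreover have "hausdorff_pre s \<delta> (A n) < top" using fin ennreal_suminf_lessD by blast
    moreover have "0 < e * (1/2) ^ Suc n" using e by simp
    ultimately show False
      by (cases "hausdorff_pre s \<delta> (A n)") (auto simp: ennreal_plus[symmetric] simp del: ennreal_plus power_Suc)
  qed
  then obtain U where U: "\<And>n. A n \<subseteq> (\<Union>i. U n i)" "\<And>n i. bounded (U n i)" "\<And>n i. diameter (U n i) \<le> \<delta>"
     "\<And>n. (\<Sum>i::nat. hweight s (U n i)) \<le> hausdorff_pre s \<delta> (A n) + ennreal (e * (1/2) ^ Suc n)"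
    by metis
  define V where "V = case_prod U \<circ> prod_decode"
  have "hausdorff_pre s \<delta> (\<Union>n. A n) \<le> (\<Sum>j. hweight s (V j))"
  proof (rule hausdorff_pre_le)
    have "U n i = V (prod_encode (n, i))" for n i by (simp add: V_def)
    note UV = this
    show "(\<Union>n. A n) \<subseteq> (\<Union>j. V j)"
    proof
      fix x assume "x \<in> (\<Union>n. A n)"
      then obtain n i where "x \<in> U n i" using U(1) by blast
      then show "x \<in> (\<Union>j. V j)" unfolding UV by blast
    qed
  qed (auto simp: V_def U split: prod.split)
  also have "\<dots> = (\<Sum>j. (case_prod (\<lambda>n i. hweight s (U n i)) \<circ> prod_decode) j)"
    by (rule arg_cong[where f = suminf]) (auto simp: V_def split: prod.split)
  also have "\<dots> = (\<Sum>n. \<Sum>i. hweight s (U n i))"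
    using suminf_ennreal_2dimen[of "\<lambda>n. \<Sum>i. hweight s (U n i)" "case_prod (\<lambda>n i. hweight s (U n i))"]
    by (simp add: comp_def)
  also have "\<dots> \<le> (\<Sum>n. hausdorff_pre s \<delta> (A n) + ennreal (e * (1/2) ^ Suc n))"
    by (intro suminf_le U(4) summableI)
  also have "\<dots> = (\<Sum>n. hausdorff_pre s \<delta> (A n)) + (\<Sum>n. ennreal (e * (1/2) ^ Suc n))"
    by (intro suminf_add[symmetric] summableI)
  also have "(\<Sum>n. ennreal (e * (1/2) ^ Suc n)) = ennreal e"
  proof -
    have "(\<lambda>n. e * (1/2) ^ Suc n) sums (e * 1)" by (intro sums_mult power_half_series)
    then show ?thesis using e by (subst suminf_ennreal2) (auto simp: sums_iff simp del: power_Suc)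
  qed
  finally show "hausdorff_pre s \<delta> (\<Union>n. A n) \<le> (\<Sum>n. hausdorff_pre s \<delta> (A n)) + ennreal e" .
qed

text \<open>A covering set of diameter at most \<delta> < d cannot meet both sets, so a cover of the
  union splits into two covers without a common nonempty member.\<close>

lemma hausdorff_pre_separated:
  assumes "\<delta> < d" "\<And>x y. x \<in> A \<Longrightarrow> y \<in> B \<Longrightarrow> d \<le> dist x y"
  shows "hausdorff_pre s \<delta> A + hausdorff_pre s \<delta> B \<le> hausdorff_pre s \<delta> (A \<union> B)"
proof (rule hausdorff_pre_greatest)
  fix U :: "nat \<Rightarrow> 'a set" assume U: "A \<union> B \<subseteq> (\<Union>i. U i)" "\<And>i. bounded (U i)" "\<And>i. diameter (U i) \<le> \<delta>"
  define V where "V i = (if U i \<inter> A = {} then {} else U i)" for i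
  define W where "W i = (if U i \<inter> B = {} then {} else U i)" for i
  have nonneg: "0 \<le> \<delta>" using order.trans[OF diameter_ge_0[OF U(2)[of 0]] U(3)[of 0]] .
  have "A \<subseteq> (\<Union>i. V i)" "B \<subseteq> (\<Union>i. W i)" using U(1) by (fastforce simp: V_def W_def)+
  note sub = this
  have "hausdorff_pre s \<delta> A \<le> (\<Sum>i. hweight s (V i))"
    by (rule hausdorff_pre_le[OF sub(1)]) (use U nonneg in \<open>auto simp: V_def\<close>)
  moreover have "hausdorff_pre s \<delta> B \<le> (\<Sum>i. hweight s (W i))"
    by (rule hausdorff_pre_le[OF sub(2)]) (use U nonneg in \<open>auto simp: W_def\<close>)
  ultimately have "hausdorff_pre s \<delta> A + hausdorff_pre s \<delta> B \<le> (\<Sum>i. hweight s (V i)) + (\<Sum>i. hweight s (W i))"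
    by (rule add_mono)
  also have "\<dots> = (\<Sum>i. hweight s (V i) + hweight s (W i))" by (intro suminf_add summableI)
  also have "\<dots> \<le> (\<Sum>i. hweight s (U i))"
  proof (intro suminf_le summableI)
    fix i
    have "V i = {} \<or> W i = {}"
    proof (rule ccontr)
      assume "\<not> (V i = {} \<or> W i = {})"
      then obtain x y where "x \<in> U i" "x \<in> A" "y \<in> U i" "y \<in> B" by (auto simp: V_def W_def split: if_splits)
      then show False
        using assms diameter_bounded_bound[OF U(2)[of i], of x y] U(3)[of i] by force
    qed
    moreover have "hweight s (V i) \<le> hweight s (U i)" "hweight s (W i) \<le> hweight s (U i)"
      by (auto simp: V_def W_def)
    ultimately show "hweight s (V i) + hweight s (W i) \<le> hweight s (U i)" by auto
  qed
  finally show "hausdorff_pre s \<delta> A + hausdorff_pre s \<delta> B \<le> (\<Sum>i. hweight s (U i))" .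
qed

text \<open>Along the increasing sequence for \<delta> = 1/(n+1) the supremum commutes with
  addition, which is what the metric property needs.\<close>

lemma hausdorff_outer_eq_SUP: "hausdorff_outer s A = (SUP n. hausdorff_pre s (1 / real (Suc n)) A)"
  unfolding hausdorff_outer_def
proof (rule antisym)
  show "(SUP \<delta>\<in>{0<..}. hausdorff_pre s \<delta> A) \<le> (SUP n. hausdorff_pre s (1 / real (Suc n)) A)"
  proof (rule SUP_least)
    fix \<delta> :: real assume "\<delta> \<in> {0<..}"
    then obtain n where "1 / real (Suc n) < \<delta>" using nat_approx_posE[of \<delta>] by auto
    then show "hausdorff_pre s \<delta> A \<le> (SUP n. hausdorff_pre s (1 / real (Suc n)) A)"
      by (intro SUP_upper2[of n] hausdorff_pre_antimono) auto
  qed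
qed (auto intro!: SUP_least SUP_upper)

lemma hausdorff_outer_UN: "hausdorff_outer s (\<Union>i. A i) \<le> (\<Sum>i::nat. hausdorff_outer s (A i))"
proof -
  have "hausdorff_pre s \<delta> (\<Union>i. A i) \<le> (\<Sum>i. hausdorff_outer s (A i))" if "\<delta> > 0" for \<delta>
    using that by (intro order.trans[OF hausdorff_pre_UN] suminf_le summableI)
      (auto simp: hausdorff_outer_def intro: SUP_upper)
  then show ?thesis unfolding hausdorff_outer_def[of s "\<Union>i. A i"] by (intro SUP_least) auto
qed

lemma hausdorff_outer_measure_space: "outer_measure_space UNIV (hausdorff_outer s :: 'a::metric_space set \<Rightarrow> ennreal)"
  unfolding outer_measure_space_def
proof (intro conjI)
  show "positive UNIV (hausdorff_outer s)"
    by (auto simp: positive_def hausdorff_outer_eq_SUP hausdorff_pre_empty)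
  show "increasing UNIV (hausdorff_outer s)"
    unfolding increasing_def hausdorff_outer_def by (auto intro!: SUP_mono hausdorff_pre_mono)
  show "countably_subadditive UNIV (hausdorff_outer s)"
      unfolding countably_subadditive_def using hausdorff_outer_UN by blast
qed

lemma hausdorff_outer_separated:
  assumes "d > 0" "\<And>x y. x \<in> A \<Longrightarrow> y \<in> B \<Longrightarrow> d \<le> dist x y"
  shows "hausdorff_outer s A + hausdorff_outer s B \<le> hausdorff_outer s (A \<union> B)"
proof -
  have inc: "incseq (\<lambda>n. hausdorff_pre s (1 / real (Suc n)) X)" for X :: "'a set"
    by (rule incseq_SucI, rule hausdorff_pre_antimono) (simp add: field_simps)
  have "hausdorff_outer s A + hausdorff_outer s B
     = (SUP n. hausdorff_pre s (1 / real (Suc n)) A + hausdorff_pre s (1 / real (Suc n)) B)"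
    unfolding hausdorff_outer_eq_SUP by (rule ennreal_SUP_add[OF inc inc, symmetric])
  also have "\<dots> \<le> hausdorff_outer s (A \<union> B)"
  proof (rule SUP_least)
    fix n
    obtain k where k: "1 / real (Suc k) < d" using nat_approx_posE[OF assms(1)] by auto
    define j where "j = max n k"
    have "1 / real (Suc j) \<le> 1 / real (Suc k)" by (intro divide_left_mono) (auto simp: j_def)
    then have j: "1 / real (Suc j) < d" using k by linarith
    have "hausdorff_pre s (1 / real (Suc n)) A + hausdorff_pre s (1 / real (Suc n)) B
      \<le> hausdorff_pre s (1 / real (Suc j)) A + hausdorff_pre s (1 / real (Suc j)) B"
      by (intro add_mono incseqD[OF inc]) (auto simp: j_def)
    also have "\<dots> \<le> hausdorff_pre s (1 / real (Suc j)) (A \<union> B)"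
      by (rule hausdorff_pre_separated[OF j]) (use assms in auto)
    also have "\<dots> \<le> hausdorff_outer s (A \<union> B)" unfolding hausdorff_outer_eq_SUP by (rule SUP_upper) simp
    finally show "hausdorff_pre s (1 / real (Suc n)) A + hausdorff_pre s (1 / real (Suc n)) B \<le> hausdorff_outer s (A \<union> B)" .
  qed
  finally show ?thesis .
qed

lemma sets_hausdorff_measure [simp]: "sets (hausdorff_measure s) = sets borel"
  unfolding hausdorff_measure_def using sets.sigma_sets_eq[of borel] by simp

lemma space_hausdorff_measure [simp]: "space (hausdorff_measure s) = UNIV"
  unfolding hausdorff_measure_def by (simp add: space_measure_of_conv)

lemma emeasure_hausdorff:
  fixes A :: "'a::metric_space set"
  assumes "A \<in> sets borel"
  shows "emeasure (hausdorff_measure s) A = hausdorff_outer s A"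
proof -
  have "measure_space UNIV (sets (borel :: 'a measure)) (hausdorff_outer s)"
    by (rule metric_outer_measure_space[OF hausdorff_outer_measure_space hausdorff_outer_separated])
  then show ?thesis unfolding hausdorff_measure_def
    by (intro emeasure_measure_of_sigma) (use assms in \<open>auto simp: measure_space_def\<close>)
qed

text \<open>A set of diameter d projects into a closed ball of radius d about the projection of one
  of its points, while the Hausdorff weight is the volume of a ball of radius d/2. The factor
  (1/2)^m is this loss; it spares the isodiametric inequality.\<close>

lemma lborel_le_hausdorff:
  fixes A :: "((real ^ 'm) \<times> real) set"
  assumes P: "P \<in> sets borel" "P \<subseteq> fst ` A"
  shows "ennreal ((1/2) ^ CARD('m)) * emeasure lborel P \<le> hausdorff_outer CARD('m) A"
proof -
  let ?m = "CARD('m)" let ?c = "ennreal ((1/2) ^ CARD('m))"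
  have "?c * emeasure lborel P \<le> hausdorff_pre ?m 1 A"
  proof (rule hausdorff_pre_greatest)
    fix U :: "nat \<Rightarrow> ((real ^ 'm) \<times> real) set"
    assume U: "A \<subseteq> (\<Union>i. U i)" "\<And>i. bounded (U i)" "\<And>i. diameter (U i) \<le> 1"
    define B where "B i = (if U i = {} then {} else cball (fst (SOME u. u \<in> U i)) (diameter (U i)))" for i
    have B: "P \<subseteq> (\<Union>i. B i)"
    proof
      fix x assume "x \<in> P"
      then obtain u i where u: "u \<in> U i" "x = fst u" using P(2) U(1) by blast
      have "(SOME u. u \<in> U i) \<in> U i" using u by (metis someI)
      then have "dist (SOME u. u \<in> U i) u \<le> diameter (U i)"
        using diameter_bounded_bound[OF U(2)] u by blast
      then have "x \<in> B i" using u dist_fst_le[of "SOME u. u \<in> U i" u] by (auto simp: B_def)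
      then show "x \<in> (\<Union>i. B i)" by blast
    qed
    have "?c * emeasure lborel P \<le> ?c * emeasure lborel (\<Union>i. B i)"
      by (intro mult_left_mono emeasure_mono B) (auto simp: B_def)
    also have "\<dots> \<le> ?c * (\<Sum>i. emeasure lborel (B i))"
      by (intro mult_left_mono emeasure_subadditive_countably) (auto simp: B_def)
    also have "\<dots> = (\<Sum>i. ?c * emeasure lborel (B i))" by simp
    also have "\<dots> = (\<Sum>i. hweight ?m (U i))"
    proof (rule arg_cong[where f = suminf], rule ext)
      fix i show "?c * emeasure lborel (B i) = hweight ?m (U i)"
        using diameter_ge_0[OF U(2)[of i]]
        by (auto simp: hweight_def B_def emeasure_cball ennreal_mult[symmetric] power_divide unit_ball_vol_nonneg)
    qed
    finally show "?c * emeasure lborel P \<le> (\<Sum>i. hweight ?m (U i))" .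
  qed
  also have "\<dots> \<le> hausdorff_outer ?m A" unfolding hausdorff_outer_def by (rule SUP_upper) simp
  finally show ?thesis .
qed

text \<open>Covering by the graph over a grid of cells of side 1/k: the number of cells grows like
  k^m and each weight decays like k^-m, so the sum is bounded independently of k. This yields the
  sigma-finiteness of the surface measure.\<close>

lemma hausdorff_outer_graph_finite:
  fixes h :: "real ^ 'm \<Rightarrow> real" and R :: nat
  assumes lip: "\<And>x y. \<bar>h x - h y\<bar> \<le> L * norm (x - y)"
  shows "hausdorff_outer CARD('m) ((\<lambda>x. (x, h x)) ` {x. \<forall>i. \<bar>x $ i\<bar> \<le> real R}) < \<infinity>"
proof -
  let ?m = "CARD('m)" let ?g = "\<lambda>x. (x, h x)"
  have L: "L \<ge> 0" using lip[of "axis undefined 1" 0] by (simp add: order.trans[OF abs_ge_zero])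
  \<comment> \<open>A cell of side 1/k has diameter at most m/k by the l^1 bound, and passing to the
    graph multiplies distances by at most 1 + L; thus a piece of the graph has diameter at most
    D/k.\<close>
  define D where "D = (1 + L) * real ?m"
  have D: "D \<ge> 0" using L by (simp add: D_def)
  \<comment> \<open>There are (2Rk+1)^m cells, each of weight at most \<open>unit_ball_vol\<close>
    times (D/(2k))^m, and 2Rk + 1 is at most (2R+1)k.\<close>
  define b where "b = unit_ball_vol (real ?m) * ((2 * real R + 1) * (D / 2)) ^ ?m"
  have main: "hausdorff_pre ?m \<delta> (?g ` {x. \<forall>i. \<bar>x $ i\<bar> \<le> real R}) \<le> ennreal b" if "\<delta> > 0" for \<delta>
  proof -
    obtain k0 where k0: "D / \<delta> < real k0" using reals_Archimedean2 by blast
    define k where "k = Suc k0"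
    have k: "k > 0" "D / real k \<le> \<delta>" using k0 that by (auto simp: k_def field_simps)
    \<comment> \<open>The cell of a point is given by the integer parts of k times its coordinates;
      each of them takes one of 2Rk + 1 values.\<close>
    define I where "I = PiE (UNIV :: 'm set) (\<lambda>_. {- int (R * k) .. int (R * k)})"
    have "card {- int (R * k) .. int (R * k)} = nat (int (2 * R * k + 1))" by simp
    then have "card {- int (R * k) .. int (R * k)} = 2 * R * k + 1" by (simp only: nat_int)
    then have I: "finite I" "card I = (2 * R * k + 1) ^ ?m"
      unfolding I_def by (simp_all only: card_PiE finite_PiE finite finite_atLeastAtMost_int prod_constant)
    obtain e where e: "bij_betw e {0..<card I} I" using ex_bij_betw_nat_finite[OF I(1)] by blast
    define cell where "cell v = {x :: real ^ 'm. \<forall>i. \<lfloor>real k * x $ i\<rfloor> = v i}" for v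
    define U where "U j = (if j < card I then ?g ` cell (e j) else {})" for j
    have dd: "dist p q \<le> D / real k" if "p \<in> ?g ` cell v" "q \<in> ?g ` cell v" for p q v
    proof -
      obtain x y where xy: "p = ?g x" "q = ?g y" "x \<in> cell v" "y \<in> cell v" using \<open>p \<in> _\<close> \<open>q \<in> _\<close> by auto
      have "\<bar>(x - y) $ i\<bar> \<le> 1 / real k" for i
      proof -
        have "\<lfloor>real k * x $ i\<rfloor> = \<lfloor>real k * y $ i\<rfloor>" using xy by (auto simp: cell_def)
        then have "\<bar>real k * x $ i - real k * y $ i\<bar> \<le> 1" by linarith
        then have "real k * \<bar>x $ i - y $ i\<bar> \<le> 1" by (metis abs_mult abs_of_nat right_diff_distrib)
        then show ?thesis using k by (simp add: field_simps)
      qed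
      then have "norm (x - y) \<le> (\<Sum>i\<in>(UNIV :: 'm set). 1 / real k)"
        by (intro order.trans[OF norm_le_l1_cart] sum_mono)
      then have n: "norm (x - y) \<le> real ?m / real k" by simp
      have "dist p q \<le> norm (x - y) + \<bar>h x - h y\<bar>"
        unfolding xy dist_norm by (auto simp: norm_Pair intro: order.trans[OF sqrt_sum_squares_le_sum_abs])
      also have "\<dots> \<le> (1 + L) * norm (x - y)" using lip[of x y] by (simp add: algebra_simps)
      also have "\<dots> \<le> (1 + L) * (real ?m / real k)" using n L by (intro mult_left_mono) auto
      finally show ?thesis by (simp add: D_def)
    qed
    have bd: "bounded (?g ` cell v)" for v
      unfolding bounded_two_points using dd[of _ v] by blast
    have di: "diameter (?g ` cell v) \<le> D / real k" for v
      by (rule diameter_le) (use D dd in \<open>auto simp: dist_norm\<close>)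
    have "hausdorff_pre ?m \<delta> (?g ` {x. \<forall>i. \<bar>x $ i\<bar> \<le> real R}) \<le> (\<Sum>j. hweight ?m (U j))"
    proof (rule hausdorff_pre_le)
      show "?g ` {x. \<forall>i. \<bar>x $ i\<bar> \<le> real R} \<subseteq> (\<Union>j. U j)"
      proof safe
        fix x :: "real ^ 'm" assume x: "\<forall>i. \<bar>x $ i\<bar> \<le> real R"
        define v where "v i = \<lfloor>real k * x $ i\<rfloor>" for i
        have "v \<in> I" unfolding I_def
        proof (intro PiE_I)
          fix i
          have "\<bar>real k * x $ i\<bar> \<le> real (R * k)" using x k by (auto simp: abs_mult)
          then show "v i \<in> {- int (R * k) .. int (R * k)}"
            unfolding v_def by (simp add: le_floor_iff floor_le_iff) linarith
        qed simp
        then obtain j where "j < card I" "e j = v" using e unfolding bij_betw_def by (metis atLeastLessThan_iff imageE)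
        moreover have "x \<in> cell v" by (simp add: cell_def v_def)
        ultimately show "(x, h x) \<in> (\<Union>j. U j)" by (auto simp: U_def)
      qed
      show "bounded (U j)" "diameter (U j) \<le> \<delta>" for j
        using bd order.trans[OF di k(2)] that by (auto simp: U_def)
    qed
    also have "\<dots> = (\<Sum>j<card I. hweight ?m (U j))"
      by (rule suminf_finite) (auto simp: U_def)
    also have "\<dots> \<le> (\<Sum>j<card I. ennreal (unit_ball_vol (real ?m) * (D / real k / 2) ^ ?m))"
    proof (rule sum_mono)
      fix j
      have "bounded (U j)" "diameter (U j) \<le> D / real k" using bd di D by (auto simp: U_def)
      then show "hweight ?m (U j) \<le> ennreal (unit_ball_vol (real ?m) * (D / real k / 2) ^ ?m)"
        using diameter_ge_0[of "U j"] by (auto simp: hweight_def intro!: ennreal_leI mult_left_mono power_mono divide_right_mono unit_ball_vol_nonneg)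
    qed
    also have "\<dots> = ennreal (real (card I) * (unit_ball_vol (real ?m) * (D / real k / 2) ^ ?m))"
      using D by (simp add: ennreal_mult unit_ball_vol_nonneg ennreal_of_nat_eq_real_of_nat)
    also have "\<dots> \<le> ennreal b"
    proof (rule ennreal_leI)
      have "real (card I) * (D / real k / 2) ^ ?m = ((2 * real R * real k + 1) * (D / real k / 2)) ^ ?m"
        unfolding I by (simp only: power_mult_distrib of_nat_power of_nat_add of_nat_mult of_nat_numeral of_nat_1)
      also have "\<dots> \<le> ((2 * real R + 1) * (D / 2)) ^ ?m"
      proof (rule power_mono)
        have "(2 * real R * real k + 1) \<le> (2 * real R + 1) * real k" using k by (simp add: algebra_simps)
        then have "(2 * real R * real k + 1) * (D / real k / 2) \<le> (2 * real R + 1) * real k * (D / real k / 2)"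
          using D by (intro mult_right_mono) auto
        also have "\<dots> = (2 * real R + 1) * (D / 2)" using k by simp
        finally show "(2 * real R * real k + 1) * (D / real k / 2) \<le> (2 * real R + 1) * (D / 2)" .
      qed (use D in auto)
      finally show "real (card I) * (unit_ball_vol (real ?m) * (D / real k / 2) ^ ?m) \<le> b"
        unfolding b_def using mult_left_mono[OF _ unit_ball_vol_nonneg[of "real ?m"]] by (simp add: mult.left_commute)
    qed
    finally show ?thesis .
  qed
  have "hausdorff_outer ?m (?g ` {x. \<forall>i. \<bar>x $ i\<bar> \<le> real R}) \<le> ennreal b"
    unfolding hausdorff_outer_def by (rule SUP_least) (use main in auto)
  then show ?thesis by (rule le_less_trans) simp
qed

subsection \<open>Functionals bounded by the $L^1$ norm\<close>

lemma test_add: "\<phi> \<in> test_functions U \<Longrightarrow> \<psi> \<in> test_functions U \<Longrightarrow> (\<lambda>x. \<phi> x + \<psi> x) \<in> test_functions U"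
  by (rule test_functionsI[of _ "supp \<phi> \<union> supp \<psi>"])
     (auto intro: C_k_add test_functionsD compact_Un dest: test_functionsD(3) simp: zero_outside_supp)

lemma test_cmult: "\<phi> \<in> test_functions U \<Longrightarrow> (\<lambda>x. c * \<phi> x) \<in> test_functions U"
  by (rule test_functionsI[of _ "supp \<phi>"])
     (auto intro: C_k_cmult test_functionsD dest: test_functionsD(3) simp: zero_outside_supp)

lemma test_mult: "\<phi> \<in> test_functions U \<Longrightarrow> \<psi> \<in> test_functions U \<Longrightarrow> (\<lambda>x. \<phi> x * \<psi> x) \<in> test_functions U"
  by (rule test_functionsI[of _ "supp \<phi>"])
     (auto intro: C_k_mult test_functionsD dest: test_functionsD(3) simp: zero_outside_supp)

lemma test_zero: "(\<lambda>x. 0) \<in> test_functions U"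
  by (rule test_functionsI[of _ "{}"]) (auto intro: C_k_const)

text \<open>For a nonnegative test function \<phi>, the functions 1 - exp(-n \<phi>) increase to the
  indicator of the set where \<phi> is positive and keep the support of \<phi>. This is how
  indicators are approximated.\<close>

lemma test_one_minus_exp:
  assumes "\<phi> \<in> test_functions U"
  shows "(\<lambda>x. 1 - exp (- (c * \<phi> x))) \<in> test_functions U"
proof (rule test_functionsI[of _ "supp \<phi>"])
  fix k
  have "((\<lambda>t. (- c) ^ j * exp (- (c * t))) has_real_derivative (- c) ^ Suc j * exp (- (c * t))) (at t)" for j t
    by (auto intro!: derivative_eq_intros)
  from C_k_compose_real[of "\<lambda>j t. (- c) ^ j * exp (- (c * t))" k \<phi> 0, OF this test_functionsD(1)[OF assms]]
  have "C_k k (\<lambda>x. exp (- (c * \<phi> x)))" by simp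
  then have "C_k k (\<lambda>x. 1 + (- 1) * exp (- (c * \<phi> x)))" by (intro C_k_add C_k_cmult C_k_const)
  then show "C_k k (\<lambda>x. 1 - exp (- (c * \<phi> x)))" by simp
qed (use assms in \<open>auto dest: test_functionsD(2,3) simp: zero_outside_supp\<close>)

text \<open>On the set where k exceeds c the integral of k - c must vanish. Sigma-finiteness cuts
  this set into pieces of finite measure, where the subtraction of integrals is legitimate.\<close>

lemma AE_le_of_set_nn_integral_le:
  assumes M: "sigma_finite_measure M" and k: "k \<in> borel_measurable M"
    and le: "\<And>A. A \<in> sets M \<Longrightarrow> (\<integral>\<^sup>+x. k x * indicator A x \<partial>M) \<le> ennreal c * emeasure M A"
  shows "AE x in M. k x \<le> ennreal c"
proof -
  obtain S :: "nat \<Rightarrow> 'a set" where S: "range S \<subseteq> sets M" "(\<Union>i. S i) = space M" "\<And>i. emeasure M (S i) \<noteq> \<infinity>"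
    using sigma_finite_measure.sigma_finite[OF M] by metis
  have [measurable]: "S n \<in> sets M" for n using S(1) by auto
  have "AE x in M. x \<in> S n \<longrightarrow> k x \<le> ennreal c" for n
  proof -
    note [measurable] = k
    define E where "E = {x \<in> space M. ennreal c < k x} \<inter> S n"
    have E[measurable]: "E \<in> sets M" unfolding E_def by measurable
    have fin: "emeasure M E < \<infinity>" using emeasure_mono[of E "S n" M] S(3)[of n]
      by (auto simp: E_def less_top[symmetric] top_unique)
    have "(\<integral>\<^sup>+x. (k x - ennreal c) * indicator E x \<partial>M) = (\<integral>\<^sup>+x. k x * indicator E x - ennreal c * indicator E x \<partial>M)"
      by (intro nn_integral_cong) (auto split: split_indicator)
    also have "\<dots> = (\<integral>\<^sup>+x. k x * indicator E x \<partial>M) - (\<integral>\<^sup>+x. ennreal c * indicator E x \<partial>M)"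
    proof (rule nn_integral_diff)
      show "(\<integral>\<^sup>+x. ennreal c * indicator E x \<partial>M) \<noteq> \<infinity>"
        using fin by (simp add: nn_integral_cmult_indicator ennreal_mult_eq_top_iff less_top[symmetric])
      show "AE x in M. ennreal c * indicator E x \<le> k x * indicator E x"
        by (intro AE_I2) (auto simp: E_def split: split_indicator)
    qed auto
    also have "\<dots> = 0"
      using le[OF E] le_less_trans[OF le[OF E], of top] fin by (simp add: nn_integral_cmult_indicator ennreal_mult_less_top fin diff_eq_0_iff_ennreal)
    finally have "AE x in M. (k x - ennreal c) * indicator E x = 0"
      by (subst (asm) nn_integral_0_iff_AE) auto
    then show ?thesis
    proof (rule AE_mp, intro AE_I2 impI)
      fix x assume "x \<in> space M" "(k x - ennreal c) * indicator E x = 0" "x \<in> S n"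
      then show "k x \<le> ennreal c"
        by (cases "x \<in> E") (auto simp: E_def diff_eq_0_iff_ennreal)
    qed
  qed
  then have "AE x in M. \<forall>n. x \<in> S n \<longrightarrow> k x \<le> ennreal c" unfolding AE_all_countable by blast
  then show ?thesis by (rule AE_mp) (use S(2) in \<open>auto intro!: AE_I2\<close>)
qed

lemma sigma_finite_locally_finite:
  assumes "sets M = sets (borel :: 'a::euclidean_space measure)" "\<And>R. emeasure M (ball 0 R) < \<infinity>"
  shows "sigma_finite_measure M"
proof
  show "\<exists>A. countable A \<and> A \<subseteq> sets M \<and> \<Union> A = space M \<and> (\<forall>a\<in>A. emeasure M a \<noteq> \<infinity>)"
  proof (intro exI[of _ "range (\<lambda>n. ball (0::'a) (real n))"] conjI)
    show "\<Union> (range (\<lambda>n. ball (0::'a) (real n))) = space M"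
      using sets_eq_imp_space_eq[OF assms(1)] reals_Archimedean2 by auto
  qed (use assms in \<open>auto simp: less_top\<close>)
qed

context
  fixes M :: "'a::euclidean_space measure"
  assumes sM: "sets M = sets borel" and fM: "\<And>R. emeasure M (ball 0 R) < \<infinity>"
begin

lemma space_M: "space M = UNIV"
  using sets_eq_imp_space_eq[OF sM] by simp

lemma compact_finite_M: "compact S \<Longrightarrow> emeasure M S < \<infinity>"
proof -
  assume "compact S"
  then obtain R where "S \<subseteq> ball 0 R" using bounded_subset_ballD compact_imp_bounded by metis
  then have "emeasure M S \<le> emeasure M (ball 0 R)" by (rule emeasure_mono) (simp add: sM)
  then show ?thesis using fM by (rule le_less_trans)
qed

lemma test_integrable_M: "\<phi> \<in> test_functions U \<Longrightarrow> integrable M \<phi>"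
  by (rule integrable_test_function[OF _ sM compact_finite_M])

text \<open>This is the closure of the test functions in L^1(M).\<close>

definition test_closure :: "('a \<Rightarrow> real) \<Rightarrow> bool" where
  "test_closure f \<longleftrightarrow> integrable M f \<and> (\<forall>e>0. \<exists>\<phi>\<in>test_functions UNIV. (\<integral>x. \<bar>f x - \<phi> x\<bar> \<partial>M) < e)"

lemma test_closure_test: "\<phi> \<in> test_functions UNIV \<Longrightarrow> test_closure \<phi>"
  unfolding test_closure_def by (auto intro: test_integrable_M bexI[of _ \<phi>])

lemma test_closure_add:
  assumes "test_closure f" "test_closure g"
  shows "test_closure (\<lambda>x. f x + g x)"
  unfolding test_closure_def
proof (intro conjI allI impI)
  show "integrable M (\<lambda>x. f x + g x)" using assms by (auto simp: test_closure_def)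
  fix e :: real assume "e > 0"
  then obtain \<phi> \<psi> where t: "\<phi> \<in> test_functions UNIV" "(\<integral>x. \<bar>f x - \<phi> x\<bar> \<partial>M) < e / 2"
    "\<psi> \<in> test_functions UNIV" "(\<integral>x. \<bar>g x - \<psi> x\<bar> \<partial>M) < e / 2"
    using assms unfolding test_closure_def by (meson half_gt_zero)
  note [simp] = test_integrable_M[OF t(1)] test_integrable_M[OF t(3)]
  have i[simp]: "integrable M f" "integrable M g" using assms by (auto simp: test_closure_def)
  have "(\<integral>x. \<bar>f x + g x - (\<phi> x + \<psi> x)\<bar> \<partial>M) \<le> (\<integral>x. \<bar>f x - \<phi> x\<bar> + \<bar>g x - \<psi> x\<bar> \<partial>M)"
    by (intro integral_mono) auto
  also have "\<dots> < e" using t by simp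
  finally show "\<exists>\<phi>\<in>test_functions UNIV. (\<integral>x. \<bar>f x + g x - \<phi> x\<bar> \<partial>M) < e"
    using test_add[OF t(1,3)] by (intro bexI[of _ "\<lambda>x. \<phi> x + \<psi> x"]) auto
qed

lemma test_closure_cmult:
  assumes "test_closure f"
  shows "test_closure (\<lambda>x. c * f x)"
  unfolding test_closure_def
proof (intro conjI allI impI)
  show "integrable M (\<lambda>x. c * f x)" using assms by (auto simp: test_closure_def)
  fix e :: real assume e: "e > 0"
  then have "e / (\<bar>c\<bar> + 1) > 0" by simp
  then obtain \<phi> where t: "\<phi> \<in> test_functions UNIV" "(\<integral>x. \<bar>f x - \<phi> x\<bar> \<partial>M) < e / (\<bar>c\<bar> + 1)"
    using assms unfolding test_closure_def by meson
  have "(\<integral>x. \<bar>c * f x - c * \<phi> x\<bar> \<partial>M) = \<bar>c\<bar> * (\<integral>x. \<bar>f x - \<phi> x\<bar> \<partial>M)"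
    by (simp add: right_diff_distrib[symmetric] abs_mult)
  also have "\<dots> \<le> (\<bar>c\<bar> + 1) * (\<integral>x. \<bar>f x - \<phi> x\<bar> \<partial>M)" by (intro mult_right_mono) auto
  also have "\<dots> < e" using t(2) by (simp add: field_simps)
  finally show "\<exists>\<phi>\<in>test_functions UNIV. (\<integral>x. \<bar>c * f x - \<phi> x\<bar> \<partial>M) < e"
    using test_cmult[OF t(1)] by (intro bexI[of _ "\<lambda>x. c * \<phi> x"]) auto
qed

lemma test_closure_lim:
  assumes s: "\<And>n::nat. test_closure (s n)" and f: "f \<in> borel_measurable M" and w: "integrable M w"
    and lim: "\<And>x. (\<lambda>n. s n x) \<longlonglongrightarrow> f x" and bd: "\<And>n x. \<bar>s n x\<bar> \<le> w x"
  shows "test_closure f"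
  unfolding test_closure_def
proof (intro conjI allI impI)
  have [simp]: "integrable M (s n)" for n using s by (auto simp: test_closure_def)
  then have [measurable]: "s n \<in> borel_measurable M" for n by blast
  note [measurable] = f
  show [simp]: "integrable M f"
    by (rule integrable_dominated_convergence[OF f borel_measurable_integrable w, of s]) (use lim bd in auto)
  have "(\<lambda>n. \<integral>x. \<bar>f x - s n x\<bar> \<partial>M) \<longlonglongrightarrow> (\<integral>x. 0 \<partial>M)"
  proof (rule integral_dominated_convergence[where w = "\<lambda>x. \<bar>f x\<bar> + w x"])
    show "AE x in M. (\<lambda>n. \<bar>f x - s n x\<bar>) \<longlonglongrightarrow> 0"
      using tendsto_rabs_zero[OF LIM_zero[OF lim]] by (auto simp: abs_minus_commute)
    show "AE x in M. norm \<bar>f x - s n x\<bar> \<le> \<bar>f x\<bar> + w x" for n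
      by (intro AE_I2) (use bd[of n] in \<open>force intro: order.trans[OF abs_triangle_ineq4]\<close>)
  qed (use w in auto)
  moreover fix e :: real assume e: "e > 0"
  ultimately obtain n where n: "(\<integral>x. \<bar>f x - s n x\<bar> \<partial>M) < e / 2"
    using order_tendstoD(2)[of _ "0::real" sequentially "e/2"] by (auto simp: eventually_sequentially)
  obtain \<phi> where \<phi>: "\<phi> \<in> test_functions UNIV" "(\<integral>x. \<bar>s n x - \<phi> x\<bar> \<partial>M) < e / 2"
    using s[of n] e unfolding test_closure_def by (meson half_gt_zero)
  note [simp] = test_integrable_M[OF \<phi>(1)]
  have "(\<integral>x. \<bar>f x - \<phi> x\<bar> \<partial>M) \<le> (\<integral>x. \<bar>f x - s n x\<bar> + \<bar>s n x - \<phi> x\<bar> \<partial>M)"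
    by (intro integral_mono) auto
  also have "\<dots> < e" using n \<phi> by simp
  finally show "\<exists>\<phi>\<in>test_functions UNIV. (\<integral>x. \<bar>f x - \<phi> x\<bar> \<partial>M) < e" using \<phi>(1) by blast
qed

text \<open>Balls are positivity sets of bumps, and by Lindelof every open set is a countable union
  of balls. This generator is chosen because it is stable under intersection, by multiplying the
  functions, and because its indicators are limits of test functions.\<close>

lemma borel_subset_sigma_positivity_sets:
  "sets borel \<subseteq> sigma_sets UNIV {{x. P x > 0} | P. P \<in> test_functions (UNIV::'a set) \<and> (\<forall>x. 0 \<le> P x)}"
    (is "_ \<subseteq> sigma_sets UNIV ?G")
proof -
  have ball: "ball a r \<in> sigma_sets UNIV ?G" for a r
  proof (cases "r > 0")
    case True
    then obtain P :: "'a \<Rightarrow> real" where "P \<in> test_functions UNIV" "\<forall>x. 0 \<le> P x" "{x. P x > 0} = ball a r"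
      using ex_bump[of r a] by blast
    then have "ball a r \<in> ?G" by blast
    then show ?thesis by (rule sigma_sets.Basic)
  next
    case False
    then have "ball a r = {}" by auto
    then show ?thesis by (simp only: sigma_sets.Empty)
  qed
  have "S \<in> sigma_sets UNIV ?G" if S: "open S" for S
  proof -
    define F where "F = {ball a r | a r. ball a r \<subseteq> S}"
    have "\<Union>F = S"
    proof
      show "S \<subseteq> \<Union>F"
      proof
        fix x assume "x \<in> S"
        then obtain e where "e > 0" "ball x e \<subseteq> S" using openE[OF S] by metis
        then show "x \<in> \<Union>F" unfolding F_def by (intro UnionI[of "ball x e"]) auto
      qed
    qed (auto simp: F_def)
    moreover obtain F' where "F' \<subseteq> F" "countable F'" "\<Union>F' = \<Union>F"
      by (rule Lindelof[of F]) (auto simp: F_def)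
    moreover have "\<Union>F' \<in> sigma_sets UNIV ?G"
      using \<open>F' \<subseteq> F\<close> \<open>countable F'\<close> by (intro sigma_sets_UNION) (auto simp: F_def intro!: ball)
    ultimately show ?thesis by simp
  qed
  then have "sigma_sets UNIV {S. open S} \<subseteq> sigma_sets UNIV ?G"
    by (intro sigma_sets_mono) auto
  then show ?thesis by (simp add: borel_def)
qed

text \<open>Dynkin's argument for \<open>A\<close>. Intersecting with a fixed positivity set
  \<open>V\<close>, which has finite measure, keeps all indicators integrable, so complements inside
  \<open>V\<close> and disjoint countable unions stay in the closure by dominated
  convergence.\<close>

lemma test_closure_indicator_bounded:
  assumes A: "A \<in> sets borel" and V: "V \<in> {{x. P x > 0} | P. P \<in> test_functions (UNIV::'a set) \<and> (\<forall>x. 0 \<le> P x)}" (is "V \<in> ?G")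
  shows "test_closure (indicator (A \<inter> V))"
proof -
  have bor: "W \<in> sets borel" if "W \<in> ?G" for W
    using that by (auto intro!: borel_open open_Collect_less dest: test_functionsD(6))
  have int: "integrable M (indicator W :: 'a \<Rightarrow> real)" if W: "W \<in> ?G" for W
  proof -
    obtain P where P: "P \<in> test_functions UNIV" "W = {x. P x > 0}" using W by blast
    then have "W \<subseteq> supp P" using zero_outside_supp[of _ P] by force
    then have "emeasure M W \<le> emeasure M (supp P)"
      using test_functionsD(2)[OF P(1)] by (intro emeasure_mono) (auto simp: sM compact_imp_closed)
    also have "\<dots> < \<infinity>" using compact_finite_M test_functionsD(2)[OF P(1)] by blast
    finally show ?thesis using bor[OF W] by (intro integrable_real_indicator) (auto simp: sM)
  qed
  have G: "test_closure (indicator W)" if W: "W \<in> ?G" for W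
  proof -
    obtain P where P: "P \<in> test_functions UNIV" "W = {x. P x > 0}" "\<And>x. 0 \<le> P x" using W by blast
    show ?thesis
    proof (rule test_closure_lim[where s = "\<lambda>n x. 1 - exp (- (real n * P x))" and w = "indicator W"])
      show "(indicator W :: 'a \<Rightarrow> real) \<in> borel_measurable M"
        by (intro borel_measurable_indicator) (simp add: sM bor[OF W])
      fix x
      show "(\<lambda>n. 1 - exp (- (real n * P x))) \<longlonglongrightarrow> indicator W x"
      proof (cases "P x > 0")
        case True
        have "(\<lambda>n. exp (- P x) ^ n) \<longlonglongrightarrow> 0" using True by (intro LIMSEQ_realpow_zero) auto
        then have "(\<lambda>n. 1 - exp (- P x) ^ n) \<longlonglongrightarrow> 1 - 0" by (rule tendsto_diff[OF tendsto_const])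
        then show ?thesis using True P(2) by (simp add: exp_of_nat_mult[symmetric])
      next
        case False
        then have "P x = 0" using P(3)[of x] by simp
        then show ?thesis using P(2) by simp
      qed
      show "\<bar>1 - exp (- (real n * P x))\<bar> \<le> indicator W x" for n
      proof (cases "P x = 0")
        case False
        then show ?thesis using P(2) P(3)[of x] by (auto simp: indicator_def less_le)
      qed (use P in simp)
    qed (use test_closure_test[OF test_one_minus_exp[OF P(1)]] int[OF W] in auto)
  qed
  have Vb: "V \<in> sets borel" using bor[OF V] .
  have stable: "Int_stable ?G"
  proof (rule Int_stableI)
    fix a b assume "a \<in> ?G" "b \<in> ?G"
    then obtain P Q where "P \<in> test_functions UNIV" "a = {x. P x > 0}" "\<And>x. 0 \<le> P x"
       "Q \<in> test_functions UNIV" "b = {x. Q x > 0}" "\<And>x. 0 \<le> Q x" by blast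
    moreover from this have "a \<inter> b = {x. P x * Q x > 0}"
      by (auto simp: zero_less_mult_iff) (metis leD)+
    ultimately show "a \<inter> b \<in> ?G" by (auto intro!: exI[of _ "\<lambda>x. P x * Q x"] test_mult)
  qed
  have bor': "B \<in> sets borel" if "B \<in> sigma_sets UNIV ?G" for B
    using that bor by (metis (no_types, lifting) sets.sigma_sets_subset space_borel subsetD subsetI)
  have "A \<in> sigma_sets UNIV ?G" using borel_subset_sigma_positivity_sets A by blast
  note As = this
  have "?G \<subseteq> Pow UNIV" by simp
  from stable this As show ?thesis
  proof (induction rule: sigma_sets_induct_disjoint)
    case (basic B)
    show ?case by (rule G[OF Int_stableD[OF stable basic V]])
  next
    case empty
    have "(\<lambda>x. indicator ({} \<inter> V) x) = (\<lambda>x. 0::real)" by simp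
    then show ?case using test_closure_test[OF test_zero] by simp
  next
    case (compl B)
    have eq: "indicator ((UNIV - B) \<inter> V) = (\<lambda>x. indicator V x + (- 1) * indicator (B \<inter> V) x :: real)"
      by (auto split: split_indicator)
    show ?case unfolding eq by (rule test_closure_add[OF G[OF V] test_closure_cmult[OF compl.IH]])
  next
    case (union B)
    have bb: "B i \<in> sets borel" for i using union bor' by auto
    show ?case
    proof (rule test_closure_lim[where s = "\<lambda>n x. \<Sum>i<n. indicator (B i \<inter> V) x" and w = "indicator V"])
      fix n show "test_closure (\<lambda>x. \<Sum>i<n. indicator (B i \<inter> V) x)"
      proof (induction n)
        case 0
        then show ?case using test_closure_test[OF test_zero] by simp
      next
        case (Suc n)
        then show ?case using union by (auto intro!: test_closure_add)
      qed
    next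
      show "(indicator (\<Union> (range B) \<inter> V) :: 'a \<Rightarrow> real) \<in> borel_measurable M"
        using bb Vb by (intro borel_measurable_indicator) (auto simp: sM)
      fix x
      have eq: "(\<Sum>i<n. indicator (B i \<inter> V) x) = (indicator ((\<Union>i<n. B i) \<inter> V) x :: real)" for n
      proof -
        have "indicator (\<Union>i<n. B i) x = (\<Sum>i<n. indicator (B i) x :: real)"
          using union.hyps(1) by (intro indicator_UN_disjoint) (auto simp: disjoint_family_on_def)
        then show ?thesis by (simp add: indicator_inter_arith sum_distrib_right)
      qed
      show "\<bar>\<Sum>i<n. indicator (B i \<inter> V) x\<bar> \<le> (indicator V x :: real)" for n
        unfolding eq by (auto split: split_indicator)
      show "(\<lambda>n. \<Sum>i<n. indicator (B i \<inter> V) x) \<longlonglongrightarrow> (indicator (\<Union> (range B) \<inter> V) x :: real)"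
      proof (cases "x \<in> \<Union> (range B) \<inter> V")
        case True
        then obtain i where i: "x \<in> B i" by blast
        have "eventually (\<lambda>n. (\<Sum>i<n. indicator (B i \<inter> V) x) = (1 :: real)) sequentially"
          using eventually_gt_at_top[of i] by eventually_elim (unfold eq, use i True in \<open>auto simp: indicator_def\<close>)
        then show ?thesis using True by (simp add: tendsto_eventually)
      next
        case False
        then have "(\<Sum>i<n. indicator (B i \<inter> V) x) = (0 :: real)" for n unfolding eq by (auto simp: indicator_def)
        then show ?thesis using False by simp
      qed
    qed (rule int[OF V])
  qed
qed

lemma test_functions_dense: "integrable M f \<Longrightarrow> test_closure f"
proof (induction rule: integrable_induct)
  case (base A c)
  have A: "A \<in> sets borel" using base by (simp add: sM)
  have "test_closure (indicator A)"
  proof (rule test_closure_lim[where s = "\<lambda>n. indicator (A \<inter> ball 0 (real (Suc n)))" and w = "indicator A"])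
    fix n
    obtain P :: "'a \<Rightarrow> real" where "P \<in> test_functions UNIV" "\<forall>x. 0 \<le> P x" "{x. P x > 0} = ball 0 (real (Suc n))"
      using ex_bump[of "real (Suc n)" 0] by auto
    then have "ball 0 (real (Suc n)) \<in> {{x. P x > 0} | P. P \<in> test_functions (UNIV::'a set) \<and> (\<forall>x. 0 \<le> P x)}" by blast
    then show "test_closure (indicator (A \<inter> ball 0 (real (Suc n))))" by (rule test_closure_indicator_bounded[OF A])
  next
    show "(indicator A :: 'a \<Rightarrow> real) \<in> borel_measurable M" "integrable M (indicator A :: 'a \<Rightarrow> real)"
      using base by (auto intro: integrable_real_indicator)
    fix x :: 'a
    obtain N where N: "norm x < real N" using reals_Archimedean2 by blast
    have "eventually (\<lambda>n. indicator (A \<inter> ball 0 (real (Suc n))) x = (indicator A x :: real)) sequentially"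
      using eventually_gt_at_top[of N] by eventually_elim (use N in \<open>auto simp: indicator_def\<close>)
    then show "(\<lambda>n. indicator (A \<inter> ball 0 (real (Suc n))) x) \<longlonglongrightarrow> (indicator A x :: real)" by (rule tendsto_eventually)
  qed (auto split: split_indicator)
  from test_closure_cmult[OF this, of c] show ?case by (simp add: mult.commute)
next
  case (add f g)
  then show ?case by (intro test_closure_add)
next
  case (lim f s)
  show ?case
    by (rule test_closure_lim[where s = s and w = "\<lambda>x. 2 * norm (f x)"]) (use lim space_M in auto)
qed

text \<open>\<open>T\<close> extends by density to a functional \<open>L\<close> on L^1(M). The set
  function L(1_A) + 2 C M(A) is a measure with a density between 0 and 3C, and subtracting 2C from
  that density gives \<open>g\<close>.\<close>

lemma L1_functional_representation:
  fixes T :: "('a \<Rightarrow> real) \<Rightarrow> real"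
  assumes lin: "\<And>\<phi> \<psi> a b. \<phi> \<in> test_functions UNIV \<Longrightarrow> \<psi> \<in> test_functions UNIV \<Longrightarrow> T (\<lambda>x. a * \<phi> x + b * \<psi> x) = a * T \<phi> + b * T \<psi>"
    and bd: "\<And>\<phi>. \<phi> \<in> test_functions UNIV \<Longrightarrow> \<bar>T \<phi>\<bar> \<le> C * (\<integral>x. \<bar>\<phi> x\<bar> \<partial>M)" and C: "C > 0"
  obtains g where "g \<in> borel_measurable borel" "\<And>x. \<bar>g x\<bar> \<le> 2 * C"
    "\<And>\<phi>. \<phi> \<in> test_functions UNIV \<Longrightarrow> T \<phi> = (\<integral>x. g x * \<phi> x \<partial>M)"
proof -
  \<comment> \<open>The extended value \<open>t\<close> is described by its estimate against all
    test functions at once, so no approximating sequence has to be remembered.\<close>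
  have "\<exists>t. \<forall>\<phi>\<in>test_functions UNIV. \<bar>t - T \<phi>\<bar> \<le> C * (\<integral>x. \<bar>f x - \<phi> x\<bar> \<partial>M)" if f: "integrable M f" for f
  proof -
    have "\<exists>\<phi>\<in>test_functions UNIV. (\<integral>x. \<bar>f x - \<phi> x\<bar> \<partial>M) < 1 / real (Suc n)" for n
      using test_functions_dense[OF f] by (simp add: test_closure_def)
    then obtain \<phi> where \<phi>: "\<And>n. \<phi> n \<in> test_functions UNIV" "\<And>n. (\<integral>x. \<bar>f x - \<phi> n x\<bar> \<partial>M) < 1 / real (Suc n)" by metis
    have dif: "\<bar>T \<psi> - T \<eta>\<bar> \<le> C * (\<integral>x. \<bar>f x - \<psi> x\<bar> \<partial>M) + C * (\<integral>x. \<bar>f x - \<eta> x\<bar> \<partial>M)"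
      if t: "\<psi> \<in> test_functions UNIV" "\<eta> \<in> test_functions UNIV" for \<psi> \<eta>
    proof -
      note [simp] = f test_integrable_M[OF t(1)] test_integrable_M[OF t(2)]
      have "\<bar>T \<psi> - T \<eta>\<bar> = \<bar>T (\<lambda>x. 1 * \<psi> x + (- 1) * \<eta> x)\<bar>" using lin[OF t, of 1 "- 1"] by simp
      also have "\<dots> \<le> C * (\<integral>x. \<bar>1 * \<psi> x + (- 1) * \<eta> x\<bar> \<partial>M)" by (intro bd test_add test_cmult t)
      also have "\<dots> \<le> C * (\<integral>x. \<bar>f x - \<psi> x\<bar> + \<bar>f x - \<eta> x\<bar> \<partial>M)"
        using C by (intro mult_left_mono integral_mono) auto
      finally show ?thesis by (simp add: distrib_left)
    qed
    have lim0: "(\<lambda>n. \<integral>x. \<bar>f x - \<phi> n x\<bar> \<partial>M) \<longlonglongrightarrow> 0"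
      by (rule tendsto_sandwich[OF _ _ tendsto_const LIMSEQ_inverse_real_of_nat])
         (use \<phi>(2) in \<open>auto simp: inverse_eq_divide less_imp_le\<close>)
    have "Cauchy (\<lambda>n. T (\<phi> n))"
    proof (rule metric_CauchyI)
      fix e :: real assume e: "e > 0"
      have "eventually (\<lambda>n. (\<integral>x. \<bar>f x - \<phi> n x\<bar> \<partial>M) < e / (2 * C)) sequentially"
        by (rule order_tendstoD(2)[OF lim0]) (use e C in simp)
      then obtain N where N: "\<And>n. n \<ge> N \<Longrightarrow> (\<integral>x. \<bar>f x - \<phi> n x\<bar> \<partial>M) < e / (2 * C)" by (auto simp: eventually_sequentially)
      have "C * (\<integral>x. \<bar>f x - \<phi> n x\<bar> \<partial>M) < e / 2" if "n \<ge> N" for n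
        using N[OF that] C by (simp add: field_simps)
      then show "\<exists>N. \<forall>m\<ge>N. \<forall>n\<ge>N. dist (T (\<phi> m)) (T (\<phi> n)) < e"
        unfolding dist_real_def using dif[OF \<phi>(1) \<phi>(1)] by (intro exI[of _ N]) (smt (verit) field_sum_of_halves)
    qed
    then obtain t where t: "(\<lambda>n. T (\<phi> n)) \<longlonglongrightarrow> t" using Cauchy_convergent convergent_def by blast
    show ?thesis
    proof (intro exI[of _ t] ballI)
      fix \<psi> :: "'a \<Rightarrow> real" assume \<psi>: "\<psi> \<in> test_functions UNIV"
      have "(\<lambda>n. C * (\<integral>x. \<bar>f x - \<phi> n x\<bar> \<partial>M) + C * (\<integral>x. \<bar>f x - \<psi> x\<bar> \<partial>M)) \<longlonglongrightarrow> C * 0 + C * (\<integral>x. \<bar>f x - \<psi> x\<bar> \<partial>M)"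
        by (intro tendsto_intros lim0)
      moreover have "(\<lambda>n. \<bar>T (\<phi> n) - T \<psi>\<bar>) \<longlonglongrightarrow> \<bar>t - T \<psi>\<bar>" by (intro tendsto_intros t)
      ultimately show "\<bar>t - T \<psi>\<bar> \<le> C * (\<integral>x. \<bar>f x - \<psi> x\<bar> \<partial>M)"
        using dif[OF \<phi>(1) \<psi>] by (intro tendsto_le[OF sequentially_bot]) auto
    qed
  qed
  then obtain L where L: "\<And>f \<phi>. integrable M f \<Longrightarrow> \<phi> \<in> test_functions UNIV \<Longrightarrow> \<bar>L f - T \<phi>\<bar> \<le> C * (\<integral>x. \<bar>f x - \<phi> x\<bar> \<partial>M)"
    by metis
  have dense: "\<exists>\<phi>\<in>test_functions UNIV. (\<integral>x. \<bar>f x - \<phi> x\<bar> \<partial>M) < e" if "integrable M f" "e > 0" for f e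
    using test_functions_dense[OF that(1)] that(2) by (auto simp: test_closure_def)
  have zeroI: "a = 0" if "\<And>e. e > 0 \<Longrightarrow> \<bar>a\<bar> \<le> K * e" "K > 0" for a K :: real
  proof (rule ccontr)
    assume "a \<noteq> 0"
    then show False using that(1)[of "\<bar>a\<bar> / (2 * K)"] that(2) by (simp add: field_simps)
  qed
  have LT: "L \<phi> = T \<phi>" if "\<phi> \<in> test_functions UNIV" for \<phi>
    using L[OF test_integrable_M[OF that] that] by simp
  \<comment> \<open>\<open>L\<close> is known only through its estimate against test functions, so
    linearity is shown up to an arbitrary error.\<close>
  have Llin: "L (\<lambda>x. a * f x + b * g x) = a * L f + b * L g" if i: "integrable M f" "integrable M g" for f g a b
  proof -
    have "L (\<lambda>x. a * f x + b * g x) - (a * L f + b * L g) = 0"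
    proof (rule zeroI[where K = "2 * C * (\<bar>a\<bar> + \<bar>b\<bar>) + 1"])
      fix e :: real assume e: "e > 0"
      obtain \<phi> \<psi> where t: "\<phi> \<in> test_functions UNIV" "(\<integral>x. \<bar>f x - \<phi> x\<bar> \<partial>M) < e"
        "\<psi> \<in> test_functions UNIV" "(\<integral>x. \<bar>g x - \<psi> x\<bar> \<partial>M) < e" using dense[OF i(1) e] dense[OF i(2) e] by metis
      note [simp] = i test_integrable_M[OF t(1)] test_integrable_M[OF t(3)]
      have "(\<integral>x. \<bar>a * f x + b * g x - (a * \<phi> x + b * \<psi> x)\<bar> \<partial>M) \<le> (\<integral>x. \<bar>a\<bar> * \<bar>f x - \<phi> x\<bar> + \<bar>b\<bar> * \<bar>g x - \<psi> x\<bar> \<partial>M)"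
        by (intro integral_mono) (auto simp: abs_mult[symmetric] right_diff_distrib)
      also have "\<dots> \<le> \<bar>a\<bar> * e + \<bar>b\<bar> * e" using t by (simp add: add_mono mult_left_mono)
      finally have 1: "C * (\<integral>x. \<bar>a * f x + b * g x - (a * \<phi> x + b * \<psi> x)\<bar> \<partial>M) \<le> C * (\<bar>a\<bar> * e + \<bar>b\<bar> * e)"
        using C by (intro mult_left_mono) auto
      have "\<bar>L (\<lambda>x. a * f x + b * g x) - T (\<lambda>x. a * \<phi> x + b * \<psi> x)\<bar> \<le> C * (\<bar>a\<bar> * e + \<bar>b\<bar> * e)"
        by (rule order.trans[OF L 1]) (auto intro!: test_add test_cmult t)
      moreover have "\<bar>L f - T \<phi>\<bar> \<le> C * e"
        by (rule order.trans[OF L[OF i(1) t(1)]]) (use t C in simp)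
      then have "\<bar>a * L f - a * T \<phi>\<bar> \<le> \<bar>a\<bar> * (C * e)" unfolding right_diff_distrib[symmetric] abs_mult
        by (rule mult_left_mono) simp
      moreover have "\<bar>L g - T \<psi>\<bar> \<le> C * e"
        by (rule order.trans[OF L[OF i(2) t(3)]]) (use t C in simp)
      then have "\<bar>b * L g - b * T \<psi>\<bar> \<le> \<bar>b\<bar> * (C * e)" unfolding right_diff_distrib[symmetric] abs_mult
        by (rule mult_left_mono) simp
      moreover have "T (\<lambda>x. a * \<phi> x + b * \<psi> x) = a * T \<phi> + b * T \<psi>" by (rule lin[OF t(1,3)])
      moreover have "C * (\<bar>a\<bar> * e + \<bar>b\<bar> * e) + \<bar>a\<bar> * (C * e) + \<bar>b\<bar> * (C * e) + e = (2 * C * (\<bar>a\<bar> + \<bar>b\<bar>) + 1) * e"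
        by (simp add: algebra_simps)
      ultimately show "\<bar>L (\<lambda>x. a * f x + b * g x) - (a * L f + b * L g)\<bar> \<le> (2 * C * (\<bar>a\<bar> + \<bar>b\<bar>) + 1) * e"
        using e by linarith
    qed (use C in \<open>simp add: add_nonneg_pos\<close>)
    then show ?thesis by simp
  qed
  have Lbd: "\<bar>L f\<bar> \<le> C * (\<integral>x. \<bar>f x\<bar> \<partial>M)" if "integrable M f" for f
  proof -
    have "T (\<lambda>x. 0) = 0" using lin[OF test_zero test_zero, of 0 0] by simp
    then show ?thesis using L[OF that test_zero] by simp
  qed
  \<comment> \<open>Since |L(1_A)| is at most C M(A), a shift by C would already give nonnegativity.
    The shift by 2C also keeps the value above C M(A), which settles unions of infinite
    measure.\<close>
  define \<nu> where "\<nu> A = (if emeasure M A < \<infinity> then ennreal (2 * C * measure M A + L (indicator A)) else \<infinity>)" for A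
  have ind: "integrable M (indicator A :: 'a \<Rightarrow> real)" "(\<integral>x. indicator A x \<partial>M) = measure M A"
    "(\<integral>x. \<bar>indicator A x\<bar> \<partial>M) = measure M A" if "A \<in> sets M" "emeasure M A < \<infinity>" for A
    using that by (auto intro: integrable_real_indicator)
  have Lind: "\<bar>L (indicator A)\<bar> \<le> C * measure M A" if "A \<in> sets M" "emeasure M A < \<infinity>" for A
    using Lbd[OF ind(1)[OF that]] ind(3)[OF that] by simp
  define N where "N = measure_of UNIV (sets borel) \<nu>"
  have sets_N: "sets N = sets M" "space N = UNIV"
    unfolding N_def sM using sets.sigma_sets_eq[of "borel :: 'a measure"] by (simp_all add: space_measure_of_conv)
  have emN: "emeasure N A = \<nu> A" if "A \<in> sets M" for A
    unfolding N_def
  proof (rule emeasure_measure_of_sigma)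
    show "sigma_algebra UNIV (sets (borel :: 'a measure))"
      using sets.sigma_algebra_axioms[of "borel :: 'a measure"] by simp
    have "\<bar>L (indicator {})\<bar> \<le> 0" using Lind[of "{}"] by simp
    then show "positive (sets borel) \<nu>" by (simp add: positive_def \<nu>_def)
    show "countably_additive (sets borel) \<nu>"
      unfolding countably_additive_def
    proof (intro allI impI)
      fix A :: "nat \<Rightarrow> 'a set" assume A: "range A \<subseteq> sets borel" "disjoint_family A" "\<Union> (range A) \<in> sets borel"
      have A': "A i \<in> sets M" for i using A sM by auto
      let ?U = "\<Union> (range A)"
      have U: "?U \<in> sets M" using A sM by auto
      show "(\<Sum>i. \<nu> (A i)) = \<nu> ?U"
      proof (cases "emeasure M ?U < \<infinity>")
        case True
        have fin: "emeasure M (A i) < \<infinity>" for i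
          using emeasure_mono[of "A i" ?U M] U True by (auto intro: le_less_trans)
        have ms: "(\<lambda>i. measure M (A i)) sums measure M ?U"
          using A' A(2) True by (intro measure_UNION) (auto simp: less_top)
        have "(\<lambda>n. measure M ?U - (\<Sum>i<n. measure M (A i))) \<longlonglongrightarrow> measure M ?U - measure M ?U"
          using ms unfolding sums_def by (intro tendsto_intros)
        then have m0: "(\<lambda>n. C * (measure M ?U - (\<Sum>i<n. measure M (A i)))) \<longlonglongrightarrow> 0"
          using tendsto_mult_right_zero by fastforce
        have "\<bar>L (indicator ?U) - (\<Sum>i<n. L (indicator (A i)))\<bar> \<le> C * (measure M ?U - (\<Sum>i<n. measure M (A i)))" for n
        proof -
          have ii: "integrable M (\<lambda>x. \<Sum>i<n. indicator (A i) x :: real)" using ind(1)[OF A' fin] by auto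
          have "L (\<lambda>x. \<Sum>i<n. indicator (A i) x) = (\<Sum>i<n. L (indicator (A i)))"
          proof (induction n)
            case 0
            then show ?case using LT[OF test_zero] lin[OF test_zero test_zero, of 0 0] by simp
          next
            case (Suc n)
            have "integrable M (\<lambda>x. \<Sum>i<n. indicator (A i) x :: real)" using ind(1)[OF A' fin] by auto
            from Llin[OF this ind(1)[OF A' fin, of n], of 1 1] Suc show ?case by simp
          qed
          note Lsum = this
          have pt: "\<bar>1 * indicator ?U x + (- 1) * (\<Sum>i<n. indicator (A i) x)\<bar> = (indicator ?U x - (\<Sum>i<n. indicator (A i) x) :: real)" for x
          proof -
            have eq: "indicator (\<Union>i<n. A i) x = (\<Sum>i<n. indicator (A i) x :: real)"
              using A(2) by (intro indicator_UN_disjoint) (auto simp: disjoint_family_on_def)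
            show ?thesis unfolding eq[symmetric] by (auto simp: indicator_def)
          qed
          from Lsum have "L (indicator ?U) - (\<Sum>i<n. L (indicator (A i))) = L (\<lambda>x. 1 * indicator ?U x + (- 1) * (\<Sum>i<n. indicator (A i) x))"
            using Llin[OF ind(1)[OF U True] ii, of 1 "- 1"] by simp
          also have "\<bar>\<dots>\<bar> \<le> C * (\<integral>x. \<bar>1 * indicator ?U x + (- 1) * (\<Sum>i<n. indicator (A i) x)\<bar> \<partial>M)"
            using ii ind(1)[OF U True] by (intro Lbd) auto
          also have "(\<integral>x. \<bar>1 * indicator ?U x + (- 1) * (\<Sum>i<n. indicator (A i) x) :: real\<bar> \<partial>M) = (\<integral>x. indicator ?U x - (\<Sum>i<n. indicator (A i) x) \<partial>M)"
            by (simp only: pt)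
          also have "\<dots> = measure M ?U - (\<Sum>i<n. measure M (A i))"
            using ii ind[OF U True] ind[OF A' fin] by simp
          finally show ?thesis .
        qed
        then have "(\<lambda>n. L (indicator ?U) - (\<Sum>i<n. L (indicator (A i)))) \<longlonglongrightarrow> 0"
          by (intro Lim_null_comparison[OF _ m0]) auto
        then have "(\<lambda>n. L (indicator ?U) - (L (indicator ?U) - (\<Sum>i<n. L (indicator (A i))))) \<longlonglongrightarrow> L (indicator ?U) - 0"
          by (intro tendsto_intros)
        then have "(\<lambda>i. L (indicator (A i))) sums L (indicator ?U)" by (simp add: sums_def)
        then have "(\<lambda>i. 2 * C * measure M (A i) + L (indicator (A i))) sums (2 * C * measure M ?U + L (indicator ?U))"
          by (intro sums_add sums_mult ms)
        moreover have "0 \<le> 2 * C * measure M (A i) + L (indicator (A i))" for i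
          using Lind[OF A' fin, of i] mult_nonneg_nonneg[of C "measure M (A i)"] C by auto
        ultimately have "(\<Sum>i. ennreal (2 * C * measure M (A i) + L (indicator (A i)))) = ennreal (2 * C * measure M ?U + L (indicator ?U))"
          by (intro suminf_ennreal_eq)
        then show ?thesis using True fin by (simp add: \<nu>_def)
      next
        case False
        \<comment> \<open>This lower bound forces the series to diverge when the union has infinite
          measure, even if every member has finite measure.\<close>
        have "ennreal C * emeasure M (A i) \<le> \<nu> (A i)" for i
        proof (cases "emeasure M (A i) < \<infinity>")
          case True
          then have "C * measure M (A i) \<le> 2 * C * measure M (A i) + L (indicator (A i))"
            using Lind[OF A' True] by auto
          then have "ennreal (C * measure M (A i)) \<le> \<nu> (A i)" using True by (simp add: \<nu>_def ennreal_leI)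
          then show ?thesis using True C by (simp add: ennreal_mult emeasure_eq_ennreal_measure less_top)
        qed (simp add: \<nu>_def)
        then have "(\<Sum>i. ennreal C * emeasure M (A i)) \<le> (\<Sum>i. \<nu> (A i))" by (intro suminf_le summableI)
        moreover have "(\<Sum>i. ennreal C * emeasure M (A i)) = ennreal C * emeasure M ?U"
          using A' A(2) by (simp add: suminf_emeasure image_subset_iff)
        moreover have "ennreal C * emeasure M ?U = \<infinity>" using False C by (simp add: less_top[symmetric] ennreal_mult_eq_top_iff)
        ultimately show ?thesis using False by (simp add: \<nu>_def top_unique)
      qed
    qed
  qed (use that sM in auto)
  interpret sigma_finite_measure M by (rule sigma_finite_locally_finite[OF sM fM])
  have "absolutely_continuous M N"
    unfolding absolutely_continuous_def
  proof
    fix A assume A: "A \<in> null_sets M"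
    then have "A \<in> sets M" "emeasure M A = 0" by auto
    moreover from this have "\<bar>L (indicator A)\<bar> \<le> 0" using Lind[of A] by (simp add: measure_def)
    ultimately show "A \<in> null_sets N" using sets_N by (intro null_setsI) (auto simp: emN \<nu>_def measure_def)
  qed
  then obtain k where k[measurable]: "k \<in> borel_measurable M" and kN: "density M k = N"
    using Radon_Nikodym[of N] sets_N by auto
  have kA: "(\<integral>\<^sup>+x. k x * indicator A x \<partial>M) = \<nu> A" if "A \<in> sets M" for A
    using emeasure_density[OF k that] emN[OF that] kN by simp
  have "AE x in M. k x \<le> ennreal (3 * C)"
  proof (rule AE_le_of_set_nn_integral_le[OF sigma_finite_measure_axioms k])
    fix A assume A: "A \<in> sets M"
    show "(\<integral>\<^sup>+x. k x * indicator A x \<partial>M) \<le> ennreal (3 * C) * emeasure M A"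
    proof (cases "emeasure M A < \<infinity>")
      case True
      have "2 * C * measure M A + L (indicator A) \<le> 3 * C * measure M A" using Lind[OF A True] by auto
      then have "\<nu> A \<le> ennreal (3 * C * measure M A)" using True by (simp add: \<nu>_def ennreal_leI)
      then show ?thesis using kA[OF A] True C by (simp add: ennreal_mult emeasure_eq_ennreal_measure less_top)
    next
      case False
      then show ?thesis using C by (simp add: less_top[symmetric] ennreal_mult_eq_top_iff ennreal_top_mult ennreal_mult_top)
    qed
  qed
  note kbd = this
  \<comment> \<open>Clipping at 3C makes the density real and bounded everywhere, not only almost
    everywhere; then g = k' - 2C lies between -2C and C.\<close>
  define k' where "k' x = enn2real (min (k x) (ennreal (3 * C)))" for x
  define g where "g x = k' x - 2 * C" for x
  have k'm[measurable]: "k' \<in> borel_measurable M" unfolding k'_def by measurable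
  then have gm: "g \<in> borel_measurable M" unfolding g_def[abs_def] by measurable
  have k'0: "0 \<le> k' x" "k' x \<le> 3 * C" for x
    unfolding k'_def using C by (auto intro!: enn2real_leI)
  have gbd: "\<bar>g x\<bar> \<le> 2 * C" for x using k'0[of x] C unfolding g_def by linarith
  have Lg: "L f = (\<integral>x. g x * f x \<partial>M)" if "integrable M f" for f
    using that
  proof (induction rule: integrable_induct)
    case (base A c)
    have i1: "integrable M (\<lambda>x. indicator A x * k' x)"
      using ind(1)[OF base] k'0 by (intro integrable_mult_bounded[where c = "3 * C"]) auto
    have "(\<integral>\<^sup>+x. ennreal (indicator A x * k' x) \<partial>M) = (\<integral>\<^sup>+x. k x * indicator A x \<partial>M)"
    proof (rule nn_integral_cong_AE, rule AE_mp[OF kbd], intro AE_I2 impI)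
      fix x assume "k x \<le> ennreal (3 * C)"
      then have "ennreal (k' x) = k x" unfolding k'_def
        by (subst ennreal_enn2real) (auto simp: min_absorb1 intro: le_less_trans)
      then show "ennreal (indicator A x * k' x) = k x * indicator A x" by (auto split: split_indicator)
    qed
    then have "ennreal (\<integral>x. indicator A x * k' x \<partial>M) = \<nu> A"
      using kA[OF base(1)] i1 k'0 by (subst (asm) nn_integral_eq_integral) auto
    also have "\<dots> = ennreal (2 * C * measure M A + L (indicator A))" using base by (simp add: \<nu>_def)
    finally have "(\<integral>x. indicator A x * k' x \<partial>M) = 2 * C * measure M A + L (indicator A)"
      using Lind[OF base] C k'0 mult_nonneg_nonneg[of C "measure M A"] by (subst (asm) ennreal_inj) (auto intro!: integral_nonneg_AE)
    then have "L (indicator A) = (\<integral>x. indicator A x * k' x \<partial>M) - (\<integral>x. 2 * C * indicator A x \<partial>M)"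
      using ind(2)[OF base] by simp
    also have "\<dots> = (\<integral>x. indicator A x * k' x - 2 * C * indicator A x \<partial>M)"
      using i1 ind(1)[OF base] by simp
    also have "\<dots> = (\<integral>x. g x * indicator A x \<partial>M)" by (simp add: g_def algebra_simps)
    finally have 1: "L (indicator A) = (\<integral>x. g x * indicator A x \<partial>M)" .
    have "L (\<lambda>x. indicator A x *\<^sub>R c) = c * L (indicator A)"
      using Llin[OF ind(1)[OF base] ind(1)[OF base], of c 0] by (simp add: mult.commute)
    then show ?case unfolding 1 by (simp add: mult_ac)
  next
    case (add f h)
    have "integrable M (\<lambda>x. g x * f x)" "integrable M (\<lambda>x. g x * h x)"
      using integrable_mult_bounded[OF add.hyps(1) gm gbd] integrable_mult_bounded[OF add.hyps(2) gm gbd] by (auto simp: mult.commute)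
    then show ?case using Llin[OF add.hyps(1,2), of 1 1] add by (simp add: distrib_left)
  next
    case (lim f s)
    have fm: "f \<in> borel_measurable M" and sm: "\<And>i. s i \<in> borel_measurable M" using lim by auto
    have "(\<lambda>i. \<integral>x. g x * s i x \<partial>M) \<longlonglongrightarrow> (\<integral>x. g x * f x \<partial>M)"
    proof (rule integral_dominated_convergence[where w = "\<lambda>x. 2 * C * (2 * norm (f x))"])
      show "AE x in M. norm (g x * s i x) \<le> 2 * C * (2 * norm (f x))" for i
        using lim.hyps(3)[of _ i] gbd C unfolding norm_mult by (intro AE_I2 mult_mono) auto
    qed (use lim gm fm sm in \<open>auto intro!: tendsto_intros\<close>)
    moreover have "(\<lambda>i. L (s i)) \<longlonglongrightarrow> L f"
    proof -
      have "(\<lambda>i. \<integral>x. \<bar>s i x - f x\<bar> \<partial>M) \<longlonglongrightarrow> (\<integral>x. 0 \<partial>M)"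
      proof (rule integral_dominated_convergence[where w = "\<lambda>x. 3 * norm (f x)"])
        show "AE x in M. norm \<bar>s i x - f x\<bar> \<le> 3 * norm (f x)" for i
          using lim.hyps(3)[of _ i] by (intro AE_I2) (force intro: order.trans[OF abs_triangle_ineq4])
        show "AE x in M. (\<lambda>i. \<bar>s i x - f x\<bar>) \<longlonglongrightarrow> 0"
          using lim.hyps(2) by (intro AE_I2 tendsto_rabs_zero LIM_zero)
      qed (use lim fm sm in auto)
      then have z: "(\<lambda>i. C * (\<integral>x. \<bar>s i x - f x\<bar> \<partial>M)) \<longlonglongrightarrow> 0" using tendsto_mult_right_zero by fastforce
      have "\<bar>L (s i) - L f\<bar> \<le> C * (\<integral>x. \<bar>s i x - f x\<bar> \<partial>M)" for i
        using Llin[OF lim.hyps(1)[of i] lim.hyps(4), of 1 "- 1"] Lbd[of "\<lambda>x. 1 * s i x + (- 1) * f x"] lim.hyps(1)[of i] lim.hyps(4) by simp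
      then have "(\<lambda>i. L (s i) - L f) \<longlonglongrightarrow> 0" by (intro Lim_null_comparison[OF _ z]) auto
      then show ?thesis by (rule LIM_zero_cancel)
    qed
    ultimately show ?case using LIMSEQ_unique lim.IH by simp
  qed
  show thesis
  proof (rule that[of g])
    show "g \<in> borel_measurable borel" using gm measurable_cong_sets[OF sM refl] by blast
    show "\<bar>g x\<bar> \<le> 2 * C" for x by (rule gbd)
    show "T \<phi> = (\<integral>x. g x * \<phi> x \<partial>M)" if "\<phi> \<in> test_functions UNIV" for \<phi>
      using Lg[OF test_integrable_M[OF that]] LT[OF that] by simp
  qed
qed

end

subsection \<open>Domains above a graph\<close>

text \<open>The remainder of \<open>g\<close> is bounded by the sum of the remainders of the two
  barriers. In this way the distance function becomes differentiable at a point where a lower and an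
  upper barrier touch.\<close>

lemma has_derivative_sandwich:
  fixes f g k :: "'a::real_normed_vector \<Rightarrow> real"
  assumes f: "(f has_derivative D) (at x)" and k: "(k has_derivative D) (at x)"
    and le: "\<And>y. f y \<le> g y" "\<And>y. g y \<le> k y" and eq: "f x = g x" "k x = g x"
  shows "(g has_derivative D) (at x)"
  unfolding has_derivative_at
proof
  show "bounded_linear D" using f by (rule has_derivative_bounded_linear)
  let ?q = "\<lambda>F h. norm (F (x + h) - F x - D h) / norm h"
  have "((\<lambda>h. ?q f h + ?q k h) \<longlongrightarrow> 0 + 0) (at 0)"
    using f k unfolding has_derivative_at by (intro tendsto_add) auto
  then have lim: "((\<lambda>h. ?q f h + ?q k h) \<longlongrightarrow> 0) (at 0)" by simp
  show "(?q g \<longlongrightarrow> 0) (at 0)"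
  proof (rule Lim_null_comparison[OF _ lim], intro always_eventually allI)
    fix h
    have "\<bar>g (x + h) - g x - D h\<bar> \<le> \<bar>f (x + h) - f x - D h\<bar> + \<bar>k (x + h) - k x - D h\<bar>"
      using le[of "x + h"] eq by linarith
    then show "norm (?q g h) \<le> ?q f h + ?q k h"
      by (simp add: add_divide_distrib[symmetric] divide_right_mono)
  qed
qed

locale graph_domain =
  fixes h :: "real ^ 'm \<Rightarrow> real" and \<gamma> :: "real ^ 'm \<Rightarrow> real ^ 'm" and K L :: real
  assumes h: "has_gradient h \<gamma>" and Lip: "\<And>x y. norm (\<gamma> x - \<gamma> y) \<le> K * norm (x - y)"
    and gL: "\<And>x. norm (\<gamma> x) \<le> L" and K: "K > 0"
begin

abbreviation "\<Omega> \<equiv> perturbed_half_space h"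

lemma L_nonneg: "L \<ge> 0" using order.trans[OF norm_ge_zero gL] .

lemma h_lipschitz: "\<bar>h x - h y\<bar> \<le> L * norm (x - y)"
  by (rule has_gradient_lipschitz[OF h gL])

lemma continuous_h: "continuous_on S h"
  using h unfolding has_gradient_def by (auto intro!: continuous_at_imp_continuous_on has_derivative_continuous)

lemma continuous_\<gamma>: "continuous_on S \<gamma>"
proof (rule continuous_on_subset[OF _ subset_UNIV], rule lipschitz_on_continuous_on)
  show "K-lipschitz_on UNIV \<gamma>" using Lip K by (intro lipschitz_onI) (auto simp: dist_norm)
qed

text \<open>Mean value inequality for h minus its linear part at x: on the segment the gradient of
  that difference is at most K |y - x|.\<close>

lemma h_taylor: "\<bar>h y - h x - \<gamma> x \<bullet> (y - x)\<bar> \<le> K * (norm (y - x))\<^sup>2"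
proof -
  have "norm ((h y - \<gamma> x \<bullet> y) - (h x - \<gamma> x \<bullet> x)) \<le> (K * norm (y - x)) * norm (y - x)"
  proof (rule differentiable_bound[of "closed_segment x y"])
    fix z assume z: "z \<in> closed_segment x y"
    show "((\<lambda>z. h z - \<gamma> x \<bullet> z) has_derivative (\<lambda>v. \<gamma> z \<bullet> v - \<gamma> x \<bullet> v)) (at z within closed_segment x y)"
      using h unfolding has_gradient_def
      by (intro has_derivative_diff has_derivative_inner_right has_derivative_ident) (blast intro: has_derivative_at_withinI)
    have "norm (z - x) \<le> norm (y - x)" using z
      by (metis dist_commute dist_norm dist_in_closed_segment(1))
    then have "norm (\<gamma> z - \<gamma> x) \<le> K * norm (y - x)"
      using Lip[of z x] K by (meson mult_left_mono order.trans less_imp_le)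
    then show "onorm (\<lambda>v. \<gamma> z \<bullet> v - \<gamma> x \<bullet> v) \<le> K * norm (y - x)"
      unfolding inner_diff_left[symmetric] using K
      by (intro onorm_bound) (simp, use Cauchy_Schwarz_ineq2[of "\<gamma> z - \<gamma> x"] mult_right_mono[OF _ norm_ge_zero] in \<open>simp, blast intro: order.trans\<close>)
  qed auto
  then show ?thesis by (simp add: inner_diff_right power2_eq_square algebra_simps)
qed

lemma open_domain: "open \<Omega>"
proof -
  have "\<Omega> = {p. h (fst p) < snd p}" by (auto simp: perturbed_half_space_def)
  moreover have "open {p. h (fst p) < snd p}"
    by (intro open_Collect_less continuous_intros continuous_on_compose2[OF continuous_h[of UNIV]]) auto
  ultimately show ?thesis by simp
qed

lemma frontier_domain: "frontier \<Omega> = range (\<lambda>x. (x, h x))"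
proof -
  have cl: "closed {p. h (fst p) \<le> snd p}"
    by (intro closed_Collect_le continuous_intros continuous_on_compose2[OF continuous_h[of UNIV]]) auto
  have "closure \<Omega> = {p. h (fst p) \<le> snd p}"
  proof
    show "closure \<Omega> \<subseteq> {p. h (fst p) \<le> snd p}"
      by (rule closure_minimal[OF _ cl]) (auto simp: perturbed_half_space_def)
    show "{p. h (fst p) \<le> snd p} \<subseteq> closure \<Omega>"
    proof
      fix p assume p: "p \<in> {p. h (fst p) \<le> snd p}"
      have "(\<lambda>n. (fst p, snd p + 1 / real (Suc n))) \<longlonglongrightarrow> (fst p, snd p + 0)"
        by (intro tendsto_intros LIMSEQ_inverse_real_of_nat[unfolded inverse_eq_divide])
      moreover have "(fst p, snd p + 1 / real (Suc n)) \<in> \<Omega>" for n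
        using p by (auto simp: perturbed_half_space_def intro: le_less_trans[of _ "snd p"])
      ultimately show "p \<in> closure \<Omega>"
        unfolding closure_sequential by (intro exI[of _ "\<lambda>n. (fst p, snd p + 1 / real (Suc n))"]) auto
    qed
  qed
  then have "frontier \<Omega> = {p. h (fst p) \<le> snd p} - \<Omega>"
    unfolding frontier_def interior_open[OF open_domain] by simp
  also have "\<dots> = {p. snd p = h (fst p)}" by (fastforce simp: perturbed_half_space_def)
  also have "\<dots> = range (\<lambda>x. (x, h x))" by (force simp: image_iff)
  finally show ?thesis .
qed

abbreviation "N x \<equiv> (- \<gamma> x, 1 :: real)"

lemma norm_N: "norm (N x) \<le> 1 + L" "norm (N x) > 0" "(norm (N x))\<^sup>2 = 1 + (norm (\<gamma> x))\<^sup>2"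
proof -
  show sq: "(norm (N x))\<^sup>2 = 1 + (norm (\<gamma> x))\<^sup>2" by (simp add: norm_Pair)
  show "norm (N x) > 0" by (simp add: zero_prod_def)
  have "norm (N x) \<le> norm (- \<gamma> x) + norm (1::real)" by (rule norm_Pair_le)
  then show "norm (N x) \<le> 1 + L" using gL[of x] by simp
qed

text \<open>Let P be a foot point of X. Stationarity puts X on the normal line through P, at P + s
  N, and the small height forces 0 < s < 1/(2K). The distance to P is an upper barrier; a ball
  touching the graph from above at P gives a lower one. Both equal the distance at X and have the
  gradient N/|N| there.\<close>

lemma strip_distance:
  assumes t: "0 < t" "t < 1 / (2 * K)"
  obtains p where "norm (x - p) \<le> t"
    "((\<lambda>z. infdist z (frontier \<Omega>)) has_derivative (\<lambda>v. ((1 / norm (N p)) *\<^sub>R N p) \<bullet> v)) (at (x, h x + t))"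
proof -
  define X where "X = (x, h x + t)"
  define d where "d = infdist X (frontier \<Omega>)"
  have cl: "closed (frontier \<Omega>)" by (rule frontier_closed)
  have ne: "frontier \<Omega> \<noteq> {}" unfolding frontier_domain by auto
  obtain P where "P \<in> frontier \<Omega>" "d = dist X P"
    using infdist_attains_inf[OF cl ne] unfolding d_def by metis
  then obtain p where p: "P = (p, h p)" "d = dist X (p, h p)" unfolding frontier_domain by auto
  have "d \<le> dist X (x, h x)" unfolding d_def frontier_domain by (rule infdist_le) auto
  also have "dist X (x, h x) = t" using t by (simp add: X_def dist_Pair_Pair dist_real_def)
  finally have dt: "d \<le> t" .
  have xp: "norm (x - p) \<le> t"
    using dist_fst_le[of X "(p, h p)"] dt p by (simp add: X_def dist_norm)
  define s where "s = h x + t - h p"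
  have min: "(norm (x - p))\<^sup>2 + s\<^sup>2 \<le> (norm (x - y))\<^sup>2 + (h x + t - h y)\<^sup>2" for y
  proof -
    have "dist X (p, h p) \<le> dist X (y, h y)"
      unfolding p(2)[symmetric] d_def frontier_domain by (rule infdist_le) auto
    then show ?thesis by (simp add: X_def dist_norm norm_Pair s_def)
  qed
  \<comment> \<open>First-order condition for the squared distance to points of the graph; the
    derivative is tested in the direction of the vector that should vanish.\<close>
  have "x - p + s *\<^sub>R \<gamma> p = 0"
  proof -
    define D where "D v = 2 * ((p - x) \<bullet> v) - 2 * s * (\<gamma> p \<bullet> v)" for v
    have "((\<lambda>y. (y - x) \<bullet> (y - x) + (h x + t - h y)\<^sup>2) has_derivative D) (at p)"
      using h unfolding has_gradient_def D_def
      by (auto intro!: derivative_eq_intros simp: s_def inner_commute algebra_simps)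
    moreover have "(p - x) \<bullet> (p - x) + (h x + t - h p)\<^sup>2 \<le> (y - x) \<bullet> (y - x) + (h x + t - h y)\<^sup>2" for y
      using min[of y] by (simp add: power2_norm_eq_inner[symmetric] norm_minus_commute s_def)
    ultimately have "D = (\<lambda>v. 0)"
      by (intro differential_zero_maxmin[of p UNIV "\<lambda>y. (y - x) \<bullet> (y - x) + (h x + t - h y)\<^sup>2" D]) auto
    then have "D (p - x - s *\<^sub>R \<gamma> p) = 0" by metis
    then have "2 * ((p - x - s *\<^sub>R \<gamma> p) \<bullet> (p - x - s *\<^sub>R \<gamma> p)) = 0"
      unfolding D_def by (simp add: inner_diff_left inner_diff_right algebra_simps)
    then have "p - x - s *\<^sub>R \<gamma> p = 0" by simp
    then show ?thesis by (simp add: algebra_simps)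
  qed
  then have xps: "x - p = - (s *\<^sub>R \<gamma> p)" by (simp add: eq_neg_iff_add_eq_0)
  have X: "X = (p, h p) + s *\<^sub>R N p"
    using xps by (simp add: X_def s_def algebra_simps)
  have XP: "X - (p, h p) = s *\<^sub>R N p" unfolding X by (simp only: add_diff_cancel_left')
  have dsN: "d = \<bar>s\<bar> * norm (N p)" unfolding p(2) dist_norm XP by (rule norm_scaleR)
  have d0: "d > 0"
  proof -
    have "X \<notin> frontier \<Omega>" using t unfolding frontier_domain X_def by auto
    then show ?thesis unfolding d_def using in_closed_iff_infdist_zero[OF cl ne] infdist_nonneg by (metis less_eq_real_def)
  qed
  have N1: "norm (N p) \<ge> 1"
    using norm_N(3)[of p] power2_le_imp_le[of 1 "norm (N p)"] by simp
  have sd: "\<bar>s\<bar> \<le> d" unfolding dsN using N1 by (simp add: mult_le_cancel_left1)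
  \<comment> \<open>Otherwise put \<sigma> = -s. The Taylor bound at p would give 0 > \<sigma> (1 +
    |\<gamma>|^2 (1 - K \<sigma>)), which is impossible for \<sigma> up to 1/(2K).\<close>
  have "s > 0"
  proof (rule ccontr)
    assume "\<not> s > 0"
    define \<sigma> where "\<sigma> = - s"
    have \<sigma>: "\<sigma> > 0" using \<open>\<not> s > 0\<close> d0 dsN by (cases "s = 0") (auto simp: \<sigma>_def)
    have "h x \<ge> h p + \<gamma> p \<bullet> (x - p) - K * (norm (x - p))\<^sup>2" using h_taylor[of x p] by linarith
    then have "h x \<ge> h p + \<sigma> * (norm (\<gamma> p))\<^sup>2 - K * (\<sigma>\<^sup>2 * (norm (\<gamma> p))\<^sup>2)"
      unfolding xps by (simp add: \<sigma>_def power2_norm_eq_inner power_mult_distrib)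
    then have "0 > \<sigma> + \<sigma> * (norm (\<gamma> p))\<^sup>2 - K * (\<sigma>\<^sup>2 * (norm (\<gamma> p))\<^sup>2)"
      using t(1) by (simp add: \<sigma>_def s_def)
    then have "0 > \<sigma> * (1 + (norm (\<gamma> p))\<^sup>2 * (1 - K * \<sigma>))" by (simp add: algebra_simps power2_eq_square)
    moreover have "K * \<sigma> \<le> 1"
    proof -
      have "\<sigma> \<le> 1 / (2 * K)" using sd dt t by (simp add: \<sigma>_def)
      then have "K * \<sigma> \<le> K * (1 / (2 * K))" using K by (intro mult_left_mono) auto
      then show ?thesis using K by simp
    qed
    then have "0 \<le> \<sigma> * (1 + (norm (\<gamma> p))\<^sup>2 * (1 - K * \<sigma>))"
      using \<sigma> by (intro mult_nonneg_nonneg add_nonneg_nonneg) auto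
    ultimately show False by linarith
  qed
  \<comment> \<open>With 2 \<rho> K = 1 the Taylor remainder K |q - P|^2 is just absorbed: every
    point q of the graph stays at distance at least \<rho> |N| from the centre \<open>Z\<close>.
    This is where the width 1/(2K) of the strip comes from.\<close>
  define \<rho> where "\<rho> = 1 / (2 * K)"
  have s\<rho>: "s < \<rho>" using sd dt t by (simp add: \<rho>_def)
  define Z where "Z = (p, h p) + \<rho> *\<^sub>R N p"
  have Zd: "\<rho> * norm (N p) \<le> infdist Z (frontier \<Omega>)"
    unfolding infdist_notempty[OF ne]
  proof (rule cINF_greatest[OF ne])
    fix q assume "q \<in> frontier \<Omega>"
    then obtain y where q: "q = (y, h y)" unfolding frontier_domain by auto
    have "(q - (p, h p)) \<bullet> N p = h y - h p - \<gamma> p \<bullet> (y - p)"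
      by (simp add: q inner_Pair inner_commute)
    also have "\<dots> \<le> K * (norm (y - p))\<^sup>2" using h_taylor[of y p] by linarith
    also have "\<dots> \<le> K * (norm (q - (p, h p)))\<^sup>2"
      using K by (intro mult_left_mono) (auto simp: q norm_Pair)
    finally have 1: "2 * \<rho> * ((q - (p, h p)) \<bullet> N p) \<le> 2 * \<rho> * (K * (norm (q - (p, h p)))\<^sup>2)"
      using K by (intro mult_left_mono) (auto simp: \<rho>_def)
    have "(norm (q - Z))\<^sup>2 = (norm (q - (p, h p)))\<^sup>2 - 2 * \<rho> * ((q - (p, h p)) \<bullet> N p) + (\<rho> * norm (N p))\<^sup>2"
    proof -
      have "(norm (a - \<rho> *\<^sub>R b))\<^sup>2 = (norm a)\<^sup>2 - 2 * \<rho> * (a \<bullet> b) + (\<rho> * norm b)\<^sup>2" for a b :: "(real ^ 'm) \<times> real"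
        unfolding power2_norm_eq_inner power_mult_distrib
        by (simp add: inner_diff_left inner_diff_right inner_commute power2_eq_square algebra_simps)
      then show ?thesis unfolding Z_def diff_diff_eq[symmetric] .
    qed
    then have "(\<rho> * norm (N p))\<^sup>2 \<le> (norm (q - Z))\<^sup>2" using 1 K by (simp add: \<rho>_def)
    then have "\<rho> * norm (N p) \<le> norm (q - Z)" by (rule power2_le_imp_le) simp
    then show "\<rho> * norm (N p) \<le> dist Z q" by (simp add: dist_norm norm_minus_commute)
  qed
  have XZ: "X - Z = - ((\<rho> - s) *\<^sub>R N p)" unfolding X Z_def by (simp add: algebra_simps)
  have N0: "norm (N p) > 0" by (rule norm_N(2))
  have normXZ: "norm (X - Z) = (\<rho> - s) * norm (N p)"
    unfolding XZ norm_minus_cancel norm_scaleR using s\<rho> by simp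
  have normXP: "norm (X - (p, h p)) = s * norm (N p)"
    unfolding XP norm_scaleR using \<open>s > 0\<close> by simp
  have "((\<lambda>z. infdist z (frontier \<Omega>)) has_derivative (\<lambda>v. ((1 / norm (N p)) *\<^sub>R N p) \<bullet> v)) (at X)"
  proof (rule has_derivative_sandwich[where f = "\<lambda>z. \<rho> * norm (N p) - norm (z - Z)" and k = "\<lambda>z. norm (z - (p, h p))"])
    have Dn: "((\<lambda>z. norm (z - a)) has_derivative (\<lambda>v. sgn (X - a) \<bullet> v)) (at X)" if "X \<noteq> a" for a
      by (rule has_derivative_compose[of "\<lambda>z. z - a" "\<lambda>v. v" X UNIV norm "\<lambda>v. sgn (X - a) \<bullet> v", simplified])
         (use that has_derivative_norm[of "X - a"] in \<open>auto intro!: derivative_eq_intros simp: inner_commute\<close>)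
    have sgnN: "sgn (N p) = (1 / norm (N p)) *\<^sub>R N p" by (simp only: sgn_div_norm inverse_eq_divide)
    have "sgn (\<rho> - s) = 1" "sgn s = 1" using s\<rho> \<open>s > 0\<close> by auto
    note sgns = this
    have sgnXZ: "sgn (X - Z) = - ((1 / norm (N p)) *\<^sub>R N p)"
      unfolding XZ sgn_minus sgn_scaleR sgns sgnN by (simp only: scaleR_one)
    have "X \<noteq> Z" using normXZ s\<rho> N0 by auto
    then show "((\<lambda>z. \<rho> * norm (N p) - norm (z - Z)) has_derivative (\<lambda>v. ((1 / norm (N p)) *\<^sub>R N p) \<bullet> v)) (at X)"
      using has_derivative_diff[OF has_derivative_const Dn, of Z] unfolding sgnXZ inner_minus_left
      by (simp only: diff_0 minus_minus simp_thms)
    have "sgn (X - (p, h p)) = (1 / norm (N p)) *\<^sub>R N p"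
      unfolding XP sgn_scaleR sgns sgnN by (simp only: scaleR_one)
    moreover have "X \<noteq> (p, h p)" using normXP \<open>s > 0\<close> N0 by auto
    ultimately show "((\<lambda>z. norm (z - (p, h p))) has_derivative (\<lambda>v. ((1 / norm (N p)) *\<^sub>R N p) \<bullet> v)) (at X)"
      using Dn[of "(p, h p)"] by simp
    show "\<rho> * norm (N p) - norm (z - Z) \<le> infdist z (frontier \<Omega>)" for z
      using infdist_triangle[of Z "frontier \<Omega>" z] Zd by (simp add: dist_norm norm_minus_commute)
    show "infdist z (frontier \<Omega>) \<le> norm (z - (p, h p))" for z
      unfolding dist_norm[symmetric] frontier_domain by (rule infdist_le) auto
    show "\<rho> * norm (N p) - norm (X - Z) = infdist X (frontier \<Omega>)"
      unfolding normXZ d_def[symmetric] dsN abs_of_pos[OF \<open>s > 0\<close>] left_diff_distrib by simp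
    show "norm (X - (p, h p)) = infdist X (frontier \<Omega>)"
      unfolding normXP d_def[symmetric] dsN using \<open>s > 0\<close> by simp
  qed
  with xp show ?thesis using that unfolding X_def by blast
qed

text \<open>The gradient of the distance is the unit normal at the foot point p rather than at x.
  Since |x - p| is at most t and \<gamma> is Lipschitz, exchanging the two normals costs K t |w|;
  the factor 1 + L undoes the normalisation of the normal.\<close>

lemma strip_normal:
  assumes t: "0 < t" "t < 1 / (2 * K)"
  shows "\<bar>w \<bullet> N x\<bar> \<le> (1 + L) * \<bar>grad (\<lambda>z. infdist z (frontier \<Omega>)) (x, h x + t) \<bullet> w\<bar> + K * t * norm w"
proof -
  obtain p where p: "norm (x - p) \<le> t"
    "((\<lambda>z. infdist z (frontier \<Omega>)) has_derivative (\<lambda>v. ((1 / norm (N p)) *\<^sub>R N p) \<bullet> v)) (at (x, h x + t))"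
    using strip_distance[OF t] by blast
  let ?g = "grad (\<lambda>z. infdist z (frontier \<Omega>)) (x, h x + t)"
  have "?g = (1 / norm (N p)) *\<^sub>R N p" by (rule grad_eqI[OF p(2)])
  then have Np: "N p = norm (N p) *\<^sub>R ?g" using norm_N(2)[of p] by simp
  have "N x = N p + (N x - N p)" by simp
  then have "\<bar>w \<bullet> N x\<bar> \<le> \<bar>w \<bullet> N p\<bar> + \<bar>w \<bullet> (N x - N p)\<bar>"
    by (metis abs_triangle_ineq inner_add_right)
  also have "\<bar>w \<bullet> N p\<bar> = norm (N p) * \<bar>?g \<bullet> w\<bar>"
    by (subst Np) (simp add: abs_mult inner_commute)
  also have "norm (N p) * \<bar>?g \<bullet> w\<bar> \<le> (1 + L) * \<bar>?g \<bullet> w\<bar>"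
    using norm_N(1)[of p] by (intro mult_right_mono) auto
  also have "\<bar>w \<bullet> (N x - N p)\<bar> \<le> norm w * norm (N x - N p)" by (rule Cauchy_Schwarz_ineq2)
  also have "norm (N x - N p) = norm (\<gamma> x - \<gamma> p)" by (simp add: norm_Pair norm_minus_commute)
  also have "norm w * norm (\<gamma> x - \<gamma> p) \<le> norm w * (K * t)"
    using order.trans[OF Lip[of x p] mult_left_mono[OF p(1), of K]] K by (intro mult_left_mono) auto
  finally show ?thesis by (simp add: mult_ac)
qed

end

subsection \<open>Perturbations of type $(K)$\<close>

text \<open>The vector on the left is the transpose of \<open>H\<close> applied to \<open>v\<close>,
  the form in which the Hessian acts as derivative of the gradient; the estimate is Cauchy-Schwarz
  over the rows.\<close>

lemma norm_sum_scaleR_rows_le: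
  fixes H :: "real ^ 'm ^ 'm"
  shows "norm (\<Sum>i\<in>UNIV. (v $ i) *\<^sub>R (H $ i)) \<le> norm H * norm v"
proof -
  have "norm (\<Sum>i\<in>UNIV. (v $ i) *\<^sub>R (H $ i)) \<le> (\<Sum>i\<in>UNIV. \<bar>v $ i\<bar> * \<bar>norm (H $ i)\<bar>)"
    by (rule order.trans[OF norm_sum]) simp
  also have "\<dots> \<le> L2_set (\<lambda>i. v $ i) UNIV * L2_set (\<lambda>i. norm (H $ i)) UNIV"
    by (rule L2_set_mult_ineq)
  also have "\<dots> = norm H * norm v" by (simp add: norm_vec_def L2_set_def)
  finally show ?thesis .
qed

text \<open>\<open>LEAST\<close> over the reals requires an attained minimum. It is the maximum of
  the norm over the compact support, and it is positive because an open set where h is nonzero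
  cannot consist of the origin alone.\<close>

lemma supp_radius:
  fixes h :: "'a::euclidean_space \<Rightarrow> real"
  assumes "continuous_on UNIV h" "compact (supp h)" "h a \<noteq> 0"
  shows "supp_radius h > 0" "supp h \<subseteq> cball 0 (supp_radius h)"
proof -
  let ?P = "\<lambda>R. R > 0 \<and> supp h \<subseteq> cball 0 R"
  have a: "a \<in> supp h" using assms(3) zero_outside_supp by metis
  obtain s where s: "s \<in> supp h" "\<And>y. y \<in> supp h \<Longrightarrow> norm y \<le> norm s"
    using continuous_attains_sup[OF assms(2), of norm] a by (auto intro: continuous_intros)
  have "norm s > 0"
  proof (cases "a = 0")
    case True
    have "open {x. h x \<noteq> 0}" using assms(1) by (intro open_Collect_neq continuous_intros)
    then obtain e where e: "e > 0" "ball a e \<subseteq> {x. h x \<noteq> 0}" using assms(3) openE by blast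
    obtain b :: 'a where b: "b \<in> Basis" by (meson SOME_Basis)
    have "(e/2) *\<^sub>R b \<in> ball a e" using e(1) b True by (simp add: norm_Basis)
    then have "(e/2) *\<^sub>R b \<in> supp h" using e(2) zero_outside_supp by blast
    then have "norm ((e/2) *\<^sub>R b) \<le> norm s" by (rule s(2))
    then show ?thesis using e(1) b by (auto simp: norm_Basis)
  next
    case False
    then show ?thesis using s(2)[OF a] by (meson less_le_trans zero_less_norm_iff)
  qed
  then have P: "?P (norm s)" using s(2) by auto
  have "supp_radius h = norm s"
    unfolding supp_radius_def by (rule Least_equality[of ?P, OF P]) (use s(1) in auto)
  with P show "supp_radius h > 0" "supp h \<subseteq> cball 0 (supp_radius h)" by auto
qed

text \<open>The Frobenius bound on the Hessian makes the gradient K-Lipschitz. The gradient vanishes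
  at a point of norm R_h + 1, and every point of the support is within 2 R_h + 1 of it; this is the
  origin of the bound K (2 R_h + 1).\<close>

lemma graph_domain_type_K:
  fixes h :: "real ^ 'm \<Rightarrow> real"
  assumes adm: "admissible_perturbation \<kappa> h" and type: "of_type_K K h"
  shows "graph_domain h (grad h) K (K * (2 * supp_radius h + 1))" "supp_radius h > 0"
proof -
  have C2: "C_k (Suc (Suc 0)) h" and cs: "compact (supp h)" and ne: "\<exists>a. h a \<noteq> 0"
    using adm by (auto simp: admissible_perturbation_def C_2_Hoelder_def numeral_2_eq_2)
  define g where "g j = pderiv_at (axis j 1) h" for j
  have B: "axis j (1::real) \<in> Basis" for j by (simp add: axis_in_Basis_iff)
  have hd: "has_gradient h (grad h)" using C2 by (auto simp: has_gradient_def intro!: has_derivative_grad)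
  have gd: "has_gradient (g j) (grad (g j))" for j :: 'm
    using C2 B[of j] by (auto simp: g_def has_gradient_def intro!: has_derivative_grad)
  have gj: "grad h x $ j = g j x" for x and j :: 'm
    using grad_inner_Basis[OF B[of j], of h x] by (simp add: g_def inner_axis)
  have Hij: "grad (g j) x $ i = hessian h x $ i $ j" for x and i j :: 'm
    using grad_inner_Basis[OF B[of i], of "g j" x] by (simp add: g_def inner_axis hessian_def)
  have ch: "continuous_on UNIV h"
    using hd unfolding has_gradient_def by (auto intro!: continuous_at_imp_continuous_on has_derivative_continuous)
  obtain a where a: "h a \<noteq> 0" using ne by blast
  note sr = supp_radius[OF ch cs a]
  show "supp_radius h > 0" by (rule sr)
  have grad0: "grad h x = 0" if "x \<notin> supp h" for x
    by (rule has_gradient_zero_outside[OF hd compact_imp_closed[OF cs] zero_outside_supp[of _ h] that])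
  have g0: "g j x = 0" if "x \<notin> supp h" for x and j :: 'm
    using grad0[OF that] gj[of x j] by simp
  have gg0: "grad (g j) x = 0" if "x \<notin> supp h" for x and j :: 'm
    by (rule has_gradient_zero_outside[OF gd compact_imp_closed[OF cs] g0 that])
  have H0: "hessian h x = 0" if "x \<notin> supp h" for x
    using gg0[OF that] Hij by (simp add: vec_eq_iff)
  have "continuous_on UNIV (\<lambda>x. hessian h x $ i $ j)" for i j :: 'm
    using C2 B[of i] B[of j] by (simp add: hessian_def)
  then have cH: "continuous_on UNIV (hessian h)"
    by (intro continuous_on_vec_lambda[of UNIV "\<lambda>i x. hessian h x $ i", simplified] continuous_on_vec_lambda[of UNIV "\<lambda>j x. hessian h x $ i $ j" for i, simplified])
  obtain b where "\<And>x. norm (hessian h x) \<le> b"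
    using continuous_compact_support_bounded[OF cH cs H0] by metis
  \<comment> \<open>The supremum in \<open>of_type_K\<close> bounds the Hessian only once its range
    is known to be bounded, which continuity and compact support provide.\<close>
  then have bdd: "bdd_above (range (\<lambda>x. norm (hessian h x)))" by (auto intro!: bdd_aboveI[of _ b])
  have HK: "norm (hessian h x) \<le> K" for x
    using cSUP_upper[OF _ bdd, of x] type unfolding of_type_K_def by simp
  have K0: "K > 0" using HK[of a] type cSUP_upper[OF _ bdd, of a] unfolding of_type_K_def
    by (meson UNIV_I norm_ge_zero order.trans order_le_less_trans)
  have D: "(grad h has_derivative (\<lambda>v. \<Sum>i\<in>UNIV. (v $ i) *\<^sub>R (hessian h x $ i))) (at x)" for x
  proof (rule has_derivative_componentwise_within[THEN iffD2], intro ballI)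
    fix b :: "real ^ 'm" assume "b \<in> Basis"
    then obtain j where j: "b = axis j 1" by (auto simp: Basis_vec_def)
    have "(\<lambda>x. grad h x \<bullet> b) = g j" using gj by (auto simp: j inner_axis)
    moreover have "(\<lambda>v. (\<Sum>i\<in>UNIV. (v $ i) *\<^sub>R (hessian h x $ i)) \<bullet> b) = (\<lambda>v. grad (g j) x \<bullet> v)"
    proof (rule ext)
      fix v :: "real ^ 'm"
      have "(\<Sum>i\<in>UNIV. (v $ i) *\<^sub>R (hessian h x $ i)) \<bullet> b = (\<Sum>i\<in>UNIV. v $ i * hessian h x $ i $ j)"
        by (simp add: j inner_axis)
      also have "\<dots> = grad (g j) x \<bullet> v" by (simp add: inner_vec_def Hij mult.commute)
      finally show "(\<Sum>i\<in>UNIV. (v $ i) *\<^sub>R (hessian h x $ i)) \<bullet> b = grad (g j) x \<bullet> v" .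
    qed
    ultimately show "((\<lambda>x. grad h x \<bullet> b) has_derivative (\<lambda>v. (\<Sum>i\<in>UNIV. (v $ i) *\<^sub>R (hessian h x $ i)) \<bullet> b)) (at x)"
      using gd[of j] unfolding has_gradient_def by simp
  qed
  have Lip: "norm (grad h x - grad h y) \<le> K * norm (x - y)" for x y
  proof (rule differentiable_bound[of UNIV])
    show "(grad h has_derivative (\<lambda>v. \<Sum>i\<in>UNIV. (v $ i) *\<^sub>R (hessian h x $ i))) (at x within UNIV)" for x
      using D by simp
    show "onorm (\<lambda>v. \<Sum>i\<in>UNIV. (v $ i) *\<^sub>R (hessian h x $ i)) \<le> K" for x
      using K0 order.trans[OF norm_sum_scaleR_rows_le mult_right_mono[OF HK norm_ge_zero]] by (intro onorm_bound) auto
  qed auto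
  show "graph_domain h (grad h) K (K * (2 * supp_radius h + 1))"
  proof
    fix x
    define x0 :: "real ^ 'm" where "x0 = (supp_radius h + 1) *\<^sub>R axis undefined 1"
    have n0: "norm x0 = supp_radius h + 1" using sr(1) by (simp add: x0_def norm_Basis[OF B])
    have z: "grad h x0 = 0" by (rule grad0) (use sr(2) n0 in force)
    show "norm (grad h x) \<le> K * (2 * supp_radius h + 1)"
    proof (cases "x \<in> supp h")
      case True
      then have "norm x \<le> supp_radius h" using sr(2) by auto
      then have "norm (x - x0) \<le> 2 * supp_radius h + 1" using n0 norm_triangle_ineq4[of x x0] by linarith
      then have "K * norm (x - x0) \<le> K * (2 * supp_radius h + 1)" using K0 by (intro mult_left_mono) auto
      then show ?thesis using Lip[of x x0] z by simp
    qed (use grad0 K0 sr(1) in auto)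
  qed (use hd Lip K0 in auto)
qed

subsection \<open>Flux through the boundary of a half space\<close>

lemma has_gradient_mult:
  assumes "has_gradient f F" "has_gradient g G"
  shows "has_gradient (\<lambda>x. f x * g x) (\<lambda>x. f x *\<^sub>R G x + g x *\<^sub>R F x)"
  unfolding has_gradient_def
proof
  fix x
  have "((\<lambda>x. f x * g x) has_derivative (\<lambda>v. f x * (G x \<bullet> v) + (F x \<bullet> v) * g x)) (at x)"
    using assms unfolding has_gradient_def by (intro has_derivative_mult) auto
  then show "((\<lambda>x. f x * g x) has_derivative (\<lambda>v. (f x *\<^sub>R G x + g x *\<^sub>R F x) \<bullet> v)) (at x)"
    by (simp add: inner_add_left mult.commute)
qed

lemma has_gradient_compose_real:
  assumes "\<And>t. (\<theta> has_real_derivative \<theta>' t) (at t)" "has_gradient f F"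
  shows "has_gradient (\<lambda>x. \<theta> (f x)) (\<lambda>x. \<theta>' (f x) *\<^sub>R F x)"
  unfolding has_gradient_def
proof
  fix x
  have "((\<lambda>x. \<theta> (f x)) has_derivative (\<lambda>v. (F x \<bullet> v) * \<theta>' (f x))) (at x)"
    using assms(2) unfolding has_gradient_def by (intro DERIV_compose_FDERIV[OF assms(1)]) auto
  then show "((\<lambda>x. \<theta> (f x)) has_derivative (\<lambda>v. (\<theta>' (f x) *\<^sub>R F x) \<bullet> v)) (at x)"
    by (simp add: mult.commute)
qed

lemma has_gradient_continuous: "has_gradient f F \<Longrightarrow> continuous_on S f"
  unfolding has_gradient_def by (auto intro!: continuous_at_imp_continuous_on has_derivative_continuous)

lemma has_gradient_snd: "has_gradient (\<lambda>p. c * snd p) (\<lambda>p::'a::euclidean_space \<times> real. (0, c))"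
  unfolding has_gradient_def by (auto intro!: derivative_eq_intros simp: inner_prod_def)

lemma has_gradient_norm_square: "has_gradient (\<lambda>p::'a::euclidean_space. c * (p \<bullet> p)) (\<lambda>p. (2 * c) *\<^sub>R p)"
  unfolding has_gradient_def by (auto intro!: derivative_eq_intros simp: inner_commute)

lemma DERIV_pos_part_square: "((\<lambda>t::real. (max 0 t)\<^sup>2) has_real_derivative 2 * max 0 t) (at t)"
proof -
  consider "t > 0" | "t < 0" | "t = 0" by linarith
  then show ?thesis
  proof cases
    case 1
    have "((\<lambda>t. t\<^sup>2) has_real_derivative 2 * t) (at t)" by (auto intro!: derivative_eq_intros)
    then have "((\<lambda>t. (max 0 t)\<^sup>2) has_real_derivative 2 * t) (at t)"
      by (rule DERIV_cong_ev[THEN iffD1, rotated 3])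
         (use 1 in \<open>auto simp: eventually_nhds intro!: exI[of _ "{0<..}"]\<close>)
    with 1 show ?thesis by simp
  next
    case 2
    have "((\<lambda>t. 0) has_real_derivative 0) (at t)" by simp
    then have "((\<lambda>t. (max 0 t)\<^sup>2) has_real_derivative 0) (at t)"
      by (rule DERIV_cong_ev[THEN iffD1, rotated 3])
         (use 2 in \<open>auto simp: eventually_nhds intro!: exI[of _ "{..<0}"]\<close>)
    with 2 show ?thesis by simp
  next
    case 3
    have "((\<lambda>x::real. \<bar>x\<bar>) \<longlongrightarrow> 0) (at 0)" by (auto intro!: tendsto_eq_intros)
    then have "((\<lambda>x::real. (max 0 x)\<^sup>2 / x) \<longlongrightarrow> 0) (at 0)"
      by (rule Lim_null_comparison[rotated]) (auto intro!: always_eventually simp: max_def power2_eq_square)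
    then show ?thesis using 3 by (simp add: DERIV_def)
  qed
qed

text \<open>A C^1 quadratic spline: its second derivative is -4 on (1, 3/2) and 4 on (3/2, 2), so
  that it falls from 1 at s = 1 to 0 at s = 2 with slope at least -2.\<close>

definition cutoff :: "real \<Rightarrow> real" where
  "cutoff s = 1 - 2 * (max 0 (s - 1))\<^sup>2 + 4 * (max 0 (s - 3/2))\<^sup>2 - 2 * (max 0 (s - 2))\<^sup>2"

definition cutoff' :: "real \<Rightarrow> real" where
  "cutoff' s = - (4 * max 0 (s - 1)) + 8 * max 0 (s - 3/2) - 4 * max 0 (s - 2)"

lemma DERIV_cutoff: "(cutoff has_real_derivative cutoff' s) (at s)"
proof -
  have D: "((\<lambda>t. (max 0 (t - a))\<^sup>2) has_real_derivative 2 * max 0 (s - a)) (at s)" for a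
  proof -
    have "((\<lambda>t. t - a) has_real_derivative 1) (at s)" by (auto intro!: derivative_eq_intros)
    from DERIV_chain2[OF DERIV_pos_part_square this] show ?thesis by simp
  qed
  show ?thesis unfolding cutoff_def[abs_def] cutoff'_def
    by (rule DERIV_cong[OF DERIV_diff[OF DERIV_add[OF DERIV_diff[OF DERIV_const DERIV_cmult[OF D]] DERIV_cmult[OF D]] DERIV_cmult[OF D]]]) simp
qed

lemma continuous_cutoff': "continuous_on S cutoff'"
  unfolding cutoff'_def[abs_def] by (intro continuous_intros)

lemma continuous_cutoff: "continuous_on S cutoff"
  unfolding cutoff_def[abs_def] by (intro continuous_intros)

lemma cutoff_eq_1: "s \<le> 1 \<Longrightarrow> cutoff s = 1"
  by (simp add: cutoff_def)

lemma cutoff_eq_0: "2 \<le> s \<Longrightarrow> cutoff s = 0"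
  by (simp add: cutoff_def power2_eq_square field_simps)

text \<open>The values actually lie in [0, 1]. The crude bound 4 follows term by term from the
  formula and recurs in later constants.\<close>

lemma cutoff_bound: "\<bar>cutoff s\<bar> \<le> 4"
proof -
  consider "s \<le> 1" | "1 \<le> s" "s \<le> 2" | "2 \<le> s" by linarith
  then show ?thesis
  proof cases
    case 2
    have "(max 0 (s - 1))\<^sup>2 \<le> 1" "(max 0 (s - 3/2))\<^sup>2 \<le> (1/2)\<^sup>2" "(max 0 (s - 2))\<^sup>2 = 0"
      using 2 by (intro power_mono power_le_one; simp add: max_def)+ (use 2 in simp)
    moreover have "0 \<le> (max 0 (s - 1))\<^sup>2" "0 \<le> (max 0 (s - 3/2))\<^sup>2" by auto
    moreover have "\<bar>1 - 2 * a + 4 * b - 2 * c\<bar> \<le> 4" if "0 \<le> a" "a \<le> 1" "0 \<le> b" "b \<le> (1/2)\<^sup>2" "c = 0" for a b c :: real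
      using that by (simp add: power2_eq_square)
    ultimately show ?thesis unfolding cutoff_def by blast
  qed (auto simp: cutoff_eq_1 cutoff_eq_0)
qed

lemma cutoff'_bound: "\<bar>cutoff' s\<bar> \<le> 2"
  unfolding cutoff'_def by (auto simp: max_def)

lemma cutoff'_eq_0: "s \<le> 1 \<or> 2 \<le> s \<Longrightarrow> cutoff' s = 0"
  unfolding cutoff'_def by (auto simp: max_def)

text \<open>The field is zero below the flat boundary. The condition \<open>div\<close> is phrased
  with C^1 functions so that spline cutoffs may be inserted.\<close>

locale flat_field =
  fixes u :: "(real ^ 'm) \<times> real \<Rightarrow> (real ^ 'm) \<times> real"
  assumes um: "u \<in> borel_measurable borel"
    and u2: "integrable lborel (\<lambda>p. (norm (u p))\<^sup>2)"
    and u0: "\<And>p. snd p \<le> 0 \<Longrightarrow> u p = 0"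
    and div: "\<And>\<psi> G S. has_gradient \<psi> G \<Longrightarrow> continuous_on UNIV G \<Longrightarrow> compact S \<Longrightarrow> S \<subseteq> {p. 0 < snd p} \<Longrightarrow>
       (\<And>p. p \<notin> S \<Longrightarrow> \<psi> p = 0) \<Longrightarrow> (\<integral>p. u p \<bullet> G p \<partial>lborel) = 0"
begin

lemma integrable_norm_u_mult:
  fixes f :: "(real ^ 'm) \<times> real \<Rightarrow> real"
  assumes "f \<in> borel_measurable borel" "\<And>p. \<bar>f p\<bar> \<le> B" "\<And>p. p \<notin> S \<Longrightarrow> f p = 0" "compact S"
  shows "integrable lborel (\<lambda>p. norm (u p) * f p)"
proof (rule Bochner_Integration.integrable_bound)
  have "integrable lborel (indicator S :: (real ^ 'm) \<times> real \<Rightarrow> real)"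
    using assms(4) emeasure_compact_finite[OF assms(4)] by (intro integrable_real_indicator) (auto simp: compact_imp_closed)
  then show "integrable lborel (\<lambda>p. B * (indicator S p + (norm (u p))\<^sup>2))"
    using u2 by (intro integrable_mult_right Bochner_Integration.integrable_add)
  show "(\<lambda>p. norm (u p) * f p) \<in> borel_measurable lborel" using um assms(1) by auto
  have B0: "0 \<le> B" using order.trans[OF abs_ge_zero assms(2)] .
  show "AE p in lborel. norm (norm (u p) * f p) \<le> norm (B * (indicator S p + (norm (u p))\<^sup>2))"
  proof (rule AE_I2)
    fix p
    show "norm (norm (u p) * f p) \<le> norm (B * (indicator S p + (norm (u p))\<^sup>2))"
    proof (cases "p \<in> S")
      case True
      have "norm (u p) \<le> 1 + (norm (u p))\<^sup>2" using power2_nonneg_ge_1_iff[of "norm (u p)"] self_le_power[of "norm (u p)" 2] zero_le_power2[of "norm (u p)"]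
        by (cases "norm (u p) \<le> 1") (smt (verit) zero_less_numeral)+
      then have "norm (u p) * \<bar>f p\<bar> \<le> (1 + (norm (u p))\<^sup>2) * B" using assms(2)[of p] by (intro mult_mono) auto
      then show ?thesis using True B0 by (simp add: abs_mult mult.commute)
    qed (use assms(3) in auto)
  qed
qed

lemma integrable_u_inner:
  fixes G :: "(real ^ 'm) \<times> real \<Rightarrow> (real ^ 'm) \<times> real"
  assumes "G \<in> borel_measurable borel" "\<And>p. norm (G p) \<le> B" "\<And>p. p \<notin> S \<Longrightarrow> G p = 0" "compact S"
  shows "integrable lborel (\<lambda>p. u p \<bullet> G p)"
  using integrable_norm_u_mult[of "\<lambda>p. norm (G p)" B S] assms um
  by (rule_tac Bochner_Integration.integrable_bound[of _ "\<lambda>p. norm (u p) * norm (G p)"])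
     (auto intro!: AE_I2 simp: Cauchy_Schwarz_ineq2)

text \<open>The dangerous term is \<psi> times the slope of the cutoff, of size 2/e, against the
  vertical component of \<open>u\<close>. Averaging over the centres y of cylinders turns it into an
  integral over the boundary: each cylinder contributes B e^(m+1), and the averaging divides by the
  volume of a ball of radius e. This explains the constant 2 B / \<omega>.\<close>

lemma flux_bound:
  fixes a :: "(real ^ 'm) \<times> real \<Rightarrow> real"
  assumes am: "a \<in> borel_measurable borel" and a0: "\<And>p. 0 \<le> a p" and t0: "0 < t0" and c: "0 \<le> c" and B: "0 \<le> B"
    and ua: "\<And>x t. 0 < t \<Longrightarrow> t < t0 \<Longrightarrow> \<bar>snd (u (x, t))\<bar> \<le> a (x, t) + c * t * norm (u (x, t))"
    and aB: "\<And>y e. 0 < e \<Longrightarrow> e < t0 \<Longrightarrow>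
       (\<integral>\<^sup>+p. indicator (ball 0 e) (fst p - y) * indicator {0<..<2 * e} (snd p) * ennreal (a p) \<partial>lborel) \<le> ennreal (B * e ^ Suc CARD('m))"
    and \<psi>: "has_gradient \<psi> G" "continuous_on UNIV G" "compact S" "\<And>p. p \<notin> S \<Longrightarrow> \<psi> p = 0"
  shows "\<bar>\<integral>p. u p \<bullet> G p \<partial>lborel\<bar> \<le> 2 * B / unit_ball_vol (real CARD('m)) * (\<integral>y. \<bar>\<psi> (y, 0)\<bar> \<partial>lborel)"
proof -
  define T where "T = (\<integral>p. u p \<bullet> G p \<partial>lborel)"
  define \<omega> where "\<omega> = unit_ball_vol (real CARD('m))"
  have \<omega>: "\<omega> > 0" by (simp add: \<omega>_def)
  have c\<psi>: "continuous_on UNIV \<psi>" by (rule has_gradient_continuous[OF \<psi>(1)])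
  have G0: "p \<notin> S \<Longrightarrow> G p = 0" for p
    using has_gradient_zero_outside[OF \<psi>(1) compact_imp_closed[OF \<psi>(3)] \<psi>(4)] by blast
  obtain BG where BG: "BG > 0" "\<And>p. norm (G p) \<le> BG"
    using continuous_compact_support_bounded[OF \<psi>(2,3) G0] by metis
  obtain B\<psi> where B\<psi>: "B\<psi> > 0" "\<And>p. norm (\<psi> p) \<le> B\<psi>"
    using continuous_compact_support_bounded[OF c\<psi> \<psi>(3,4)] by metis
  obtain R0 where R0: "S \<subseteq> ball 0 R0" using \<psi>(3) bounded_subset_ballD compact_imp_bounded by metis
  define R where "R = max R0 0"
  have R: "norm x < R" if "(x, t) \<in> S" for x t
    using R0 that norm_fst_le[of x t] by (force simp: R_def)
  have [measurable]: "\<psi> \<in> borel_measurable borel" "G \<in> borel_measurable borel" "u \<in> borel_measurable borel" "a \<in> borel_measurable borel"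
    using c\<psi> \<psi>(2) um am by (auto intro: borel_measurable_continuous_onI)
  have [measurable]: "(\<lambda>y. \<psi> (y, 0)) \<in> borel_measurable borel"
    by (intro borel_measurable_continuous_onI continuous_on_compose2[OF c\<psi>] continuous_intros) auto
  define ft :: "(real ^ 'm) \<times> real \<Rightarrow> real ^ 'm" where "ft = fst"
  define sn :: "(real ^ 'm) \<times> real \<Rightarrow> real" where "sn = snd"
  have [measurable]: "ft \<in> borel_measurable borel" "sn \<in> borel_measurable borel"
    by (auto simp: ft_def sn_def intro!: borel_measurable_continuous_onI continuous_intros)
  have ind_ball: "(\<lambda>x. indicator (ball 0 e) (f x) :: ennreal) \<in> borel_measurable M"
    if "f \<in> borel_measurable M" for e and f :: "'c \<Rightarrow> real ^ 'm" and M
    by (rule measurable_compose[OF that]) (intro borel_measurable_indicator, simp)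
  have [measurable]: "(\<lambda>p. indicator (ball 0 e) (ft p - y) :: ennreal) \<in> borel_measurable borel" for e y
    by (rule ind_ball) measurable
  have [measurable]: "(\<lambda>q. indicator (ball 0 e) (ft (fst q) - snd q) :: ennreal) \<in> borel_measurable (lborel \<Otimes>\<^sub>M lborel)" for e
    by (rule ind_ball) measurable
  have "(\<lambda>p. indicator {0<..<2 * e} (sn p) :: real) \<in> borel_measurable lborel"
    "(\<lambda>p. indicator {0<..<2 * e} (sn p) * ennreal (\<bar>\<psi> p\<bar> * a p)) \<in> borel_measurable lborel"
    "(\<lambda>p. indicator (ball 0 e) (ft p - y) * indicator {0<..<2 * e} (sn p) * ennreal (a p)) \<in> borel_measurable lborel" for e y
    by measurable
  note meas = this[unfolded ft_def sn_def]
  \<comment> \<open>\<open>F\<close> collects the terms without a factor 1/e. Its second summand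
    arises from c t |u| with t < 2e against the slope 2/e, which gives 4 c.\<close>
  define F where "F p = 4 * (norm (u p) * norm (G p)) + 4 * c * (norm (u p) * \<bar>\<psi> p\<bar>)" for p
  have F0: "0 \<le> F p" for p using c by (simp add: F_def)
  have iF: "integrable lborel F" unfolding F_def
    using BG B\<psi> G0 \<psi>(3,4) by (intro Bochner_Integration.integrable_add integrable_mult_right integrable_norm_u_mult) auto
  have [measurable]: "F \<in> borel_measurable borel" using iF by auto
  have int\<psi>: "integrable lborel (\<lambda>y. \<bar>\<psi> (y, 0)\<bar>)"
    by (rule integrable_bounded_compact_support[where S = "cball 0 R" and B = B\<psi>])
       (use B\<psi>(2) \<psi>(4) R emeasure_compact_finite[of "cball (0::real^'m) R"] in \<open>force simp: less_imp_le\<close>)+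
  have step: "\<bar>T\<bar> \<le> (\<integral>p. indicator {0<..<2 * e} (snd p) * F p \<partial>lborel)
       + 2 * B / \<omega> * ((\<integral>y. \<bar>\<psi> (y, 0)\<bar> \<partial>lborel) + \<eta> * measure lborel (ball (0 :: real ^ 'm) (R + 1)))"
    if e: "0 < e" "e < 1" "2 * e < t0" and \<eta>: "\<eta> > 0"
      and uc: "\<And>p q. norm (p - q) < 4 * e \<Longrightarrow> norm (\<psi> p - \<psi> q) < \<eta>" for e \<eta>
  proof -
    define \<theta> where "\<theta> p = cutoff ((1 / e) * snd p)" for p :: "(real ^ 'm) \<times> real"
    define \<theta>' where "\<theta>' p = cutoff' ((1 / e) * snd p)" for p :: "(real ^ 'm) \<times> real"
    have g\<theta>: "has_gradient \<theta> (\<lambda>p. \<theta>' p *\<^sub>R (0, 1 / e))"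
      unfolding \<theta>_def[abs_def] \<theta>'_def by (rule has_gradient_compose_real[OF DERIV_cutoff has_gradient_snd])
    have c\<theta>': "continuous_on UNIV \<theta>'" unfolding \<theta>'_def[abs_def]
      by (intro continuous_on_compose2[OF continuous_cutoff'[of UNIV]] continuous_intros) auto
    have c\<theta>: "continuous_on UNIV \<theta>" by (rule has_gradient_continuous[OF g\<theta>])
    have [measurable]: "\<theta> \<in> borel_measurable borel" "\<theta>' \<in> borel_measurable borel"
      using c\<theta> c\<theta>' by (auto intro: borel_measurable_continuous_onI)
    have \<theta>b: "\<bar>\<theta> p\<bar> \<le> 4" "\<bar>\<theta>' p\<bar> \<le> 2" for p by (simp_all add: \<theta>_def \<theta>'_def cutoff_bound cutoff'_bound)
    have \<theta>z: "\<theta> p = 0" "\<theta>' p = 0" if "2 * e \<le> snd p" for p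
      using that e by (auto simp: \<theta>_def \<theta>'_def field_simps intro!: cutoff_eq_0 cutoff'_eq_0)
    have \<theta>1: "\<theta> p = 1" if "snd p \<le> e" for p
      using that e by (auto simp: \<theta>_def field_simps intro!: cutoff_eq_1)
    define G1 where "G1 p = \<psi> p *\<^sub>R (\<theta>' p *\<^sub>R (0, 1 / e)) + \<theta> p *\<^sub>R G p" for p
    have g1: "has_gradient (\<lambda>p. \<psi> p * \<theta> p) G1"
      unfolding G1_def by (rule has_gradient_mult[OF \<psi>(1) g\<theta>])
    have gd: "has_gradient (\<lambda>p. \<psi> p - \<psi> p * \<theta> p) (\<lambda>p. G p - G1 p)"
      using \<psi>(1) g1 unfolding has_gradient_def inner_diff_left by (auto intro: has_derivative_diff)
    have cG1: "continuous_on UNIV G1" unfolding G1_def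
      by (intro continuous_intros c\<psi> c\<theta> c\<theta>' \<psi>(2))
    have G1b: "norm (G1 p) \<le> B\<psi> * (2 / e) + 4 * BG" for p
    proof -
      have "norm (G1 p) \<le> \<bar>\<psi> p\<bar> * (\<bar>\<theta>' p\<bar> * (1 / e)) + \<bar>\<theta> p\<bar> * norm (G p)"
        unfolding G1_def using e by (intro order.trans[OF norm_triangle_ineq]) (simp add: norm_Pair abs_mult)
      also have "\<dots> \<le> B\<psi> * (2 * (1 / e)) + 4 * BG"
        using B\<psi> BG \<theta>b e by (intro add_mono mult_mono) (auto simp: less_imp_le)
      finally show ?thesis by simp
    qed
    have i1: "integrable lborel (\<lambda>p. u p \<bullet> G p)"
      by (rule integrable_u_inner[OF _ BG(2) G0 \<psi>(3)]) auto
    have i2: "integrable lborel (\<lambda>p. u p \<bullet> G1 p)"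
      by (rule integrable_u_inner[OF _ G1b _ \<psi>(3)]) (use cG1 G0 \<psi>(4) in \<open>auto simp: G1_def zero_prod_def[symmetric] intro: borel_measurable_continuous_onI\<close>)
    \<comment> \<open>The function \<psi> (1 - \<theta>) vanishes up to height e, so the divergence
      condition applies to it and only \<psi> \<theta> contributes to the flux.\<close>
    have "compact (S \<inter> {p. e \<le> snd p})"
      using \<psi>(3) by (intro compact_Int_closed closed_Collect_le continuous_intros)
    then have "(\<integral>p. u p \<bullet> (G p - G1 p) \<partial>lborel) = 0"
      by (rule div[OF gd continuous_on_diff[OF \<psi>(2) cG1]]) (use e \<psi>(4) \<theta>1 in auto)
    then have T1: "T = (\<integral>p. u p \<bullet> G1 p \<partial>lborel)"
      using i1 i2 unfolding T_def by (simp add: inner_diff_right)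
    \<comment> \<open>\<open>b y\<close> dominates |\<psi>| on the whole cylinder of size e over y.
      The uniform continuity error \<eta> is charged only on a bounded ball, which keeps
      \<open>b\<close> integrable.\<close>
    define b where "b y = \<bar>\<psi> (y, 0)\<bar> + \<eta> * indicator (ball 0 (R + 1)) y" for y
    have b0: "0 \<le> b y" for y using \<eta> by (simp add: b_def)
    have ib: "integrable lborel b" unfolding b_def
      using int\<psi> by (intro Bochner_Integration.integrable_add integrable_mult_right integrable_real_indicator)
        (use emeasure_lborel_ball_finite[of "0 :: real ^ 'm" "R + 1"] in auto)
    have [measurable]: "b \<in> borel_measurable borel" using ib by auto
    have \<psi>b: "\<bar>\<psi> p\<bar> \<le> b y" if "fst p - y \<in> ball 0 e" "snd p \<in> {0<..<2 * e}" for p y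
    proof (cases "p \<in> S")
      case True
      have "norm (p - (y, 0)) \<le> norm (fst p - y) + norm (snd p)"
        using norm_Pair_le[of "fst p - y" "snd p"] by (simp add: minus_prod_def)
      then have "norm (p - (y, 0)) < 4 * e" using that e by auto
      from uc[OF this] have "\<bar>\<psi> p\<bar> \<le> \<bar>\<psi> (y, 0)\<bar> + \<eta>" unfolding real_norm_def by linarith
      moreover have "norm (fst p) < R" using R[of "fst p" "snd p"] True by simp
      then have "y \<in> ball 0 (R + 1)"
        using that(1) e norm_triangle_sub[of y "fst p"] by (simp add: norm_minus_commute)
      ultimately show ?thesis by (simp add: b_def)
    qed (use \<psi>(4) b0 in simp)
    \<comment> \<open>The factor \<omega> e^m is written as the integral over y of the indicator
      that y lies within e of the horizontal position; Tonelli then exchanges the point and the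
      centre.\<close>
    have "ennreal (\<omega> * e ^ CARD('m)) * (\<integral>\<^sup>+p. indicator {0<..<2 * e} (snd p) * ennreal (\<bar>\<psi> p\<bar> * a p) \<partial>lborel)
        \<le> ennreal (\<omega> * e ^ CARD('m)) * ennreal (B * e / \<omega> * integral\<^sup>L lborel b)"
    proof -
      have vol: "(\<integral>\<^sup>+y. indicator (ball 0 e) (x - y) \<partial>lborel) = ennreal (\<omega> * e ^ CARD('m))" for x :: "real ^ 'm"
      proof -
        have "(\<integral>\<^sup>+y. indicator (ball 0 e) (x - y) \<partial>lborel) = (\<integral>\<^sup>+y. indicator (ball x e) y \<partial>lborel)"
          by (intro nn_integral_cong) (auto simp: indicator_def dist_norm norm_minus_commute)
        also have "\<dots> = ennreal (\<omega> * e ^ CARD('m))" using e by (simp add: emeasure_ball \<omega>_def)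
        finally show ?thesis .
      qed
      have "ennreal (\<omega> * e ^ CARD('m)) * (\<integral>\<^sup>+p. indicator {0<..<2 * e} (snd p) * ennreal (\<bar>\<psi> p\<bar> * a p) \<partial>lborel)
        = (\<integral>\<^sup>+p. (\<integral>\<^sup>+y. indicator (ball 0 e) (fst p - y) * (indicator {0<..<2 * e} (snd p) * ennreal (\<bar>\<psi> p\<bar> * a p)) \<partial>lborel) \<partial>lborel)"
      proof (subst nn_integral_cmult[symmetric, OF meas(2)], intro nn_integral_cong)
        fix p :: "(real ^ 'm) \<times> real"
        have "(\<lambda>y. indicator (ball 0 e) (fst p - y) :: ennreal) \<in> borel_measurable lborel" by (rule ind_ball) measurable
        then show "ennreal (\<omega> * e ^ CARD('m)) * (indicator {0<..<2 * e} (snd p) * ennreal (\<bar>\<psi> p\<bar> * a p))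
          = (\<integral>\<^sup>+y. indicator (ball 0 e) (fst p - y) * (indicator {0<..<2 * e} (snd p) * ennreal (\<bar>\<psi> p\<bar> * a p)) \<partial>lborel)"
          by (subst nn_integral_multc) (simp_all only: vol)
      qed
      also have "\<dots> \<le> (\<integral>\<^sup>+p. (\<integral>\<^sup>+y. ennreal (b y) * (indicator (ball 0 e) (fst p - y) * indicator {0<..<2 * e} (snd p) * ennreal (a p)) \<partial>lborel) \<partial>lborel)"
      proof (intro nn_integral_mono)
        fix p :: "(real ^ 'm) \<times> real" and y :: "real ^ 'm"
        show "indicator (ball 0 e) (fst p - y) * (indicator {0<..<2 * e} (snd p) * ennreal (\<bar>\<psi> p\<bar> * a p))
          \<le> ennreal (b y) * (indicator (ball 0 e) (fst p - y) * indicator {0<..<2 * e} (snd p) * ennreal (a p))"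
          using \<psi>b[of p y] a0[of p] b0[of y]
          by (auto split: split_indicator simp: ennreal_mult[symmetric] intro!: ennreal_leI mult_right_mono)
      qed
      also have "\<dots> = (\<integral>\<^sup>+y. (\<integral>\<^sup>+p. ennreal (b y) * (indicator (ball 0 e) (fst p - y) * indicator {0<..<2 * e} (snd p) * ennreal (a p)) \<partial>lborel) \<partial>lborel)"
      proof (rule lborel_pair.Fubini'[symmetric])
        have "(\<lambda>q. ennreal (b (snd q)) * (indicator (ball 0 e) (ft (fst q) - snd q) * indicator {0<..<2 * e} (sn (fst q)) * ennreal (a (fst q)))) \<in> borel_measurable (lborel \<Otimes>\<^sub>M lborel)"
          by measurable
        then show "(\<lambda>(p, y). ennreal (b y) * (indicator (ball 0 e) (fst p - y) * indicator {0<..<2 * e} (snd p) * ennreal (a p))) \<in> borel_measurable (lborel \<Otimes>\<^sub>M lborel)"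
          by (simp add: ft_def sn_def case_prod_beta')
      qed
      also have "\<dots> = (\<integral>\<^sup>+y. ennreal (b y) * (\<integral>\<^sup>+p. indicator (ball 0 e) (fst p - y) * indicator {0<..<2 * e} (snd p) * ennreal (a p) \<partial>lborel) \<partial>lborel)"
        by (intro nn_integral_cong nn_integral_cmult meas)
      also have "\<dots> \<le> (\<integral>\<^sup>+y. ennreal (b y) * ennreal (B * e ^ Suc CARD('m)) \<partial>lborel)"
        using e by (intro nn_integral_mono mult_left_mono aB) auto
      also have "\<dots> = ennreal (integral\<^sup>L lborel b) * ennreal (B * e ^ Suc CARD('m))"
        using ib b0 by (simp add: nn_integral_multc nn_integral_eq_integral)
      also have "\<dots> = ennreal (\<omega> * e ^ CARD('m)) * ennreal (B * e / \<omega> * integral\<^sup>L lborel b)"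
        using \<omega> e B b0 by (simp add: ennreal_mult[symmetric] integral_nonneg_AE field_simps)
      finally show ?thesis .
    qed
    then have key': "(\<integral>\<^sup>+p. indicator {0<..<2 * e} (snd p) * ennreal (\<bar>\<psi> p\<bar> * a p) \<partial>lborel) \<le> ennreal (B * e / \<omega> * integral\<^sup>L lborel b)"
      by (subst (asm) ennreal_mult_le_mult_iff) (use \<omega> e in auto)
    \<comment> \<open>Outside the strip the pairing vanishes: above because of the cutoff, below
      because \<open>u\<close> is zero. Inside, only the vertical component of \<open>u\<close>
      meets the factor 1/e.\<close>
    have pt: "ennreal \<bar>u p \<bullet> G1 p\<bar> \<le> ennreal (indicator {0<..<2 * e} (snd p) * F p) + ennreal (2 / e) * (indicator {0<..<2 * e} (snd p) * ennreal (\<bar>\<psi> p\<bar> * a p))" for p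
    proof (cases "snd p \<in> {0<..<2 * e}")
      case True
      have "u p \<bullet> G1 p = \<theta> p * (u p \<bullet> G p) + \<psi> p * \<theta>' p / e * snd (u p)"
        by (simp add: G1_def inner_add_right inner_prod_def algebra_simps)
      also have "\<bar>\<dots>\<bar> \<le> \<bar>\<theta> p\<bar> * \<bar>u p \<bullet> G p\<bar> + (\<bar>\<psi> p\<bar> * \<bar>\<theta>' p\<bar> / e) * \<bar>snd (u p)\<bar>"
        using e by (intro order.trans[OF abs_triangle_ineq]) (simp add: abs_mult)
      also have "\<dots> \<le> 4 * (norm (u p) * norm (G p)) + (\<bar>\<psi> p\<bar> * 2 / e) * (a p + c * (2 * e) * norm (u p))"
      proof (intro add_mono mult_mono)
        have "\<bar>snd (u (fst p, snd p))\<bar> \<le> a (fst p, snd p) + c * snd p * norm (u (fst p, snd p))"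
          using True e by (intro ua) auto
        also have "\<dots> \<le> a p + c * (2 * e) * norm (u p)"
          using True c by (auto intro!: mult_right_mono mult_left_mono)
        finally show "\<bar>snd (u p)\<bar> \<le> a p + c * (2 * e) * norm (u p)" by simp
        show "\<bar>\<psi> p\<bar> * \<bar>\<theta>' p\<bar> / e \<le> \<bar>\<psi> p\<bar> * 2 / e"
          using \<theta>b(2)[of p] e by (intro divide_right_mono mult_left_mono) auto
      qed (use \<theta>b(1)[of p] e in \<open>auto simp: Cauchy_Schwarz_ineq2\<close>)
      also have "\<dots> = F p + 2 / e * (\<bar>\<psi> p\<bar> * a p)" using e by (simp add: F_def field_simps)
      finally have "ennreal \<bar>u p \<bullet> G1 p\<bar> \<le> ennreal (F p + 2 / e * (\<bar>\<psi> p\<bar> * a p))" by (rule ennreal_leI)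
      also have "ennreal (F p + 2 / e * (\<bar>\<psi> p\<bar> * a p)) = ennreal (F p) + ennreal (2 / e) * ennreal (\<bar>\<psi> p\<bar> * a p)"
        using F0[of p] a0[of p] e by (subst ennreal_plus, simp, simp, subst ennreal_mult, simp_all)
      finally show ?thesis
        using True by (simp only: indicator_simps mult_1)
    next
      case False
      then have "u p \<bullet> G1 p = 0" using \<theta>z[of p] u0[of p] by (auto simp: G1_def not_less zero_prod_def[symmetric])
      then show ?thesis by simp
    qed
    have iF': "integrable lborel (\<lambda>p. indicator {0<..<2 * e} (snd p) * F p)"
      using integrable_mult_bounded[OF iF meas(1)[of e], where c = 1] by (simp add: mult.commute)
    have "ennreal \<bar>T\<bar> \<le> (\<integral>\<^sup>+p. ennreal \<bar>u p \<bullet> G1 p\<bar> \<partial>lborel)"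
      unfolding T1 using integral_norm_bound_ennreal[OF i2] by simp
    also have "\<dots> \<le> (\<integral>\<^sup>+p. ennreal (indicator {0<..<2 * e} (snd p) * F p) + ennreal (2 / e) * (indicator {0<..<2 * e} (snd p) * ennreal (\<bar>\<psi> p\<bar> * a p)) \<partial>lborel)"
      by (intro nn_integral_mono pt)
    also have "\<dots> = (\<integral>\<^sup>+p. ennreal (indicator {0<..<2 * e} (snd p) * F p) \<partial>lborel) + ennreal (2 / e) * (\<integral>\<^sup>+p. indicator {0<..<2 * e} (snd p) * ennreal (\<bar>\<psi> p\<bar> * a p) \<partial>lborel)"
      using iF' meas(2) by (subst nn_integral_add) (auto simp: nn_integral_cmult)
    also have "\<dots> \<le> ennreal (\<integral>p. indicator {0<..<2 * e} (snd p) * F p \<partial>lborel) + ennreal (2 / e) * ennreal (B * e / \<omega> * integral\<^sup>L lborel b)"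
      using iF' F0 by (intro add_mono mult_left_mono key') (auto simp: nn_integral_eq_integral)
    also have "\<dots> = ennreal ((\<integral>p. indicator {0<..<2 * e} (snd p) * F p \<partial>lborel) + 2 * B / \<omega> * integral\<^sup>L lborel b)"
    proof -
      have "0 \<le> (\<integral>p. indicator {0<..<2 * e} (snd p) * F p \<partial>lborel)" "0 \<le> integral\<^sup>L lborel b"
        using F0 b0 by (auto intro!: integral_nonneg_AE)
      moreover have "2 / e * (B * e / \<omega> * integral\<^sup>L lborel b) = 2 * B / \<omega> * integral\<^sup>L lborel b" using e by simp
      ultimately show ?thesis using e B \<omega> by (simp add: ennreal_mult[symmetric] ennreal_plus[symmetric] del: ennreal_plus)
    qed
    finally have "\<bar>T\<bar> \<le> (\<integral>p. indicator {0<..<2 * e} (snd p) * F p \<partial>lborel) + 2 * B / \<omega> * integral\<^sup>L lborel b"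
      using F0 b0 B \<omega> by (subst (asm) ennreal_le_iff) (auto intro!: add_nonneg_nonneg integral_nonneg_AE mult_nonneg_nonneg)
    moreover have "integral\<^sup>L lborel b = (\<integral>y. \<bar>\<psi> (y, 0)\<bar> \<partial>lborel) + \<eta> * measure lborel (ball (0 :: real ^ 'm) (R + 1))"
      unfolding b_def using int\<psi>
      by (subst Bochner_Integration.integral_add)
        (use emeasure_lborel_ball_finite[of "0 :: real ^ 'm" "R + 1"] in \<open>auto intro!: integrable_real_indicator\<close>)
    ultimately show ?thesis by simp
  qed
  \<comment> \<open>The strips shrink to the empty set while \<open>F\<close> is integrable, so the
    harmless terms disappear in the limit.\<close>
  have lim: "(\<lambda>n. \<integral>p. indicator {0<..<2 * (1 / real (Suc n))} (snd p) * F p \<partial>lborel) \<longlonglongrightarrow> (\<integral>p. 0 \<partial>(lborel :: ((real ^ 'm) \<times> real) measure))"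
  proof (rule integral_dominated_convergence[where w = F])
    show "AE p in lborel. (\<lambda>n. indicator {0<..<2 * (1 / real (Suc n))} (snd p) * F p) \<longlonglongrightarrow> 0"
    proof (rule AE_I2)
      fix p :: "(real ^ 'm) \<times> real"
      show "(\<lambda>n. indicator {0<..<2 * (1 / real (Suc n))} (snd p) * F p) \<longlonglongrightarrow> 0"
      proof (cases "snd p > 0")
        case True
        have "(\<lambda>n. 2 * (1 / real (Suc n))) \<longlonglongrightarrow> 2 * 0"
          by (intro tendsto_intros LIMSEQ_inverse_real_of_nat[unfolded inverse_eq_divide])
        then have "eventually (\<lambda>n. 2 * (1 / real (Suc n)) < snd p) sequentially" using True by (auto intro: order_tendstoD(2))
        then have "eventually (\<lambda>n. indicator {0<..<2 * (1 / real (Suc n))} (snd p) * F p = 0) sequentially"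
          by eventually_elim auto
        then show ?thesis by (rule tendsto_eventually)
      qed auto
    qed
    show "AE p in lborel. norm (indicator {0<..<2 * (1 / real (Suc n))} (snd p) * F p) \<le> F p" for n
      using F0 by (intro AE_I2) (auto split: split_indicator)
    show "(\<lambda>p. indicator {0<..<2 * (1 / real (Suc n))} (snd p) * F p) \<in> borel_measurable lborel" for n
      by (rule borel_measurable_times[OF meas(1) borel_measurable_integrable[OF iF]])
  qed (use iF in auto)
  have "\<bar>T\<bar> \<le> 2 * B / \<omega> * ((\<integral>y. \<bar>\<psi> (y, 0)\<bar> \<partial>lborel) + \<eta> * measure lborel (ball (0 :: real ^ 'm) (R + 1)))" if \<eta>: "\<eta> > 0" for \<eta>
  proof (rule tendsto_lowerbound)
    obtain d where d: "d > 0" "\<And>p q. norm (p - q) < d \<Longrightarrow> norm (\<psi> p - \<psi> q) < \<eta>"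
      using uniformly_continuous_compact_support[OF c\<psi> \<psi>(3,4) \<eta>] by metis
    have "(\<lambda>n. (\<integral>p. indicator {0<..<2 * (1 / real (Suc n))} (snd p) * F p \<partial>lborel)
      + 2 * B / \<omega> * ((\<integral>y. \<bar>\<psi> (y, 0)\<bar> \<partial>lborel) + \<eta> * measure lborel (ball (0 :: real ^ 'm) (R + 1)))) \<longlonglongrightarrow>
      0 + 2 * B / \<omega> * ((\<integral>y. \<bar>\<psi> (y, 0)\<bar> \<partial>lborel) + \<eta> * measure lborel (ball (0 :: real ^ 'm) (R + 1)))"
      using lim by (intro tendsto_add tendsto_const) simp
    then show "(\<lambda>n. (\<integral>p. indicator {0<..<2 * (1 / real (Suc n))} (snd p) * F p \<partial>lborel)
      + 2 * B / \<omega> * ((\<integral>y. \<bar>\<psi> (y, 0)\<bar> \<partial>lborel) + \<eta> * measure lborel (ball (0 :: real ^ 'm) (R + 1)))) \<longlonglongrightarrow>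
      2 * B / \<omega> * ((\<integral>y. \<bar>\<psi> (y, 0)\<bar> \<partial>lborel) + \<eta> * measure lborel (ball (0 :: real ^ 'm) (R + 1)))" by simp
    define d' where "d' = min (d / 4) (min 1 (t0 / 2))"
    have "d' > 0" using d t0 by (simp add: d'_def)
    then have "eventually (\<lambda>n. 1 / real (Suc n) < d') sequentially"
      using order_tendstoD(2)[OF LIMSEQ_inverse_real_of_nat] by (auto simp: inverse_eq_divide)
    then show "\<forall>\<^sub>F n in sequentially. \<bar>T\<bar> \<le> (\<integral>p. indicator {0<..<2 * (1 / real (Suc n))} (snd p) * F p \<partial>lborel)
      + 2 * B / \<omega> * ((\<integral>y. \<bar>\<psi> (y, 0)\<bar> \<partial>lborel) + \<eta> * measure lborel (ball (0 :: real ^ 'm) (R + 1)))"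
    proof eventually_elim
      case (elim n)
      then have n: "1 / real (Suc n) < d / 4" "1 / real (Suc n) < 1" "1 / real (Suc n) < t0 / 2"
        unfolding d'_def by linarith+
      show ?case
      proof (rule step[OF _ n(2) _ \<eta>])
        show "norm (\<psi> p - \<psi> q) < \<eta>" if "norm (p - q) < 4 * (1 / real (Suc n))" for p q
          using n(1) that by (intro d(2)) linarith
        show "2 * (1 / real (Suc n)) < t0" using n(3) by linarith
      qed simp
    qed
  qed simp
  note bound = this
  \<comment> \<open>It remains to let the continuity error \<eta> tend to zero.\<close>
  have "(\<lambda>n. 2 * B / \<omega> * ((\<integral>y. \<bar>\<psi> (y, 0)\<bar> \<partial>lborel) + (1 / real (Suc n)) * measure lborel (ball (0 :: real ^ 'm) (R + 1))))
    \<longlonglongrightarrow> 2 * B / \<omega> * ((\<integral>y. \<bar>\<psi> (y, 0)\<bar> \<partial>lborel) + 0 * measure lborel (ball (0 :: real ^ 'm) (R + 1)))"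
    by (intro tendsto_mult tendsto_add tendsto_const LIMSEQ_inverse_real_of_nat[unfolded inverse_eq_divide])
  then have "\<bar>T\<bar> \<le> 2 * B / \<omega> * ((\<integral>y. \<bar>\<psi> (y, 0)\<bar> \<partial>lborel) + 0 * measure lborel (ball (0 :: real ^ 'm) (R + 1)))"
    by (rule tendsto_lowerbound) (intro always_eventually allI bound, simp_all)
  then show ?thesis by (simp add: T_def \<omega>_def)
qed

end

subsection \<open>Extension by averaging\<close>

lemma ennreal_power2_le_imp_le:
  fixes a :: ennreal
  assumes "a\<^sup>2 \<le> (ennreal c)\<^sup>2" "0 \<le> c"
  shows "a \<le> ennreal c"
proof (cases a)
  case (real r)
  then show ?thesis using assms power2_le_imp_le[of r c] by (auto simp: ennreal_power intro: ennreal_leI)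
next
  case top
  then show ?thesis using assms by (simp add: ennreal_power top_unique)
qed

text \<open>The bound on \<open>v\<close> is stated for the nonnegative integral, so that
  integrability of the inner product is part of the conclusion.\<close>

lemma inner_integral_Cauchy_Schwarz:
  fixes u v :: "'a \<Rightarrow> 'b::euclidean_space"
  assumes [measurable]: "u \<in> borel_measurable M" "v \<in> borel_measurable M"
    and u: "integrable M (\<lambda>x. (norm (u x))\<^sup>2)" and v: "(\<integral>\<^sup>+x. ennreal ((norm (v x))\<^sup>2) \<partial>M) \<le> ennreal Q" and Q: "0 \<le> Q"
  shows "integrable M (\<lambda>x. u x \<bullet> v x)" "\<bar>\<integral>x. u x \<bullet> v x \<partial>M\<bar> \<le> sqrt (\<integral>x. (norm (u x))\<^sup>2 \<partial>M) * sqrt Q"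
proof -
  let ?A = "\<integral>x. (norm (u x))\<^sup>2 \<partial>M"
  have A0: "0 \<le> ?A" by (intro integral_nonneg_AE) auto
  have "(\<integral>\<^sup>+x. ennreal (norm (u x)) * ennreal (norm (v x)) \<partial>M)\<^sup>2 \<le> (\<integral>\<^sup>+x. (ennreal (norm (u x)))\<^sup>2 \<partial>M) * (\<integral>\<^sup>+x. (ennreal (norm (v x)))\<^sup>2 \<partial>M)"
    by (rule Cauchy_Schwarz_nn_integral) measurable
  also have "\<dots> = ennreal ?A * (\<integral>\<^sup>+x. ennreal ((norm (v x))\<^sup>2) \<partial>M)"
    using u by (simp add: ennreal_power nn_integral_eq_integral)
  also have "\<dots> \<le> ennreal ?A * ennreal Q" by (intro mult_left_mono v) simp
  also have "\<dots> = (ennreal (sqrt ?A * sqrt Q))\<^sup>2"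
    using A0 Q by (simp add: ennreal_power ennreal_mult[symmetric] power_mult_distrib)
  finally have "(\<integral>\<^sup>+x. ennreal (norm (u x)) * ennreal (norm (v x)) \<partial>M) \<le> ennreal (sqrt ?A * sqrt Q)"
    using A0 Q by (rule_tac ennreal_power2_le_imp_le) simp_all
  then have le: "(\<integral>\<^sup>+x. ennreal (norm (u x \<bullet> v x)) \<partial>M) \<le> ennreal (sqrt ?A * sqrt Q)"
    by (rule order.trans[rotated])
      (intro nn_integral_mono, auto simp: ennreal_mult[symmetric] Cauchy_Schwarz_ineq2 intro!: ennreal_leI)
  show i: "integrable M (\<lambda>x. u x \<bullet> v x)"
    by (rule integrableI_bounded) (use le in \<open>auto intro: le_less_trans\<close>)
  show "\<bar>\<integral>x. u x \<bullet> v x \<partial>M\<bar> \<le> sqrt ?A * sqrt Q"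
    using order.trans[OF integral_norm_bound_ennreal[OF i] le] A0 Q by (subst (asm) ennreal_le_iff) auto
qed

text \<open>The radius 1/2 leaves a margin: both \<rho> and its gradient vanish wherever the norm is
  at least 1.\<close>

locale averaging_kernel =
  fixes \<rho> :: "real ^ 'm \<Rightarrow> real" and B0 B1 :: real
  assumes \<rho>: "\<rho> \<in> test_functions UNIV" "\<And>x. 0 \<le> \<rho> x" "\<And>x. 1/2 \<le> norm x \<Longrightarrow> \<rho> x = 0"
    "integrable lborel \<rho>" "integral\<^sup>L lborel \<rho> = 1"
    and B0: "\<And>x. \<rho> x \<le> B0" and B1: "\<And>x. norm (grad \<rho> x) \<le> B1"
begin

definition kern :: "(real ^ 'm) \<times> real \<Rightarrow> real ^ 'm \<Rightarrow> real" where
  "kern p y = (if snd p > 0 then inverse (snd p) ^ CARD('m) * \<rho> (inverse (snd p) *\<^sub>R (y - fst p)) else 0)"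

text \<open>The gradient of \<open>kern\<close> in both the centre and the scale t. The scale acts
  on the factor t^-m as well as on the argument z, which produces the terms m \<rho> and the product
  of z with the gradient of \<rho>.\<close>

definition gkern :: "(real ^ 'm) \<times> real \<Rightarrow> real ^ 'm \<Rightarrow> (real ^ 'm) \<times> real" where
  "gkern p y = (let s = inverse (snd p); z = s *\<^sub>R (y - fst p) in
     s ^ Suc CARD('m) *\<^sub>R (- grad \<rho> z, - (grad \<rho> z \<bullet> z + real CARD('m) * \<rho> z)))"

text \<open>For |z| at most 1 the horizontal part of \<open>gkern\<close> contributes
  \<open>B1\<close> and the vertical part \<open>B1\<close> + m \<open>B0\<close>, up to the power
  of the scale.\<close>

definition C1 :: real where "C1 = 2 * B1 + real CARD('m) * B0"

lemma B_nonneg: "0 \<le> B0" "0 \<le> B1" "0 \<le> C1"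
  using order.trans[OF \<rho>(2) B0] order.trans[OF norm_ge_zero B1] by (auto simp: C1_def)

lemma grad_\<rho>_zero: "1 \<le> norm x \<Longrightarrow> grad \<rho> x = 0"
  by (rule has_gradient_zero_outside[OF has_gradient_test[OF \<rho>(1)], of "cball 0 (1/2)"]) (auto intro: \<rho>(3))

lemma continuous_\<rho>: "continuous_on UNIV \<rho>" "continuous_on UNIV (grad \<rho>)"
  using test_functionsD(6)[OF \<rho>(1)] continuous_on_grad_test[OF \<rho>(1)] .

lemma measurable_\<rho> [measurable]: "\<rho> \<in> borel_measurable borel" "grad \<rho> \<in> borel_measurable borel"
  using continuous_\<rho> by (auto intro: borel_measurable_continuous_onI)

lemma measurable_kern [measurable]: "kern p \<in> borel_measurable borel" "gkern p \<in> borel_measurable borel"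
  unfolding kern_def[abs_def] gkern_def[abs_def] Let_def by measurable

lemma norm_rescaled: "0 < snd p \<Longrightarrow> norm (inverse (snd p) *\<^sub>R (y - fst p)) = norm (y - fst p) / snd p"
  by (simp only: norm_scaleR) (simp add: divide_inverse mult.commute)

lemma kern_zero: "snd p \<le> norm (y - fst p) \<Longrightarrow> kern p y = 0"
  and kern_bounds: "0 \<le> kern p y" "0 < snd p \<Longrightarrow> kern p y \<le> B0 * inverse (snd p) ^ CARD('m)"
proof -
  show "kern p y = 0" if le: "snd p \<le> norm (y - fst p)"
  proof (cases "0 < snd p")
    case True
    then have "1/2 \<le> norm (inverse (snd p) *\<^sub>R (y - fst p))"
      unfolding norm_rescaled[OF True] using le by (simp add: le_divide_eq)
    then show ?thesis by (simp only: kern_def \<rho>(3)) simp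
  qed (simp add: kern_def)
  show "0 \<le> kern p y" using \<rho>(2) by (auto simp: kern_def)
  show "kern p y \<le> B0 * inverse (snd p) ^ CARD('m)" if "0 < snd p"
    using that B0 by (auto simp: kern_def mult.commute intro!: mult_left_mono)
qed

lemma gkern_zero: "0 < snd p \<Longrightarrow> snd p \<le> norm (y - fst p) \<Longrightarrow> gkern p y = 0"
proof -
  assume "0 < snd p" "snd p \<le> norm (y - fst p)"
  then have "1 \<le> norm (inverse (snd p) *\<^sub>R (y - fst p))" using norm_rescaled[of p y] by simp
  then show ?thesis using grad_\<rho>_zero \<rho>(3)[of "inverse (snd p) *\<^sub>R (y - fst p)"]
    by (simp add: gkern_def Let_def zero_prod_def[symmetric])
qed

lemma norm_gkern: 
  assumes "0 < snd p"
  shows "norm (gkern p y) \<le> C1 * inverse (snd p) ^ Suc CARD('m)"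
proof (cases "snd p \<le> norm (y - fst p)")
  case True
  then show ?thesis using gkern_zero[OF assms True] B_nonneg assms by simp
next
  case False
  define z where "z = inverse (snd p) *\<^sub>R (y - fst p)"
  have z: "norm z \<le> 1" using False assms unfolding z_def norm_rescaled[OF assms] by simp
  have "norm (- grad \<rho> z, - (grad \<rho> z \<bullet> z + real CARD('m) * \<rho> z)) \<le> norm (grad \<rho> z) + \<bar>grad \<rho> z \<bullet> z + real CARD('m) * \<rho> z\<bar>"
    using norm_Pair_le[of "- grad \<rho> z" "- (grad \<rho> z \<bullet> z + real CARD('m) * \<rho> z)"] by simp
  also have "\<bar>grad \<rho> z \<bullet> z + real CARD('m) * \<rho> z\<bar> \<le> \<bar>grad \<rho> z \<bullet> z\<bar> + \<bar>real CARD('m) * \<rho> z\<bar>" by (rule abs_triangle_ineq)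
  also have "\<bar>grad \<rho> z \<bullet> z\<bar> \<le> B1 * 1"
    using B1[of z] z B_nonneg by (intro order.trans[OF Cauchy_Schwarz_ineq2] mult_mono) auto
  also have "\<bar>real CARD('m) * \<rho> z\<bar> \<le> real CARD('m) * B0" using B0[of z] \<rho>(2)[of z] by (simp add: abs_mult mult_left_mono)
  finally have "norm (- grad \<rho> z, - (grad \<rho> z \<bullet> z + real CARD('m) * \<rho> z)) \<le> C1" using B1[of z] by (simp add: C1_def)
  then have "inverse (snd p) ^ Suc CARD('m) * norm (- grad \<rho> z, - (grad \<rho> z \<bullet> z + real CARD('m) * \<rho> z)) \<le> inverse (snd p) ^ Suc CARD('m) * C1"
    using assms by (intro mult_left_mono) auto
  moreover have "gkern p y = inverse (snd p) ^ Suc CARD('m) *\<^sub>R (- grad \<rho> z, - (grad \<rho> z \<bullet> z + real CARD('m) * \<rho> z))"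
    by (simp add: gkern_def Let_def z_def)
  ultimately show ?thesis using assms by (simp only: norm_scaleR) (simp add: mult.commute)
qed

lemma integral_kern: 
  assumes "0 < snd p"
  shows "integrable lborel (kern p)" "integral\<^sup>L lborel (kern p) = 1"
proof -
  let ?t = "snd p"
  have eq: "lborel = density (distr lborel borel (\<lambda>z. fst p + ?t *\<^sub>R z)) (\<lambda>_. ennreal (\<bar>?t\<bar> ^ CARD('m)))"
    using lborel_affine[of ?t "fst p"] assms by simp
  have k: "kern p (fst p + ?t *\<^sub>R z) = inverse ?t ^ CARD('m) * \<rho> z" for z
    using assms by (simp add: kern_def)
  have i: "integrable lborel (\<lambda>z. ?t ^ CARD('m) * (inverse ?t ^ CARD('m) * \<rho> z))" using \<rho>(4) by simp
  show "integrable lborel (kern p)"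
    by (subst eq, subst integrable_density) (use i assms in \<open>auto simp: integrable_distr_eq k\<close>)
  have "integral\<^sup>L lborel (kern p) = (\<integral>z. ?t ^ CARD('m) * (inverse ?t ^ CARD('m) * \<rho> z) \<partial>lborel)"
    by (subst eq, subst integral_density) (use assms in \<open>auto simp: integral_distr k\<close>)
  also have "\<dots> = 1" using assms \<rho>(5) by (simp add: power_mult_distrib[symmetric] mult.assoc[symmetric])
  finally show "integral\<^sup>L lborel (kern p) = 1" .
qed

lemma kern_has_derivative:
  assumes t: "0 < snd p"
  shows "((\<lambda>p. kern p y) has_derivative (\<lambda>v. gkern p y \<bullet> v)) (at p)"
proof -
  define s where "s = inverse (snd p)"
  define z where "z = s *\<^sub>R (y - fst p)"
  have s: "s > 0" using t by (simp add: s_def)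
  have Ds: "((\<lambda>p. inverse (snd p)) has_derivative (\<lambda>v. - (s * snd v * s))) (at p)"
    using t unfolding s_def by (auto intro!: derivative_eq_intros)
  have Dsm: "((\<lambda>p. inverse (snd p) ^ CARD('m)) has_derivative (\<lambda>v. real CARD('m) * (- (s * snd v * s)) * s ^ (CARD('m) - 1))) (at p)"
    using has_derivative_power[OF Ds, of "CARD('m)"] by (simp add: s_def)
  have Dz: "((\<lambda>p. inverse (snd p) *\<^sub>R (y - fst p)) has_derivative (\<lambda>v. s *\<^sub>R (- fst v) + (- (s * snd v * s)) *\<^sub>R (y - fst p))) (at p)"
  proof -
    have "((\<lambda>p. y - fst p) has_derivative (\<lambda>v. - fst v)) (at p)" by (auto intro!: derivative_eq_intros)
    from has_derivative_scaleR[OF Ds this] show ?thesis by (simp add: s_def)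
  qed
  have Dr: "((\<lambda>p. \<rho> (inverse (snd p) *\<^sub>R (y - fst p))) has_derivative
       (\<lambda>v. grad \<rho> z \<bullet> (s *\<^sub>R (- fst v) + (- (s * snd v * s)) *\<^sub>R (y - fst p)))) (at p)"
    using has_derivative_compose[OF Dz test_functionsD(5)[OF \<rho>(1)]] by (simp add: z_def s_def)
  have "((\<lambda>p. inverse (snd p) ^ CARD('m) * \<rho> (inverse (snd p) *\<^sub>R (y - fst p))) has_derivative
    (\<lambda>v. s ^ CARD('m) * (grad \<rho> z \<bullet> (s *\<^sub>R (- fst v) + (- (s * snd v * s)) *\<^sub>R (y - fst p)))
       + real CARD('m) * (- (s * snd v * s)) * s ^ (CARD('m) - 1) * \<rho> z)) (at p)"
    using has_derivative_mult[OF Dsm Dr] by (simp add: s_def z_def)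
  moreover have "s ^ CARD('m) * (grad \<rho> z \<bullet> (s *\<^sub>R (- fst v) + (- (s * snd v * s)) *\<^sub>R (y - fst p)))
       + real CARD('m) * (- (s * snd v * s)) * s ^ (CARD('m) - 1) * \<rho> z = gkern p y \<bullet> v" for v
  proof -
    have sm: "s ^ CARD('m) = s * s ^ (CARD('m) - 1)" by (cases "CARD('m)") auto
    have gz: "grad \<rho> z \<bullet> z = s * (grad \<rho> z \<bullet> (y - fst p))" by (simp add: z_def)
    have "gkern p y \<bullet> v = s ^ Suc CARD('m) * (- (grad \<rho> z \<bullet> fst v) - (grad \<rho> z \<bullet> z + real CARD('m) * \<rho> z) * snd v)"
      unfolding gkern_def Let_def s_def[symmetric] z_def[symmetric] inner_scaleR_left
      by (simp add: inner_prod_def left_diff_distrib minus_mult_left[symmetric] distrib_right)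
    also have "\<dots> = s ^ CARD('m) * (grad \<rho> z \<bullet> (s *\<^sub>R (- fst v) + (- (s * snd v * s)) *\<^sub>R (y - fst p)))
       + real CARD('m) * (- (s * snd v * s)) * s ^ (CARD('m) - 1) * \<rho> z"
      unfolding gz power_Suc sm by (simp add: inner_add_right algebra_simps)
    finally show ?thesis ..
  qed
  ultimately have "((\<lambda>p. inverse (snd p) ^ CARD('m) * \<rho> (inverse (snd p) *\<^sub>R (y - fst p))) has_derivative (\<lambda>v. gkern p y \<bullet> v)) (at p)"
    by simp
  then show ?thesis
  proof (rule has_derivative_transform_within_open)
    show "open {p :: (real ^ 'm) \<times> real. 0 < snd p}" by (intro open_Collect_less continuous_intros)
  qed (use t in \<open>auto simp: kern_def\<close>)
qed

lemma near_height:
  assumes "dist p q < snd p / 2"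
  shows "snd p / 2 < snd q" "snd q < 2 * snd p" "norm (fst p - fst q) < snd p / 2"
  using assms dist_snd_le[of p q] dist_fst_le[of p q] by (auto simp: dist_real_def dist_norm)

text \<open>Within distance t/2 of a point at height t all heights lie between t/2 and 2t. Hence one
  bounded function with support in a ball of radius 3t dominates all nearby kernels; this majorant
  serves both differentiation and continuity.\<close>

lemma gkern_near:
  assumes "0 < snd p" "dist p q < snd p / 2"
  shows "norm (gkern q y) \<le> C1 * (2 / snd p) ^ Suc CARD('m) * indicator (cball (fst p) (3 * snd p)) y"
proof (cases "y \<in> cball (fst p) (3 * snd p)")
  case True
  note n = near_height[OF assms(2)]
  have "norm (gkern q y) \<le> C1 * inverse (snd q) ^ Suc CARD('m)" using n assms by (intro norm_gkern) auto
  also have "\<dots> \<le> C1 * (2 / snd p) ^ Suc CARD('m)"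
    using n assms B_nonneg by (intro mult_left_mono power_mono) (auto simp: field_simps)
  finally show ?thesis using True by simp
next
  case False
  note n = near_height[OF assms(2)]
  have "3 * snd p < norm (y - fst p)" using False by (simp add: dist_norm norm_minus_commute)
  also have "\<dots> \<le> norm (y - fst q) + norm (fst p - fst q)"
    using norm_triangle_ineq[of "y - fst q" "fst q - fst p"] by (simp add: norm_minus_commute)
  finally have "snd q \<le> norm (y - fst q)" using n assms(1) by linarith
  then have "gkern q y = 0" using n assms by (intro gkern_zero) auto
  then show ?thesis using B_nonneg assms(1) by simp
qed

lemma kern_lipschitz:
  assumes "0 < snd p" "dist p q < snd p / 2"
  shows "\<bar>kern q y - kern p y\<bar> \<le> C1 * (2 / snd p) ^ Suc CARD('m) * indicator (cball (fst p) (3 * snd p)) y * norm (q - p)"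
proof -
  let ?b = "C1 * (2 / snd p) ^ Suc CARD('m) * indicator (cball (fst p) (3 * snd p)) y"
  have "norm (kern q y - kern p y) \<le> ?b * norm (q - p)"
  proof (rule differentiable_bound[of "ball p (snd p / 2)" "\<lambda>p. kern p y" "\<lambda>p v. gkern p y \<bullet> v"])
    fix r assume r: "r \<in> ball p (snd p / 2)"
    then have d: "dist p r < snd p / 2" by simp
    have "0 < snd r" using near_height(1)[OF d] assms(1) by simp
    then show "((\<lambda>p. kern p y) has_derivative (\<bullet>) (gkern r y)) (at r within ball p (snd p / 2))"
      using kern_has_derivative[of r y] by (simp add: has_derivative_at_withinI)
    show "onorm (\<lambda>v. gkern r y \<bullet> v) \<le> ?b"
      using gkern_near[OF assms(1) d, of y] order.trans[OF norm_ge_zero gkern_near[OF assms(1) d, of y]]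
      by (intro onorm_bound) (simp, use Cauchy_Schwarz_ineq2[of "gkern r y"] mult_right_mono[OF gkern_near[OF assms(1) d, of y] norm_ge_zero] in \<open>simp only: real_norm_def, blast intro: order.trans\<close>)
  qed (use assms in auto)
  then show ?thesis by simp
qed

end

section \<open>The extension of a boundary function, its gradient and its energy\<close>

locale averaging_extension = averaging_kernel \<rho> B0 B1 for \<rho> :: "real ^ 'm \<Rightarrow> real" and B0 B1 +
  fixes f :: "real ^ 'm \<Rightarrow> real"
  assumes fm [measurable]: "f \<in> borel_measurable borel"
    and loc: "\<And>a r. integrable lborel (\<lambda>y. indicator (cball a r) y * f y)"
begin

definition ext :: "(real ^ 'm) \<times> real \<Rightarrow> real" where
  "ext p = (\<integral>y. f y * kern p y \<partial>lborel)"

definition gext :: "(real ^ 'm) \<times> real \<Rightarrow> (real ^ 'm) \<times> real" where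
  "gext p = (\<integral>y. f y *\<^sub>R gkern p y \<partial>lborel)"

lemma loc': "integrable lborel (\<lambda>y. indicator (cball a r) y * (f y - c))"
proof -
  have "integrable lborel (\<lambda>y. indicator (cball a r) y * f y - c * indicator (cball a r) y)"
    using emeasure_lborel_cball_finite[of a r]
    by (intro Bochner_Integration.integrable_diff loc integrable_mult_right integrable_real_indicator) auto
  then show ?thesis by (simp add: algebra_simps)
qed

lemma integrable_diff_kern: "integrable lborel (\<lambda>y. (f y - c) * kern p y)"
proof (cases "0 < snd p")
  case True
  have "integrable lborel (\<lambda>y. (indicator (cball (fst p) (snd p)) y * (f y - c)) * kern p y)"
    using kern_bounds True by (intro integrable_mult_bounded[OF loc', of _ "B0 * inverse (snd p) ^ CARD('m)"]) auto
  moreover have "(indicator (cball (fst p) (snd p)) y * (f y - c)) * kern p y = (f y - c) * kern p y" for y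
    using kern_zero[of p y] by (auto simp: indicator_def dist_norm norm_minus_commute)
  ultimately show ?thesis by simp
qed (simp add: kern_def)

lemma ext_minus_const: "0 < snd p \<Longrightarrow> ext p - c = (\<integral>y. (f y - c) * kern p y \<partial>lborel)"
  using integrable_diff_kern[of 0 p] integral_kern[of p] by (simp add: ext_def left_diff_distrib)

lemma integrable_scaleR_gkern:
  assumes "0 < snd p"
  shows "integrable lborel (\<lambda>y. (f y - c) *\<^sub>R gkern p y)"
proof (rule Bochner_Integration.integrable_bound)
  show "integrable lborel (\<lambda>y. (C1 * inverse (snd p) ^ Suc CARD('m)) * (indicator (cball (fst p) (snd p)) y * (f y - c)))"
    using loc' by (rule integrable_mult_right)
  show "AE y in lborel. norm ((f y - c) *\<^sub>R gkern p y) \<le> norm ((C1 * inverse (snd p) ^ Suc CARD('m)) * (indicator (cball (fst p) (snd p)) y * (f y - c)))"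
  proof (rule AE_I2)
    fix y
    show "norm ((f y - c) *\<^sub>R gkern p y) \<le> norm ((C1 * inverse (snd p) ^ Suc CARD('m)) * (indicator (cball (fst p) (snd p)) y * (f y - c)))"
    proof (cases "snd p \<le> norm (y - fst p)")
      case True
      then show ?thesis using gkern_zero[OF assms True] by simp
    next
      case False
      then have "y \<in> cball (fst p) (snd p)" by (simp add: dist_norm norm_minus_commute)
      then show ?thesis using mult_left_mono[OF norm_gkern[OF assms, of y], of "\<bar>f y - c\<bar>"] B_nonneg assms
        by (simp add: abs_mult mult_ac)
    qed
  qed
qed measurable

text \<open>The kernel has mass one at every scale, so subtracting a constant from \<open>f\<close>
  does not change the derivative. With c = f x the gradient becomes an average of differences f y -
  f x, which the energy controls.\<close>

lemma ext_has_derivative_shifted: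
  assumes t: "0 < snd p"
  shows "(ext has_derivative (\<lambda>v. (\<integral>y. (f y - c) *\<^sub>R gkern p y \<partial>lborel) \<bullet> v)) (at p)"
proof -
  let ?b = "\<lambda>y. \<bar>indicator (cball (fst p) (3 * snd p)) y * (f y - c)\<bar> * (C1 * (2 / snd p) ^ Suc CARD('m))"
  have "((\<lambda>q. \<integral>y. (f y - c) * kern q y \<partial>lborel) has_derivative (\<lambda>v. \<integral>y. (f y - c) * (gkern p y \<bullet> v) \<partial>lborel)) (at p)"
  proof (rule has_derivative_integral(3)[where e = "snd p / 2" and B = ?b])
    show "((\<lambda>q. (f y - c) * kern q y) has_derivative (\<lambda>v. (f y - c) * (gkern p y \<bullet> v))) (at p)" for y
      by (intro has_derivative_mult_right kern_has_derivative t)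
    show "\<bar>(f y - c) * kern q y - (f y - c) * kern p y\<bar> \<le> ?b y * norm (q - p)" if "dist p q < snd p / 2" for q y
    proof -
      have "\<bar>f y - c\<bar> * \<bar>kern q y - kern p y\<bar> \<le> \<bar>f y - c\<bar> * (C1 * (2 / snd p) ^ Suc CARD('m) * indicator (cball (fst p) (3 * snd p)) y * norm (q - p))"
        by (intro mult_left_mono kern_lipschitz t that) simp
      then show ?thesis by (simp add: right_diff_distrib[symmetric] abs_mult mult_ac)
    qed
    show "integrable lborel ?b" by (intro integrable_mult_left integrable_abs loc')
  qed (use t integrable_diff_kern in auto)
  then have "((\<lambda>q. (\<integral>y. (f y - c) * kern q y \<partial>lborel) + c) has_derivative (\<lambda>v. \<integral>y. (f y - c) * (gkern p y \<bullet> v) \<partial>lborel)) (at p)"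
    using has_derivative_add[OF _ has_derivative_const] by fastforce
  then have "(ext has_derivative (\<lambda>v. \<integral>y. (f y - c) * (gkern p y \<bullet> v) \<partial>lborel)) (at p)"
  proof (rule has_derivative_transform_within_open)
    show "open {p :: (real ^ 'm) \<times> real. 0 < snd p}" by (intro open_Collect_less continuous_intros)
    show "(\<integral>y. (f y - c) * kern q y \<partial>lborel) + c = ext q" if "q \<in> {p. 0 < snd p}" for q
      using ext_minus_const[of q c] that by simp
  qed (use t in auto)
  moreover have "(\<integral>y. (f y - c) * (gkern p y \<bullet> v) \<partial>lborel) = (\<integral>y. (f y - c) *\<^sub>R gkern p y \<partial>lborel) \<bullet> v" for v
    using integral_inner_left[of v lborel "\<lambda>y. (f y - c) *\<^sub>R gkern p y"] integrable_scaleR_gkern[OF t, of c] by simp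
  ultimately show ?thesis by simp
qed

lemma ext_has_derivative: "0 < snd p \<Longrightarrow> (ext has_derivative (\<lambda>v. gext p \<bullet> v)) (at p)"
  using ext_has_derivative_shifted[of p 0] by (simp add: gext_def)

lemma gext_eq:
  assumes "0 < snd p"
  shows "gext p = (\<integral>y. (f y - c) *\<^sub>R gkern p y \<partial>lborel)"
  using grad_eqI[OF ext_has_derivative[OF assms]] grad_eqI[OF ext_has_derivative_shifted[OF assms, of c]] by simp

lemma isCont_gext:
  assumes t: "0 < snd p"
  shows "isCont gext p"
  unfolding continuous_at_sequentially comp_def
proof (intro allI impI)
  fix X assume X: "X \<longlonglongrightarrow> p"
  have "eventually (\<lambda>n. dist (X n) p < snd p / 2) sequentially" using X t by (intro tendstoD) auto
  then obtain N where N: "\<And>n. n \<ge> N \<Longrightarrow> dist p (X n) < snd p / 2" by (auto simp: eventually_sequentially dist_commute)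
  have "(\<lambda>n. gext (X (n + N))) \<longlonglongrightarrow> gext p"
    unfolding gext_def
  proof (rule integral_dominated_convergence[where w = "\<lambda>y. \<bar>indicator (cball (fst p) (3 * snd p)) y * (f y - 0)\<bar> * (C1 * (2 / snd p) ^ Suc CARD('m))"])
    show "integrable lborel (\<lambda>y. \<bar>indicator (cball (fst p) (3 * snd p)) y * (f y - 0)\<bar> * (C1 * (2 / snd p) ^ Suc CARD('m)))"
      by (intro integrable_mult_left integrable_abs loc')
    show "AE y in lborel. (\<lambda>n. f y *\<^sub>R gkern (X (n + N)) y) \<longlonglongrightarrow> f y *\<^sub>R gkern p y"
    proof (rule AE_I2)
      fix y
      have Xs: "(\<lambda>n. X (n + N)) \<longlonglongrightarrow> p" using X by (rule LIMSEQ_ignore_initial_segment)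
      have i: "(\<lambda>n. inverse (snd (X (n + N)))) \<longlonglongrightarrow> inverse (snd p)"
        using t by (intro tendsto_intros Xs) auto
      have z: "(\<lambda>n. inverse (snd (X (n + N))) *\<^sub>R (y - fst (X (n + N)))) \<longlonglongrightarrow> inverse (snd p) *\<^sub>R (y - fst p)"
        by (intro tendsto_intros i Xs)
      have g: "(\<lambda>n. grad \<rho> (inverse (snd (X (n + N))) *\<^sub>R (y - fst (X (n + N))))) \<longlonglongrightarrow> grad \<rho> (inverse (snd p) *\<^sub>R (y - fst p))"
        using continuous_\<rho>(2) z by (rule continuous_on_tendsto_compose) auto
      have r: "(\<lambda>n. \<rho> (inverse (snd (X (n + N))) *\<^sub>R (y - fst (X (n + N))))) \<longlonglongrightarrow> \<rho> (inverse (snd p) *\<^sub>R (y - fst p))"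
        using continuous_\<rho>(1) z by (rule continuous_on_tendsto_compose) auto
      show "(\<lambda>n. f y *\<^sub>R gkern (X (n + N)) y) \<longlonglongrightarrow> f y *\<^sub>R gkern p y"
        unfolding gkern_def Let_def
        by (intro tendsto_scaleR tendsto_const tendsto_power i tendsto_Pair tendsto_minus g tendsto_add tendsto_inner z tendsto_mult r)
    qed
    show "AE y in lborel. norm (f y *\<^sub>R gkern (X (n + N)) y) \<le> \<bar>indicator (cball (fst p) (3 * snd p)) y * (f y - 0)\<bar> * (C1 * (2 / snd p) ^ Suc CARD('m))" for n
    proof (rule AE_I2)
      fix y
      have "\<bar>f y\<bar> * norm (gkern (X (n + N)) y) \<le> \<bar>f y\<bar> * (C1 * (2 / snd p) ^ Suc CARD('m) * indicator (cball (fst p) (3 * snd p)) y)"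
        by (intro mult_left_mono gkern_near t N) auto
      then show "norm (f y *\<^sub>R gkern (X (n + N)) y) \<le> \<bar>indicator (cball (fst p) (3 * snd p)) y * (f y - 0)\<bar> * (C1 * (2 / snd p) ^ Suc CARD('m))"
        by (simp add: abs_mult mult_ac)
    qed
  qed measurable
  then show "(\<lambda>n. gext (X n)) \<longlonglongrightarrow> gext p" by (rule LIMSEQ_offset)
qed

lemma isCont_ext: "0 < snd p \<Longrightarrow> isCont ext p"
  using has_derivative_continuous[OF ext_has_derivative] .

text \<open>A majorant for the squared gradient at height t, up to a constant. The maximum with t
  makes it decrease in t, so the value at height t also controls all larger heights; this supplies
  majorants that do not depend on the upward shift.\<close>

definition dens :: "real ^ 'm \<Rightarrow> real \<Rightarrow> ennreal" where
  "dens x t = (\<integral>\<^sup>+y. ennreal ((f y - f x)\<^sup>2 / max t (norm (y - x)) ^ (CARD('m) + 2)) \<partial>lborel)"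

text \<open>The square of the Gagliardo seminorm of order 1/2 on the flat boundary of dimension
  m.\<close>

definition energy :: ennreal where
  "energy = (\<integral>\<^sup>+x. \<integral>\<^sup>+y. ennreal ((f y - f x)\<^sup>2 / norm (y - x) ^ (CARD('m) + 1)) \<partial>lborel \<partial>lborel)"

definition \<omega> :: real where "\<omega> = unit_ball_vol (real CARD('m))"

lemma \<omega>_pos: "\<omega> > 0" by (simp add: \<omega>_def)

text \<open>Cauchy-Schwarz on a ball of radius \<tau>, whose volume is \<omega> \<tau>^m.\<close>

lemma square_average_bound:
  fixes g :: "real ^ 'm \<Rightarrow> 'b::euclidean_space"
  assumes g: "\<And>y. norm (g y) \<le> \<bar>f y - f x\<bar> * (c * indicator (ball x \<tau>) y)" and \<tau>: "0 < \<tau>" and c: "0 \<le> c"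
    and gi: "integrable lborel g"
  shows "ennreal ((norm (integral\<^sup>L lborel g))\<^sup>2) \<le> ennreal (c\<^sup>2 * \<omega> * \<tau> ^ CARD('m)) * (\<integral>\<^sup>+y. ennreal ((f y - f x)\<^sup>2) * indicator (ball x \<tau>) y \<partial>lborel)"
proof -
  have [measurable]: "ball x \<tau> \<in> sets borel" by simp
  have "ennreal (norm (integral\<^sup>L lborel g)) \<le> (\<integral>\<^sup>+y. ennreal (norm (g y)) \<partial>lborel)"
    by (rule integral_norm_bound_ennreal[OF gi])
  also have "\<dots> \<le> (\<integral>\<^sup>+y. (ennreal c * indicator (ball x \<tau>) y) * (ennreal \<bar>f y - f x\<bar> * indicator (ball x \<tau>) y) \<partial>lborel)"
  proof (rule nn_integral_mono)
    fix y
    show "ennreal (norm (g y)) \<le> (ennreal c * indicator (ball x \<tau>) y) * (ennreal \<bar>f y - f x\<bar> * indicator (ball x \<tau>) y)"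
      using g[of y] c by (auto simp: ennreal_mult[symmetric] mult.commute split: split_indicator intro!: ennreal_leI)
  qed
  finally have "(ennreal (norm (integral\<^sup>L lborel g)))\<^sup>2 \<le> (\<integral>\<^sup>+y. (ennreal c * indicator (ball x \<tau>) y) * (ennreal \<bar>f y - f x\<bar> * indicator (ball x \<tau>) y) \<partial>lborel)\<^sup>2"
    by (rule power_mono) simp
  also have "\<dots> \<le> (\<integral>\<^sup>+y. (ennreal c * indicator (ball x \<tau>) y)\<^sup>2 \<partial>lborel) * (\<integral>\<^sup>+y. (ennreal \<bar>f y - f x\<bar> * indicator (ball x \<tau>) y)\<^sup>2 \<partial>lborel)"
    by (rule Cauchy_Schwarz_nn_integral) measurable
  also have "(\<integral>\<^sup>+y. (ennreal c * indicator (ball x \<tau>) y)\<^sup>2 \<partial>lborel) = (\<integral>\<^sup>+y. ennreal (c\<^sup>2) * indicator (ball x \<tau>) y \<partial>lborel)"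
    using c by (intro nn_integral_cong) (auto simp: ennreal_power split: split_indicator)
  also have "\<dots> = ennreal (c\<^sup>2 * \<omega> * \<tau> ^ CARD('m))"
    using \<tau> c \<omega>_pos by (simp add: nn_integral_cmult_indicator emeasure_ball ennreal_mult[symmetric] \<omega>_def mult.assoc)
  also have "(\<integral>\<^sup>+y. (ennreal \<bar>f y - f x\<bar> * indicator (ball x \<tau>) y)\<^sup>2 \<partial>lborel) = (\<integral>\<^sup>+y. ennreal ((f y - f x)\<^sup>2) * indicator (ball x \<tau>) y \<partial>lborel)"
    by (intro nn_integral_cong) (auto simp: ennreal_power split: split_indicator)
  finally show ?thesis by (simp add: ennreal_power)
qed

text \<open>Inside the ball the maximum of t and |y - x| is at most \<tau>, so the weight in
  \<open>dens\<close> is at least \<tau>^-(m+2).\<close>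

lemma ball_integral_le_dens:
  assumes "0 < \<tau>" "t \<le> \<tau>"
  shows "(\<integral>\<^sup>+y. ennreal ((f y - f x)\<^sup>2) * indicator (ball x \<tau>) y \<partial>lborel) \<le> ennreal (\<tau> ^ (CARD('m) + 2)) * dens x t"
proof -
  have "(\<integral>\<^sup>+y. ennreal ((f y - f x)\<^sup>2) * indicator (ball x \<tau>) y \<partial>lborel)
     \<le> (\<integral>\<^sup>+y. ennreal (\<tau> ^ (CARD('m) + 2)) * ennreal ((f y - f x)\<^sup>2 / max t (norm (y - x)) ^ (CARD('m) + 2)) \<partial>lborel)"
  proof (rule nn_integral_mono)
    fix y
    show "ennreal ((f y - f x)\<^sup>2) * indicator (ball x \<tau>) y \<le> ennreal (\<tau> ^ (CARD('m) + 2)) * ennreal ((f y - f x)\<^sup>2 / max t (norm (y - x)) ^ (CARD('m) + 2))"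
    proof (cases "y \<in> ball x \<tau> \<and> f y \<noteq> f x")
      case True
      then have "norm (y - x) > 0" "norm (y - x) < \<tau>" by (auto simp: dist_norm norm_minus_commute)
      then have M: "0 < max t (norm (y - x))" "max t (norm (y - x)) \<le> \<tau>" using assms by (auto simp: less_max_iff_disj)
      then have "max t (norm (y - x)) ^ (CARD('m) + 2) \<le> \<tau> ^ (CARD('m) + 2)" by (intro power_mono) auto
      then have "(f y - f x)\<^sup>2 * max t (norm (y - x)) ^ (CARD('m) + 2) \<le> (f y - f x)\<^sup>2 * \<tau> ^ (CARD('m) + 2)" by (intro mult_left_mono) auto
      then have "(f y - f x)\<^sup>2 \<le> \<tau> ^ (CARD('m) + 2) * ((f y - f x)\<^sup>2 / max t (norm (y - x)) ^ (CARD('m) + 2))"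
        using M(1) by (simp add: field_simps)
      then show ?thesis using True M assms by (simp add: ennreal_mult[symmetric] ennreal_leI)
    qed (auto split: split_indicator)
  qed
  also have "\<dots> = ennreal (\<tau> ^ (CARD('m) + 2)) * dens x t" unfolding dens_def by (intro nn_integral_cmult) measurable
  finally show ?thesis .
qed

text \<open>The powers of \<tau> cancel: \<tau>^-2(m+1) from the squared kernel gradient, \<tau>^m
  from Cauchy-Schwarz and \<tau>^(m+2) from \<open>dens\<close>. So the bound is uniform over all
  heights from t upwards.\<close>

lemma gext_bound:
  assumes "0 < t" "t \<le> \<tau>"
  shows "ennreal ((norm (gext (x, \<tau>)))\<^sup>2) \<le> ennreal (C1\<^sup>2 * \<omega>) * dens x t"
proof -
  have \<tau>: "0 < \<tau>" using assms by simp
  let ?c = "C1 * inverse \<tau> ^ Suc CARD('m)"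
  have "ennreal ((norm (\<integral>y. (f y - f x) *\<^sub>R gkern (x, \<tau>) y \<partial>lborel))\<^sup>2) \<le> ennreal (?c\<^sup>2 * \<omega> * \<tau> ^ CARD('m)) * (\<integral>\<^sup>+y. ennreal ((f y - f x)\<^sup>2) * indicator (ball x \<tau>) y \<partial>lborel)"
  proof (rule square_average_bound)
    show "norm ((f y - f x) *\<^sub>R gkern (x, \<tau>) y) \<le> \<bar>f y - f x\<bar> * (?c * indicator (ball x \<tau>) y)" for y
      using gkern_zero[of "(x, \<tau>)" y] norm_gkern[of "(x, \<tau>)" y] \<tau>
      by (cases "y \<in> ball x \<tau>") (auto simp: dist_norm norm_minus_commute intro!: mult_left_mono)
  qed (use \<tau> B_nonneg integrable_scaleR_gkern[of "(x, \<tau>)"] in auto)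
  also have "\<dots> \<le> ennreal (?c\<^sup>2 * \<omega> * \<tau> ^ CARD('m)) * (ennreal (\<tau> ^ (CARD('m) + 2)) * dens x t)"
    by (intro mult_left_mono ball_integral_le_dens \<tau> assms) simp
  also have "\<dots> = ennreal (?c\<^sup>2 * \<omega> * \<tau> ^ CARD('m) * \<tau> ^ (CARD('m) + 2)) * dens x t"
    using \<omega>_pos \<tau> by (simp add: ennreal_mult mult.assoc)
  also have "?c\<^sup>2 * \<omega> * \<tau> ^ CARD('m) * \<tau> ^ (CARD('m) + 2) = C1\<^sup>2 * \<omega> * ((inverse \<tau> * \<tau>) ^ Suc CARD('m))\<^sup>2"
    unfolding power_mult_distrib by (simp add: power2_eq_square power_add mult_ac)
  finally show ?thesis using \<tau> gext_eq[of "(x, \<tau>)" "f x"] by simp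
qed

lemma ext_minus_bound:
  assumes "0 < \<tau>"
  shows "ennreal ((ext (x, \<tau>) - f x)\<^sup>2) \<le> ennreal (B0\<^sup>2 * \<omega> * inverse \<tau> ^ CARD('m)) * (\<integral>\<^sup>+y. ennreal ((f y - f x)\<^sup>2) * indicator (ball x \<tau>) y \<partial>lborel)"
proof -
  let ?c = "B0 * inverse \<tau> ^ CARD('m)"
  have "ennreal ((norm (\<integral>y. (f y - f x) * kern (x, \<tau>) y \<partial>lborel))\<^sup>2) \<le> ennreal (?c\<^sup>2 * \<omega> * \<tau> ^ CARD('m)) * (\<integral>\<^sup>+y. ennreal ((f y - f x)\<^sup>2) * indicator (ball x \<tau>) y \<partial>lborel)"
  proof (rule square_average_bound)
    show "norm ((f y - f x) * kern (x, \<tau>) y) \<le> \<bar>f y - f x\<bar> * (?c * indicator (ball x \<tau>) y)" for y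
      using kern_zero[of "(x, \<tau>)" y] kern_bounds[of "(x, \<tau>)" y] assms
      by (cases "y \<in> ball x \<tau>") (auto simp: dist_norm norm_minus_commute abs_mult intro!: mult_left_mono)
  qed (use assms B_nonneg integrable_diff_kern[of _ "(x, \<tau>)"] in auto)
  also have "?c\<^sup>2 * \<omega> * \<tau> ^ CARD('m) = B0\<^sup>2 * \<omega> * inverse \<tau> ^ CARD('m) * (inverse \<tau> * \<tau>) ^ CARD('m)"
    unfolding power_mult_distrib by (simp add: power2_eq_square mult_ac)
  finally show ?thesis using assms ext_minus_const[of "(x, \<tau>)" "f x"] by simp
qed

lemma ext_minus_le_dens:
  assumes "0 < t" "t \<le> \<tau>"
  shows "ennreal ((ext (x, \<tau>) - f x)\<^sup>2) \<le> ennreal (B0\<^sup>2 * \<omega> * \<tau>\<^sup>2) * dens x t"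
proof -
  have \<tau>: "0 < \<tau>" using assms by simp
  have "ennreal ((ext (x, \<tau>) - f x)\<^sup>2) \<le> ennreal (B0\<^sup>2 * \<omega> * inverse \<tau> ^ CARD('m)) * (ennreal (\<tau> ^ (CARD('m) + 2)) * dens x t)"
    by (intro order.trans[OF ext_minus_bound] mult_left_mono ball_integral_le_dens \<tau> assms) simp
  also have "\<dots> = ennreal (B0\<^sup>2 * \<omega> * inverse \<tau> ^ CARD('m) * \<tau> ^ (CARD('m) + 2)) * dens x t"
    using \<omega>_pos \<tau> by (simp add: ennreal_mult mult.assoc)
  also have "B0\<^sup>2 * \<omega> * inverse \<tau> ^ CARD('m) * \<tau> ^ (CARD('m) + 2) = B0\<^sup>2 * \<omega> * \<tau>\<^sup>2 * (inverse \<tau> * \<tau>) ^ CARD('m)"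
    unfolding power_mult_distrib by (simp add: power_add power2_eq_square mult_ac)
  finally show ?thesis using \<tau> by simp
qed

text \<open>On the ball of radius \<tau> the energy weight is at least \<tau>^-(m+1), which leaves
  one power of \<tau>. This rate of convergence to the boundary values later fixes the choice of the
  shift.\<close>

lemma ext_minus_L2:
  assumes "0 < \<tau>"
  shows "(\<integral>\<^sup>+x. ennreal ((ext (x, \<tau>) - f x)\<^sup>2) \<partial>lborel) \<le> ennreal (B0\<^sup>2 * \<omega> * \<tau>) * energy"
proof -
  have "(\<integral>\<^sup>+x. ennreal ((ext (x, \<tau>) - f x)\<^sup>2) \<partial>lborel) \<le> (\<integral>\<^sup>+x. ennreal (B0\<^sup>2 * \<omega> * \<tau>) * (\<integral>\<^sup>+y. ennreal ((f y - f x)\<^sup>2 / norm (y - x) ^ (CARD('m) + 1)) \<partial>lborel) \<partial>lborel)"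
  proof (rule nn_integral_mono)
    fix x
    have "(\<integral>\<^sup>+y. ennreal ((f y - f x)\<^sup>2) * indicator (ball x \<tau>) y \<partial>lborel)
      \<le> (\<integral>\<^sup>+y. ennreal (\<tau> ^ (CARD('m) + 1)) * ennreal ((f y - f x)\<^sup>2 / norm (y - x) ^ (CARD('m) + 1)) \<partial>lborel)"
    proof (rule nn_integral_mono)
      fix y
      show "ennreal ((f y - f x)\<^sup>2) * indicator (ball x \<tau>) y \<le> ennreal (\<tau> ^ (CARD('m) + 1)) * ennreal ((f y - f x)\<^sup>2 / norm (y - x) ^ (CARD('m) + 1))"
      proof (cases "y \<in> ball x \<tau> \<and> f y \<noteq> f x")
        case True
        then have M: "norm (y - x) > 0" "norm (y - x) < \<tau>" by (auto simp: dist_norm norm_minus_commute)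
        then have "norm (y - x) ^ (CARD('m) + 1) \<le> \<tau> ^ (CARD('m) + 1)" by (intro power_mono) auto
        then have "(f y - f x)\<^sup>2 * norm (y - x) ^ (CARD('m) + 1) \<le> (f y - f x)\<^sup>2 * \<tau> ^ (CARD('m) + 1)" by (intro mult_left_mono) auto
        then have "(f y - f x)\<^sup>2 \<le> \<tau> ^ (CARD('m) + 1) * ((f y - f x)\<^sup>2 / norm (y - x) ^ (CARD('m) + 1))"
          using M(1) by (simp add: field_simps)
        then show ?thesis using True assms by (simp add: ennreal_mult[symmetric] ennreal_leI)
      qed (auto split: split_indicator)
    qed
    also have "\<dots> = ennreal (\<tau> ^ (CARD('m) + 1)) * (\<integral>\<^sup>+y. ennreal ((f y - f x)\<^sup>2 / norm (y - x) ^ (CARD('m) + 1)) \<partial>lborel)"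
      by (intro nn_integral_cmult) measurable
    finally have 1: "(\<integral>\<^sup>+y. ennreal ((f y - f x)\<^sup>2) * indicator (ball x \<tau>) y \<partial>lborel) \<le> ennreal (\<tau> ^ (CARD('m) + 1)) * (\<integral>\<^sup>+y. ennreal ((f y - f x)\<^sup>2 / norm (y - x) ^ (CARD('m) + 1)) \<partial>lborel)" .
    have "ennreal ((ext (x, \<tau>) - f x)\<^sup>2) \<le> ennreal (B0\<^sup>2 * \<omega> * inverse \<tau> ^ CARD('m)) * (ennreal (\<tau> ^ (CARD('m) + 1)) * (\<integral>\<^sup>+y. ennreal ((f y - f x)\<^sup>2 / norm (y - x) ^ (CARD('m) + 1)) \<partial>lborel))"
      by (intro order.trans[OF ext_minus_bound[OF assms]] mult_left_mono 1) simp
    also have "\<dots> = ennreal (B0\<^sup>2 * \<omega> * inverse \<tau> ^ CARD('m) * \<tau> ^ (CARD('m) + 1)) * (\<integral>\<^sup>+y. ennreal ((f y - f x)\<^sup>2 / norm (y - x) ^ (CARD('m) + 1)) \<partial>lborel)"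
      using \<omega>_pos assms by (simp add: ennreal_mult mult.assoc)
    also have "B0\<^sup>2 * \<omega> * inverse \<tau> ^ CARD('m) * \<tau> ^ (CARD('m) + 1) = B0\<^sup>2 * \<omega> * \<tau> * (inverse \<tau> * \<tau>) ^ CARD('m)"
      unfolding power_mult_distrib by (simp add: mult_ac)
    finally show "ennreal ((ext (x, \<tau>) - f x)\<^sup>2) \<le> ennreal (B0\<^sup>2 * \<omega> * \<tau>) * (\<integral>\<^sup>+y. ennreal ((f y - f x)\<^sup>2 / norm (y - x) ^ (CARD('m) + 1)) \<partial>lborel)"
      using assms by simp
  qed
  also have "\<dots> = ennreal (B0\<^sup>2 * \<omega> * \<tau>) * energy"
    unfolding energy_def by (intro nn_integral_cmult) measurable
  finally show ?thesis .
qed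

text \<open>Heights up to r contribute r^-(m+1), and the tail contributes the same divided by m +
  1.\<close>

lemma nn_integral_max_power:
  assumes r: "0 < r"
  shows "(\<integral>\<^sup>+t. ennreal (1 / max t r ^ (CARD('m) + 2)) * indicator {0<..} t \<partial>lborel) \<le> ennreal (2 / r ^ (CARD('m) + 1))"
proof -
  define c where "c = real (CARD('m) + 1)"
  have c: "c \<ge> 1" by (simp add: c_def)
  define F where "F t = - (inverse t ^ (CARD('m) + 1)) / c" for t :: real
  have "(\<integral>\<^sup>+t. ennreal (1 / max t r ^ (CARD('m) + 2)) * indicator {0<..} t \<partial>lborel)
    \<le> (\<integral>\<^sup>+t. ennreal (1 / r ^ (CARD('m) + 2)) * indicator {0..r} t + ennreal (1 / max t r ^ (CARD('m) + 2)) * indicator {r..} t \<partial>lborel)"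
    by (intro nn_integral_mono) (auto split: split_indicator simp: max_def)
  also have "\<dots> = ennreal (1 / r ^ (CARD('m) + 2)) * ennreal r + (\<integral>\<^sup>+t. ennreal (1 / max t r ^ (CARD('m) + 2)) * indicator {r..} t \<partial>lborel)"
    using r by (subst nn_integral_add) (auto simp: nn_integral_cmult_indicator)
  also have "(\<integral>\<^sup>+t. ennreal (1 / max t r ^ (CARD('m) + 2)) * indicator {r..} t \<partial>lborel) = ennreal (0 - F r)"
  proof (rule nn_integral_FTC_atLeast)
    fix t assume t: "r \<le> t"
    then have t0: "t > 0" using r by simp
    have "((\<lambda>t. inverse t ^ Suc CARD('m)) has_real_derivative (1 + real CARD('m)) * (- (inverse t * inverse t) * inverse t ^ CARD('m))) (at t)"
      using t0 by (intro DERIV_power_Suc) (auto intro!: derivative_eq_intros)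
    then have "((\<lambda>t. inverse t ^ Suc CARD('m)) has_real_derivative real (CARD('m) + 1) * inverse t ^ CARD('m) * (- (inverse t * inverse t))) (at t)"
      by (simp add: mult_ac add.commute)
    then have "(F has_real_derivative - (real (CARD('m) + 1) * inverse t ^ CARD('m) * (- (inverse t * inverse t))) / c) (at t)"
      unfolding F_def[abs_def] Suc_eq_plus1 by (intro DERIV_cdivide DERIV_minus)
    moreover have "- (real (CARD('m) + 1) * inverse t ^ CARD('m) * (- (inverse t * inverse t))) / c = 1 / max t r ^ (CARD('m) + 2)"
      using t t0 by (simp add: c_def max_absorb1 divide_inverse power_inverse) 
    ultimately show "(F has_real_derivative 1 / max t r ^ (CARD('m) + 2)) (at t)" by simp
    show "0 \<le> 1 / max t r ^ (CARD('m) + 2)" using t0 by simp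
  next
    have "((\<lambda>t. - (inverse t ^ (CARD('m) + 1)) / c) \<longlongrightarrow> - (0 ^ (CARD('m) + 1)) / c) at_top"
      using c by (intro tendsto_intros tendsto_inverse_0_at_top filterlim_ident) auto
    then show "(F \<longlongrightarrow> 0) at_top" by (simp add: F_def[abs_def])
  qed measurable
  also have "ennreal (1 / r ^ (CARD('m) + 2)) * ennreal r + ennreal (0 - F r) \<le> ennreal (2 / r ^ (CARD('m) + 1))"
  proof -
    have "1 / r ^ (CARD('m) + 2) * r = 1 / r ^ (CARD('m) + 1)" using r by (simp add: field_simps)
    moreover have "0 - F r = 1 / r ^ (CARD('m) + 1) / c" using r by (simp add: F_def divide_inverse power_inverse)
    moreover have "1 / r ^ (CARD('m) + 1) / c \<le> 1 / r ^ (CARD('m) + 1)" using c r by (simp add: divide_le_eq_1_pos field_simps mult_left_le)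
    moreover have "2 / r ^ (CARD('m) + 1) = 1 / r ^ (CARD('m) + 1) + 1 / r ^ (CARD('m) + 1)"
      by (simp only: add_divide_distrib[symmetric] one_add_one)
    ultimately have le: "1 / r ^ (CARD('m) + 2) * r + (0 - F r) \<le> 2 / r ^ (CARD('m) + 1)" and F0: "0 \<le> 0 - F r"
      using r c by (linarith, simp)
    have "ennreal (1 / r ^ (CARD('m) + 2)) * ennreal r + ennreal (0 - F r) = ennreal (1 / r ^ (CARD('m) + 2) * r + (0 - F r))"
      using r F0 by (subst ennreal_plus, simp, simp, subst ennreal_mult, simp_all)
    with le show ?thesis by (simp only: ennreal_leI)
  qed
  finally show ?thesis .
qed

text \<open>Tonelli: integrating the height first turns the exponent m + 2 of \<open>dens\<close>
  into the exponent m + 1 of the energy.\<close>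

lemma nn_integral_dens: "(\<integral>\<^sup>+x. \<integral>\<^sup>+t. indicator {0<..} t * dens x t \<partial>lborel \<partial>lborel) \<le> 2 * energy"
proof -
  have "(\<integral>\<^sup>+t. indicator {0<..} t * dens x t \<partial>lborel) \<le> 2 * (\<integral>\<^sup>+y. ennreal ((f y - f x)\<^sup>2 / norm (y - x) ^ (CARD('m) + 1)) \<partial>lborel)" for x
  proof -
    have "(\<integral>\<^sup>+t. indicator {0<..} t * dens x t \<partial>lborel) = (\<integral>\<^sup>+t. \<integral>\<^sup>+y. indicator {0<..} t * ennreal ((f y - f x)\<^sup>2 / max t (norm (y - x)) ^ (CARD('m) + 2)) \<partial>lborel \<partial>lborel)"
      unfolding dens_def by (intro nn_integral_cong nn_integral_cmult[symmetric]) measurable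
    also have "\<dots> = (\<integral>\<^sup>+y. \<integral>\<^sup>+t. indicator {0<..} t * ennreal ((f y - f x)\<^sup>2 / max t (norm (y - x)) ^ (CARD('m) + 2)) \<partial>lborel \<partial>lborel)"
      by (rule lborel_pair.Fubini') measurable
    also have "\<dots> \<le> (\<integral>\<^sup>+y. 2 * ennreal ((f y - f x)\<^sup>2 / norm (y - x) ^ (CARD('m) + 1)) \<partial>lborel)"
    proof (rule nn_integral_mono)
      fix y
      show "(\<integral>\<^sup>+t. indicator {0<..} t * ennreal ((f y - f x)\<^sup>2 / max t (norm (y - x)) ^ (CARD('m) + 2)) \<partial>lborel) \<le> 2 * ennreal ((f y - f x)\<^sup>2 / norm (y - x) ^ (CARD('m) + 1))"
      proof (cases "y = x")
        case False
        have "(\<integral>\<^sup>+t. indicator {0<..} t * ennreal ((f y - f x)\<^sup>2 / max t (norm (y - x)) ^ (CARD('m) + 2)) \<partial>lborel)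
          = (\<integral>\<^sup>+t. ennreal ((f y - f x)\<^sup>2) * (ennreal (1 / max t (norm (y - x)) ^ (CARD('m) + 2)) * indicator {0<..} t) \<partial>lborel)"
          using False by (intro nn_integral_cong) (auto simp: ennreal_mult[symmetric] split: split_indicator)
        also have "\<dots> = ennreal ((f y - f x)\<^sup>2) * (\<integral>\<^sup>+t. ennreal (1 / max t (norm (y - x)) ^ (CARD('m) + 2)) * indicator {0<..} t \<partial>lborel)"
          by (intro nn_integral_cmult) measurable
        also have "\<dots> \<le> ennreal ((f y - f x)\<^sup>2) * ennreal (2 / norm (y - x) ^ (CARD('m) + 1))"
          using False by (intro mult_left_mono nn_integral_max_power) auto
        also have "\<dots> = ennreal (2 * ((f y - f x)\<^sup>2 / norm (y - x) ^ (CARD('m) + 1)))"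
          by (simp add: ennreal_mult[symmetric] mult.commute)
        also have "\<dots> = 2 * ennreal ((f y - f x)\<^sup>2 / norm (y - x) ^ (CARD('m) + 1))"
          by (subst ennreal_mult) auto
        finally show ?thesis .
      qed simp
    qed
    also have "\<dots> = 2 * (\<integral>\<^sup>+y. ennreal ((f y - f x)\<^sup>2 / norm (y - x) ^ (CARD('m) + 1)) \<partial>lborel)"
      by (intro nn_integral_cmult) measurable
    finally show ?thesis .
  qed
  then have "(\<integral>\<^sup>+x. \<integral>\<^sup>+t. indicator {0<..} t * dens x t \<partial>lborel \<partial>lborel) \<le> (\<integral>\<^sup>+x. 2 * (\<integral>\<^sup>+y. ennreal ((f y - f x)\<^sup>2 / norm (y - x) ^ (CARD('m) + 1)) \<partial>lborel) \<partial>lborel)"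
    by (intro nn_integral_mono)
  also have "\<dots> = 2 * energy" unfolding energy_def by (intro nn_integral_cmult) measurable
  finally show ?thesis .
qed

end

subsection \<open>Pairing a field with an extension\<close>

lemma nn_integral_lborel_pair:
  fixes h :: "'a::euclidean_space \<times> 'b::euclidean_space \<Rightarrow> ennreal"
  assumes "h \<in> borel_measurable (lborel \<Otimes>\<^sub>M lborel)"
  shows "(\<integral>\<^sup>+p. h p \<partial>lborel) = (\<integral>\<^sup>+x. \<integral>\<^sup>+t. h (x, t) \<partial>lborel \<partial>lborel)"
  using lborel.nn_integral_fst[OF assms] by (simp add: lborel_prod)

lemma measurable_lborel_pair: "borel_measurable (lborel \<Otimes>\<^sub>M lborel) = borel_measurable (borel :: ('a::euclidean_space \<times> 'b::euclidean_space) measure)"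
proof (rule measurable_cong_sets)
  show "sets (lborel \<Otimes>\<^sub>M lborel) = sets (borel :: ('a \<times> 'b) measure)"
    unfolding lborel_prod by (rule sets_lborel)
qed simp

context averaging_extension
begin

definition hext :: "(real ^ 'm) \<times> real \<Rightarrow> (real ^ 'm) \<times> real" where
  "hext p = (if 0 < snd p then gext p else 0)"

lemma open_half: "open {p :: (real ^ 'm) \<times> real. 0 < snd p}"
  by (intro open_Collect_less continuous_intros)

lemma continuous_on_gext: "continuous_on {p. 0 < snd p} gext"
  by (auto intro!: continuous_at_imp_continuous_on isCont_gext)

lemma continuous_on_ext: "continuous_on {p. 0 < snd p} ext"
  by (auto intro!: continuous_at_imp_continuous_on isCont_ext)

lemma measurable_on_half:
  fixes g :: "(real ^ 'm) \<times> real \<Rightarrow> 'b::euclidean_space"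
  assumes "continuous_on {p. 0 < snd p} g"
  shows "(\<lambda>p. if 0 < snd p then g p else 0) \<in> borel_measurable borel"
proof -
  have "(\<lambda>p. indicator {p. 0 < snd p} p *\<^sub>R g p) \<in> borel_measurable borel"
    using assms open_half by (intro borel_measurable_continuous_on_indicator) auto
  moreover have "(\<lambda>p. indicator {p. 0 < snd p} p *\<^sub>R g p) = (\<lambda>p. if 0 < snd p then g p else 0)" by auto
  ultimately show ?thesis by simp
qed

lemma measurable_hext: "hext \<in> borel_measurable borel"
  unfolding hext_def[abs_def] by (rule measurable_on_half[OF continuous_on_gext])

definition half_dens :: "(real ^ 'm) \<times> real \<Rightarrow> ennreal" where
  "half_dens p = indicator {0<..} (snd p) * dens (fst p) (snd p)"

lemma measurable_half_dens_pair: "half_dens \<in> borel_measurable (lborel \<Otimes>\<^sub>M lborel)"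
  unfolding half_dens_def[abs_def] dens_def by measurable

lemma measurable_half_dens: "half_dens \<in> borel_measurable borel"
  using measurable_half_dens_pair unfolding measurable_lborel_pair .

lemma nn_integral_half_dens: "(\<integral>\<^sup>+p. half_dens p \<partial>lborel) \<le> 2 * energy"
  using nn_integral_dens by (subst nn_integral_lborel_pair[OF measurable_half_dens_pair]) (simp add: half_dens_def)

lemma hext_bound: "ennreal ((norm (hext p))\<^sup>2) \<le> ennreal (C1\<^sup>2 * \<omega>) * half_dens p"
  using gext_bound[of "snd p" "snd p" "fst p"] by (auto simp: hext_def half_dens_def)

lemma nn_integral_hext:
  assumes "energy \<le> ennreal E" "0 \<le> E"
  shows "(\<integral>\<^sup>+p. ennreal ((norm (hext p))\<^sup>2) \<partial>lborel) \<le> ennreal (2 * C1\<^sup>2 * \<omega> * E)"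
proof -
  have "(\<integral>\<^sup>+p. ennreal ((norm (hext p))\<^sup>2) \<partial>lborel) \<le> (\<integral>\<^sup>+p. ennreal (C1\<^sup>2 * \<omega>) * half_dens p \<partial>lborel)"
    by (intro nn_integral_mono hext_bound)
  also have "\<dots> = ennreal (C1\<^sup>2 * \<omega>) * (\<integral>\<^sup>+p. half_dens p \<partial>lborel)"
    using measurable_half_dens by (intro nn_integral_cmult) simp
  also have "\<dots> \<le> ennreal (C1\<^sup>2 * \<omega>) * (2 * ennreal E)"
    by (intro mult_left_mono order.trans[OF nn_integral_half_dens] assms) auto
  also have "\<dots> = ennreal (C1\<^sup>2 * \<omega>) * ennreal (2 * E)"
    using assms by (simp add: ennreal_mult)
  also have "\<dots> = ennreal (2 * C1\<^sup>2 * \<omega> * E)"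
    using assms \<omega>_pos by (simp add: ennreal_mult[symmetric] mult_ac)
  finally show ?thesis .
qed

end

text \<open>The extension is smooth only at positive heights, whereas the trace identity needs a C^1
  function on the whole space. This C^1 function is the shift t + \<delta> for t at least 0 and
  stays at least \<delta>/2 for every t, so the extension may be evaluated at the height it
  gives.\<close>

definition stretch :: "real \<Rightarrow> real \<Rightarrow> real" where
  "stretch \<delta> t = t + \<delta> + (max 0 (- t))\<^sup>2 / (2 * \<delta>)"

definition stretch' :: "real \<Rightarrow> real \<Rightarrow> real" where
  "stretch' \<delta> t = 1 - max 0 (- t) / \<delta>"

lemma DERIV_stretch: "0 < \<delta> \<Longrightarrow> (stretch \<delta> has_real_derivative stretch' \<delta> t) (at t)"
proof -
  assume \<delta>: "0 < \<delta>"
  have "((\<lambda>t. - t) has_real_derivative - 1) (at t)" by (auto intro!: derivative_eq_intros)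
  from DERIV_chain2[OF DERIV_pos_part_square this]
  have D: "((\<lambda>t. (max 0 (- t))\<^sup>2) has_real_derivative 2 * max 0 (- t) * - 1) (at t)" .
  show ?thesis unfolding stretch_def[abs_def] stretch'_def
    by (rule DERIV_cong[OF DERIV_add[OF DERIV_add[OF DERIV_ident DERIV_const] DERIV_cdivide[OF D]]]) (use \<delta> in \<open>simp add: field_simps\<close>)
qed

lemma stretch_pos: 
  assumes "0 < \<delta>"
  shows "0 < stretch \<delta> t"
proof -
  have "2 * \<delta> * stretch \<delta> t = 2 * \<delta> * t + 2 * \<delta>\<^sup>2 + (max 0 (- t))\<^sup>2"
    using assms by (simp add: stretch_def field_simps power2_eq_square)
  also have "\<dots> > 0"
  proof (cases "0 \<le> t")
    case True
    then show ?thesis using assms by (simp add: add_nonneg_pos)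
  next
    case False
    then have "2 * \<delta> * t + 2 * \<delta>\<^sup>2 + (max 0 (- t))\<^sup>2 = (\<delta> + t)\<^sup>2 + \<delta>\<^sup>2" by (simp add: power2_eq_square algebra_simps)
    moreover have "0 < (\<delta> + t)\<^sup>2 + \<delta>\<^sup>2" using assms by (simp add: add_nonneg_pos)
    ultimately show ?thesis by linarith
  qed
  finally show ?thesis using assms by (simp add: zero_less_mult_iff)
qed

lemma stretch_nonneg: "0 \<le> t \<Longrightarrow> stretch \<delta> t = t + \<delta>" "0 \<le> t \<Longrightarrow> stretch' \<delta> t = 1"
  by (simp_all add: stretch_def stretch'_def)

lemma continuous_stretch: "0 < \<delta> \<Longrightarrow> continuous_on S (stretch \<delta>)" "0 < \<delta> \<Longrightarrow> continuous_on S (stretch' \<delta>)"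
  unfolding stretch_def[abs_def] stretch'_def[abs_def] by (auto intro!: continuous_intros)

text \<open>Split at the level l = K^(-(m-1)/2). Below it z^2 is at most l^2, the second summand.
  Above it z^2 = z^q z^(2-q) with q - 2 = 2/(m-1), and z^(2-q) is at most l^(2-q) = K. The estimate
  does the work of Hoelder's inequality on a ball of radius of order K.\<close>

lemma square_le_powr:
  fixes z :: real
  assumes "0 \<le> z" "1 \<le> K" "2 \<le> m"
  shows "z\<^sup>2 \<le> K * z powr (2 * real m / (real m - 1)) + inverse K ^ (m - 1)"
proof -
  define r where "r = real m - 1"
  have r: "r \<ge> 1" "real (m - 1) = r" using assms(3) by (auto simp: r_def)
  define q where "q = 2 * real m / r"
  define l where "l = K powr (- r / 2)"
  have l0: "l > 0" using assms by (simp add: l_def)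
  have l2: "l\<^sup>2 = inverse K ^ (m - 1)"
  proof -
    have "l\<^sup>2 = K powr (- r)" by (simp add: l_def power2_eq_square powr_add[symmetric])
    also have "\<dots> = inverse (K ^ (m - 1))" using assms r by (simp add: powr_minus powr_realpow[symmetric])
    finally show ?thesis by (simp add: power_inverse)
  qed
  have z0: "0 \<le> K * z powr q" using assms by simp
  show ?thesis
  proof (cases "z \<le> l")
    case True
    then have "z\<^sup>2 \<le> l\<^sup>2" using assms by (intro power_mono) auto
    then show ?thesis using z0 l2 by (simp add: q_def r_def)
  next
    case False
    then have z: "z > l" "z > 0" using l0 by auto
    have q2: "q - 2 = 2 / r" using r by (simp add: q_def r_def field_simps)
    have "z\<^sup>2 = z powr 2" using z by (simp add: powr_numeral)
    also have "\<dots> = z powr q * z powr (- (2 / r))" by (simp add: powr_add[symmetric] q2[symmetric])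
    also have "z powr (- (2 / r)) \<le> l powr (- (2 / r))"
      using z l0 r by (intro powr_mono2') auto
    also have "l powr (- (2 / r)) = K" using assms r by (simp add: l_def powr_powr)
    finally have "z\<^sup>2 \<le> z powr q * K" by (simp add: mult_left_mono)
    moreover have "0 \<le> inverse K ^ (m - 1)" using assms by simp
    ultimately show ?thesis by (simp add: q_def r_def mult.commute)
  qed
qed

locale trace_extension = flat_field u + averaging_extension \<rho> B0 B1 f
  for u :: "(real ^ 'm) \<times> real \<Rightarrow> (real ^ 'm) \<times> real" and \<rho> :: "real ^ 'm \<Rightarrow> real" and B0 B1 and f +
  fixes E :: real
  assumes card: "2 \<le> CARD('m)" and E: "energy \<le> ennreal E" "0 \<le> E"
    and fq: "integrable lborel (\<lambda>x. \<bar>f x\<bar> powr (2 * real CARD('m) / (real CARD('m) - 1)))"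
begin

lemma pairing_bound:
  "integrable lborel (\<lambda>p. u p \<bullet> hext p)"
  "\<bar>\<integral>p. u p \<bullet> hext p \<partial>lborel\<bar> \<le> sqrt (\<integral>p. (norm (u p))\<^sup>2 \<partial>lborel) * sqrt (2 * C1\<^sup>2 * \<omega> * E)"
  using inner_integral_Cauchy_Schwarz[of u lborel hext "2 * C1\<^sup>2 * \<omega> * E"] um measurable_hext u2 nn_integral_hext[OF E] \<omega>_pos E(2)
  by simp_all

lemma AE_half_dens_finite: "AE p in lborel. half_dens p < \<infinity>"
proof -
  have "(\<integral>\<^sup>+p. half_dens p \<partial>lborel) \<le> 2 * ennreal E"
    by (intro order.trans[OF nn_integral_half_dens] mult_left_mono E) simp
  also have "\<dots> < \<infinity>" by (simp add: ennreal_mult_less_top)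
  finally have "(\<integral>\<^sup>+p. half_dens p \<partial>lborel) \<noteq> \<infinity>" by simp
  from nn_integral_PInf_AE[OF _ this] measurable_half_dens show ?thesis by (simp add: less_top)
qed

lemma integrable_half_dens: "integrable lborel (\<lambda>p. enn2real (half_dens p))"
proof (rule integrableI_bounded)
  show "(\<lambda>p. enn2real (half_dens p)) \<in> borel_measurable lborel" using measurable_half_dens by simp
  have "(\<integral>\<^sup>+p. ennreal (norm (enn2real (half_dens p))) \<partial>lborel) \<le> (\<integral>\<^sup>+p. half_dens p \<partial>lborel)"
    by (intro nn_integral_mono) (simp add: ennreal_enn2real_if)
  also have "\<dots> \<le> 2 * ennreal E" by (intro order.trans[OF nn_integral_half_dens] mult_left_mono E) simp
  also have "\<dots> < \<infinity>" by (simp add: ennreal_mult_less_top)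
  finally show "(\<integral>\<^sup>+p. ennreal (norm (enn2real (half_dens p))) \<partial>lborel) < \<infinity>" .
qed

text \<open>The exponent 2m/(m-1) yields linear growth in the radius: the constant part K^-(m-1)
  meets a volume of order K^m. Together with the height 2K of the half ball this is compensated by
  the factor K^-2 of the squared cutoff gradient.\<close>

lemma nn_integral_square_ball:
  assumes "1 \<le> K"
  shows "(\<integral>\<^sup>+x. ennreal ((f x)\<^sup>2) * indicator (cball 0 (2 * K)) x \<partial>lborel)
     \<le> ennreal (K * ((\<integral>x. \<bar>f x\<bar> powr (2 * real CARD('m) / (real CARD('m) - 1)) \<partial>lborel) + \<omega> * 2 ^ CARD('m)))"
proof -
  have [measurable]: "cball (0 :: real ^ 'm) (2 * K) \<in> sets borel" by simp
  let ?q = "2 * real CARD('m) / (real CARD('m) - 1)"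
  let ?A = "\<integral>x. \<bar>f x\<bar> powr ?q \<partial>lborel"
  have "(\<integral>\<^sup>+x. ennreal ((f x)\<^sup>2) * indicator (cball 0 (2 * K)) x \<partial>lborel)
    \<le> (\<integral>\<^sup>+x. ennreal K * ennreal (\<bar>f x\<bar> powr ?q) + ennreal (inverse K ^ (CARD('m) - 1)) * indicator (cball 0 (2 * K)) x \<partial>lborel)"
  proof (rule nn_integral_mono)
    fix x
    have "ennreal ((f x)\<^sup>2) \<le> ennreal (K * \<bar>f x\<bar> powr ?q + inverse K ^ (CARD('m) - 1))"
      using square_le_powr[of "\<bar>f x\<bar>" K "CARD('m)"] assms card by (intro ennreal_leI) simp
    also have "\<dots> = ennreal K * ennreal (\<bar>f x\<bar> powr ?q) + ennreal (inverse K ^ (CARD('m) - 1))"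
      using assms by (simp add: ennreal_mult)
    finally show "ennreal ((f x)\<^sup>2) * indicator (cball 0 (2 * K)) x
      \<le> ennreal K * ennreal (\<bar>f x\<bar> powr ?q) + ennreal (inverse K ^ (CARD('m) - 1)) * indicator (cball 0 (2 * K)) x"
      by (auto split: split_indicator)
  qed
  also have "\<dots> = ennreal K * ennreal ?A + ennreal (inverse K ^ (CARD('m) - 1)) * ennreal (\<omega> * (2 * K) ^ CARD('m))"
    using fq assms by (subst nn_integral_add) (auto simp: nn_integral_cmult nn_integral_eq_integral nn_integral_cmult_indicator emeasure_cball \<omega>_def)
  also have "\<dots> = ennreal (K * ?A + inverse K ^ (CARD('m) - 1) * (\<omega> * (2 * K) ^ CARD('m)))"
    using assms \<omega>_pos by (simp add: ennreal_mult[symmetric] ennreal_plus[symmetric] del: ennreal_plus)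
  also have "inverse K ^ (CARD('m) - 1) * (\<omega> * (2 * K) ^ CARD('m)) = K * (\<omega> * 2 ^ CARD('m))"
  proof -
    have "K ^ CARD('m) = K * K ^ (CARD('m) - 1)" by (cases "CARD('m)") auto
    then have "inverse K ^ (CARD('m) - 1) * (\<omega> * (2 * K) ^ CARD('m)) = (inverse K * K) ^ (CARD('m) - 1) * K * (\<omega> * 2 ^ CARD('m))"
      by (simp add: power_mult_distrib)
    then show ?thesis using assms by simp
  qed
  finally show ?thesis by (simp add: distrib_left)
qed

context
  fixes g :: "real ^ 'm \<Rightarrow> real" and c :: real
  assumes gm: "g \<in> borel_measurable borel" and gc: "\<And>x. \<bar>g x\<bar> \<le> c"
    and trace: "\<And>\<psi> G S. has_gradient \<psi> G \<Longrightarrow> continuous_on UNIV G \<Longrightarrow> compact S \<Longrightarrow> (\<And>p. p \<notin> S \<Longrightarrow> \<psi> p = 0) \<Longrightarrow>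
       (\<integral>p. u p \<bullet> G p \<partial>lborel) = (\<integral>x. g x * \<psi> (x, 0) \<partial>lborel)"
    and gf: "integrable lborel (\<lambda>x. g x * f x)"
begin

definition K :: "nat \<Rightarrow> real" where "K n = real (Suc n)"
text \<open>The boundary error is of order sqrt(K^m \<delta>), from a bounded weight on a ball of
  radius 2K and the L^2 rate sqrt \<delta>. The exponent m + 2 makes it 1/K.\<close>

definition \<delta> :: "nat \<Rightarrow> real" where "\<delta> n = inverse (K n) ^ (CARD('m) + 2)"
definition \<eta> :: "nat \<Rightarrow> (real ^ 'm) \<times> real \<Rightarrow> real" where "\<eta> n p = cutoff (1 / (K n)\<^sup>2 * (p \<bullet> p))"
definition \<eta>' :: "nat \<Rightarrow> (real ^ 'm) \<times> real \<Rightarrow> (real ^ 'm) \<times> real" where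
  "\<eta>' n p = cutoff' (1 / (K n)\<^sup>2 * (p \<bullet> p)) *\<^sub>R ((2 * (1 / (K n)\<^sup>2)) *\<^sub>R p)"

lemma K_ge: "1 \<le> K n" "0 < K n" by (simp_all add: K_def)

lemma \<delta>_pos: "0 < \<delta> n" "\<delta> n \<le> 1"
proof -
  have "0 < inverse (K n)" "inverse (K n) \<le> 1" using K_ge[of n] by (auto simp: inverse_le_1_iff)
  then show "0 < \<delta> n" "\<delta> n \<le> 1" unfolding \<delta>_def using power_le_one[of "inverse (K n)"] by (simp_all only: zero_less_power less_imp_le)
qed

lemma \<eta>_gradient: "has_gradient (\<eta> n) (\<eta>' n)"
  unfolding \<eta>_def[abs_def] \<eta>'_def[abs_def] by (rule has_gradient_compose_real[OF DERIV_cutoff has_gradient_norm_square])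

lemma \<eta>_continuous: "continuous_on S (\<eta> n)" "continuous_on S (\<eta>' n)"
  unfolding \<eta>_def[abs_def] \<eta>'_def[abs_def]
  by (intro continuous_intros continuous_on_compose2[OF continuous_cutoff[of UNIV]] continuous_on_compose2[OF continuous_cutoff'[of UNIV]]; simp)+

text \<open>The spline is applied to |p|^2 / K^2, so it already vanishes for |p|^2 at least 2 K^2;
  2K is a convenient larger radius. The gradient bound 8/K is the slope 2 times 2/K^2 times
  2K.\<close>

lemma \<eta>_props:
  "norm p \<le> K n \<Longrightarrow> \<eta> n p = 1" "norm p \<le> K n \<Longrightarrow> \<eta>' n p = 0"
  "2 * K n \<le> norm p \<Longrightarrow> \<eta> n p = 0" "2 * K n \<le> norm p \<Longrightarrow> \<eta>' n p = 0"
  "\<bar>\<eta> n p\<bar> \<le> 4" "norm (\<eta>' n p) \<le> 8 / K n"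
proof -
  have k: "0 < K n" by (rule K_ge)
  have le: "1 / (K n)\<^sup>2 * (p \<bullet> p) \<le> 1" if "norm p \<le> K n"
    using power_mono[OF that norm_ge_zero, of 2] k by (simp add: power2_norm_eq_inner divide_le_eq)
  have ge: "2 \<le> 1 / (K n)\<^sup>2 * (p \<bullet> p)" if "2 * K n \<le> norm p"
  proof -
    have "(2 * K n)\<^sup>2 \<le> p \<bullet> p" using power_mono[OF that, of 2] k by (simp add: power2_norm_eq_inner)
    moreover have "2 * (K n)\<^sup>2 \<le> (2 * K n)\<^sup>2" by (simp add: power_mult_distrib)
    ultimately have "2 * (K n)\<^sup>2 \<le> p \<bullet> p" by linarith
    then show ?thesis using k by (simp add: le_divide_eq)
  qed
  show "norm p \<le> K n \<Longrightarrow> \<eta> n p = 1" "norm p \<le> K n \<Longrightarrow> \<eta>' n p = 0"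
    unfolding \<eta>_def \<eta>'_def using le by (simp_all add: cutoff_eq_1 cutoff'_eq_0)
  show z: "2 * K n \<le> norm p \<Longrightarrow> \<eta> n p = 0" "2 * K n \<le> norm p \<Longrightarrow> \<eta>' n p = 0"
    unfolding \<eta>_def \<eta>'_def using ge by (simp_all add: cutoff_eq_0 cutoff'_eq_0)
  show "\<bar>\<eta> n p\<bar> \<le> 4" unfolding \<eta>_def by (rule cutoff_bound)
  show "norm (\<eta>' n p) \<le> 8 / K n"
  proof (cases "2 * K n \<le> norm p")
    case True
    then show ?thesis using z k by simp
  next
    case False
    have "norm (\<eta>' n p) = \<bar>cutoff' (1 / (K n)\<^sup>2 * (p \<bullet> p))\<bar> * (2 / (K n)\<^sup>2 * norm p)"
      unfolding \<eta>'_def norm_scaleR using k by simp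
    also have "\<dots> \<le> 2 * (2 / (K n)\<^sup>2 * (2 * K n))"
      using False k cutoff'_bound by (intro mult_mono mult_left_mono) auto
    also have "\<dots> = 8 / K n" using k by (simp add: power2_eq_square)
    finally show ?thesis .
  qed
qed

text \<open>\<open>A\<close> and \<open>B\<close> are the two parts of the product rule for the
  cutoff times the shifted extension, restricted to the half space: \<open>A\<close> carries the
  gradient of the extension and \<open>B\<close> that of the cutoff.\<close>

definition A :: "nat \<Rightarrow> (real ^ 'm) \<times> real \<Rightarrow> (real ^ 'm) \<times> real" where
  "A n p = (if 0 < snd p then \<eta> n p *\<^sub>R gext (fst p, snd p + \<delta> n) else 0)"
definition B :: "nat \<Rightarrow> (real ^ 'm) \<times> real \<Rightarrow> (real ^ 'm) \<times> real" where
  "B n p = (if 0 < snd p then ext (fst p, snd p + \<delta> n) *\<^sub>R \<eta>' n p else 0)"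

lemma measurable_AB: "A n \<in> borel_measurable borel" "B n \<in> borel_measurable borel"
proof -
  have "continuous_on {p. 0 < snd p} (\<lambda>p. \<eta> n p *\<^sub>R gext (fst p, snd p + \<delta> n))"
    using \<delta>_pos(1)[of n] by (intro continuous_intros \<eta>_continuous continuous_on_compose2[OF continuous_on_gext]) auto
  then show "A n \<in> borel_measurable borel" unfolding A_def[abs_def] by (rule measurable_on_half)
  have "continuous_on {p. 0 < snd p} (\<lambda>p. ext (fst p, snd p + \<delta> n) *\<^sub>R \<eta>' n p)"
    using \<delta>_pos(1)[of n] by (intro continuous_intros \<eta>_continuous continuous_on_compose2[OF continuous_on_ext]) auto
  then show "B n \<in> borel_measurable borel" unfolding B_def[abs_def] by (rule measurable_on_half)
qed

text \<open>The density at the unshifted height bounds the gradient at the shifted one, so a single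
  integrable majorant serves for all n. The factor 16 is the square of the cutoff bound 4.\<close>

lemma A_bound: "ennreal ((norm (A n p))\<^sup>2) \<le> ennreal (16 * (C1\<^sup>2 * \<omega>)) * half_dens p"
proof (cases "0 < snd p")
  case True
  have "(norm (A n p))\<^sup>2 \<le> 16 * (norm (gext (fst p, snd p + \<delta> n)))\<^sup>2"
  proof -
    have "norm (A n p) \<le> 4 * norm (gext (fst p, snd p + \<delta> n))"
      using True \<eta>_props(5)[of n p] by (simp add: A_def mult_right_mono)
    from power_mono[OF this norm_ge_zero, of 2] show ?thesis by (simp add: power_mult_distrib)
  qed
  then have "ennreal ((norm (A n p))\<^sup>2) \<le> ennreal (16 * (norm (gext (fst p, snd p + \<delta> n)))\<^sup>2)" by (rule ennreal_leI)
  also have "\<dots> = ennreal 16 * ennreal ((norm (gext (fst p, snd p + \<delta> n)))\<^sup>2)" by (subst ennreal_mult) auto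
  also have "\<dots> \<le> ennreal 16 * (ennreal (C1\<^sup>2 * \<omega>) * dens (fst p) (snd p))"
    using True \<delta>_pos(1)[of n] by (intro mult_left_mono gext_bound) auto
  also have "\<dots> = ennreal (16 * (C1\<^sup>2 * \<omega>)) * half_dens p"
    using True \<omega>_pos by (subst ennreal_mult) (auto simp: half_dens_def mult.assoc)
  finally show ?thesis .
qed (simp add: A_def)

lemma integrable_uA: "integrable lborel (\<lambda>p. u p \<bullet> A n p)"
proof (rule inner_integral_Cauchy_Schwarz(1))
  have "(\<integral>\<^sup>+p. ennreal ((norm (A n p))\<^sup>2) \<partial>lborel) \<le> (\<integral>\<^sup>+p. ennreal (16 * (C1\<^sup>2 * \<omega>)) * half_dens p \<partial>lborel)"
    by (intro nn_integral_mono A_bound)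
  also have "\<dots> = ennreal (16 * (C1\<^sup>2 * \<omega>)) * (\<integral>\<^sup>+p. half_dens p \<partial>lborel)"
    using measurable_half_dens by (intro nn_integral_cmult) simp
  also have "\<dots> \<le> ennreal (16 * (C1\<^sup>2 * \<omega>)) * (ennreal 2 * ennreal E)"
    using order.trans[OF nn_integral_half_dens mult_left_mono[OF E(1), of 2]] by (intro mult_left_mono) simp_all
  also have "\<dots> = ennreal (16 * (C1\<^sup>2 * \<omega>) * (2 * E))" using E(2) \<omega>_pos by (simp only: ennreal_mult[symmetric]) (subst ennreal_mult[symmetric], simp_all)
  finally show "(\<integral>\<^sup>+p. ennreal ((norm (A n p))\<^sup>2) \<partial>lborel) \<le> ennreal (16 * (C1\<^sup>2 * \<omega>) * (2 * E))" .
qed (use um u2 measurable_AB E \<omega>_pos in auto)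

lemma limit_A: "(\<lambda>n. \<integral>p. u p \<bullet> A n p \<partial>lborel) \<longlonglongrightarrow> (\<integral>p. u p \<bullet> hext p \<partial>lborel)"
proof (rule integral_dominated_convergence[where w = "\<lambda>p. (norm (u p))\<^sup>2 + 16 * (C1\<^sup>2 * \<omega>) * enn2real (half_dens p)"])
  show "(\<lambda>p. u p \<bullet> hext p) \<in> borel_measurable lborel" "(\<lambda>p. u p \<bullet> A n p) \<in> borel_measurable lborel" for n
    using um measurable_hext measurable_AB by auto
  show "integrable lborel (\<lambda>p. (norm (u p))\<^sup>2 + 16 * (C1\<^sup>2 * \<omega>) * enn2real (half_dens p))"
    by (intro Bochner_Integration.integrable_add u2 integrable_mult_right integrable_half_dens)
  show "AE p in lborel. (\<lambda>n. u p \<bullet> A n p) \<longlonglongrightarrow> u p \<bullet> hext p"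
  proof (rule AE_I2)
    fix p :: "(real ^ 'm) \<times> real"
    show "(\<lambda>n. u p \<bullet> A n p) \<longlonglongrightarrow> u p \<bullet> hext p"
    proof (cases "0 < snd p")
      case True
      obtain N where N: "norm p \<le> real N" using real_arch_simple by blast
      have "eventually (\<lambda>n. \<eta> n p = 1) sequentially"
        using eventually_ge_at_top[of N] by eventually_elim (use N in \<open>auto intro!: \<eta>_props simp: K_def\<close>)
      then have e: "(\<lambda>n. \<eta> n p) \<longlonglongrightarrow> 1" by (rule tendsto_eventually)
      have "(\<lambda>n. inverse (K n) ^ (CARD('m) + 2)) \<longlonglongrightarrow> 0 ^ (CARD('m) + 2)"
        unfolding K_def by (intro tendsto_power LIMSEQ_inverse_real_of_nat)
      then have d: "\<delta> \<longlonglongrightarrow> 0" by (simp add: \<delta>_def[abs_def])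
      have "(\<lambda>n. (fst p, snd p + \<delta> n)) \<longlonglongrightarrow> (fst p, snd p + 0)" by (intro tendsto_intros d)
      then have "(\<lambda>n. gext (fst p, snd p + \<delta> n)) \<longlonglongrightarrow> gext p"
        using isCont_tendsto_compose[OF isCont_gext[OF True]] by simp
      then have "(\<lambda>n. u p \<bullet> (\<eta> n p *\<^sub>R gext (fst p, snd p + \<delta> n))) \<longlonglongrightarrow> u p \<bullet> (1 *\<^sub>R gext p)"
        by (intro tendsto_intros e)
      then show ?thesis using True by (simp add: A_def hext_def)
    qed (simp add: A_def hext_def)
  qed
  show "AE p in lborel. norm (u p \<bullet> A n p) \<le> (norm (u p))\<^sup>2 + 16 * (C1\<^sup>2 * \<omega>) * enn2real (half_dens p)" for n
  proof (rule AE_mp[OF AE_half_dens_finite], intro AE_I2 impI)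
    fix p assume "half_dens p < \<infinity>"
    then have hd: "half_dens p = ennreal (enn2real (half_dens p))" by simp
    have "ennreal ((norm (A n p))\<^sup>2) \<le> ennreal (16 * (C1\<^sup>2 * \<omega>)) * ennreal (enn2real (half_dens p))"
      using A_bound[of n p] hd by simp
    also have "\<dots> = ennreal (16 * (C1\<^sup>2 * \<omega>) * enn2real (half_dens p))"
      using \<omega>_pos by (intro ennreal_mult[symmetric]) auto
    finally have 1: "(norm (A n p))\<^sup>2 \<le> 16 * (C1\<^sup>2 * \<omega>) * enn2real (half_dens p)"
      using \<omega>_pos by (subst (asm) ennreal_le_iff) auto
    have "\<bar>u p \<bullet> A n p\<bar> \<le> norm (u p) * norm (A n p)" by (rule Cauchy_Schwarz_ineq2)
    also have "\<dots> \<le> (norm (u p))\<^sup>2 + (norm (A n p))\<^sup>2"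
      using sum_squares_bound[of "norm (u p)" "norm (A n p)"] mult_nonneg_nonneg[OF norm_ge_zero[of "u p"] norm_ge_zero[of "A n p"]] by linarith
    finally show "norm (u p \<bullet> A n p) \<le> (norm (u p))\<^sup>2 + 16 * (C1\<^sup>2 * \<omega>) * enn2real (half_dens p)" using 1 by simp
  qed
qed

text \<open>A bound for the squared L^2 norm of \<open>B n\<close> that is uniform in n. The factor
  256 is 128/K^2 times K times the height 2K, and 1152 = 128 times 9 comes from shifted heights up
  to 3K.\<close>

definition Q :: real where
  "Q = 256 * ((\<integral>x. \<bar>f x\<bar> powr (2 * real CARD('m) / (real CARD('m) - 1)) \<partial>lborel) + \<omega> * 2 ^ CARD('m)) + 1152 * (B0\<^sup>2 * \<omega>) * (2 * E)"

lemma Q_nonneg: "0 \<le> Q"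
  using \<omega>_pos E(2) unfolding Q_def by (intro add_nonneg_nonneg mult_nonneg_nonneg integral_nonneg_AE) auto

text \<open>The extension is split as f plus its deviation from f. The first part is handled by the
  integrability of a power of f, the second by the energy density, whose factor \<tau>^2 is at most
  9 K^2 and cancels the squared cutoff gradient.\<close>

lemma B_bound:
  "ennreal ((norm (B n p))\<^sup>2) \<le> ennreal (128 / (K n)\<^sup>2) * (ennreal ((f (fst p))\<^sup>2) * indicator (cball 0 (2 * K n)) (fst p) * indicator {0..2 * K n} (snd p))
     + ennreal (1152 * (B0\<^sup>2 * \<omega>)) * half_dens p"
proof (cases "0 < snd p \<and> norm p < 2 * K n")
  case True
  then have t: "0 < snd p" by simp
  have np: "norm (fst p) \<le> 2 * K n" "\<bar>snd p\<bar> \<le> 2 * K n"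
    using True norm_fst_le[of "fst p" "snd p"] norm_snd_le[of "snd p" "fst p"] by auto
  define \<tau> where "\<tau> = snd p + \<delta> n"
  have \<tau>: "snd p \<le> \<tau>" "0 < \<tau>" "\<tau> \<le> 3 * K n"
    using t \<delta>_pos[of n] np K_ge[of n] by (auto simp: \<tau>_def)
  define e where "e = ext (fst p, \<tau>)"
  have nB: "norm (B n p) \<le> \<bar>e\<bar> * (8 / K n)"
    using t mult_left_mono[OF \<eta>_props(6)[of n p], of "\<bar>e\<bar>"] by (simp add: B_def e_def \<tau>_def)
  have "e\<^sup>2 \<le> 2 * (f (fst p))\<^sup>2 + 2 * (e - f (fst p))\<^sup>2"
    using sum_squares_bound[of "f (fst p)" "e - f (fst p)"] by (simp add: power2_eq_square algebra_simps)
  then have "e\<^sup>2 * (64 / (K n)\<^sup>2) \<le> (2 * (f (fst p))\<^sup>2 + 2 * (e - f (fst p))\<^sup>2) * (64 / (K n)\<^sup>2)"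
    by (intro mult_right_mono) auto
  moreover have "(norm (B n p))\<^sup>2 \<le> e\<^sup>2 * (64 / (K n)\<^sup>2)"
    using power_mono[OF nB norm_ge_zero, of 2] by (simp add: power_mult_distrib power_divide)
  ultimately have "(norm (B n p))\<^sup>2 \<le> 128 / (K n)\<^sup>2 * (f (fst p))\<^sup>2 + 128 / (K n)\<^sup>2 * (e - f (fst p))\<^sup>2"
    by (simp add: algebra_simps)
  then have "ennreal ((norm (B n p))\<^sup>2) \<le> ennreal (128 / (K n)\<^sup>2 * (f (fst p))\<^sup>2 + 128 / (K n)\<^sup>2 * (e - f (fst p))\<^sup>2)"
    by (rule ennreal_leI)
  also have "\<dots> = ennreal (128 / (K n)\<^sup>2) * ennreal ((f (fst p))\<^sup>2) + ennreal (128 / (K n)\<^sup>2) * ennreal ((e - f (fst p))\<^sup>2)"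
    by (subst ennreal_plus, simp, simp, subst ennreal_mult, simp, simp, subst ennreal_mult, simp_all)
  also have "ennreal (128 / (K n)\<^sup>2) * ennreal ((e - f (fst p))\<^sup>2) \<le> ennreal (1152 * (B0\<^sup>2 * \<omega>)) * half_dens p"
  proof -
    have "ennreal (128 / (K n)\<^sup>2) * ennreal ((e - f (fst p))\<^sup>2) \<le> ennreal (128 / (K n)\<^sup>2) * (ennreal (B0\<^sup>2 * \<omega> * \<tau>\<^sup>2) * dens (fst p) (snd p))"
      unfolding e_def by (intro mult_left_mono ext_minus_le_dens t \<tau>) simp
    also have "\<dots> = ennreal (128 / (K n)\<^sup>2 * (B0\<^sup>2 * \<omega> * \<tau>\<^sup>2)) * half_dens p"
      using t \<omega>_pos by (subst ennreal_mult) (auto simp: half_dens_def mult.assoc)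
    also have "\<dots> \<le> ennreal (1152 * (B0\<^sup>2 * \<omega>)) * half_dens p"
    proof (intro mult_right_mono ennreal_leI)
      have "\<tau>\<^sup>2 \<le> 9 * (K n)\<^sup>2" using power_mono[OF \<tau>(3), of 2] \<tau> by (simp add: power_mult_distrib)
      then have "128 / (K n)\<^sup>2 * (B0\<^sup>2 * \<omega> * \<tau>\<^sup>2) \<le> 128 / (K n)\<^sup>2 * (B0\<^sup>2 * \<omega> * (9 * (K n)\<^sup>2))"
        using \<omega>_pos by (intro mult_left_mono) auto
      also have "\<dots> = 1152 * (B0\<^sup>2 * \<omega>)" using K_ge[of n] by simp
      finally show "128 / (K n)\<^sup>2 * (B0\<^sup>2 * \<omega> * \<tau>\<^sup>2) \<le> 1152 * (B0\<^sup>2 * \<omega>)" .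
    qed simp
    finally show ?thesis .
  qed
  finally show ?thesis using t np by (simp add: add_left_mono)
next
  case False
  then have "B n p = 0" using \<eta>_props(4)[of n p] by (auto simp: B_def)
  then show ?thesis by simp
qed

lemma nn_integral_B: "(\<integral>\<^sup>+p. ennreal ((norm (B n p))\<^sup>2) \<partial>lborel) \<le> ennreal Q"
proof -
  let ?I = "\<lambda>p. ennreal ((f (fst p))\<^sup>2) * indicator (cball 0 (2 * K n)) (fst p) * indicator {0..2 * K n} (snd p)"
  let ?A = "\<integral>x. \<bar>f x\<bar> powr (2 * real CARD('m) / (real CARD('m) - 1)) \<partial>lborel"
  have A0: "0 \<le> ?A" by (intro integral_nonneg_AE) auto
  have [measurable]: "cball (0 :: real ^ 'm) (2 * K n) \<in> sets borel" by simp
  have Im: "?I \<in> borel_measurable (lborel \<Otimes>\<^sub>M lborel)" by measurable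
  have Ib: "?I \<in> borel_measurable lborel" using Im unfolding measurable_lborel_pair by simp
  have "(\<integral>\<^sup>+p. ?I p \<partial>lborel) = (\<integral>\<^sup>+x. \<integral>\<^sup>+t. (ennreal ((f x)\<^sup>2) * indicator (cball 0 (2 * K n)) x) * indicator {0..2 * K n} t \<partial>lborel \<partial>lborel)"
    by (subst nn_integral_lborel_pair[OF Im]) simp
  also have "\<dots> = (\<integral>\<^sup>+x. (ennreal ((f x)\<^sup>2) * indicator (cball 0 (2 * K n)) x) * ennreal (2 * K n) \<partial>lborel)"
    using K_ge[of n] by (intro nn_integral_cong, subst nn_integral_cmult_indicator) auto
  also have "\<dots> = (\<integral>\<^sup>+x. ennreal ((f x)\<^sup>2) * indicator (cball 0 (2 * K n)) x \<partial>lborel) * ennreal (2 * K n)"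
    by (intro nn_integral_multc) measurable
  also have "\<dots> \<le> ennreal (K n * (?A + \<omega> * 2 ^ CARD('m))) * ennreal (2 * K n)"
    by (intro mult_right_mono nn_integral_square_ball K_ge) simp
  finally have I: "(\<integral>\<^sup>+p. ?I p \<partial>lborel) \<le> ennreal (K n * (?A + \<omega> * 2 ^ CARD('m)) * (2 * K n))"
    using A0 \<omega>_pos K_ge[of n] by (subst ennreal_mult) auto
  have "(\<integral>\<^sup>+p. ennreal ((norm (B n p))\<^sup>2) \<partial>lborel) \<le> (\<integral>\<^sup>+p. ennreal (128 / (K n)\<^sup>2) * ?I p + ennreal (1152 * (B0\<^sup>2 * \<omega>)) * half_dens p \<partial>lborel)"
    by (intro nn_integral_mono B_bound)
  also have "\<dots> = ennreal (128 / (K n)\<^sup>2) * (\<integral>\<^sup>+p. ?I p \<partial>lborel) + ennreal (1152 * (B0\<^sup>2 * \<omega>)) * (\<integral>\<^sup>+p. half_dens p \<partial>lborel)"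
    using Ib measurable_half_dens by (subst nn_integral_add) (auto simp: nn_integral_cmult)
  also have "\<dots> \<le> ennreal (128 / (K n)\<^sup>2) * ennreal (K n * (?A + \<omega> * 2 ^ CARD('m)) * (2 * K n)) + ennreal (1152 * (B0\<^sup>2 * \<omega>)) * (ennreal 2 * ennreal E)"
    using I order.trans[OF nn_integral_half_dens mult_left_mono[OF E(1), of 2]] by (intro add_mono mult_left_mono) simp_all
  also have "\<dots> = ennreal (128 / (K n)\<^sup>2 * (K n * (?A + \<omega> * 2 ^ CARD('m)) * (2 * K n)) + 1152 * (B0\<^sup>2 * \<omega>) * (2 * E))"
  proof -
    have nn: "0 \<le> K n * (?A + \<omega> * 2 ^ CARD('m)) * (2 * K n)" "0 \<le> 1152 * (B0\<^sup>2 * \<omega>)" "0 \<le> 2 * E" "0 \<le> 128 / (K n)\<^sup>2"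
      using A0 \<omega>_pos K_ge[of n] E(2) by auto
    show ?thesis
      by (subst ennreal_plus[OF mult_nonneg_nonneg[OF nn(4,1)] mult_nonneg_nonneg[OF nn(2,3)]])
         (simp only: ennreal_mult[OF nn(4,1)] ennreal_mult[OF nn(2,3)] ennreal_mult[OF zero_le_numeral E(2)])
  qed
  also have "128 / (K n)\<^sup>2 * (K n * (?A + \<omega> * 2 ^ CARD('m)) * (2 * K n)) + 1152 * (B0\<^sup>2 * \<omega>) * (2 * E) = Q"
    using K_ge[of n] by (simp add: Q_def power2_eq_square)
  finally show ?thesis .
qed

definition u_tail :: "nat \<Rightarrow> (real ^ 'm) \<times> real \<Rightarrow> (real ^ 'm) \<times> real" where
  "u_tail n p = indicator (- ball 0 (K n)) p *\<^sub>R u p"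

lemma u_tail_B: "u p \<bullet> B n p = u_tail n p \<bullet> B n p"
  using \<eta>_props(2)[of p n] by (auto simp: u_tail_def B_def indicator_def)

lemma measurable_u_tail: "u_tail n \<in> borel_measurable borel"
  unfolding u_tail_def[abs_def] using um by (intro borel_measurable_scaleR borel_measurable_indicator) (auto intro: borel_closed simp: closed_Compl)

lemma integrable_u_tail: "integrable lborel (\<lambda>p. (norm (u_tail n p))\<^sup>2)"
proof (rule Bochner_Integration.integrable_bound[OF u2])
  show "(\<lambda>p. (norm (u_tail n p))\<^sup>2) \<in> borel_measurable lborel" using measurable_u_tail by measurable
qed (auto simp: u_tail_def indicator_def)

lemma integrable_uB: "integrable lborel (\<lambda>p. u p \<bullet> B n p)"
  unfolding u_tail_B
  using inner_integral_Cauchy_Schwarz(1)[OF _ _ integrable_u_tail nn_integral_B Q_nonneg] measurable_u_tail measurable_AB by simp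

text \<open>\<open>B n\<close> is only bounded in L^2, not small. Smallness comes from
  \<open>u\<close>: the cutoff gradient vanishes up to radius \<open>K n\<close>, so only the tail
  of \<open>u\<close> is paired with it.\<close>

lemma limit_B: "(\<lambda>n. \<integral>p. u p \<bullet> B n p \<partial>lborel) \<longlonglongrightarrow> 0"
proof -
  have "(\<lambda>n. \<integral>p. (norm (u_tail n p))\<^sup>2 \<partial>lborel) \<longlonglongrightarrow> (\<integral>p. 0 \<partial>(lborel :: ((real ^ 'm) \<times> real) measure))"
  proof (rule integral_dominated_convergence[where w = "\<lambda>p. (norm (u p))\<^sup>2"])
    show "AE p in lborel. (\<lambda>n. (norm (u_tail n p))\<^sup>2) \<longlonglongrightarrow> 0"
    proof (rule AE_I2)
      fix p :: "(real ^ 'm) \<times> real"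
      obtain N where N: "norm p \<le> real N" using real_arch_simple by blast
      have "eventually (\<lambda>n. (norm (u_tail n p))\<^sup>2 = 0) sequentially"
        using eventually_ge_at_top[of N] by eventually_elim (use N in \<open>auto simp: K_def u_tail_def\<close>)
      then show "(\<lambda>n. (norm (u_tail n p))\<^sup>2) \<longlonglongrightarrow> 0" by (rule tendsto_eventually)
    qed
    show "(\<lambda>p. (norm (u_tail n p))\<^sup>2) \<in> borel_measurable lborel" for n using measurable_u_tail by measurable
    show "AE p in lborel. norm ((norm (u_tail n p))\<^sup>2) \<le> (norm (u p))\<^sup>2" for n by (auto simp: u_tail_def indicator_def)
  qed (use u2 in auto)
  then have "(\<lambda>n. sqrt (\<integral>p. (norm (u_tail n p))\<^sup>2 \<partial>lborel) * sqrt Q) \<longlonglongrightarrow> sqrt 0 * sqrt Q"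
    by (intro tendsto_intros) simp
  then have z: "(\<lambda>n. sqrt (\<integral>p. (norm (u_tail n p))\<^sup>2 \<partial>lborel) * sqrt Q) \<longlonglongrightarrow> 0" by simp
  show ?thesis
    unfolding u_tail_B
    by (rule Lim_null_comparison[OF _ z])
       (use inner_integral_Cauchy_Schwarz(2)[OF _ _ integrable_u_tail nn_integral_B Q_nonneg] measurable_u_tail measurable_AB in \<open>simp add: always_eventually\<close>)
qed

text \<open>The trace identity for the cutoff times the extension at the stretched height. Since
  \<open>u\<close> is zero below the boundary, only heights where the stretch is a plain shift
  count, and on the boundary itself the height becomes \<open>\<delta> n\<close>.\<close>

lemma trace_step: "(\<integral>p. u p \<bullet> A n p \<partial>lborel) + (\<integral>p. u p \<bullet> B n p \<partial>lborel) = (\<integral>x. g x * (\<eta> n (x, 0) * ext (x, \<delta> n)) \<partial>lborel)"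
proof -
  let ?s = "\<lambda>p :: (real ^ 'm) \<times> real. (fst p, stretch (\<delta> n) (snd p))"
  define GS where "GS p = (fst (gext (?s p)), stretch' (\<delta> n) (snd p) * snd (gext (?s p)))" for p
  have pos: "0 < snd (?s p)" for p using stretch_pos[OF \<delta>_pos(1)] by simp
  have g0: "has_gradient (\<lambda>p. ext (?s p)) GS"
    unfolding has_gradient_def
  proof
    fix p :: "(real ^ 'm) \<times> real"
    have "((\<lambda>p :: (real ^ 'm) \<times> real. stretch (\<delta> n) (snd p)) has_derivative (\<lambda>v. snd v * stretch' (\<delta> n) (snd p))) (at p)"
      by (rule DERIV_compose_FDERIV[OF DERIV_stretch[OF \<delta>_pos(1)]]) (auto intro!: derivative_eq_intros)
    then have "(?s has_derivative (\<lambda>v. (fst v, snd v * stretch' (\<delta> n) (snd p)))) (at p)"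
      by (intro has_derivative_Pair) (auto intro!: derivative_eq_intros)
    from has_derivative_compose[OF this ext_has_derivative[OF pos]]
    have "((\<lambda>p. ext (?s p)) has_derivative (\<lambda>v. gext (?s p) \<bullet> (fst v, snd v * stretch' (\<delta> n) (snd p)))) (at p)" .
    moreover have "gext (?s p) \<bullet> (fst v, snd v * stretch' (\<delta> n) (snd p)) = GS p \<bullet> v" for v
      by (simp add: GS_def inner_prod_def)
    ultimately show "((\<lambda>p. ext (?s p)) has_derivative (\<lambda>v. GS p \<bullet> v)) (at p)" by simp
  qed
  have cs: "continuous_on UNIV (\<lambda>p. gext (?s p))"
    using stretch_pos[OF \<delta>_pos(1)[of n]]
    by (intro continuous_on_compose2[OF continuous_on_gext] continuous_intros continuous_on_compose2[OF continuous_stretch(1)[OF \<delta>_pos(1), of UNIV]]) auto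
  have cGS: "continuous_on UNIV GS" unfolding GS_def
    by (intro continuous_intros cs continuous_on_compose2[OF continuous_stretch(2)[OF \<delta>_pos(1), of UNIV]]) auto
  define G where "G p = \<eta> n p *\<^sub>R GS p + ext (?s p) *\<^sub>R \<eta>' n p" for p
  have hg: "has_gradient (\<lambda>p. \<eta> n p * ext (?s p)) G"
    unfolding G_def by (rule has_gradient_mult[OF \<eta>_gradient g0])
  have cG: "continuous_on UNIV G" unfolding G_def
    by (intro continuous_intros \<eta>_continuous cGS has_gradient_continuous[OF g0])
  have "(\<integral>p. u p \<bullet> G p \<partial>lborel) = (\<integral>x. g x * (\<eta> n (x, 0) * ext (?s (x, 0))) \<partial>lborel)"
    by (rule trace[OF hg cG compact_cball[of 0 "2 * K n"]]) (use \<eta>_props(3) in auto)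
  moreover have "u p \<bullet> G p = u p \<bullet> A n p + u p \<bullet> B n p" for p
    using u0[of p] by (cases "0 < snd p") (auto simp: G_def GS_def A_def B_def stretch_nonneg inner_add_right)
  ultimately show ?thesis
    using integrable_uA integrable_uB by (simp add: stretch_nonneg)
qed

text \<open>The boundary value of the shifted extension is f plus a deviation. The f part converges
  because g f is integrable and the cutoff is bounded; the deviation is paired by Cauchy-Schwarz
  with a function supported in a ball of radius \<open>2 * K n\<close> and is of order 1 /
  \<open>K n\<close>.\<close>

lemma limit_boundary: "(\<lambda>n. \<integral>x. g x * (\<eta> n (x, 0) * ext (x, \<delta> n)) \<partial>lborel) \<longlonglongrightarrow> (\<integral>x. g x * f x \<partial>lborel)"
proof -
  have c0: "0 \<le> c" using order.trans[OF abs_ge_zero gc] .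
  have m\<eta>[measurable]: "(\<lambda>x. \<eta> n (x, 0)) \<in> borel_measurable borel" for n
    by (intro borel_measurable_continuous_onI continuous_on_compose2[OF \<eta>_continuous(1)[of UNIV]] continuous_intros) auto
  have me[measurable]: "(\<lambda>x. ext (x, \<delta> n)) \<in> borel_measurable borel" for n
    using \<delta>_pos(1)[of n] by (intro borel_measurable_continuous_onI continuous_on_compose2[OF continuous_on_ext] continuous_intros) auto
  note [measurable] = gm
  define w where "w n x = g x * \<eta> n (x, 0)" for n x
  have [measurable]: "w n \<in> borel_measurable borel" for n unfolding w_def[abs_def] by measurable
  have wb: "\<bar>w n x\<bar> \<le> 4 * c * indicator (cball 0 (2 * K n)) x" for n and x :: "real ^ 'm"
  proof (cases "norm x \<le> 2 * K n")
    case True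
    have "\<bar>g x\<bar> * \<bar>\<eta> n (x, 0)\<bar> \<le> c * 4" using gc[of x] \<eta>_props(5)[of n "(x,0)"] c0 by (intro mult_mono) auto
    then show ?thesis using True by (simp add: w_def abs_mult mult.commute)
  next
    case False
    then show ?thesis using \<eta>_props(3)[of n "(x, 0)"] by (simp add: w_def norm_Pair)
  qed
  have vol: "measure lborel (cball (0 :: real ^ 'm) (2 * K n)) = \<omega> * (2 * K n) ^ CARD('m)" for n
    using K_ge[of n] by (simp add: content_cball \<omega>_def)
  have cbi: "integrable lborel (\<lambda>x. (4 * c)\<^sup>2 * indicator (cball (0 :: real ^ 'm) (2 * K n)) x)" for n
    using emeasure_lborel_cball_finite[of "0 :: real ^ 'm" "2 * K n"] by (intro integrable_mult_right integrable_real_indicator) auto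
  have wsq: "(norm (w n x))\<^sup>2 \<le> (4 * c)\<^sup>2 * indicator (cball 0 (2 * K n)) x" for n and x :: "real ^ 'm"
    using power_mono[OF wb[of n x], of 2] by (auto simp: power_mult_distrib indicator_def)
  have wi: "integrable lborel (\<lambda>x. (norm (w n x))\<^sup>2)" for n
    by (rule Bochner_Integration.integrable_bound[OF cbi[of n]]) (use wsq[of n] in \<open>auto intro!: AE_I2 order.trans[OF _ abs_ge_self]\<close>)
  have wint: "(\<integral>x. (norm (w n x))\<^sup>2 \<partial>lborel) \<le> (4 * c)\<^sup>2 * (\<omega> * (2 * K n) ^ CARD('m))" for n
    using integral_mono[OF wi cbi wsq, of n] by (simp add: vol)
  have vq: "(\<integral>\<^sup>+x. ennreal ((norm (ext (x, \<delta> n) - f x))\<^sup>2) \<partial>lborel) \<le> ennreal (B0\<^sup>2 * \<omega> * \<delta> n * E)" for n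
  proof -
    have "(\<integral>\<^sup>+x. ennreal ((norm (ext (x, \<delta> n) - f x))\<^sup>2) \<partial>lborel) \<le> ennreal (B0\<^sup>2 * \<omega> * \<delta> n) * ennreal E"
      using order.trans[OF ext_minus_L2[OF \<delta>_pos(1)[of n]] mult_left_mono[OF E(1)]] by simp
    then show ?thesis using E(2) \<omega>_pos \<delta>_pos(1)[of n] by (subst ennreal_mult) auto
  qed
  have vq0: "0 \<le> B0\<^sup>2 * \<omega> * \<delta> n * E" for n using E(2) \<omega>_pos \<delta>_pos(1)[of n] by simp
  have i1: "integrable lborel (\<lambda>x. w n x * (ext (x, \<delta> n) - f x))" for n
    using inner_integral_Cauchy_Schwarz(1)[OF _ _ wi vq vq0] by simp
  have i2: "integrable lborel (\<lambda>x. w n x * f x)" for n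
    using integrable_mult_bounded[OF gf, of "\<lambda>x. \<eta> n (x, 0)" 4] \<eta>_props(5) by (simp add: w_def mult_ac)
  have err: "(\<lambda>n. \<integral>x. w n x * (ext (x, \<delta> n) - f x) \<partial>lborel) \<longlonglongrightarrow> 0"
  proof (rule Lim_null_comparison)
    define k where "k = sqrt ((4 * c)\<^sup>2 * \<omega> * 2 ^ CARD('m) * B0\<^sup>2 * \<omega> * E)"
    show "(\<lambda>n. k * inverse (real (Suc n))) \<longlonglongrightarrow> 0"
      by (rule tendsto_mult_right_zero[OF LIMSEQ_inverse_real_of_nat])
    show "\<forall>\<^sub>F n in sequentially. norm (\<integral>x. w n x * (ext (x, \<delta> n) - f x) \<partial>lborel) \<le> k * inverse (real (Suc n))"
    proof (intro always_eventually allI)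
      fix n
      have "\<bar>\<integral>x. w n x * (ext (x, \<delta> n) - f x) \<partial>lborel\<bar> \<le> sqrt (\<integral>x. (norm (w n x))\<^sup>2 \<partial>lborel) * sqrt (B0\<^sup>2 * \<omega> * \<delta> n * E)"
        using inner_integral_Cauchy_Schwarz(2)[OF _ _ wi vq vq0, of n n] by simp
      also have "\<dots> \<le> sqrt ((4 * c)\<^sup>2 * (\<omega> * (2 * K n) ^ CARD('m))) * sqrt (B0\<^sup>2 * \<omega> * \<delta> n * E)"
        by (intro mult_right_mono real_sqrt_le_mono wint) (use vq0 in simp)
      also have "\<dots> = sqrt (((4 * c)\<^sup>2 * (\<omega> * (2 * K n) ^ CARD('m))) * (B0\<^sup>2 * \<omega> * \<delta> n * E))"
        by (rule real_sqrt_mult[symmetric])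
      also have "((4 * c)\<^sup>2 * (\<omega> * (2 * K n) ^ CARD('m))) * (B0\<^sup>2 * \<omega> * \<delta> n * E)
         = (4 * c)\<^sup>2 * \<omega> * 2 ^ CARD('m) * B0\<^sup>2 * \<omega> * E * ((K n * inverse (K n)) ^ CARD('m) * (inverse (K n))\<^sup>2)"
        unfolding \<delta>_def power_mult_distrib power_add by (simp add: mult_ac)
      also have "\<dots> = (4 * c)\<^sup>2 * \<omega> * 2 ^ CARD('m) * B0\<^sup>2 * \<omega> * E * (inverse (K n))\<^sup>2" using K_ge(2)[of n] by simp
      also have "sqrt \<dots> = k * inverse (K n)" using K_ge(2)[of n] unfolding real_sqrt_mult[of _ "(inverse (K n))\<^sup>2"] k_def by simp
      finally show "norm (\<integral>x. w n x * (ext (x, \<delta> n) - f x) \<partial>lborel) \<le> k * inverse (real (Suc n))" by (simp add: K_def)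
    qed
  qed
  have main: "(\<lambda>n. \<integral>x. w n x * f x \<partial>lborel) \<longlonglongrightarrow> (\<integral>x. g x * f x \<partial>lborel)"
  proof (rule integral_dominated_convergence[where w = "\<lambda>x. 4 * \<bar>g x * f x\<bar>"])
    show "AE x in lborel. (\<lambda>n. w n x * f x) \<longlonglongrightarrow> g x * f x"
    proof (rule AE_I2)
      fix x :: "real ^ 'm"
      obtain N where N: "norm x \<le> real N" using real_arch_simple by blast
      have "eventually (\<lambda>n. w n x * f x = g x * f x) sequentially"
        using eventually_ge_at_top[of N] by eventually_elim (use N \<eta>_props(1)[of "(x, 0)"] in \<open>auto simp: K_def w_def norm_Pair\<close>)
      then show "(\<lambda>n. w n x * f x) \<longlonglongrightarrow> g x * f x" by (rule tendsto_eventually)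
    qed
    show "AE x in lborel. norm (w n x * f x) \<le> 4 * \<bar>g x * f x\<bar>" for n
    proof (rule AE_I2)
      fix x
      show "norm (w n x * f x) \<le> 4 * \<bar>g x * f x\<bar>"
        using mult_right_mono[OF \<eta>_props(5)[of n "(x, 0)"], of "\<bar>g x * f x\<bar>"] by (simp add: w_def abs_mult mult_ac)
    qed
  qed (use gf in auto)
  have "(\<lambda>n. (\<integral>x. w n x * f x \<partial>lborel) + (\<integral>x. w n x * (ext (x, \<delta> n) - f x) \<partial>lborel)) \<longlonglongrightarrow> (\<integral>x. g x * f x \<partial>lborel) + 0"
    by (intro tendsto_add main err)
  moreover have "(\<integral>x. w n x * f x \<partial>lborel) + (\<integral>x. w n x * (ext (x, \<delta> n) - f x) \<partial>lborel) = (\<integral>x. g x * (\<eta> n (x, 0) * ext (x, \<delta> n)) \<partial>lborel)" for n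
    by (subst Bochner_Integration.integral_add[OF i2 i1, symmetric]) (simp add: w_def algebra_simps)
  ultimately show ?thesis by simp
qed

lemma pairing_represents: "(\<integral>p. u p \<bullet> hext p \<partial>lborel) = (\<integral>x. g x * f x \<partial>lborel)"
proof -
  have "(\<lambda>n. (\<integral>p. u p \<bullet> A n p \<partial>lborel) + (\<integral>p. u p \<bullet> B n p \<partial>lborel)) \<longlonglongrightarrow> (\<integral>p. u p \<bullet> hext p \<partial>lborel) + 0"
    by (intro tendsto_add limit_A limit_B)
  then show ?thesis unfolding trace_step using limit_boundary LIMSEQ_unique by fastforce
qed

end

end

subsection \<open>Flattening the boundary by a shear\<close>

text \<open>The bound is zero when the boundary seminorm of the field vanishes; then
  \<open>T\<close> is zero on all test functions.\<close>

lemma L1_functional_representation_nonneg: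
  fixes M :: "'a::euclidean_space measure" and T :: "('a \<Rightarrow> real) \<Rightarrow> real"
  assumes M: "sets M = sets borel" "\<And>R. emeasure M (ball 0 R) < \<infinity>"
    and lin: "\<And>\<phi> \<psi> a b. \<phi> \<in> test_functions UNIV \<Longrightarrow> \<psi> \<in> test_functions UNIV \<Longrightarrow> T (\<lambda>x. a * \<phi> x + b * \<psi> x) = a * T \<phi> + b * T \<psi>"
    and bd: "\<And>\<phi>. \<phi> \<in> test_functions UNIV \<Longrightarrow> \<bar>T \<phi>\<bar> \<le> C * (\<integral>x. \<bar>\<phi> x\<bar> \<partial>M)" and C: "C \<ge> 0"
  obtains g where "g \<in> borel_measurable borel" "\<And>x. \<bar>g x\<bar> \<le> 2 * C"
    "\<And>\<phi>. \<phi> \<in> test_functions UNIV \<Longrightarrow> T \<phi> = (\<integral>x. g x * \<phi> x \<partial>M)"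
proof (cases "C = 0")
  case True
  then show ?thesis using bd by (intro that[of "\<lambda>x. 0"]) auto
next
  case False
  with C have "C > 0" by simp
  show ?thesis
    by (rule L1_functional_representation[OF M lin bd \<open>C > 0\<close>]) (use that in auto)
qed

text \<open>Borel measurability is what survives composition with the shear; a Lebesgue measurable
  field is therefore replaced, coordinate by coordinate, by a Borel one equal to it almost
  everywhere.\<close>

lemma borel_representative:
  fixes w :: "'a::euclidean_space \<Rightarrow> 'a"
  assumes "w \<in> borel_measurable lebesgue"
  obtains v where "v \<in> borel_measurable borel" "AE x in lborel. v x = w x"
proof -
  have "\<exists>g\<in>borel_measurable lborel. AE x in lborel. w x \<bullet> b = g x" for b
    by (rule completion_ex_borel_measurable_real) (use assms in measurable)
  then obtain g where g: "\<And>b. g b \<in> borel_measurable lborel" "\<And>b. AE x in lborel. w x \<bullet> b = g b x" by metis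
  show ?thesis
  proof (rule that[of "\<lambda>x. \<Sum>b\<in>Basis. g b x *\<^sub>R b"])
    show "(\<lambda>x. \<Sum>b\<in>Basis. g b x *\<^sub>R b) \<in> borel_measurable borel"
      using g(1) by (intro borel_measurable_sum borel_measurable_scaleR) auto
    have "AE x in lborel. \<forall>b\<in>(Basis :: 'a set). w x \<bullet> b = g b x"
      using g(2) by (intro AE_finite_allI) auto
    then show "AE x in lborel. (\<Sum>b\<in>Basis. g b x *\<^sub>R b) = w x"
    proof eventually_elim
      case (elim x)
      then have "(\<Sum>b\<in>Basis. g b x *\<^sub>R b) = (\<Sum>b\<in>Basis. (w x \<bullet> b) *\<^sub>R b)" by (intro sum.cong) auto
      then show ?case by (simp add: euclidean_representation)
    qed
  qed
qed

context graph_domain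
begin

definition shear :: "(real ^ 'm) \<times> real \<Rightarrow> (real ^ 'm) \<times> real" where
  "shear p = (fst p, snd p + h (fst p))"

definition unshear :: "(real ^ 'm) \<times> real \<Rightarrow> (real ^ 'm) \<times> real" where
  "unshear p = (fst p, snd p - h (fst p))"

lemma shear_inverse [simp]: "shear (unshear p) = p" "unshear (shear p) = p"
  by (simp_all add: shear_def unshear_def)

lemma continuous_shear: "continuous_on S shear" "continuous_on S unshear"
  unfolding shear_def[abs_def] unshear_def[abs_def]
  by (intro continuous_intros continuous_on_compose2[OF continuous_h[of UNIV]]; simp)+

lemma measurable_shear [measurable]: "shear \<in> borel_measurable borel" "unshear \<in> borel_measurable borel"
  by (auto intro: borel_measurable_continuous_onI continuous_shear)

lemma shear_in_domain: "shear p \<in> \<Omega> \<longleftrightarrow> 0 < snd p"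
  by (auto simp: shear_def perturbed_half_space_def)

text \<open>By Tonelli, since the shear translates every vertical line along itself.\<close>

lemma distr_shear: "distr lborel borel shear = lborel"
proof (rule measure_eqI)
  fix A assume "A \<in> sets (distr lborel borel shear)"
  then have A: "A \<in> sets borel" by simp
  have m1: "(\<lambda>p. indicator A (shear p) :: ennreal) \<in> borel_measurable (lborel \<Otimes>\<^sub>M lborel)"
    unfolding measurable_lborel_pair by (rule measurable_compose[OF measurable_shear(1)]) (intro borel_measurable_indicator A)
  have m2: "(\<lambda>p. indicator A p :: ennreal) \<in> borel_measurable (lborel \<Otimes>\<^sub>M lborel)"
    unfolding measurable_lborel_pair by (intro borel_measurable_indicator A)
  have "emeasure (distr lborel borel shear) A = (\<integral>\<^sup>+p. indicator A p \<partial>distr lborel borel shear)"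
    using A by simp
  also have "\<dots> = (\<integral>\<^sup>+p. indicator A (shear p) \<partial>lborel)"
    using A by (subst nn_integral_distr) auto
  also have "\<dots> = (\<integral>\<^sup>+x. \<integral>\<^sup>+t. indicator A (x, t + h x) \<partial>lborel \<partial>lborel)"
    by (subst nn_integral_lborel_pair[OF m1]) (simp add: shear_def)
  also have "\<dots> = (\<integral>\<^sup>+x. \<integral>\<^sup>+t. indicator A (x, t) \<partial>lborel \<partial>lborel)"
  proof (rule nn_integral_cong)
    fix x
    have "(\<lambda>t. indicator A (x, t) :: ennreal) \<in> borel_measurable borel"
      using measurable_compose_Pair1[OF _ m2, of x] by simp
    from nn_integral_real_affine[OF this, of 1 "h x"]
    show "(\<integral>\<^sup>+t. indicator A (x, t + h x) \<partial>lborel) = (\<integral>\<^sup>+t. indicator A (x, t) \<partial>lborel)"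
      by (simp add: add.commute)
  qed
  also have "\<dots> = (\<integral>\<^sup>+p. indicator A p \<partial>lborel)" by (rule nn_integral_lborel_pair[OF m2, symmetric])
  finally show "emeasure (distr lborel borel shear) A = emeasure lborel A" using A by simp
qed simp

lemma integral_shear:
  fixes F :: "(real ^ 'm) \<times> real \<Rightarrow> real"
  assumes "F \<in> borel_measurable borel"
  shows "(\<integral>p. F (shear p) \<partial>lborel) = (\<integral>p. F p \<partial>lborel)"
    "integrable lborel (\<lambda>p. F (shear p)) \<longleftrightarrow> integrable lborel F"
proof -
  show "(\<integral>p. F (shear p) \<partial>lborel) = (\<integral>p. F p \<partial>lborel)"
    by (subst (2) distr_shear[symmetric], subst integral_distr) (use assms in auto)
  show "integrable lborel (\<lambda>p. F (shear p)) \<longleftrightarrow> integrable lborel F"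
    by (subst (2) distr_shear[symmetric], subst integrable_distr_eq) (use assms in auto)
qed

lemma nn_integral_shear:
  assumes "F \<in> borel_measurable borel"
  shows "(\<integral>\<^sup>+p. F (shear p) \<partial>lborel) = (\<integral>\<^sup>+p. F p \<partial>lborel)"
  by (subst (2) distr_shear[symmetric], subst nn_integral_distr) (use assms in auto)

lemma h_has_derivative: "(h has_derivative (\<lambda>v. \<gamma> x \<bullet> v)) (at x)"
  using h by (simp add: has_gradient_def)

text \<open>The gradient of the composition with the shear: the transposed Jacobian applied to the
  field at the sheared point. \<open>push\<close> is the analogue for the inverse shear.\<close>

definition pull :: "((real ^ 'm) \<times> real \<Rightarrow> (real ^ 'm) \<times> real) \<Rightarrow> (real ^ 'm) \<times> real \<Rightarrow> (real ^ 'm) \<times> real" where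
  "pull G q = (fst (G (shear q)) + snd (G (shear q)) *\<^sub>R \<gamma> (fst q), snd (G (shear q)))"

definition push :: "((real ^ 'm) \<times> real \<Rightarrow> (real ^ 'm) \<times> real) \<Rightarrow> (real ^ 'm) \<times> real \<Rightarrow> (real ^ 'm) \<times> real" where
  "push G p = (fst (G (unshear p)) - snd (G (unshear p)) *\<^sub>R \<gamma> (fst p), snd (G (unshear p)))"

lemma has_gradient_shear:
  assumes "has_gradient \<phi> G"
  shows "has_gradient (\<lambda>q. \<phi> (shear q)) (pull G)" "has_gradient (\<lambda>p. \<phi> (unshear p)) (push G)"
  unfolding has_gradient_def
proof (safe)
  fix x :: "real ^ 'm" and t :: real
  let ?q = "(x, t)"
  have dh: "((\<lambda>q. h (fst q)) has_derivative (\<lambda>v. \<gamma> x \<bullet> fst v)) (at ?q)"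
  proof -
    have "(fst has_derivative fst) (at ?q)" by (auto intro!: derivative_eq_intros)
    from has_derivative_compose[OF this h_has_derivative] show ?thesis by simp
  qed
  have "(shear has_derivative (\<lambda>v. (fst v, snd v + \<gamma> x \<bullet> fst v))) (at ?q)"
    unfolding shear_def[abs_def] using dh by (auto intro!: derivative_eq_intros)
  then have "((\<lambda>q. \<phi> (shear q)) has_derivative (\<lambda>v. G (shear ?q) \<bullet> (fst v, snd v + \<gamma> x \<bullet> fst v))) (at ?q)"
    by (rule has_derivative_compose) (rule assms[unfolded has_gradient_def, rule_format])
  then show "((\<lambda>q. \<phi> (shear q)) has_derivative (\<lambda>v. pull G ?q \<bullet> v)) (at ?q)"
    by (simp add: pull_def inner_prod_def inner_add_left algebra_simps)
  have "(unshear has_derivative (\<lambda>v. (fst v, snd v - \<gamma> x \<bullet> fst v))) (at ?q)"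
    unfolding unshear_def[abs_def] using dh by (auto intro!: derivative_eq_intros)
  then have "((\<lambda>q. \<phi> (unshear q)) has_derivative (\<lambda>v. G (unshear ?q) \<bullet> (fst v, snd v - \<gamma> x \<bullet> fst v))) (at ?q)"
    by (rule has_derivative_compose) (rule assms[unfolded has_gradient_def, rule_format])
  then show "((\<lambda>p. \<phi> (unshear p)) has_derivative (\<lambda>v. push G ?q \<bullet> v)) (at ?q)"
    by (simp add: push_def inner_prod_def inner_diff_left algebra_simps)
qed

lemma continuous_pull_push:
  assumes "continuous_on UNIV G"
  shows "continuous_on UNIV (pull G)" "continuous_on UNIV (push G)"
proof -
  have 1: "continuous_on UNIV (\<lambda>q. G (shear q))" "continuous_on UNIV (\<lambda>q. G (unshear q))"
    by (rule continuous_on_compose2[OF assms continuous_shear(1)], simp, rule continuous_on_compose2[OF assms continuous_shear(2)], simp)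
  have 2: "continuous_on UNIV (\<lambda>q :: (real ^ 'm) \<times> real. \<gamma> (fst q))"
    by (rule continuous_on_compose2[OF continuous_\<gamma>[of UNIV]]) (auto intro: continuous_intros)
  show "continuous_on UNIV (pull G)" "continuous_on UNIV (push G)"
    unfolding pull_def[abs_def] push_def[abs_def] by (intro continuous_intros 1 2)+
qed

abbreviation graph :: "real ^ 'm \<Rightarrow> (real ^ 'm) \<times> real" where "graph x \<equiv> (x, h x)"

lemma measurable_graph [measurable]: "graph \<in> borel_measurable borel"
  by (intro borel_measurable_continuous_onI continuous_intros continuous_h)

definition \<mu> :: "((real ^ 'm) \<times> real) measure" where "\<mu> = distr lborel borel graph"

lemma sets_\<mu>: "sets \<mu> = sets borel" by (simp add: \<mu>_def)

lemma \<mu>_ball_finite: "emeasure \<mu> (ball 0 R) < \<infinity>"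
proof -
  have "emeasure \<mu> (ball 0 R) = emeasure lborel (graph -` ball 0 R)"
    unfolding \<mu>_def by (subst emeasure_distr) auto
  also have "\<dots> \<le> emeasure lborel (ball (0 :: real ^ 'm) R)"
    by (intro emeasure_mono) (auto intro: le_less_trans[OF norm_fst_le])
  also have "\<dots> < \<infinity>" by (rule emeasure_lborel_ball_finite)
  finally show ?thesis .
qed

lemma integral_\<mu>: "F \<in> borel_measurable borel \<Longrightarrow> (\<integral>p. F p \<partial>\<mu>) = (\<integral>x. F (graph x) \<partial>lborel)" for F :: "_ \<Rightarrow> real"
  unfolding \<mu>_def by (rule integral_distr) auto

end

subsection \<open>Surface measure on a Lipschitz graph\<close>

context graph_domain
begin

definition \<Gamma> :: "((real ^ 'm) \<times> real) set" where "\<Gamma> = frontier \<Omega>"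

definition S :: "((real ^ 'm) \<times> real) measure" where "S = surface_measure \<Gamma>"

lemma \<Gamma>_eq: "\<Gamma> = range graph" by (simp add: \<Gamma>_def frontier_domain)

lemma \<Gamma>_borel [measurable]: "\<Gamma> \<in> sets borel" unfolding \<Gamma>_def by (simp add: borel_closed)

lemma S_eq: "S = restrict_space (hausdorff_measure CARD('m)) \<Gamma>"
  by (simp add: S_def surface_measure_def)

lemma space_S: "space S = \<Gamma>" by (simp add: S_eq space_restrict_space)

lemma sets_S: "A \<in> sets S \<longleftrightarrow> A \<in> sets borel \<and> A \<subseteq> \<Gamma>"
  unfolding S_eq by (subst sets_restrict_space_iff) auto

lemma emeasure_S: "A \<in> sets S \<Longrightarrow> emeasure S A = hausdorff_outer CARD('m) A"
  unfolding S_eq using sets_S[of A] by (subst emeasure_restrict_space) (auto simp: S_eq emeasure_hausdorff)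

lemma borel_measurable_S: "f \<in> measurable borel M \<Longrightarrow> f \<in> measurable S M"
  unfolding S_eq by (rule measurable_restrict_space1) (simp cong: measurable_cong_sets)

lemma measurable_graph_S [measurable]: "graph \<in> measurable lborel S"
  unfolding S_eq by (rule measurable_restrict_space2) (auto simp: \<Gamma>_eq cong: measurable_cong_sets)

lemma sigma_finite_S: "sigma_finite_measure S"
proof
  define A where "A R = graph ` {x. \<forall>i. \<bar>x $ i\<bar> \<le> real R}" for R
  have A_eq: "A R = \<Gamma> \<inter> {p. \<forall>i. \<bar>fst p $ i\<bar> \<le> real R}" for R by (auto simp: A_def \<Gamma>_eq)
  have "closed {p :: (real ^ 'm) \<times> real. \<forall>i. \<bar>fst p $ i\<bar> \<le> real R}" for R
    by (intro closed_Collect_all closed_Collect_le continuous_intros)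
  then have AS: "A R \<in> sets S" for R unfolding sets_S A_eq by (auto intro: borel_closed)
  have "emeasure S (A R) < \<infinity>" for R
    using hausdorff_outer_graph_finite[OF h_lipschitz, of R] by (simp only: emeasure_S[OF AS]) (simp only: A_def)
  moreover have "\<Gamma> \<subseteq> (\<Union>R. A R)"
  proof
    fix p assume p: "p \<in> \<Gamma>"
    obtain R where "norm (fst p) \<le> real R" using real_arch_simple by blast
    then have "p \<in> A R" using p order.trans[OF component_le_norm_cart] unfolding A_eq by blast
    then show "p \<in> (\<Union>R. A R)" by blast
  qed
  ultimately show "\<exists>A. countable A \<and> A \<subseteq> sets S \<and> \<Union> A = space S \<and> (\<forall>a\<in>A. emeasure S a \<noteq> \<infinity>)"
    using AS by (intro exI[of _ "range A"]) (force simp: space_S A_eq less_top)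
qed

text \<open>The same transport of Lebesgue measure as \<open>\<mu>\<close>, but on the sigma-algebra
  of the surface measure, where Radon-Nikodym can be applied.\<close>

definition \<nu> :: "((real ^ 'm) \<times> real) measure" where "\<nu> = distr lborel S graph"

lemma \<nu>_le: 
  assumes A: "A \<in> sets S"
  shows "emeasure \<nu> A \<le> ennreal (2 ^ CARD('m)) * emeasure S A"
proof -
  let ?P = "graph -` A"
  have P: "?P \<in> sets borel" using A measurable_sets[OF measurable_graph, of A] by (simp add: sets_S)
  have "emeasure \<nu> A = emeasure lborel ?P" unfolding \<nu>_def using A by (subst emeasure_distr) auto
  also have "\<dots> = ennreal (2 ^ CARD('m)) * (ennreal ((1/2) ^ CARD('m)) * emeasure lborel ?P)"
    by (simp add: mult.assoc[symmetric] ennreal_mult[symmetric] power_mult_distrib[symmetric])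
  also have "\<dots> \<le> ennreal (2 ^ CARD('m)) * hausdorff_outer CARD('m) A"
    by (intro mult_left_mono lborel_le_hausdorff P) force+
  finally show ?thesis by (simp add: emeasure_S[OF A])
qed

text \<open>A version of the density of \<open>\<nu>\<close> with respect to the surface measure
  that is bounded everywhere. The bound 2^m undoes the factor (1/2)^m lost when Hausdorff and
  Lebesgue measure were compared.\<close>

definition has_surface_density :: "((real ^ 'm) \<times> real \<Rightarrow> real) \<Rightarrow> bool" where
  "has_surface_density r \<longleftrightarrow> r \<in> borel_measurable S \<and> (\<forall>x. 0 \<le> r x \<and> r x \<le> 2 ^ CARD('m)) \<and> density S (\<lambda>x. ennreal (r x)) = \<nu>"

lemma ex_surface_density: "\<exists>r. has_surface_density r"
proof -
  interpret sigma_finite_measure S by (rule sigma_finite_S)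
  have "absolutely_continuous S \<nu>"
    unfolding absolutely_continuous_def
  proof
    fix A assume "A \<in> null_sets S"
    then show "A \<in> null_sets \<nu>" using \<nu>_le[of A] by (auto simp: null_sets_def \<nu>_def)
  qed
  then obtain k where k[measurable]: "k \<in> borel_measurable S" and kN: "density S k = \<nu>"
    using Radon_Nikodym[of \<nu>] by (auto simp: \<nu>_def)
  have AE: "AE x in S. k x \<le> ennreal (2 ^ CARD('m))"
  proof (rule AE_le_of_set_nn_integral_le[OF sigma_finite_S k])
    fix A assume A: "A \<in> sets S"
    show "(\<integral>\<^sup>+x. k x * indicator A x \<partial>S) \<le> ennreal (2 ^ CARD('m)) * emeasure S A"
      using \<nu>_le[OF A] emeasure_density[OF k A] kN by simp
  qed
  define r where "r x = enn2real (min (k x) (ennreal (2 ^ CARD('m))))" for x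
  have rm: "r \<in> borel_measurable S" unfolding r_def[abs_def] by measurable
  have "r x \<le> 2 ^ CARD('m)" for x unfolding r_def by (intro enn2real_leI) auto
  moreover have "density S (\<lambda>x. ennreal (r x)) = density S k"
  proof (rule density_cong)
    show "AE x in S. ennreal (r x) = k x"
    proof (rule AE_mp[OF AE], intro AE_I2 impI)
      fix x assume "k x \<le> ennreal (2 ^ CARD('m))"
      then show "ennreal (r x) = k x" unfolding r_def
        by (subst ennreal_enn2real) (auto simp: min_absorb1 intro: le_less_trans)
    qed
  qed (use rm in auto)
  ultimately show ?thesis using rm kN by (intro exI[of _ r]) (auto simp: has_surface_density_def r_def)
qed

context
  fixes r assumes r: "has_surface_density r"
begin

lemma r_measurable [measurable]: "r \<in> borel_measurable S" and r_bounds: "0 \<le> r x" "r x \<le> 2 ^ CARD('m)"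
  and r_density: "density S (\<lambda>x. ennreal (r x)) = \<nu>"
  using r unfolding has_surface_density_def by blast+

lemma integral_graph:
  fixes F :: "_ \<Rightarrow> real"
  assumes [measurable]: "F \<in> borel_measurable S"
  shows "integrable S (\<lambda>p. r p * F p) \<longleftrightarrow> integrable lborel (\<lambda>x. F (graph x))"
    "(\<integral>p. r p * F p \<partial>S) = (\<integral>x. F (graph x) \<partial>lborel)"
proof -
  have r0: "AE x in S. 0 \<le> r x" using r_bounds by simp
  have "integrable S (\<lambda>p. r p * F p) \<longleftrightarrow> integrable \<nu> F"
    unfolding r_density[symmetric] using integrable_real_density[OF r_measurable r0 assms] by simp
  then show "integrable S (\<lambda>p. r p * F p) \<longleftrightarrow> integrable lborel (\<lambda>x. F (graph x))"
    unfolding \<nu>_def by (simp add: integrable_distr_eq)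
  have "(\<integral>p. r p * F p \<partial>S) = integral\<^sup>L \<nu> F"
    unfolding r_density[symmetric] using integral_real_density[OF r_measurable r0 assms] by simp
  then show "(\<integral>p. r p * F p \<partial>S) = (\<integral>x. F (graph x) \<partial>lborel)"
    unfolding \<nu>_def by (simp add: integral_distr)
qed

lemma nn_integral_graph_le:
  assumes [measurable]: "F \<in> borel_measurable S"
  shows "(\<integral>\<^sup>+x. F (graph x) \<partial>lborel) \<le> ennreal (2 ^ CARD('m)) * (\<integral>\<^sup>+p. F p \<partial>S)"
proof -
  have "(\<integral>\<^sup>+x. F (graph x) \<partial>lborel) = (\<integral>\<^sup>+p. F p \<partial>\<nu>)" unfolding \<nu>_def by (subst nn_integral_distr) auto
  also have "\<dots> = (\<integral>\<^sup>+p. ennreal (r p) * F p \<partial>S)" unfolding r_density[symmetric] by (subst nn_integral_density) auto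
  also have "\<dots> \<le> (\<integral>\<^sup>+p. ennreal (2 ^ CARD('m)) * F p \<partial>S)" by (intro nn_integral_mono mult_right_mono ennreal_leI r_bounds) simp
  also have "\<dots> = ennreal (2 ^ CARD('m)) * (\<integral>\<^sup>+p. F p \<partial>S)" by (intro nn_integral_cmult) measurable
  finally show ?thesis .
qed

lemma norm_graph_diff: "norm (graph x - graph y) \<le> (1 + L) * norm (x - y)"
proof -
  have "norm (graph x - graph y) \<le> norm (x - y) + norm (h x - h y)" using norm_Pair_le[of "x - y" "h x - h y"] by simp
  then show ?thesis using h_lipschitz[of x y] by (simp add: algebra_simps)
qed

text \<open>Distances on the graph exceed those of the projections by at most the factor 1 + L,
  raised here to the power n = m + 1 of the kernel. Each of the two integrations costs the density
  bound 2^m.\<close>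

lemma energy_graph_le:
  assumes f: "f \<in> borel_measurable S"
  shows "(\<integral>\<^sup>+x. \<integral>\<^sup>+y. ennreal ((f (graph y) - f (graph x))\<^sup>2 / norm (y - x) ^ (CARD('m) + 1)) \<partial>lborel \<partial>lborel)
    \<le> ennreal ((1 + L) ^ (CARD('m) + 1) * 4 ^ CARD('m)) * Hhalf_energy \<Gamma> f"
proof -
  interpret sigma_finite_measure S by (rule sigma_finite_S)
  note [measurable] = f
  have [measurable]: "(\<lambda>p. p) \<in> borel_measurable S" by (rule borel_measurable_S) simp
  let ?c = "(1 + L) ^ (CARD('m) + 1)"
  let ?e = "\<lambda>X Y. ennreal (\<bar>f X - f Y\<bar>\<^sup>2 / norm (X - Y) ^ DIM((real ^ 'm) \<times> real))"
  have D: "DIM((real ^ 'm) \<times> real) = CARD('m) + 1" by simp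
  have pt: "ennreal ((f (graph y) - f (graph x))\<^sup>2 / norm (y - x) ^ (CARD('m) + 1)) \<le> ennreal ?c * ?e (graph x) (graph y)" for x y
  proof (cases "x = y")
    case False
    then have n: "0 < norm (y - x)" "0 < norm (graph x - graph y)" by (auto simp: zero_prod_def)
    have "norm (graph x - graph y) ^ (CARD('m) + 1) \<le> ((1 + L) * norm (y - x)) ^ (CARD('m) + 1)"
      using norm_graph_diff[of x y] by (intro power_mono) (auto simp: norm_minus_commute)
    then have "(f (graph y) - f (graph x))\<^sup>2 * norm (graph x - graph y) ^ (CARD('m) + 1) \<le> (f (graph y) - f (graph x))\<^sup>2 * (?c * norm (y - x) ^ (CARD('m) + 1))"
      unfolding power_mult_distrib by (intro mult_left_mono) auto
    then have "(f (graph y) - f (graph x))\<^sup>2 / norm (y - x) ^ (CARD('m) + 1) \<le> ?c * ((f (graph y) - f (graph x))\<^sup>2 / norm (graph x - graph y) ^ (CARD('m) + 1))"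
      using n by (simp add: divide_le_eq le_divide_eq pos_divide_le_eq field_simps del: power_Suc power_Suc2 Suc_eq_plus1 add_Suc_right)
    also have "\<dots> = ?c * (\<bar>f (graph x) - f (graph y)\<bar>\<^sup>2 / norm (graph x - graph y) ^ (CARD('m) + 1))"
      by (simp add: power2_commute)
    finally show ?thesis unfolding D using L_nonneg by (subst ennreal_mult[symmetric]) (auto intro!: ennreal_leI)
  qed simp
  have "(\<integral>\<^sup>+x. \<integral>\<^sup>+y. ennreal ((f (graph y) - f (graph x))\<^sup>2 / norm (y - x) ^ (CARD('m) + 1)) \<partial>lborel \<partial>lborel)
     \<le> (\<integral>\<^sup>+x. \<integral>\<^sup>+y. ennreal ?c * ?e (graph x) (graph y) \<partial>lborel \<partial>lborel)"
    by (intro nn_integral_mono pt)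
  also have "\<dots> \<le> (\<integral>\<^sup>+x. ennreal (2 ^ CARD('m)) * (\<integral>\<^sup>+Y. ennreal ?c * ?e (graph x) Y \<partial>S) \<partial>lborel)"
    by (intro nn_integral_mono nn_integral_graph_le) measurable
  also have "\<dots> \<le> ennreal (2 ^ CARD('m)) * (\<integral>\<^sup>+X. ennreal (2 ^ CARD('m)) * (\<integral>\<^sup>+Y. ennreal ?c * ?e X Y \<partial>S) \<partial>S)"
    by (intro nn_integral_graph_le) measurable
  also have "(\<integral>\<^sup>+X. ennreal (2 ^ CARD('m)) * (\<integral>\<^sup>+Y. ennreal ?c * ?e X Y \<partial>S) \<partial>S) = ennreal (2 ^ CARD('m)) * (\<integral>\<^sup>+X. (\<integral>\<^sup>+Y. ennreal ?c * ?e X Y \<partial>S) \<partial>S)"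
    by (intro nn_integral_cmult) measurable
  also have "(\<integral>\<^sup>+X. (\<integral>\<^sup>+Y. ennreal ?c * ?e X Y \<partial>S) \<partial>S) = (\<integral>\<^sup>+X. ennreal ?c * (\<integral>\<^sup>+Y. ?e X Y \<partial>S) \<partial>S)"
    by (intro nn_integral_cong nn_integral_cmult) measurable
  also have "\<dots> = ennreal ?c * (\<integral>\<^sup>+X. (\<integral>\<^sup>+Y. ?e X Y \<partial>S) \<partial>S)"
    by (intro nn_integral_cmult) measurable
  also have "ennreal (2 ^ CARD('m)) * (ennreal (2 ^ CARD('m)) * (ennreal ?c * (\<integral>\<^sup>+X. (\<integral>\<^sup>+Y. ?e X Y \<partial>S) \<partial>S)))
     = ennreal (?c * 4 ^ CARD('m)) * Hhalf_energy \<Gamma> f"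
  proof -
    have "ennreal (?c * 4 ^ CARD('m)) = ennreal (2 ^ CARD('m)) * (ennreal (2 ^ CARD('m)) * ennreal ?c)"
      using L_nonneg by (simp add: ennreal_mult[symmetric] power_mult_distrib[symmetric] mult.commute)
    then show ?thesis unfolding Hhalf_energy_def S_def[symmetric] by (simp only: mult.assoc)
  qed
  finally show ?thesis .
qed

end

end

subsection \<open>Solenoidal fields\<close>

locale solenoidal_field = graph_domain h \<gamma> K L for h :: "real ^ 'm \<Rightarrow> real" and \<gamma> K L +
  fixes w :: "(real ^ 'm) \<times> real \<Rightarrow> (real ^ 'm) \<times> real"
  assumes dim: "2 \<le> CARD('m)" and w: "w \<in> vBMOL2 \<Omega>" and div_w: "div_free \<Omega> w"
begin

lemma domain_sets [measurable]: "\<Omega> \<in> sets borel" "\<Omega> \<in> sets lebesgue"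
  using open_domain by auto

lemma w_L2: "w \<in> borel_measurable (lebesgue_on \<Omega>)" "integrable (lebesgue_on \<Omega>) (\<lambda>x. (norm (w x))\<^sup>2)"
  using w by (auto simp: vBMOL2_def L2_space_def)

lemma measurable_w1: "(\<lambda>x. indicator \<Omega> x *\<^sub>R w x) \<in> borel_measurable lebesgue"
  using w_L2(1) by (subst (asm) borel_measurable_restrict_space_iff) auto

text \<open>A Borel version of the field, extended by zero outside the domain.\<close>

definition v :: "(real ^ 'm) \<times> real \<Rightarrow> (real ^ 'm) \<times> real" where
  "v = (SOME v. v \<in> borel_measurable borel \<and> (AE x in lborel. v x = indicator \<Omega> x *\<^sub>R w x) \<and> (\<forall>x. x \<notin> \<Omega> \<longrightarrow> v x = 0))"

lemma v: "v \<in> borel_measurable borel" "AE x in lborel. v x = indicator \<Omega> x *\<^sub>R w x" "x \<notin> \<Omega> \<Longrightarrow> v x = 0"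
proof -
  obtain v0 where v0: "v0 \<in> borel_measurable borel" "AE x in lborel. v0 x = indicator \<Omega> x *\<^sub>R w x"
    using borel_representative[OF measurable_w1] by blast
  define v1 where "v1 x = indicator \<Omega> x *\<^sub>R v0 x" for x
  have "v1 \<in> borel_measurable borel" unfolding v1_def[abs_def] using v0(1) by measurable
  moreover have "AE x in lborel. v1 x = indicator \<Omega> x *\<^sub>R w x"
    using v0(2) by eventually_elim (auto simp: v1_def indicator_def)
  ultimately have "\<exists>v. v \<in> borel_measurable borel \<and> (AE x in lborel. v x = indicator \<Omega> x *\<^sub>R w x) \<and> (\<forall>x. x \<notin> \<Omega> \<longrightarrow> v x = 0)"
    by (intro exI[of _ v1]) (auto simp: v1_def)
  from someI_ex[OF this] show "v \<in> borel_measurable borel" "AE x in lborel. v x = indicator \<Omega> x *\<^sub>R w x" "x \<notin> \<Omega> \<Longrightarrow> v x = 0"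
    unfolding v_def[symmetric] by blast+
qed

lemma v_AE_lebesgue: "AE x in lebesgue. v x = indicator \<Omega> x *\<^sub>R w x"
  using v(2) by (rule AE_completion)

lemma integral_w:
  assumes G: "G \<in> borel_measurable borel"
  shows "(\<integral>x. w x \<bullet> G x \<partial>lebesgue_on \<Omega>) = (\<integral>x. v x \<bullet> G x \<partial>lborel)"
proof -
  have Gl: "G \<in> borel_measurable lebesgue" and vl: "v \<in> borel_measurable lebesgue"
    using G v(1) by (auto intro: measurable_completion)
  have "(\<integral>x. w x \<bullet> G x \<partial>lebesgue_on \<Omega>) = (\<integral>x. indicator \<Omega> x *\<^sub>R (w x \<bullet> G x) \<partial>lebesgue)"
    by (rule integral_restrict_space) simp
  also have "\<dots> = (\<integral>x. (indicator \<Omega> x *\<^sub>R w x) \<bullet> G x \<partial>lebesgue)" by simp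
  also have "\<dots> = (\<integral>x. v x \<bullet> G x \<partial>lebesgue)"
  proof (rule integral_cong_AE)
    show "AE x in lebesgue. (indicator \<Omega> x *\<^sub>R w x) \<bullet> G x = v x \<bullet> G x"
      using v_AE_lebesgue by eventually_elim simp
  qed (rule borel_measurable_inner[OF measurable_w1 Gl] borel_measurable_inner[OF vl Gl])+
  also have "\<dots> = (\<integral>x. v x \<bullet> G x \<partial>lborel)"
    using v(1) G by (intro integral_completion) auto
  finally show ?thesis .
qed

lemma v_L2: "integrable lborel (\<lambda>x. (norm (v x))\<^sup>2)" "(\<integral>x. (norm (v x))\<^sup>2 \<partial>lborel) = (L2_norm \<Omega> w)\<^sup>2"
proof -
  have vb: "(\<lambda>x. (norm (v x))\<^sup>2) \<in> borel_measurable lborel" using v(1) by simp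
  have vl: "(\<lambda>x. (norm (v x))\<^sup>2) \<in> borel_measurable lebesgue" using vb by (rule measurable_completion)
  have wl: "(\<lambda>x. indicator \<Omega> x *\<^sub>R (norm (w x))\<^sup>2) \<in> borel_measurable lebesgue"
  proof -
    have "(\<lambda>x. (norm (indicator \<Omega> x *\<^sub>R w x))\<^sup>2) \<in> borel_measurable lebesgue" using measurable_w1 by measurable
    moreover have "(\<lambda>x. (norm (indicator \<Omega> x *\<^sub>R w x))\<^sup>2) = (\<lambda>x. indicator \<Omega> x *\<^sub>R (norm (w x))\<^sup>2)" by (auto simp: indicator_def)
    ultimately show ?thesis by simp
  qed
  have ae: "AE x in lebesgue. indicator \<Omega> x *\<^sub>R (norm (w x))\<^sup>2 = (norm (v x))\<^sup>2"
    using v_AE_lebesgue by eventually_elim (auto simp: indicator_def)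
  have "integrable lebesgue (\<lambda>x. indicator \<Omega> x *\<^sub>R (norm (w x))\<^sup>2)"
    using w_L2(2) by (subst (asm) integrable_restrict_space) auto
  then have "integrable lebesgue (\<lambda>x. (norm (v x))\<^sup>2)" by (subst (asm) integrable_cong_AE[OF wl vl ae])
  then show "integrable lborel (\<lambda>x. (norm (v x))\<^sup>2)" using vb by (simp add: integrable_completion)
  have "(\<integral>x. (norm (w x))\<^sup>2 \<partial>lebesgue_on \<Omega>) = (\<integral>x. indicator \<Omega> x *\<^sub>R (norm (w x))\<^sup>2 \<partial>lebesgue)"
    by (rule integral_restrict_space) simp
  also have "\<dots> = (\<integral>x. (norm (v x))\<^sup>2 \<partial>lebesgue)" by (rule integral_cong_AE[OF wl vl ae])
  also have "\<dots> = (\<integral>x. (norm (v x))\<^sup>2 \<partial>lborel)" by (rule integral_completion[OF vb])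
  finally show "(\<integral>x. (norm (v x))\<^sup>2 \<partial>lborel) = (L2_norm \<Omega> w)\<^sup>2"
    unfolding L2_norm_def by (simp add: integral_nonneg_AE)
qed

lemma v_locally_integrable: "integrable lborel (\<lambda>x. indicator (ball 0 R) x *\<^sub>R v x)"
proof (rule Bochner_Integration.integrable_bound)
  show "integrable lborel (\<lambda>x. indicator (ball 0 R) x + (norm (v x))\<^sup>2)"
    using emeasure_lborel_ball_finite[of "0 :: (real ^ 'm) \<times> real" R] by (intro Bochner_Integration.integrable_add v_L2 integrable_real_indicator) auto
  show "AE x in lborel. norm (indicator (ball 0 R) x *\<^sub>R v x) \<le> norm (indicator (ball 0 R) x + (norm (v x))\<^sup>2)"
  proof (rule AE_I2)
    fix x
    have "norm (v x) \<le> 1 + (norm (v x))\<^sup>2"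
      using sum_squares_bound[of "norm (v x)" 1] norm_ge_zero[of "v x"] by (simp, linarith)
    then show "norm (indicator (ball 0 R) x *\<^sub>R v x) \<le> norm (indicator (ball 0 R) x + (norm (v x))\<^sup>2)"
      by (auto simp: indicator_def)
  qed
next
  show "(\<lambda>x. indicator (ball 0 R) x *\<^sub>R v x) \<in> borel_measurable lborel"
    using v(1) by (intro borel_measurable_scaleR borel_measurable_indicator) auto
qed

text \<open>The Piola transform of \<open>v\<close> under the shear, whose Jacobian determinant is
  one. It preserves pairings with gradients, hence the divergence condition, and its vertical
  component is the product of \<open>v\<close> with the normal \<open>N\<close>.\<close>

definition u :: "(real ^ 'm) \<times> real \<Rightarrow> (real ^ 'm) \<times> real" where
  "u q = (fst (v (shear q)), snd (v (shear q)) - \<gamma> (fst q) \<bullet> fst (v (shear q)))"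

lemma u_pull: "u q \<bullet> pull G q = v (shear q) \<bullet> G (shear q)"
  by (simp add: u_def pull_def inner_prod_def inner_add_right inner_commute algebra_simps)

lemma u_push: "u q \<bullet> G q = v (shear q) \<bullet> push G (shear q)"
proof -
  have "fst (shear q) = fst q" by (simp add: shear_def)
  then show ?thesis by (simp add: u_def push_def inner_prod_def inner_diff_right inner_commute algebra_simps)
qed

lemma measurable_u: "u \<in> borel_measurable borel"
proof -
  have c: "continuous_on UNIV (\<lambda>q :: (real ^ 'm) \<times> real. \<gamma> (fst q))"
    by (rule continuous_on_compose2[OF continuous_\<gamma>[of UNIV]]) (auto intro: continuous_intros)
  have [measurable]: "(\<lambda>q. \<gamma> (fst q)) \<in> borel_measurable (borel :: ((real ^ 'm) \<times> real) measure)"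
    using c by (rule borel_measurable_continuous_onI)
  have vs: "(\<lambda>q. v (shear q)) \<in> borel_measurable borel" using v(1) measurable_shear(1) by (rule measurable_compose[rotated])
  have "continuous_on UNIV (fst :: (real ^ 'm) \<times> real \<Rightarrow> _)" "continuous_on UNIV (snd :: (real ^ 'm) \<times> real \<Rightarrow> _)"
    by (auto intro: continuous_intros)
  note fs = this[THEN borel_measurable_continuous_onI]
  have [measurable]: "(\<lambda>q. fst (v (shear q))) \<in> borel_measurable borel" "(\<lambda>q. snd (v (shear q))) \<in> borel_measurable borel"
    using measurable_compose[OF vs fs(1)] measurable_compose[OF vs fs(2)] .
  have "(\<lambda>q. snd (v (shear q)) - \<gamma> (fst q) \<bullet> fst (v (shear q))) \<in> borel_measurable borel" by measurable
  then show ?thesis unfolding u_def[abs_def]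
    by (intro borel_measurable_Pair) auto
qed

lemma norm_pair_sum: "norm p \<le> norm (fst p) + \<bar>snd p\<bar>" for p :: "(real ^ 'm) \<times> real"
  using norm_Pair_le[of "fst p" "snd p"] by simp

lemma norm_u_v: "norm (u q) \<le> (2 + L) * norm (v (shear q))" "norm (v (shear q)) \<le> (2 + L) * norm (u q)"
proof -
  let ?v = "v (shear q)"
  have g: "\<bar>\<gamma> (fst q) \<bullet> z\<bar> \<le> L * norm z" for z
    by (rule order.trans[OF Cauchy_Schwarz_ineq2]) (intro mult_right_mono gL norm_ge_zero)
  have n: "norm (fst p) \<le> norm p" "\<bar>snd p\<bar> \<le> norm p" for p :: "(real ^ 'm) \<times> real"
    using norm_fst_le[of "fst p" "snd p"] norm_snd_le[of "snd p" "fst p"] by auto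
  have "norm (u q) \<le> norm (fst ?v) + \<bar>snd ?v - \<gamma> (fst q) \<bullet> fst ?v\<bar>"
    using norm_pair_sum[of "u q"] by (simp add: u_def)
  also have "\<dots> \<le> norm ?v + norm ?v + L * norm ?v"
    using n[of ?v] g[of "fst ?v"] mult_left_mono[OF n(1)[of ?v] L_nonneg] by linarith
  finally show "norm (u q) \<le> (2 + L) * norm ?v" by (simp add: algebra_simps)
  have f: "fst ?v = fst (u q)" "snd ?v = snd (u q) + \<gamma> (fst q) \<bullet> fst (u q)" by (simp_all add: u_def)
  have "norm ?v \<le> norm (fst (u q)) + \<bar>snd (u q) + \<gamma> (fst q) \<bullet> fst (u q)\<bar>"
    using norm_pair_sum[of ?v] unfolding f by simp
  also have "\<dots> \<le> norm (u q) + norm (u q) + L * norm (u q)"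
    using n[of "u q"] g[of "fst (u q)"] mult_left_mono[OF n(1)[of "u q"] L_nonneg] by linarith
  finally show "norm ?v \<le> (2 + L) * norm (u q)" by (simp add: algebra_simps)
qed

lemma u_L2: "integrable lborel (\<lambda>q. (norm (u q))\<^sup>2)"
  "sqrt (\<integral>q. (norm (u q))\<^sup>2 \<partial>lborel) \<le> (2 + L) * L2_norm \<Omega> w"
proof -
  have sq: "(norm (u q))\<^sup>2 \<le> (2 + L)\<^sup>2 * (norm (v (shear q)))\<^sup>2" for q
    using power_mono[OF norm_u_v(1)[of q] norm_ge_zero, of 2] by (simp add: power_mult_distrib)
  have F: "(\<lambda>p. (norm (v p))\<^sup>2) \<in> borel_measurable borel" using v(1) by simp
  have i: "integrable lborel (\<lambda>q. (2 + L)\<^sup>2 * (norm (v (shear q)))\<^sup>2)"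
    using integral_shear(2)[OF F] v_L2(1) by (intro integrable_mult_right) simp
  show iu: "integrable lborel (\<lambda>q. (norm (u q))\<^sup>2)"
    by (rule Bochner_Integration.integrable_bound[OF i]) (use measurable_u sq in \<open>auto intro!: AE_I2\<close>)
  have "(\<integral>q. (norm (u q))\<^sup>2 \<partial>lborel) \<le> (\<integral>q. (2 + L)\<^sup>2 * (norm (v (shear q)))\<^sup>2 \<partial>lborel)"
    by (rule integral_mono[OF iu i sq])
  also have "\<dots> = ((2 + L) * L2_norm \<Omega> w)\<^sup>2"
    using integral_shear(1)[OF F] v_L2(2) by (simp add: power_mult_distrib)
  finally have "sqrt (\<integral>q. (norm (u q))\<^sup>2 \<partial>lborel) \<le> sqrt (((2 + L) * L2_norm \<Omega> w)\<^sup>2)" by (rule real_sqrt_le_mono)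
  also have "\<dots> = (2 + L) * L2_norm \<Omega> w"
    using L_nonneg by (simp add: L2_norm_def integral_nonneg_AE)
  finally show "sqrt (\<integral>q. (norm (u q))\<^sup>2 \<partial>lborel) \<le> (2 + L) * L2_norm \<Omega> w" .
qed

lemma integral_u_push:
  assumes "G \<in> borel_measurable borel" "push G \<in> borel_measurable borel"
  shows "(\<integral>q. u q \<bullet> G q \<partial>lborel) = (\<integral>p. v p \<bullet> push G p \<partial>lborel)"
  unfolding u_push using assms v(1) by (intro integral_shear(1)) auto

lemma push_support:
  assumes "compact C"
  shows "compact (shear ` C)" "(\<And>p. p \<notin> C \<Longrightarrow> \<psi> p = 0) \<Longrightarrow> p \<notin> shear ` C \<Longrightarrow> \<psi> (unshear p) = 0"
proof -
  show "compact (shear ` C)" using assms(1) by (intro compact_continuous_image continuous_shear)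
  show "\<psi> (unshear p) = 0" if z: "\<And>p. p \<notin> C \<Longrightarrow> \<psi> p = 0" and "p \<notin> shear ` C"
  proof (rule z)
    show "unshear p \<notin> C"
    proof
      assume "unshear p \<in> C"
      then have "shear (unshear p) \<in> shear ` C" by (rule imageI)
      with that show False by simp
    qed
  qed
qed

text \<open>A function above the flat boundary is carried back by the inverse shear. The result is
  C^1 with compact support in the domain, to which the divergence condition has been
  extended.\<close>

sublocale flat_field u
proof
  show "u \<in> borel_measurable borel" by (rule measurable_u)
  show "integrable lborel (\<lambda>p. (norm (u p))\<^sup>2)" by (rule u_L2)
  show "u p = 0" if "snd p \<le> 0" for p
    using that v(3)[of "shear p"] shear_in_domain[of p] by (simp add: u_def zero_prod_def)
  fix \<psi> :: "(real ^ 'm) \<times> real \<Rightarrow> real" and G C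
  assume \<psi>: "has_gradient \<psi> G" "continuous_on UNIV G" "compact C" "C \<subseteq> {p. 0 < snd p}" "\<And>p. p \<notin> C \<Longrightarrow> \<psi> p = 0"
  have "(\<integral>q. u q \<bullet> G q \<partial>lborel) = (\<integral>p. v p \<bullet> push G p \<partial>lborel)"
    using \<psi>(2) continuous_pull_push(2)[OF \<psi>(2)] by (intro integral_u_push borel_measurable_continuous_onI)
  also have "\<dots> = (\<integral>p. 0 * \<psi> (unshear p) \<partial>(lborel :: ((real ^ 'm) \<times> real) measure))"
  proof (rule test_identity_extends[OF open_domain v(1) v_locally_integrable])
    show "(\<integral>x. v x \<bullet> grad \<phi> x \<partial>lborel) = (\<integral>x. 0 * \<phi> x \<partial>lborel)" if "\<phi> \<in> test_functions \<Omega>" for \<phi>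
      using div_w that integral_w[OF borel_measurable_continuous_onI[OF continuous_on_grad_test[OF that]]]
      by (simp add: div_free_def)
    show "shear ` C \<subseteq> \<Omega>" using \<psi>(4) shear_in_domain by auto
    show "\<psi> (unshear p) = 0" if "p \<notin> shear ` C" for p by (rule push_support(2)[OF \<psi>(3)]) (use \<psi>(5) that in auto)
  qed (use has_gradient_shear(2)[OF \<psi>(1)] continuous_pull_push(2)[OF \<psi>(2)] push_support(1)[OF \<psi>(3)] emeasure_lborel_ball_finite in auto)
  finally show "(\<integral>p. u p \<bullet> G p \<partial>lborel) = 0" by simp
qed

definition b :: real where
  "b = enn2real (b_seminorm \<infinity> \<Omega> (\<lambda>y. grad (\<lambda>z. infdist z (frontier \<Omega>)) y \<bullet> w y))"

lemma b_seminorm_finite: "b_seminorm \<infinity> \<Omega> (\<lambda>y. grad (\<lambda>z. infdist z (frontier \<Omega>)) y \<bullet> w y) = ennreal b"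
  and b_le: "b \<le> enn2real (vbmo_seminorm \<infinity> \<infinity> \<Omega> w)" and b_nonneg: "0 \<le> b"
proof -
  let ?b = "b_seminorm \<infinity> \<Omega> (\<lambda>y. grad (\<lambda>z. infdist z (frontier \<Omega>)) y \<bullet> w y)"
  have fin: "vbmo_seminorm \<infinity> \<infinity> \<Omega> w < \<infinity>" using w by (simp add: vBMOL2_def vBMO_def)
  have le: "?b \<le> vbmo_seminorm \<infinity> \<infinity> \<Omega> w" by (simp add: vbmo_seminorm_def)
  then have "?b < \<infinity>" using fin by (rule le_less_trans)
  then show "?b = ennreal b" by (simp add: b_def)
  show "b \<le> enn2real (vbmo_seminorm \<infinity> \<infinity> \<Omega> w)" unfolding b_def using le fin by (intro enn2real_mono) auto
  show "0 \<le> b" by (simp add: b_def)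
qed

lemma boundary_ball_integral:
  assumes "0 < \<rho>"
  shows "(\<integral>\<^sup>+p\<in>\<Omega> \<inter> ball (graph y) \<rho>. ennreal \<bar>grad (\<lambda>z. infdist z (frontier \<Omega>)) p \<bullet> w p\<bar> \<partial>lebesgue) \<le> ennreal (b * \<rho> ^ Suc CARD('m))"
    (is "?I \<le> _")
proof -
  have "?I / ennreal (\<rho> ^ DIM((real ^ 'm) \<times> real)) \<le> ennreal b"
    unfolding b_seminorm_finite[symmetric] b_seminorm_def
    using assms by (intro SUP_upper2[of "(graph y, \<rho>)"]) (auto simp: frontier_domain)
  then have "?I / ennreal (\<rho> ^ Suc CARD('m)) * ennreal (\<rho> ^ Suc CARD('m)) \<le> ennreal b * ennreal (\<rho> ^ Suc CARD('m))"
    by (intro mult_right_mono) auto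
  moreover have "?I / ennreal (\<rho> ^ Suc CARD('m)) * ennreal (\<rho> ^ Suc CARD('m)) = ?I"
    using assms by (simp add: ennreal_divide_times del: power_Suc)
  ultimately show ?thesis using b_nonneg assms by (simp add: ennreal_mult)
qed

text \<open>The part of the normal component that the error K t |v| does not cover; inside the strip
  it is at most (1 + L) times |grad d \<bullet> w|, with d the distance from the boundary. It is
  Borel by construction, so measurability of the gradient of the distance need not be
  discussed.\<close>

definition excess :: "(real ^ 'm) \<times> real \<Rightarrow> real" where
  "excess p = max 0 (\<bar>v p \<bullet> N (fst p)\<bar> - K * (snd p - h (fst p)) * norm (v p))"

lemma measurable_excess: "excess \<in> borel_measurable borel"
proof -
  have "continuous_on UNIV (\<lambda>p :: (real ^ 'm) \<times> real. N (fst p))" "continuous_on UNIV (\<lambda>p :: (real ^ 'm) \<times> real. snd p - h (fst p))"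
    by (intro continuous_intros continuous_on_compose2[OF continuous_\<gamma>[of UNIV]] continuous_on_compose2[OF continuous_h[of UNIV]]; simp)+
  note this[THEN borel_measurable_continuous_onI, measurable]
  note v(1)[measurable]
  show ?thesis unfolding excess_def[abs_def] by measurable
qed

text \<open>The sheared cylinder of radius e and height 2e lies in a ball of radius (3 + L) e about
  the boundary point over y: e horizontally, 2e vertically and L e for the variation of h. The
  condition e < 1/(4K) keeps the height below 1/(2K).\<close>

lemma flux_cylinder:
  assumes e: "0 < e" "e < 1 / (4 * K)"
  shows "(\<integral>\<^sup>+q. indicator (ball 0 e) (fst q - y) * indicator {0<..<2 * e} (snd q) * ennreal (excess (shear q)) \<partial>lborel)
    \<le> ennreal ((1 + L) * (3 + L) ^ Suc CARD('m) * b * e ^ Suc CARD('m))"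
proof -
  let ?g = "\<lambda>p. grad (\<lambda>z. infdist z (frontier \<Omega>)) p"
  define Z where "Z = \<Omega> \<inter> ball (graph y) ((3 + L) * e)"
  define Y where "Y = {p. fst p - y \<in> ball 0 e \<and> snd p - h (fst p) \<in> {0<..<2 * e}}"
  have Yo: "open Y"
  proof -
    have "Y = {p. norm (fst p - y) < e} \<inter> {p. 0 < snd p - h (fst p)} \<inter> {p. snd p - h (fst p) < 2 * e}" by (auto simp: Y_def)
    moreover have "open \<dots>"
      by (intro open_Int open_Collect_less continuous_intros continuous_on_compose2[OF continuous_h[of UNIV]]) auto
    ultimately show ?thesis by simp
  qed
  have YZ: "Y \<subseteq> Z"
  proof
    fix p assume p: "p \<in> Y"
    have "norm (p - graph y) \<le> norm (fst p - y) + \<bar>snd p - h y\<bar>" using norm_pair_sum[of "p - graph y"] by simp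
    also have "\<bar>snd p - h y\<bar> \<le> \<bar>snd p - h (fst p)\<bar> + L * norm (fst p - y)" using h_lipschitz[of "fst p" y] by linarith
    also have "L * norm (fst p - y) \<le> L * e" using p L_nonneg by (intro mult_left_mono) (auto simp: Y_def)
    finally have "norm (p - graph y) < (3 + L) * e" using p by (auto simp: Y_def algebra_simps)
    moreover have "p \<in> \<Omega>" using p by (auto simp: Y_def perturbed_half_space_def split: prod.splits)
    ultimately show "p \<in> Z" by (simp add: Z_def dist_norm norm_minus_commute)
  qed
  let ?k = "\<lambda>p. indicator Y p * ennreal (excess p / (1 + L))"
  have km: "?k \<in> borel_measurable lborel"
    using measurable_excess Yo by (intro borel_measurable_times_ennreal borel_measurable_indicator) auto
  have "(\<integral>\<^sup>+q. indicator (ball 0 e) (fst q - y) * indicator {0<..<2 * e} (snd q) * ennreal (excess (shear q)) \<partial>lborel)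
    = (\<integral>\<^sup>+q. ennreal (1 + L) * ?k (shear q) \<partial>lborel)"
  proof (rule nn_integral_cong)
    fix q :: "(real ^ 'm) \<times> real"
    have "indicator Y (shear q) = (indicator (ball 0 e) (fst q - y) * indicator {0<..<2 * e} (snd q) :: ennreal)"
      by (auto simp: Y_def shear_def indicator_def)
    moreover have "ennreal (1 + L) * ennreal (excess (shear q) / (1 + L)) = ennreal (excess (shear q))"
      using L_nonneg by (subst ennreal_mult[symmetric]) (auto simp: excess_def)
    ultimately show "indicator (ball 0 e) (fst q - y) * indicator {0<..<2 * e} (snd q) * ennreal (excess (shear q)) = ennreal (1 + L) * ?k (shear q)"
      by (metis mult.left_commute)
  qed
  also have "\<dots> = (\<integral>\<^sup>+p. ennreal (1 + L) * ?k p \<partial>lborel)"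
    using km by (intro nn_integral_shear[where F = "\<lambda>p. ennreal (1 + L) * ?k p"]) simp
  also have "\<dots> = ennreal (1 + L) * (\<integral>\<^sup>+p. ?k p \<partial>lborel)" using km by (rule nn_integral_cmult)
  also have "(\<integral>\<^sup>+p. ?k p \<partial>lborel) = (\<integral>\<^sup>+p. ?k p \<partial>lebesgue)" by (rule nn_integral_completion[symmetric])
  also have "\<dots> \<le> (\<integral>\<^sup>+p\<in>Z. ennreal \<bar>?g p \<bullet> w p\<bar> \<partial>lebesgue)"
  proof (rule nn_integral_mono_AE, rule AE_mp[OF v_AE_lebesgue], intro AE_I2 impI)
    fix p assume vw: "v p = indicator \<Omega> p *\<^sub>R w p"
    show "?k p \<le> ennreal \<bar>?g p \<bullet> w p\<bar> * indicator Z p"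
    proof (cases "p \<in> Y")
      case True
      then have pZ: "p \<in> Z" using YZ by auto
      then have vp: "v p = w p" using vw by (simp add: Z_def)
      define t where "t = snd p - h (fst p)"
      have t: "0 < t" "t < 1 / (2 * K)" using True e by (auto simp: Y_def t_def)
      have "(fst p, h (fst p) + t) = p" by (simp add: t_def)
      then have "\<bar>w p \<bullet> N (fst p)\<bar> \<le> (1 + L) * \<bar>?g p \<bullet> w p\<bar> + K * t * norm (w p)"
        using strip_normal[OF t, of "w p" "fst p"] by simp
      then have "excess p \<le> (1 + L) * \<bar>?g p \<bullet> w p\<bar>"
        using L_nonneg unfolding excess_def vp t_def[symmetric] by simp
      then have "excess p / (1 + L) \<le> \<bar>?g p \<bullet> w p\<bar>" using L_nonneg by (simp add: divide_le_eq mult.commute)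
      then show ?thesis using True pZ by (simp add: ennreal_leI)
    qed simp
  qed
  also have "\<dots> \<le> ennreal (b * ((3 + L) * e) ^ Suc CARD('m))"
    unfolding Z_def using e L_nonneg by (intro boundary_ball_integral) simp
  finally have "(\<integral>\<^sup>+q. indicator (ball 0 e) (fst q - y) * indicator {0<..<2 * e} (snd q) * ennreal (excess (shear q)) \<partial>lborel)
     \<le> ennreal (1 + L) * ennreal (b * ((3 + L) * e) ^ Suc CARD('m))" by (simp add: mult_left_mono)
  also have "\<dots> = ennreal ((1 + L) * (3 + L) ^ Suc CARD('m) * b * e ^ Suc CARD('m))"
    unfolding power_mult_distrib using L_nonneg b_nonneg e by (subst ennreal_mult[symmetric]) (auto simp: mult_ac)
  finally show ?thesis .
qed

definition flux_const :: real where
  "flux_const = 2 * ((1 + L) * (3 + L) ^ Suc CARD('m) * b) / unit_ball_vol (real CARD('m))"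

lemma flux_const_nonneg: "0 \<le> flux_const"
  using L_nonneg b_nonneg by (simp add: flux_const_def)

lemma trace_functional_bound:
  assumes \<phi>: "\<phi> \<in> test_functions UNIV"
  shows "\<bar>\<integral>p. v p \<bullet> grad \<phi> p \<partial>lborel\<bar> \<le> flux_const * (\<integral>p. \<bar>\<phi> p\<bar> \<partial>\<mu>)"
proof -
  have cg: "continuous_on UNIV (grad \<phi>)" by (rule continuous_on_grad_test[OF \<phi>])
  have "(\<integral>p. v p \<bullet> grad \<phi> p \<partial>lborel) = (\<integral>q. v (shear q) \<bullet> grad \<phi> (shear q) \<partial>lborel)"
    using v(1) borel_measurable_continuous_onI[OF cg] by (intro integral_shear(1)[symmetric]) simp
  also have "\<dots> = (\<integral>q. u q \<bullet> pull (grad \<phi>) q \<partial>lborel)" by (simp add: u_pull)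
  also have "\<bar>\<dots>\<bar> \<le> flux_const * (\<integral>y. \<bar>\<phi> (shear (y, 0))\<bar> \<partial>lborel)"
    unfolding flux_const_def
  \<comment> \<open>The error is K t |v|, and |v| at the sheared point is at most (2 + L) |u|; hence
    the constant \<open>c\<close>. The height limit 1/(4K) is the one under which the cylinder
    estimate holds.\<close>
  proof (rule flux_bound[where a = "\<lambda>q. excess (shear q)" and c = "K * (2 + L)" and \<psi> = "\<lambda>q. \<phi> (shear q)" and S = "unshear ` supp \<phi>" and ?t0.0 = "1 / (4 * K)"])
    show "(\<lambda>q. excess (shear q)) \<in> borel_measurable borel"
      using measurable_shear(1) measurable_excess by (rule measurable_compose)
    show "0 < 1 / (4 * K)" using K by simp
    show "\<bar>snd (u (x, t))\<bar> \<le> excess (shear (x, t)) + K * (2 + L) * t * norm (u (x, t))" if "0 < t" "t < 1 / (4 * K)" for x t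
    proof -
      have "snd (u (x, t)) = v (shear (x, t)) \<bullet> N x"
        by (simp add: u_def inner_prod_def inner_commute)
      then have "\<bar>snd (u (x, t))\<bar> \<le> excess (shear (x, t)) + K * t * norm (v (shear (x, t)))"
        by (simp add: excess_def shear_def)
      also have "K * t * norm (v (shear (x, t))) \<le> K * t * ((2 + L) * norm (u (x, t)))"
        using that K by (intro mult_left_mono norm_u_v(2)) auto
      finally show ?thesis by (simp add: mult_ac)
    qed
    show "has_gradient (\<lambda>q. \<phi> (shear q)) (pull (grad \<phi>))" by (rule has_gradient_shear(1)[OF has_gradient_test[OF \<phi>]])
    show "continuous_on UNIV (pull (grad \<phi>))" by (rule continuous_pull_push(1)[OF cg])
    show "compact (unshear ` supp \<phi>)" by (intro compact_continuous_image continuous_shear test_functionsD(2)[OF \<phi>])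
    show "\<phi> (shear p) = 0" if "p \<notin> unshear ` supp \<phi>" for p
    proof (rule zero_outside_supp[of _ \<phi>])
      show "shear p \<notin> supp \<phi>"
      proof
        assume "shear p \<in> supp \<phi>"
        then have "unshear (shear p) \<in> unshear ` supp \<phi>" by (rule imageI)
        with that show False by simp
      qed
    qed
    show "0 \<le> K * (2 + L)" using K L_nonneg by simp
    show "0 \<le> (1 + L) * (3 + L) ^ Suc CARD('m) * b" using L_nonneg b_nonneg by simp
    show "0 \<le> excess (shear p)" for p by (simp add: excess_def)
  qed (rule flux_cylinder)
  also have "(\<integral>y. \<bar>\<phi> (shear (y, 0))\<bar> \<partial>lborel) = (\<integral>p. \<bar>\<phi> p\<bar> \<partial>\<mu>)"
    using borel_measurable_continuous_onI[OF test_functionsD(6)[OF \<phi>]] by (subst integral_\<mu>) (auto simp: shear_def)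
  finally show ?thesis .
qed

lemma ex_flat_trace:
  obtains g where "g \<in> borel_measurable borel" "\<And>x. \<bar>g x\<bar> \<le> 2 * flux_const"
    "\<And>\<phi>. \<phi> \<in> test_functions UNIV \<Longrightarrow> (\<integral>p. v p \<bullet> grad \<phi> p \<partial>lborel) = (\<integral>p. g p * \<phi> p \<partial>\<mu>)"
proof (rule L1_functional_representation_nonneg[OF sets_\<mu> \<mu>_ball_finite _ trace_functional_bound flux_const_nonneg])
  fix \<phi> \<psi> :: "(real ^ 'm) \<times> real \<Rightarrow> real" and a b
  assume t: "\<phi> \<in> test_functions UNIV" "\<psi> \<in> test_functions UNIV"
  have i: "integrable lborel (\<lambda>p. v p \<bullet> grad \<eta> p)" if \<eta>: "\<eta> \<in> test_functions UNIV" for \<eta>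
  proof -
    have g0: "p \<notin> supp \<eta> \<Longrightarrow> grad \<eta> p = 0" for p
      by (rule has_gradient_zero_outside[OF has_gradient_test[OF \<eta>] compact_imp_closed[OF test_functionsD(2)[OF \<eta>]] zero_outside_supp[of _ \<eta>]])
    obtain B where B: "\<And>p. norm (grad \<eta> p) \<le> B"
      using continuous_compact_support_bounded[OF continuous_on_grad_test[OF \<eta>] test_functionsD(2)[OF \<eta>] g0] by metis
    have G: "grad \<eta> \<in> borel_measurable borel" by (rule borel_measurable_continuous_onI[OF continuous_on_grad_test[OF \<eta>]])
    have "(\<integral>\<^sup>+p. ennreal ((norm (grad \<eta> p))\<^sup>2) \<partial>lborel) \<le> (\<integral>\<^sup>+p. ennreal (B\<^sup>2) * indicator (supp \<eta>) p \<partial>lborel)"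
      using B g0 by (intro nn_integral_mono) (auto split: split_indicator intro!: ennreal_leI power_mono)
    also have "\<dots> = ennreal (B\<^sup>2) * emeasure lborel (supp \<eta>)"
      using test_functionsD(2)[OF \<eta>] by (intro nn_integral_cmult_indicator) (auto simp: compact_imp_closed)
    also have "\<dots> < \<infinity>" using emeasure_compact_finite[OF test_functionsD(2)[OF \<eta>]] by (simp add: ennreal_mult_less_top)
    finally obtain Q where "0 \<le> Q" "(\<integral>\<^sup>+p. ennreal ((norm (grad \<eta> p))\<^sup>2) \<partial>lborel) = ennreal Q"
      by (cases "\<integral>\<^sup>+p. ennreal ((norm (grad \<eta> p))\<^sup>2) \<partial>lborel") auto
    then show ?thesis
      using v(1) G v_L2(1) by (intro inner_integral_Cauchy_Schwarz(1)[where Q = Q]) auto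
  qed
  have "((\<lambda>x. a * \<phi> x + b * \<psi> x) has_derivative (\<lambda>h. (a *\<^sub>R grad \<phi> x + b *\<^sub>R grad \<psi> x) \<bullet> h)) (at x)" for x
    using has_derivative_add[OF has_derivative_mult_right[OF test_functionsD(5)[OF t(1)], of a x] has_derivative_mult_right[OF test_functionsD(5)[OF t(2)], of b x]]
    by (simp add: inner_add_left)
  from grad_eqI[OF this] have "grad (\<lambda>x. a * \<phi> x + b * \<psi> x) = (\<lambda>x. a *\<^sub>R grad \<phi> x + b *\<^sub>R grad \<psi> x)" by blast
  then show "(\<integral>p. v p \<bullet> grad (\<lambda>x. a * \<phi> x + b * \<psi> x) p \<partial>lborel) = a * (\<integral>p. v p \<bullet> grad \<phi> p \<partial>lborel) + b * (\<integral>p. v p \<bullet> grad \<psi> p \<partial>lborel)"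
    using i[OF t(1)] i[OF t(2)] by (simp add: inner_add_right)
qed (use that in auto)

lemma flat_trace_identity:
  assumes g: "g \<in> borel_measurable borel" "\<And>x. \<bar>g x\<bar> \<le> c"
    and id: "\<And>\<phi>. \<phi> \<in> test_functions UNIV \<Longrightarrow> (\<integral>p. v p \<bullet> grad \<phi> p \<partial>lborel) = (\<integral>p. g p * \<phi> p \<partial>\<mu>)"
    and \<psi>: "has_gradient \<psi> G" "continuous_on UNIV G" "compact C" "\<And>p. p \<notin> C \<Longrightarrow> \<psi> p = 0"
  shows "(\<integral>p. u p \<bullet> G p \<partial>lborel) = (\<integral>x. g (graph x) * \<psi> (x, 0) \<partial>lborel)"
proof -
  have "(\<integral>q. u q \<bullet> G q \<partial>lborel) = (\<integral>p. v p \<bullet> push G p \<partial>lborel)"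
    using \<psi>(2) continuous_pull_push(2)[OF \<psi>(2)] by (intro integral_u_push borel_measurable_continuous_onI)
  also have "\<dots> = (\<integral>p. g p * \<psi> (unshear p) \<partial>\<mu>)"
    by (rule test_identity_extends[OF open_UNIV v(1) v_locally_integrable sets_\<mu> \<mu>_ball_finite g id
          has_gradient_shear(2)[OF \<psi>(1)] continuous_pull_push(2)[OF \<psi>(2)] push_support(1)[OF \<psi>(3)] subset_UNIV])
       (use \<psi>(4) push_support(2)[OF \<psi>(3), of \<psi>] in auto)
  also have "\<dots> = (\<integral>x. g (graph x) * \<psi> (x, 0) \<partial>lborel)"
  proof -
    have "(\<lambda>p. \<psi> (unshear p)) \<in> borel_measurable borel"
      by (rule borel_measurable_continuous_onI[OF has_gradient_continuous[OF has_gradient_shear(2)[OF \<psi>(1)]]])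
    then show ?thesis using g(1) by (subst integral_\<mu>) (auto simp: unshear_def)
  qed
  finally show ?thesis .
qed

end

subsection \<open>The normal trace as a functional\<close>

locale trace_pairing = solenoidal_field h \<gamma> K L w + averaging_kernel \<rho> B0 B1
  for h :: "real ^ 'm \<Rightarrow> real" and \<gamma> K L w and \<rho> :: "real ^ 'm \<Rightarrow> real" and B0 B1
begin

abbreviation lift :: "((real ^ 'm) \<times> real \<Rightarrow> real) \<Rightarrow> (real ^ 'm) \<times> real \<Rightarrow> (real ^ 'm) \<times> real" where
  "lift f \<equiv> averaging_extension.hext \<rho> (\<lambda>x. f (graph x))"

text \<open>Defined through the extension rather than by an integral over the boundary, so that it
  makes sense for every \<open>f\<close> of the space, also when its product with the trace is not
  integrable.\<close>

definition pairing :: "((real ^ 'm) \<times> real \<Rightarrow> real) \<Rightarrow> real" where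
  "pairing f = (\<integral>p. u p \<bullet> lift f p \<partial>lborel)"

definition energy_const :: real where "energy_const = (1 + L) ^ (CARD('m) + 1) * 4 ^ CARD('m)"

lemma energy_const_nonneg: "0 \<le> energy_const" using L_nonneg by (simp add: energy_const_def)

lemma trace_extension_Hhalf:
  assumes f: "f \<in> Hhalf \<Gamma>"
  shows "trace_extension u \<rho> B0 B1 (\<lambda>x. f (graph x)) (energy_const * (Hhalf_norm \<Gamma> f)\<^sup>2)"
proof -
  obtain r where r: "has_surface_density r" using ex_surface_density by blast
  let ?f = "\<lambda>x. f (graph x)"
  let ?q = "2 * real CARD('m) / (real CARD('m) - 1)"
  have fS[measurable]: "f \<in> borel_measurable S" and fe: "Hhalf_energy \<Gamma> f < \<infinity>"
    using f by (auto simp: Hhalf_def S_def)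
  \<comment> \<open>With n = m + 1 the exponent (2n - 2)/(n - 2) becomes 2m/(m - 1).\<close>
  have q: "(2 * real DIM((real ^ 'm) \<times> real) - 2) / (real DIM((real ^ 'm) \<times> real) - 2) = ?q" by simp
  have iq: "integrable S (\<lambda>p. \<bar>f p\<bar> powr ?q)"
    using f unfolding Hhalf_def S_def[symmetric] q by simp
  have fm: "?f \<in> borel_measurable borel" using measurable_compose[OF measurable_graph_S fS] by simp
  have "integrable S (\<lambda>p. r p * \<bar>f p\<bar> powr ?q)"
    using integrable_mult_bounded[OF iq r_measurable[OF r], of "2 ^ CARD('m)"] r_bounds[OF r] by (simp add: mult.commute)
  then have fq: "integrable lborel (\<lambda>x. \<bar>?f x\<bar> powr ?q)"
    using integral_graph(1)[OF r, of "\<lambda>p. \<bar>f p\<bar> powr ?q"] by simp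
  have q1: "1 \<le> ?q" using dim by (simp add: le_divide_eq)
  have loc: "integrable lborel (\<lambda>y. indicator (cball a s) y * ?f y)" for a s
  proof (rule Bochner_Integration.integrable_bound)
    show "integrable lborel (\<lambda>y. indicator (cball a s) y + \<bar>?f y\<bar> powr ?q)"
      using emeasure_lborel_cball_finite[of a s] by (intro Bochner_Integration.integrable_add fq integrable_real_indicator) auto
    show "(\<lambda>y. indicator (cball a s) y * ?f y) \<in> borel_measurable lborel"
      using fm by (intro borel_measurable_times borel_measurable_indicator) auto
    show "AE y in lborel. norm (indicator (cball a s) y * ?f y) \<le> norm (indicator (cball a s) y + \<bar>?f y\<bar> powr ?q)"
    proof (rule AE_I2)
      fix y
      have "\<bar>?f y\<bar> \<le> 1 + \<bar>?f y\<bar> powr ?q"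
      proof (cases "\<bar>?f y\<bar> \<le> 1")
        case False
        then have "\<bar>?f y\<bar> powr 1 \<le> \<bar>?f y\<bar> powr ?q" using q1 by (intro powr_mono) auto
        then show ?thesis using False by simp
      qed (simp add: add_increasing2)
      then show "norm (indicator (cball a s) y * ?f y) \<le> norm (indicator (cball a s) y + \<bar>?f y\<bar> powr ?q)"
        by (auto simp: indicator_def)
    qed
  qed
  interpret A: averaging_extension \<rho> B0 B1 ?f by standard (use fm loc in auto)
  have "A.energy \<le> ennreal energy_const * Hhalf_energy \<Gamma> f"
    unfolding A.energy_def energy_const_def by (rule energy_graph_le[OF r fS])
  also have "Hhalf_energy \<Gamma> f = ennreal ((Hhalf_norm \<Gamma> f)\<^sup>2)" using fe by (simp add: Hhalf_norm_def)
  also have "ennreal energy_const * ennreal ((Hhalf_norm \<Gamma> f)\<^sup>2) = ennreal (energy_const * (Hhalf_norm \<Gamma> f)\<^sup>2)"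
    using energy_const_nonneg by (simp add: ennreal_mult)
  finally show ?thesis
    using dim fq energy_const_nonneg by unfold_locales auto
qed

definition pairing_const :: real where
  "pairing_const = (2 + L) * sqrt (2 * C1\<^sup>2 * unit_ball_vol (real CARD('m)) * energy_const)"

lemma pairing_bound_Hhalf:
  assumes f: "f \<in> Hhalf \<Gamma>"
  shows "integrable lborel (\<lambda>p. u p \<bullet> lift f p)" "\<bar>pairing f\<bar> \<le> pairing_const * L2_norm \<Omega> w * Hhalf_norm \<Gamma> f"
proof -
  interpret X: trace_extension u \<rho> B0 B1 "\<lambda>x. f (graph x)" "energy_const * (Hhalf_norm \<Gamma> f)\<^sup>2"
    by (rule trace_extension_Hhalf[OF f])
  show "integrable lborel (\<lambda>p. u p \<bullet> lift f p)" by (rule X.pairing_bound(1))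
  have H0: "0 \<le> Hhalf_norm \<Gamma> f" by (simp add: Hhalf_norm_def)
  have "\<bar>pairing f\<bar> \<le> sqrt (\<integral>p. (norm (u p))\<^sup>2 \<partial>lborel) * sqrt (2 * C1\<^sup>2 * X.\<omega> * (energy_const * (Hhalf_norm \<Gamma> f)\<^sup>2))"
    unfolding pairing_def by (rule X.pairing_bound(2))
  also have "sqrt (2 * C1\<^sup>2 * X.\<omega> * (energy_const * (Hhalf_norm \<Gamma> f)\<^sup>2)) = sqrt (2 * C1\<^sup>2 * X.\<omega> * energy_const) * Hhalf_norm \<Gamma> f"
    using H0 by (simp add: mult.assoc[symmetric] real_sqrt_mult[of _ "(Hhalf_norm \<Gamma> f)\<^sup>2"])
  also have "sqrt (\<integral>p. (norm (u p))\<^sup>2 \<partial>lborel) * (sqrt (2 * C1\<^sup>2 * X.\<omega> * energy_const) * Hhalf_norm \<Gamma> f)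
    \<le> (2 + L) * L2_norm \<Omega> w * (sqrt (2 * C1\<^sup>2 * X.\<omega> * energy_const) * Hhalf_norm \<Gamma> f)"
    using H0 X.\<omega>_pos energy_const_nonneg by (intro mult_right_mono u_L2(2)) auto
  finally show "\<bar>pairing f\<bar> \<le> pairing_const * L2_norm \<Omega> w * Hhalf_norm \<Gamma> f"
    by (simp add: pairing_const_def X.\<omega>_def mult_ac)
qed

lemma lift_linear:
  assumes "f \<in> Hhalf \<Gamma>" "g \<in> Hhalf \<Gamma>"
  shows "lift (\<lambda>x. c * f x + d * g x) p = c *\<^sub>R lift f p + d *\<^sub>R lift g p"
proof -
  interpret X: trace_extension u \<rho> B0 B1 "\<lambda>x. f (graph x)" "energy_const * (Hhalf_norm \<Gamma> f)\<^sup>2"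
    by (rule trace_extension_Hhalf[OF assms(1)])
  interpret Y: trace_extension u \<rho> B0 B1 "\<lambda>x. g (graph x)" "energy_const * (Hhalf_norm \<Gamma> g)\<^sup>2"
    by (rule trace_extension_Hhalf[OF assms(2)])
  interpret Z: averaging_extension \<rho> B0 B1 "\<lambda>x. c * f (graph x) + d * g (graph x)"
  proof
    show "(\<lambda>x. c * f (graph x) + d * g (graph x)) \<in> borel_measurable borel" using X.fm Y.fm by measurable
    show "integrable lborel (\<lambda>y. indicator (cball z s) y * (c * f (graph y) + d * g (graph y)))" for z s
      using Bochner_Integration.integrable_add[OF integrable_mult_right[OF X.loc[of z s], of c] integrable_mult_right[OF Y.loc[of z s], of d]]
      by (simp add: algebra_simps)
  qed
  show ?thesis
  proof (cases "0 < snd p")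
    case True
    have i: "integrable lborel (\<lambda>y. f (graph y) *\<^sub>R gkern p y)" "integrable lborel (\<lambda>y. g (graph y) *\<^sub>R gkern p y)"
      using X.integrable_scaleR_gkern[OF True, of 0] Y.integrable_scaleR_gkern[OF True, of 0] by simp_all
    have "(\<integral>y. (c * f (graph y) + d * g (graph y)) *\<^sub>R gkern p y \<partial>lborel)
      = (\<integral>y. c *\<^sub>R (f (graph y) *\<^sub>R gkern p y) + d *\<^sub>R (g (graph y) *\<^sub>R gkern p y) \<partial>lborel)"
      by (simp only: scaleR_add_left scaleR_scaleR)
    also have "\<dots> = c *\<^sub>R (\<integral>y. f (graph y) *\<^sub>R gkern p y \<partial>lborel) + d *\<^sub>R (\<integral>y. g (graph y) *\<^sub>R gkern p y \<partial>lborel)"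
      using i by (simp del: scaleR_scaleR)
    finally show ?thesis using True unfolding X.hext_def Y.hext_def Z.hext_def X.gext_def Y.gext_def Z.gext_def by simp
  qed (simp add: X.hext_def Y.hext_def Z.hext_def)
qed

lemma pairing_dual: "pairing \<in> Hhalf_dual \<Gamma>"
  unfolding Hhalf_dual_def
proof (intro CollectI conjI ballI allI)
  fix f g a b assume fg: "f \<in> Hhalf \<Gamma>" "g \<in> Hhalf \<Gamma>"
  show "pairing (\<lambda>x. a * f x + b * g x) = a * pairing f + b * pairing g"
    using pairing_bound_Hhalf(1)[OF fg(1)] pairing_bound_Hhalf(1)[OF fg(2)]
    unfolding pairing_def by (simp add: lift_linear[OF fg, simplified] inner_add_right)
next
  show "\<exists>B. \<forall>f\<in>Hhalf \<Gamma>. \<bar>pairing f\<bar> \<le> B * Hhalf_norm \<Gamma> f"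
    using pairing_bound_Hhalf(2) by blast
qed

lemma pairing_const_nonneg: "0 \<le> pairing_const"
  using L_nonneg energy_const_nonneg by (simp add: pairing_const_def)

lemma L2_norm_nonneg: "0 \<le> L2_norm \<Omega> w"
  by (simp add: L2_norm_def integral_nonneg_AE)

lemma pairing_dual_norm: "Hhalf_dual_norm \<Gamma> pairing \<le> pairing_const * L2_norm \<Omega> w"
  unfolding Hhalf_dual_norm_def
proof (rule cSUP_least)
  have "Hhalf_energy \<Gamma> (\<lambda>x. 0) = 0" by (simp add: Hhalf_energy_def)
  then have "(\<lambda>x. 0) \<in> {f \<in> Hhalf \<Gamma>. Hhalf_norm \<Gamma> f \<le> 1}" by (simp add: Hhalf_def Hhalf_norm_def)
  then show "{f \<in> Hhalf \<Gamma>. Hhalf_norm \<Gamma> f \<le> 1} \<noteq> {}" by blast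
  fix f assume "f \<in> {f \<in> Hhalf \<Gamma>. Hhalf_norm \<Gamma> f \<le> 1}"
  then have f: "f \<in> Hhalf \<Gamma>" "Hhalf_norm \<Gamma> f \<le> 1" by auto
  have "pairing_const * L2_norm \<Omega> w * Hhalf_norm \<Gamma> f \<le> pairing_const * L2_norm \<Omega> w * 1"
    using f(2) pairing_const_nonneg L2_norm_nonneg by (intro mult_left_mono) auto
  then show "\<bar>pairing f\<bar> \<le> pairing_const * L2_norm \<Omega> w" using pairing_bound_Hhalf(2)[OF f(1)] by simp
qed

text \<open>The functional is first represented by \<open>g0\<close> against Lebesgue measure
  transported to the graph. Multiplying by the surface density \<open>r\<close> passes to the
  surface measure and accounts for the factor 2^m; the factor 2 comes from the representation of L^1
  functionals.\<close>

lemma normal_trace_exists: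
  "\<exists>g. is_normal_trace \<Omega> w g \<and> g \<in> Linf_space \<Gamma> \<and> represents \<Gamma> g pairing \<and> Linf_norm \<Gamma> g \<le> 2 ^ CARD('m) * (2 * flux_const)"
proof -
  obtain r where r: "has_surface_density r" using ex_surface_density by blast
  obtain g0 where g0: "g0 \<in> borel_measurable borel" "\<And>x. \<bar>g0 x\<bar> \<le> 2 * flux_const"
    "\<And>\<phi>. \<phi> \<in> test_functions UNIV \<Longrightarrow> (\<integral>p. v p \<bullet> grad \<phi> p \<partial>lborel) = (\<integral>p. g0 p * \<phi> p \<partial>\<mu>)"
    using ex_flat_trace by blast
  note [measurable] = r_measurable[OF r] borel_measurable_S[OF g0(1)]
  define g where "g p = r p * g0 p" for p
  have gm[measurable]: "g \<in> borel_measurable S" unfolding g_def[abs_def] by measurable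
  let ?c = "2 ^ CARD('m) * (2 * flux_const)"
  have gb: "\<bar>g p\<bar> \<le> ?c" for p
    using r_bounds[OF r, of p] g0(2)[of p] unfolding g_def abs_mult by (intro mult_mono) auto
  have trace: "is_normal_trace \<Omega> w g"
    unfolding is_normal_trace_def \<Gamma>_def[symmetric] S_def[symmetric]
  proof (intro ballI conjI)
    fix \<phi> :: "(real ^ 'm) \<times> real \<Rightarrow> real" assume \<phi>: "\<phi> \<in> test_functions UNIV"
    have \<phi>m: "\<phi> \<in> borel_measurable borel" by (rule borel_measurable_continuous_onI[OF test_functionsD(6)[OF \<phi>]])
    note [measurable] = borel_measurable_S[OF \<phi>m]
    have "emeasure \<mu> C < \<infinity>" if "compact C" for C
      using compact_finite_M[OF sets_\<mu> \<mu>_ball_finite that] .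
    then have "integrable \<mu> \<phi>" by (intro integrable_test_function[OF \<phi> sets_\<mu>])
    then have "integrable \<mu> (\<lambda>p. \<phi> p * g0 p)"
      using g0 by (intro integrable_mult_bounded[where c = "2 * flux_const"]) (auto simp: measurable_cong_sets[OF sets_\<mu> refl])
    then have "integrable lborel (\<lambda>x. \<phi> (graph x) * g0 (graph x))"
      unfolding \<mu>_def using g0(1) \<phi>m by (subst (asm) integrable_distr_eq) auto
    then have "integrable S (\<lambda>p. r p * (g0 p * \<phi> p))"
      using integral_graph(1)[OF r, of "\<lambda>p. g0 p * \<phi> p"] by (simp add: mult.commute)
    then show "integrable S (\<lambda>p. g p * \<phi> p)" by (simp add: g_def mult.assoc)
    have "(\<integral>p. g p * \<phi> p \<partial>S) = (\<integral>p. r p * (g0 p * \<phi> p) \<partial>S)" by (simp add: g_def mult.assoc)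
    also have "\<dots> = (\<integral>x. g0 (graph x) * \<phi> (graph x) \<partial>lborel)" by (rule integral_graph(2)[OF r]) measurable
    also have "\<dots> = (\<integral>p. g0 p * \<phi> p \<partial>\<mu>)" using g0(1) \<phi>m by (subst integral_\<mu>) auto
    also have "\<dots> = (\<integral>p. v p \<bullet> grad \<phi> p \<partial>lborel)" using g0(3)[OF \<phi>] by simp
    also have "\<dots> = (\<integral>x. w x \<bullet> grad \<phi> x \<partial>lebesgue_on \<Omega>)"
      by (rule integral_w[OF borel_measurable_continuous_onI[OF continuous_on_grad_test[OF \<phi>]], symmetric])
    finally show "(\<integral>x. g x * \<phi> x \<partial>S) = (\<integral>x. w x \<bullet> grad \<phi> x \<partial>lebesgue_on \<Omega>)" .
  qed
  have ess: "esssup S (\<lambda>x. ennreal \<bar>g x\<bar>) \<le> ennreal ?c"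
    by (rule esssup_I) (use gb in \<open>auto intro!: AE_I2 ennreal_leI\<close>)
  then have Linf: "g \<in> Linf_space \<Gamma>"
    unfolding Linf_space_def S_def[symmetric] by (auto intro: le_less_trans)
  have norm: "Linf_norm \<Gamma> g \<le> ?c"
    unfolding Linf_norm_def S_def[symmetric] using ess flux_const_nonneg by (intro enn2real_leI) auto
  have repr: "represents \<Gamma> g pairing"
    unfolding represents_def S_def[symmetric]
  proof (intro ballI impI)
    fix f assume f: "f \<in> Hhalf \<Gamma>" and gf: "integrable S (\<lambda>x. g x * f x)"
    have [measurable]: "f \<in> borel_measurable S" using f by (simp add: Hhalf_def S_def)
    interpret X: trace_extension u \<rho> B0 B1 "\<lambda>x. f (graph x)" "energy_const * (Hhalf_norm \<Gamma> f)\<^sup>2"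
      by (rule trace_extension_Hhalf[OF f])
    have "integrable S (\<lambda>p. r p * (g0 p * f p))" using gf by (simp add: g_def mult.assoc)
    then have i: "integrable lborel (\<lambda>x. g0 (graph x) * f (graph x))"
      using integral_graph(1)[OF r, of "\<lambda>p. g0 p * f p"] by simp
    have "pairing f = (\<integral>x. g0 (graph x) * f (graph x) \<partial>lborel)"
      unfolding pairing_def
    proof (rule X.pairing_represents[where c = "2 * flux_const"])
      show "(\<lambda>x. g0 (graph x)) \<in> borel_measurable borel" using g0(1) by measurable
      show "\<bar>g0 (graph x)\<bar> \<le> 2 * flux_const" for x by (rule g0(2))
      show "(\<integral>p. u p \<bullet> G p \<partial>lborel) = (\<integral>x. g0 (graph x) * \<psi> (x, 0) \<partial>lborel)"
        if "has_gradient \<psi> G" "continuous_on UNIV G" "compact C" "\<And>p. p \<notin> C \<Longrightarrow> \<psi> p = 0" for \<psi> G C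
        by (rule flat_trace_identity[OF g0 that])
    qed (rule i)
    also have "\<dots> = (\<integral>p. r p * (g0 p * f p) \<partial>S)" by (rule integral_graph(2)[OF r, symmetric]) measurable
    finally show "pairing f = (\<integral>x. g x * f x \<partial>S)" by (simp add: g_def mult.assoc)
  qed
  from trace Linf repr norm show ?thesis by blast
qed

end

lemma ex_averaging_kernel: "\<exists>(\<rho> :: real ^ 'm \<Rightarrow> real) B0 B1. averaging_kernel \<rho> B0 B1"
proof -
  obtain \<rho> :: "real ^ 'm \<Rightarrow> real" where \<rho>: "\<rho> \<in> test_functions UNIV" "\<And>x. 0 \<le> \<rho> x" "\<And>x. 1/2 \<le> norm x \<Longrightarrow> \<rho> x = 0"
    "integrable lborel \<rho>" "integral\<^sup>L lborel \<rho> = 1"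
    using ex_mollifier[of "1/2", where 'a = "real ^ 'm"] by auto
  obtain B0 where B0: "\<And>x. norm (\<rho> x) \<le> B0"
    using continuous_compact_support_bounded[OF test_functionsD(6)[OF \<rho>(1)] test_functionsD(2)[OF \<rho>(1)] zero_outside_supp[of _ \<rho>]] by metis
  have g0: "x \<notin> supp \<rho> \<Longrightarrow> grad \<rho> x = 0" for x
    by (rule has_gradient_zero_outside[OF has_gradient_test[OF \<rho>(1)] compact_imp_closed[OF test_functionsD(2)[OF \<rho>(1)]] zero_outside_supp[of _ \<rho>]])
  obtain B1 where B1: "\<And>x. norm (grad \<rho> x) \<le> B1"
    using continuous_compact_support_bounded[OF continuous_on_grad_test[OF \<rho>(1)] test_functionsD(2)[OF \<rho>(1)] g0] by metis
  have "averaging_kernel \<rho> B0 B1"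
    by standard (use \<rho> B0 B1 in \<open>auto intro: order.trans[OF abs_ge_self]\<close>)
  then show ?thesis by blast
qed

theorem lemma3:
  assumes "DIM((real ^ 'm) \<times> real) \<ge> 3"
  shows "\<exists>C :: real \<Rightarrow> ennreal \<Rightarrow> real \<Rightarrow> real.
    (\<forall>K Rs R\<^sub>h. C K Rs R\<^sub>h > 0) \<and>
    (\<forall>\<kappa> K. \<forall>h :: real ^ 'm \<Rightarrow> real. \<forall>w.
       0 < \<kappa> \<and> \<kappa> < 1 \<and> admissible_perturbation \<kappa> h \<and> of_type_K K h \<and>
       w \<in> vBMOL2 (perturbed_half_space h) \<and> div_free (perturbed_half_space h) w \<longrightarrow>
       (\<exists>g l. is_normal_trace (perturbed_half_space h) w g \<and>
          g \<in> Linf_space (frontier (perturbed_half_space h)) \<and>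
          l \<in> Hhalf_dual (frontier (perturbed_half_space h)) \<and>
          represents (frontier (perturbed_half_space h)) g l \<and>
          Linf_norm (frontier (perturbed_half_space h)) g
            + Hhalf_dual_norm (frontier (perturbed_half_space h)) l
          \<le> C K (reach (perturbed_half_space h)) (supp_radius h)
               * vBMOL2_norm (perturbed_half_space h) w))"
proof -
  have dim: "2 \<le> CARD('m)" using assms by simp
  \<comment> \<open>The kernel is fixed before the domain and the field, so its bounds depend on the
    dimension only.\<close>
  obtain \<rho> :: "real ^ 'm \<Rightarrow> real" and B0 B1 where ker: "averaging_kernel \<rho> B0 B1"
    using ex_averaging_kernel by blast
  \<comment> \<open>The absolute value keeps the constants nonnegative for arbitrary real arguments,
    over which positivity is claimed; for an admissible \<open>h\<close> it is the gradient bound of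
    \<open>h\<close>.\<close>
  define lip where "lip K R = \<bar>K * (2 * R + 1)\<bar>" for K R :: real
  define c1 where "c1 K R = 2 ^ CARD('m) * (2 * (2 * ((1 + lip K R) * (3 + lip K R) ^ Suc CARD('m)) / unit_ball_vol (real CARD('m))))" for K R
  define c2 where "c2 K R = (2 + lip K R) * sqrt (2 * (averaging_kernel.C1 TYPE('m) B0 B1)\<^sup>2 * unit_ball_vol (real CARD('m)) * ((1 + lip K R) ^ (CARD('m) + 1) * 4 ^ CARD('m)))" for K R
  have lip0: "0 \<le> lip K R" for K R by (simp add: lip_def)
  have c0: "0 \<le> c1 K R" "0 \<le> c2 K R" for K R using lip0[of K R] by (simp_all add: c1_def c2_def)
  show ?thesis
  \<comment> \<open>\<open>c1\<close> bounds the supremum norm by the boundary seminorm and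
    \<open>c2\<close> the dual norm by the L^2 norm; the summand 1 gives positivity from their
    nonnegativity alone.\<close>
  proof (intro exI[of _ "\<lambda>K Rs R. 1 + c1 K R + c2 K R"] conjI allI impI)
    show "0 < 1 + c1 K R + c2 K R" for K R using c0[of K R] by linarith
    fix \<kappa> K and h :: "real ^ 'm \<Rightarrow> real" and w
    assume A: "0 < \<kappa> \<and> \<kappa> < 1 \<and> admissible_perturbation \<kappa> h \<and> of_type_K K h \<and>
       w \<in> vBMOL2 (perturbed_half_space h) \<and> div_free (perturbed_half_space h) w"
    let ?R = "supp_radius h" let ?L = "K * (2 * supp_radius h + 1)"
    have gd: "graph_domain h (grad h) K ?L" and R: "0 < ?R"
      using graph_domain_type_K[of \<kappa> h K] A by auto
    interpret trace_pairing h "grad h" K ?L w \<rho> B0 B1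
      using gd ker dim A by (intro trace_pairing.intro solenoidal_field.intro solenoidal_field_axioms.intro) auto
    have L: "?L = lip K ?R" using K R by (simp add: lip_def)
    obtain g where g: "is_normal_trace \<Omega> w g" "g \<in> Linf_space \<Gamma>" "represents \<Gamma> g pairing" "Linf_norm \<Gamma> g \<le> 2 ^ CARD('m) * (2 * flux_const)"
      using normal_trace_exists by blast
    let ?vb = "enn2real (vbmo_seminorm \<infinity> \<infinity> \<Omega> w)"
    have "2 ^ CARD('m) * (2 * flux_const) = c1 K ?R * b" unfolding flux_const_def unfolding c1_def L by simp
    also have "\<dots> \<le> c1 K ?R * ?vb" by (intro mult_left_mono b_le c0)
    finally have 1: "Linf_norm \<Gamma> g \<le> c1 K ?R * ?vb" using g(4) by linarith
    have "pairing_const = c2 K ?R" unfolding pairing_const_def energy_const_def unfolding c2_def L by simp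
    then have 2: "Hhalf_dual_norm \<Gamma> pairing \<le> c2 K ?R * L2_norm \<Omega> w" using pairing_dual_norm by simp
    have "c1 K ?R * ?vb + c2 K ?R * L2_norm \<Omega> w \<le> (1 + c1 K ?R + c2 K ?R) * (?vb + L2_norm \<Omega> w)"
    proof -
      have "0 \<le> c2 K ?R * ?vb" "0 \<le> c1 K ?R * L2_norm \<Omega> w" using c0 L2_norm_nonneg by auto
      moreover have "(1 + c1 K ?R + c2 K ?R) * (?vb + L2_norm \<Omega> w) = ?vb + L2_norm \<Omega> w + c1 K ?R * ?vb + c1 K ?R * L2_norm \<Omega> w + c2 K ?R * ?vb + c2 K ?R * L2_norm \<Omega> w"
        by (simp add: algebra_simps)
      moreover have "0 \<le> ?vb" by simp
      ultimately show ?thesis using L2_norm_nonneg by linarith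
    qed
    then have "Linf_norm \<Gamma> g + Hhalf_dual_norm \<Gamma> pairing \<le> (1 + c1 K ?R + c2 K ?R) * vBMOL2_norm \<Omega> w"
      using 1 2 by (simp add: vBMOL2_norm_def)
    then show "\<exists>g l. is_normal_trace \<Omega> w g \<and> g \<in> Linf_space (frontier \<Omega>) \<and> l \<in> Hhalf_dual (frontier \<Omega>) \<and>
       represents (frontier \<Omega>) g l \<and> Linf_norm (frontier \<Omega>) g + Hhalf_dual_norm (frontier \<Omega>) l
         \<le> (1 + c1 K ?R + c2 K ?R) * vBMOL2_norm \<Omega> w"
      using g pairing_dual unfolding \<Gamma>_def by blast
  qed
qed

end
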